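(* For every $\ell \in \mathbb{N}$ there exists $H_\ell^- \in (0,1)$ such that for all $h \in (H_\ell^-, 1]$ (with $\alpha = \arccos h$) the functional $E_h$ attains its infimum in $\mathcal{A}_h(\ell - \alpha/\pi)$.
   Context: $\mathbb{N} = \{1,2,\dots\}$ and $\mathbb{S}^1 \subset \mathbb{R}^2$ is the unit circle. For $h \in [0,1]$ put $\alpha = \arccos h \in [0,\pi/2]$; this relation between $h$ and $\alpha$ is assumed throughout. For $m = (m_1,m_2) \in H^1_{\mathrm{loc}}(\mathbb{R};\mathbb{S}^1)$ define $$E_h(m) = \frac12\left(\|m'\|_{L^2(\mathbb{R})}^2 + \|m_1-h\|_{\dot H^{1/2}(\mathbb{R})}^2 + \|m_1-h\|_{L^2(\mathbb{R})}^2\right) \in [0,\infty], \qquad \|f\|_{\dot H^{1/2}(\mathbb{R})}^2 = \frac{1}{2\pi}\int_{\mathbb{R}}\int_{\mathbb{R}} \frac{|f(s)-f(t)|^2}{|s-t|^2}\,ds\,dt.$$ Every $m \in H^1_{\mathrm{loc}}(\mathbb{R};\mathbb{S}^1)$ is continuous and has a continuous lifting $\phi\colon\mathbb{R}\to\mathbb{R}$ with $m = (\cos\phi,\sin\phi)$, unique up to a constant. If $E_h(m)<\infty$, then at each of $+\infty$ and $-\infty$ the map $m$ converges to one of the points $(\cos\alpha,\pm\sin\alpha)$, and the winding number $\deg(m) = \frac{1}{2\pi}\lim_{x_1\to\infty}(\phi(x_1)-\phi(-x_1))$ is well-defined and belongs to $\mathbb{Z}\pm\{0,\alpha/\pi\}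 := \mathbb{Z}\cup(\mathbb{Z}+\alpha/\pi)\cup(\mathbb{Z}-\alpha/\pi)$. For $d$ in this set, $$\mathcal{A}_h(d) = \{m\in H^1_{\mathrm{loc}}(\mathbb{R};\mathbb{S}^1) : E_h(m)<\infty,\ \deg(m)=d\}.$$ "$E_h$ attains its infimum in $\mathcal{A}_h(d)$" means that there is $m\in\mathcal{A}_h(d)$ with $E_h(m) = \inf_{\mathcal{A}_h(d)}E_h$. *)

theory Defs
  imports "HOL-Analysis.Analysis"
begin

definition locally_integrable :: "(real \<Rightarrow> 'a::euclidean_space) \<Rightarrow> bool" where
  "locally_integrable f \<longleftrightarrow> (\<forall>a b. set_integrable lborel {a..b} f)"

definition locally_square_integrable :: "(real \<Rightarrow> 'a::euclidean_space) \<Rightarrow> bool" where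
  "locally_square_integrable f \<longleftrightarrow>
     f \<in> borel_measurable borel \<and> (\<forall>a b. set_integrable lborel {a..b} (\<lambda>x. (norm (f x))\<^sup>2))"

text \<open>Test functions are taken in \<open>C\<^sub>c\<^sup>1(\<real>)\<close>, as in Brezis, \<^emph>\<open>Functional Analysis, Sobolev Spaces and
  Partial Differential Equations\<close>, Chapter 8; by density this yields the same weak derivatives
  as smooth test functions.\<close>

definition test_function :: "(real \<Rightarrow> real) \<Rightarrow> bool" where
  "test_function \<psi> \<longleftrightarrow> \<psi> C1_differentiable_on UNIV \<and> compact (closure {x. \<psi> x \<noteq> 0})"

definition has_weak_derivative ::
    "(real \<Rightarrow> 'a::euclidean_space) \<Rightarrow> (real \<Rightarrow> 'a) \<Rightarrow> bool" where
  "has_weak_derivative f g \<longleftrightarrow>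
     locally_integrable f \<and> locally_integrable g \<and>
     (\<forall>\<psi>. test_function \<psi> \<longrightarrow>
        (LINT x|lborel. deriv \<psi> x *\<^sub>R f x) = - (LINT x|lborel. \<psi> x *\<^sub>R g x))"

text \<open>Weak derivatives are unique up to null sets, so the choice below does not affect the
  \<open>L\<^sup>2\<close> norm.\<close>

definition weak_deriv :: "(real \<Rightarrow> 'a::euclidean_space) \<Rightarrow> real \<Rightarrow> 'a" where
  "weak_deriv f = (SOME g. has_weak_derivative f g)"

text \<open>The space \<open>H\<^sup>1\<^sub>l\<^sub>o\<^sub>c(\<real>; S\<^sup>1)\<close>; each class of almost everywhere equal maps is represented by its
  unique continuous member.\<close>

definition H1loc_circle :: "(real \<Rightarrow> real \<times> real) set" where
  "H1loc_circle = {m. continuous_on UNIV m \<and> (\<forall>x. m x \<in> sphere 0 1) \<and>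
     locally_square_integrable m \<and>
     (\<exists>g. has_weak_derivative m g \<and> locally_square_integrable g)}"

definition L2_norm_sq :: "(real \<Rightarrow> 'a::euclidean_space) \<Rightarrow> ennreal" where
  "L2_norm_sq f = (\<integral>\<^sup>+ x. ennreal ((norm (f x))\<^sup>2) \<partial>lborel)"

text \<open>On the diagonal, a null set, the integrand is 0 by the convention for division by 0.\<close>

definition H_half_seminorm_sq :: "(real \<Rightarrow> real) \<Rightarrow> ennreal" where
  "H_half_seminorm_sq f =
     ennreal (1 / (2 * pi)) *
     (\<integral>\<^sup>+ t. (\<integral>\<^sup>+ s. ennreal (\<bar>f s - f t\<bar>\<^sup>2 / \<bar>s - t\<bar>\<^sup>2) \<partial>lborel) \<partial>lborel)"

definition energy :: "real \<Rightarrow> (real \<Rightarrow> real \<times> real) \<Rightarrow> ennreal" where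
  "energy h m = ennreal (1 / 2) *
     (L2_norm_sq (weak_deriv m) +
      H_half_seminorm_sq (\<lambda>x. fst (m x) - h) +
      L2_norm_sq (\<lambda>x. fst (m x) - h))"

definition is_lifting :: "(real \<Rightarrow> real \<times> real) \<Rightarrow> (real \<Rightarrow> real) \<Rightarrow> bool" where
  "is_lifting m \<phi> \<longleftrightarrow> continuous_on UNIV \<phi> \<and> (\<forall>x. m x = (cos (\<phi> x), sin (\<phi> x)))"

text \<open>A relation rather than a function, so that nothing is claimed when the limit does not exist;
  liftings differ by constants, so \<open>d\<close> does not depend on the lifting.\<close>

definition has_degree :: "(real \<Rightarrow> real \<times> real) \<Rightarrow> real \<Rightarrow> bool" where
  "has_degree m d \<longleftrightarrow>
     (\<exists>\<phi>. is_lifting m \<phi> \<and> ((\<lambda>x. (\<phi> x - \<phi> (- x)) / (2 * pi)) \<longlongrightarrow> d) at_top)"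

definition admissible :: "real \<Rightarrow> real \<Rightarrow> (real \<Rightarrow> real \<times> real) set" where
  "admissible h d = {m \<in> H1loc_circle. energy h m < \<infinity> \<and> has_degree m d}"

definition attains_infimum :: "real \<Rightarrow> real \<Rightarrow> bool" where
  "attains_infimum h d \<longleftrightarrow>
     (\<exists>m \<in> admissible h d. energy h m = (INF u \<in> admissible h d. energy h u))"

end

theory Submission
  imports Defs "HOL-Complex_Analysis.Great_Picard"
begin

text \<open>The energy depends on \<open>m\<close> only through \<open>|m'|\<close> and \<open>m\<^sub>1 = cos \<theta>\<close> with \<open>\<theta> = arccos m\<^sub>1\<close>, and \<open>m\<close> has degree
  \<open>l - \<alpha> / \<pi>\<close> only if \<open>\<theta>\<close> takes the values \<open>\<pi>, 0, \<pi>, \<dots>, 0, \<pi>\<close> in this order, where \<open>\<pi>\<close> occurs \<open>l\<close> times.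
  Conversely every such \<open>\<theta>\<close> unfolds to a map of this degree with the same energy. Let \<open>e\<^sub>h(l)\<close> be the resulting
  minimal energy. A minimising sequence either converges up to translation, or splits into pieces with \<open>j\<close> and
  \<open>l - j\<close> occurrences of \<open>\<pi>\<close> whose distance tends to infinity, at a cost close to \<open>e\<^sub>1(j) + e\<^sub>1(l - j)\<close> when
  \<open>h\<close> is close to 1. As \<open>e\<^sub>h(l)\<close> is at most \<open>e\<^sub>1(l) + o(1)\<close> for \<open>h \<rightarrow> 1\<close>, splitting is excluded near \<open>h = 1\<close> by the
  strict inequality \<open>e\<^sub>1(l) < e\<^sub>1(j) + e\<^sub>1(l - j)\<close>. By induction on \<open>l\<close> both terms on the right are attained.
  For \<open>h = 1\<close> the function \<open>1 - cos \<theta>\<close> is nonnegative, so two disjoint profiles at distance of order \<open>x\<close> attract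
  each other with a gain of order \<open>1 / x\<^sup>2\<close> from the nonlocal term, while minimisers decay so fast that
  truncating them to \<open>[-2x, 2x]\<close> costs less than that.\<close>

section \<open>Functions with bounded difference quotients in \<open>L\<^sup>2\<close>\<close>

text \<open>For \<open>h < 1\<close> and \<open>l \<ge> 2\<close> the difference
  \<open>h - cos \<theta>\<close> takes both signs, so the attraction between two groups is not
  visible at \<open>h\<close> itself. This is why energies are compared at \<open>h = 1\<close> and
  only the strictness of the inequality is carried over to nearby \<open>h\<close>, with a range
  that depends on \<open>l\<close>. The delicate point at \<open>h = 1\<close> is that only the
  square of \<open>1 - cos \<theta>\<close> is known to be integrable: its integral
  \<open>M(x)\<close> over \<open>[-x, x]\<close> may a priori grow like the square root of
  \<open>x\<close>. Gain and cost of joining two truncated minimisers are therefore measured by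
  \<open>M(x)\<close>: the gain has order \<open>M1 * M2 / x^2\<close>, and each cost has to be
  \<open>o(M / x^2)\<close>, where \<open>M\<close> stays above a positive constant. Such a cost
  presupposes decay of the tail energy \<open>T\<close>. Minimality provides it: the energy balance
  of a truncation keeps the discarded tail on the favourable side, so \<open>T(2 * x)\<close> is at
  most a small multiple of \<open>T(x / 2)\<close> plus a term of order \<open>1 / x^2\<close>;
  iterating over scales gives \<open>T(y) = O(1 / y^2)\<close>.\<close>

lemma floor_grid:
  fixes x :: real
  assumes "x \<in> {of_int i / 2^n ..< (of_int i + 1) / 2^n}"
  shows "\<lfloor>2^n * x\<rfloor> = i"
  using assms by (intro floor_unique) (auto simp: field_simps)

lemma nn_integral_UNIV_eq_SUP:
  fixes f :: "real \<Rightarrow> ennreal"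
  assumes [measurable]: "f \<in> borel_measurable borel"
  shows "(\<integral>\<^sup>+x. f x \<partial>lborel) = (SUP k::nat. \<integral>\<^sup>+x\<in>{- real k..<real k}. f x \<partial>lborel)"
proof -
  have sup: "(SUP k::nat. f x * indicator {- real k..<real k} x) = f x" for x
  proof (rule antisym)
    show "(SUP k::nat. f x * indicator {- real k..<real k} x) \<le> f x"
      by (intro SUP_least) (auto simp: indicator_def)
    obtain k :: nat where "\<bar>x\<bar> < real k" using reals_Archimedean2 by blast
    then have "f x * indicator {- real k..<real k} x = f x" by (auto simp: indicator_def)
    then show "f x \<le> (SUP k::nat. f x * indicator {- real k..<real k} x)"
      using SUP_upper[of k UNIV "\<lambda>k::nat. f x * indicator {- real k..<real k} x"] by simp
  qed
  have "(\<integral>\<^sup>+x. (SUP k::nat. f x * indicator {- real k..<real k} x) \<partial>lborel)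
     = (SUP k::nat. \<integral>\<^sup>+x\<in>{- real k..<real k}. f x \<partial>lborel)"
    by (intro nn_integral_monotone_convergence_SUP)
       (auto simp: incseq_def le_fun_def indicator_def)
  then show ?thesis unfolding sup .
qed

text \<open>For absolutely continuous \<open>F\<close> these are the averages of the derivative over
  the dyadic cells of length \<open>1 / 2^n\<close>, that is, its conditional expectations. They
  form a martingale in \<open>n\<close>, which is the source of the orthogonality used
  below.\<close>

definition grid_quot :: "(real \<Rightarrow> 'a::euclidean_space) \<Rightarrow> nat \<Rightarrow> real \<Rightarrow> 'a" where
  "grid_quot F n x = 2^n *\<^sub>R (F ((of_int \<lfloor>2^n * x\<rfloor> + 1) / 2^n) - F (of_int \<lfloor>2^n * x\<rfloor> / 2^n))"

lemma borel_measurable_grid_quot [measurable]: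
  "grid_quot F n \<in> borel_measurable borel"
proof -
  define H where "H i = 2^n *\<^sub>R (F ((of_int i + 1) / 2^n) - F (of_int i / 2^n))" for i :: int
  have "(\<lambda>x::real. \<lfloor>2^n * x\<rfloor>) \<in> measurable borel (count_space UNIV)"
    by measurable
  from measurable_compose[OF this, of H borel] show ?thesis
    unfolding grid_quot_def[abs_def] H_def by simp
qed

lemma grid_set_integrable:
  fixes f :: "real \<Rightarrow> 'b::euclidean_space"
  assumes "\<And>i. set_integrable lborel {of_int i / 2^n ..< (of_int i + 1) / 2^n} f"
  shows "set_integrable lborel {of_int i / 2^n ..< (of_int i + real j) / 2^n} f"
proof (induction j)
  case 0
  then show ?case by (simp add: set_integrable_def)
next
  case (Suc j)
  have eq: "{of_int i / 2^n ..< (of_int i + real (Suc j)) / 2^n :: real} =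
    {of_int i / 2^n ..< (of_int i + real j) / 2^n} \<union>
    {of_int (i + int j) / 2^n ..< (of_int (i + int j) + 1) / 2^n}"
    by (auto simp: field_simps)
  show ?case
    unfolding eq using Suc assms[of "i + int j"] by (intro set_integrable_Un) auto
qed

lemma grid_set_integral:
  fixes f :: "real \<Rightarrow> 'b::euclidean_space"
  assumes int: "\<And>i. set_integrable lborel {of_int i / 2^n ..< (of_int i + 1) / 2^n} f"
  shows "(LINT x:{of_int i / 2^n ..< (of_int i + real j) / 2^n}|lborel. f x)
    = (\<Sum>k<j. LINT x:{of_int (i + int k) / 2^n ..< (of_int (i + int k) + 1) / 2^n}|lborel. f x)"
proof (induction j)
  case 0
  then show ?case by (simp add: set_lebesgue_integral_def)
next
  case (Suc j)
  let ?A = "{of_int i / 2^n ..< (of_int i + real j) / 2^n :: real}"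
  let ?B = "{of_int (i + int j) / 2^n ..< (of_int (i + int j) + 1) / 2^n :: real}"
  have eq: "{of_int i / 2^n ..< (of_int i + real (Suc j)) / 2^n :: real} = ?A \<union> ?B"
    by (auto simp: field_simps)
  have "(LINT x:?A \<union> ?B|lborel. f x) = (LINT x:?A|lborel. f x) + (LINT x:?B|lborel. f x)"
    using int[of "i + int j"] grid_set_integrable[OF int] by (intro set_integral_Un) auto
  then show ?case
    unfolding eq using Suc by simp
qed

lemma cell_integral_const:
  fixes f :: "real \<Rightarrow> 'b::euclidean_space"
  assumes "\<And>x. x \<in> {of_int i / 2^n ..< (of_int i + 1) / 2^n} \<Longrightarrow> f x = c"
  shows "set_integrable lborel {of_int i / 2^n ..< (of_int i + 1) / 2^n} f"
    "(LINT x:{of_int i / 2^n ..< (of_int i + 1) / 2^n}|lborel. f x) = (1 / 2^n) *\<^sub>R c"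
proof -
  let ?C = "{of_int i / 2^n ..< (of_int i + 1) / 2^n :: real}"
  have eq: "(\<lambda>x. indicator ?C x *\<^sub>R f x) = (\<lambda>x. indicator ?C x *\<^sub>R c)"
    using assms by (auto simp: indicator_def fun_eq_iff)
  have le: "of_int i / 2^n \<le> ((of_int i + 1) / 2^n :: real)"
    by (simp add: divide_right_mono)
  have len: "(of_int i + 1) / 2^n - of_int i / 2^n = (1 / 2^n :: real)"
    by (simp add: add_divide_distrib)
  have em: "emeasure lborel ?C < \<infinity>"
    using le by simp
  show "set_integrable lborel ?C f"
    unfolding set_integrable_def eq using em by (intro integrable_scaleR_left integrable_real_indicator) auto
  show "(LINT x:?C|lborel. f x) = (1 / 2^n) *\<^sub>R c"
    unfolding set_lebesgue_integral_def eq using em le len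
    by (subst integral_scaleR_left) (auto intro!: integrable_real_indicator)
qed

lemma grid_quot_cell:
  "x \<in> {of_int i / 2^n ..< (of_int i + 1) / 2^n} \<Longrightarrow>
    grid_quot F n x = 2^n *\<^sub>R (F ((of_int i + 1) / 2^n) - F (of_int i / 2^n))"
  using floor_grid[of x i n] by (simp add: grid_quot_def)

lemma grid_quot_cell_integral:
  shows "set_integrable lborel {of_int i / 2^n ..< (of_int i + 1) / 2^n} (grid_quot F n)"
    "(LINT x:{of_int i / 2^n ..< (of_int i + 1) / 2^n}|lborel. grid_quot F n x)
      = F ((of_int i + 1) / 2^n) - F (of_int i / 2^n)"
proof -
  note cell = cell_integral_const[of i n "grid_quot F n", OF grid_quot_cell[of _ i n F]]
  show "set_integrable lborel {of_int i / 2^n ..< (of_int i + 1) / 2^n} (grid_quot F n)"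
    by (rule cell(1))
  show "(LINT x:{of_int i / 2^n ..< (of_int i + 1) / 2^n}|lborel. grid_quot F n x)
      = F ((of_int i + 1) / 2^n) - F (of_int i / 2^n)"
    using cell(2) by simp
qed

lemma grid_quot_integral_same:
  shows "set_integrable lborel {of_int i / 2^n ..< (of_int i + real j) / 2^n} (grid_quot F n)"
    "(LINT x:{of_int i / 2^n ..< (of_int i + real j) / 2^n}|lborel. grid_quot F n x)
      = F ((of_int i + real j) / 2^n) - F (of_int i / 2^n)"
proof -
  show "set_integrable lborel {of_int i / 2^n ..< (of_int i + real j) / 2^n} (grid_quot F n)"
    by (rule grid_set_integrable) (rule grid_quot_cell_integral)
  have "(LINT x:{of_int i / 2^n ..< (of_int i + real j) / 2^n}|lborel. grid_quot F n x)
      = (\<Sum>k<j. F ((of_int i + real (Suc k)) / 2^n) - F ((of_int i + real k) / 2^n))"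
    unfolding grid_set_integral[OF grid_quot_cell_integral(1)]
  proof (rule sum.cong)
    fix k
    show "(LINT x:{of_int (i + int k) / 2^n ..< (of_int (i + int k) + 1) / 2^n}|lborel. grid_quot F n x)
      = F ((of_int i + real (Suc k)) / 2^n) - F ((of_int i + real k) / 2^n)"
      using grid_quot_cell_integral(2)[of "i + int k" n F] by (simp add: add_ac)
  qed simp
  also have "\<dots> = F ((of_int i + real j) / 2^n) - F (of_int i / 2^n)"
    by (subst sum_lessThan_telescope) simp
  finally show "(LINT x:{of_int i / 2^n ..< (of_int i + real j) / 2^n}|lborel. grid_quot F n x)
      = F ((of_int i + real j) / 2^n) - F (of_int i / 2^n)" .
qed

lemma grid_refine:
  assumes "n \<le> m"
  shows "(of_int i + real j) / 2^n = (of_int (i * 2^(m - n)) + real (j * 2^(m - n))) / (2^m :: real)"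
    "of_int i / 2^n = of_int (i * 2^(m - n)) / (2^m :: real)"
proof -
  have "(2::real)^m = 2^n * 2^(m - n)" using assms by (simp add: power_add[symmetric])
  then show "(of_int i + real j) / 2^n = (of_int (i * 2^(m - n)) + real (j * 2^(m - n))) / (2^m :: real)"
    "of_int i / 2^n = of_int (i * 2^(m - n)) / (2^m :: real)"
    by (simp_all add: field_simps)
qed

lemma grid_quot_integral:
  assumes "n \<le> m"
  shows "set_integrable lborel {of_int i / 2^n ..< (of_int i + real j) / 2^n} (grid_quot F m)"
    "(LINT x:{of_int i / 2^n ..< (of_int i + real j) / 2^n}|lborel. grid_quot F m x)
      = F ((of_int i + real j) / 2^n) - F (of_int i / 2^n)"
  unfolding grid_refine(1)[OF assms, of i j] grid_refine(2)[OF assms, of i]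
  by (rule grid_quot_integral_same)+

lemma grid_quot_sq_integrable:
  assumes "n \<le> m"
  shows "set_integrable lborel {of_int i / 2^n ..< (of_int i + real j) / 2^n} (\<lambda>x. (norm (grid_quot F m x))\<^sup>2)"
proof -
  have "set_integrable lborel {of_int i / 2^m ..< (of_int i + 1) / 2^m} (\<lambda>x. (norm (grid_quot F m x))\<^sup>2)"
    for i
    by (rule cell_integral_const(1)) (subst grid_quot_cell, assumption, rule refl)
  from grid_set_integrable[OF this, of "i * 2^(m - n)" "j * 2^(m - n)"] show ?thesis
    by (simp only: grid_refine(1)[OF assms, of i j] grid_refine(2)[OF assms, of i])
qed

text \<open>On a cell of level \<open>n\<close> the coarse quotient is constant, and there the fine
  quotient has the same integral as the coarse one. So the fine minus the coarse quotient is
  orthogonal to the coarse one.\<close>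

lemma grid_quot_inner:
  fixes F :: "real \<Rightarrow> 'a::euclidean_space" and i :: int and j n m :: nat
  assumes "n \<le> m"
  defines "I \<equiv> {of_int i / 2^n ..< (of_int i + real j) / 2^n}"
  shows "set_integrable lborel I (\<lambda>x. grid_quot F m x \<bullet> grid_quot F n x)"
    "(LINT x:I|lborel. grid_quot F m x \<bullet> grid_quot F n x) = (LINT x:I|lborel. (norm (grid_quot F n x))\<^sup>2)"
proof -
  define C where "C i = {of_int i / 2^n ..< (of_int i + 1) / 2^n :: real}" for i :: int
  define v where "v i = 2^n *\<^sub>R (F ((of_int i + 1) / 2^n) - F (of_int i / 2^n))" for i :: int
  have v: "grid_quot F n x = v i" if "x \<in> C i" for x i
    using that unfolding C_def v_def by (rule grid_quot_cell)
  have int: "set_integrable lborel (C i) (grid_quot F m)" 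
      and val: "(LINT x:C i|lborel. grid_quot F m x) = (1 / 2^n) *\<^sub>R v i" for i
    using grid_quot_integral[OF assms(1), of i 1 F] by (auto simp: C_def v_def)
  have eq: "(\<lambda>x. indicator (C i) x *\<^sub>R (grid_quot F m x \<bullet> grid_quot F n x)) =
      (\<lambda>x. (indicator (C i) x *\<^sub>R grid_quot F m x) \<bullet> v i)" for i
    using v by (auto simp: indicator_def fun_eq_iff)
  have 1: "set_integrable lborel (C i) (\<lambda>x. grid_quot F m x \<bullet> grid_quot F n x)" for i
    using int unfolding set_integrable_def eq by (intro integrable_inner_left) auto
  have 2: "(LINT x:C i|lborel. grid_quot F m x \<bullet> grid_quot F n x) = (1 / 2^n) * (v i \<bullet> v i)" for i
    using int[of i] val[of i] unfolding set_lebesgue_integral_def eq set_integrable_def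
    by (subst integral_inner_left) auto
  have 3: "set_integrable lborel (C i) (\<lambda>x. (norm (grid_quot F n x))\<^sup>2)"
      "(LINT x:C i|lborel. (norm (grid_quot F n x))\<^sup>2) = (1 / 2^n) * (v i \<bullet> v i)" for i
    using cell_integral_const[of i n "\<lambda>x. (norm (grid_quot F n x))\<^sup>2" "v i \<bullet> v i"] v[of _ i]
    by (auto simp: C_def power2_norm_eq_inner)
  show "set_integrable lborel I (\<lambda>x. grid_quot F m x \<bullet> grid_quot F n x)"
    unfolding I_def by (rule grid_set_integrable[OF 1[unfolded C_def]])
  show "(LINT x:I|lborel. grid_quot F m x \<bullet> grid_quot F n x) = (LINT x:I|lborel. (norm (grid_quot F n x))\<^sup>2)"
    unfolding I_def grid_set_integral[OF 1[unfolded C_def]] grid_set_integral[OF 3(1)[unfolded C_def]]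
    using 2[unfolded C_def] 3(2)[unfolded C_def] by (intro sum.cong) (simp_all only:)
qed

lemma grid_quot_pythagoras_set:
  fixes F :: "real \<Rightarrow> 'a::euclidean_space" and i :: int and j n m :: nat
  assumes "n \<le> m"
  defines "I \<equiv> {of_int i / 2^n ..< (of_int i + real j) / 2^n}"
  shows "(\<integral>\<^sup>+x\<in>I. ennreal ((norm (grid_quot F m x))\<^sup>2) \<partial>lborel) =
    (\<integral>\<^sup>+x\<in>I. ennreal ((norm (grid_quot F n x))\<^sup>2) \<partial>lborel) +
    (\<integral>\<^sup>+x\<in>I. ennreal ((norm (grid_quot F m x - grid_quot F n x))\<^sup>2) \<partial>lborel)"
proof -
  note im = grid_quot_sq_integrable[OF assms(1), of i j F, folded I_def]
  note i_n = grid_quot_sq_integrable[OF order_refl, of i n j F, folded I_def]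
  note inn = grid_quot_inner[OF assms(1), of i j F, folded I_def]
  have eq: "(norm (a - b))\<^sup>2 = (norm a)\<^sup>2 - 2 * (a \<bullet> b) + (norm b)\<^sup>2" for a b :: 'a
    by (simp add: power2_norm_eq_inner algebra_simps inner_commute)
  have id: "set_integrable lborel I (\<lambda>x. (norm (grid_quot F m x - grid_quot F n x))\<^sup>2)"
    unfolding eq by (intro set_integral_add set_integral_diff im i_n set_integrable_mult_right inn)
  have "(LINT x:I|lborel. (norm (grid_quot F m x - grid_quot F n x))\<^sup>2)
     = (LINT x:I|lborel. (norm (grid_quot F m x))\<^sup>2) - 2 * (LINT x:I|lborel. grid_quot F m x \<bullet> grid_quot F n x)
       + (LINT x:I|lborel. (norm (grid_quot F n x))\<^sup>2)"
  proof -
    have i2: "set_integrable lborel I (\<lambda>x. 2 * (grid_quot F m x \<bullet> grid_quot F n x))"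
      by (intro set_integrable_mult_right inn)
    show ?thesis
      unfolding eq set_integral_add(2)[OF set_integral_diff(1)[OF im i2] i_n] set_integral_diff(2)[OF im i2]
      by simp
  qed
  then have r: "(LINT x:I|lborel. (norm (grid_quot F m x))\<^sup>2) = (LINT x:I|lborel. (norm (grid_quot F n x))\<^sup>2)
      + (LINT x:I|lborel. (norm (grid_quot F m x - grid_quot F n x))\<^sup>2)"
    unfolding inn by simp
  have conv: "(\<integral>\<^sup>+x\<in>I. ennreal (f x) \<partial>lborel) = ennreal (LINT x:I|lborel. f x)"
    if "set_integrable lborel I f" "\<And>x. 0 \<le> f x" for f :: "real \<Rightarrow> real"
  proof -
    have "(\<integral>\<^sup>+x\<in>I. ennreal (f x) \<partial>lborel) = (\<integral>\<^sup>+x. ennreal (indicator I x *\<^sub>R f x) \<partial>lborel)"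
      by (intro nn_integral_cong) (auto simp: indicator_def)
    also have "\<dots> = ennreal (LINT x:I|lborel. f x)"
      using that unfolding set_integrable_def set_lebesgue_integral_def
      by (intro nn_integral_eq_integral) auto
    finally show ?thesis .
  qed
  have nn: "0 \<le> (LINT x:I|lborel. f x)" if "\<And>x. 0 \<le> f x" for f :: "real \<Rightarrow> real"
    using that unfolding set_lebesgue_integral_def by (intro Bochner_Integration.integral_nonneg) (simp add: indicator_def)
  show ?thesis
    using r by (simp add: conv im i_n id ennreal_plus[symmetric] nn del: ennreal_plus)
qed

lemma grid_quot_pythagoras:
  assumes "n \<le> m"
  shows "(\<integral>\<^sup>+x. ennreal ((norm (grid_quot F m x))\<^sup>2) \<partial>lborel) =
    (\<integral>\<^sup>+x. ennreal ((norm (grid_quot F n x))\<^sup>2) \<partial>lborel) +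
    (\<integral>\<^sup>+x. ennreal ((norm (grid_quot F m x - grid_quot F n x))\<^sup>2) \<partial>lborel)"
proof -
  have m1: "(\<lambda>x. ennreal ((norm (grid_quot F m x))\<^sup>2)) \<in> borel_measurable borel"
    and m2: "(\<lambda>x. ennreal ((norm (grid_quot F n x))\<^sup>2) +
      ennreal ((norm (grid_quot F m x - grid_quot F n x))\<^sup>2)) \<in> borel_measurable borel"
    by measurable
  \<comment> \<open>Integers are grid points of every level, so each window \<open>[-k, k)\<close>
    is a union of whole cells.\<close>
  have set: "{- real k..<real k} = {of_int (- int k * 2^n) / 2^n ..< (of_int (- int k * 2^n) + real (2 * k * 2^n)) / 2^n :: real}"
    for k :: nat
  proof -
    have "- real k = of_int (- int k * 2^n) / 2^n" by simp
    moreover have "real k = (of_int (- int k * 2^n) + real (2 * k * 2^n)) / 2^n" by simp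
    ultimately show ?thesis by metis
  qed
  have "(\<integral>\<^sup>+x\<in>{- real k..<real k}. ennreal ((norm (grid_quot F m x))\<^sup>2) \<partial>lborel) =
    (\<integral>\<^sup>+x\<in>{- real k..<real k}. ennreal ((norm (grid_quot F n x))\<^sup>2) +
      ennreal ((norm (grid_quot F m x - grid_quot F n x))\<^sup>2) \<partial>lborel)" for k :: nat
    unfolding set grid_quot_pythagoras_set[OF assms]
    by (subst nn_integral_add[symmetric]) (auto simp: distrib_right)
  then have "(\<integral>\<^sup>+x. ennreal ((norm (grid_quot F m x))\<^sup>2) \<partial>lborel) =
     (\<integral>\<^sup>+x. ennreal ((norm (grid_quot F n x))\<^sup>2) +
      ennreal ((norm (grid_quot F m x - grid_quot F n x))\<^sup>2) \<partial>lborel)"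
    unfolding nn_integral_UNIV_eq_SUP[OF m1] nn_integral_UNIV_eq_SUP[OF m2] by simp
  then show ?thesis
    by (subst (asm) nn_integral_add) auto
qed

text \<open>On one cell of length \<open>1 / 2^n\<close> the squared quotient integrates to
  \<open>2^n\<close> times the squared increment of \<open>F\<close>, which \<open>bound\<close>
  makes at most \<open>q\<close> of that cell. Superadditivity of \<open>q\<close> collects the
  cells.\<close>

lemma nn_integral_grid_quot_le:
  fixes F :: "real \<Rightarrow> 'a::euclidean_space"
  assumes super: "\<And>a b c. a \<le> b \<Longrightarrow> b \<le> c \<Longrightarrow> q a b + q b c \<le> q a c"
    and bound: "\<And>a b. a \<le> b \<Longrightarrow> ennreal ((norm (F b - F a))\<^sup>2) \<le> ennreal (b - a) * q a b"
  shows "(\<integral>\<^sup>+x\<in>{of_int i / 2^n ..< (of_int i + real j) / 2^n}. ennreal ((norm (grid_quot F n x))\<^sup>2) \<partial>lborel)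
    \<le> q (of_int i / 2^n) ((of_int i + real j) / 2^n)"
proof (induction j)
  case 0
  then show ?case by simp
next
  case (Suc j)
  let ?A = "{of_int i / 2^n ..< (of_int i + real j) / 2^n :: real}"
  let ?a = "of_int (i + int j) / 2^n :: real"
  let ?b = "(of_int (i + int j) + 1) / 2^n :: real"
  let ?f = "\<lambda>x. ennreal ((norm (grid_quot F n x))\<^sup>2)"
  define v where "v = F ?b - F ?a"
  have ab: "?a \<le> ?b" by (simp add: divide_right_mono)
  have len: "?b - ?a = 1 / 2^n" by (simp add: add_divide_distrib)
  have "?f x * indicator {of_int i / 2^n ..< (of_int i + real (Suc j)) / 2^n :: real} x
    = ?f x * indicator ?A x + ?f x * indicator {?a..<?b} x" for x
    by (auto simp: indicator_def field_simps)
  then have "(\<integral>\<^sup>+x\<in>{of_int i / 2^n ..< (of_int i + real (Suc j)) / 2^n}. ?f x \<partial>lborel)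
    = (\<integral>\<^sup>+x\<in>?A. ?f x \<partial>lborel) + (\<integral>\<^sup>+x\<in>{?a..<?b}. ?f x \<partial>lborel)"
    by (simp add: nn_integral_add)
  also have "(\<integral>\<^sup>+x\<in>{?a..<?b}. ?f x \<partial>lborel) = (\<integral>\<^sup>+x\<in>{?a..<?b}. ennreal ((2^n * norm v)\<^sup>2) \<partial>lborel)"
    using grid_quot_cell[of _ "i + int j" n F]
    by (intro nn_integral_cong) (auto simp: indicator_def v_def simp del: of_int_add)
  also have "\<dots> = ennreal ((2^n * norm v)\<^sup>2) * ennreal (1 / 2^n)"
    using ab len by (subst nn_integral_cmult_indicator) auto
  also have "\<dots> = ennreal (2^n) * ennreal ((norm v)\<^sup>2)"
    by (simp add: ennreal_mult[symmetric] power_mult_distrib power2_eq_square)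
  also have "\<dots> \<le> ennreal (2^n) * (ennreal (1 / 2^n) * q ?a ?b)"
    using bound[OF ab] unfolding len v_def by (intro mult_left_mono) auto
  also have "\<dots> = q ?a ?b"
    by (simp add: mult.assoc[symmetric] ennreal_mult[symmetric])
  also have "(\<integral>\<^sup>+x\<in>?A. ?f x \<partial>lborel) + q ?a ?b \<le> q (of_int i / 2^n) ?a + q ?a ?b"
    using Suc by (intro add_right_mono) simp
  also have "\<dots> \<le> q (of_int i / 2^n) ?b"
    by (intro super ab) (simp add: divide_right_mono)
  finally show ?case by (simp add: add_ac)
qed

section \<open>Passage to the limit in the difference quotients\<close>

lemma Cauchy_fast_subseq:
  fixes d :: "nat \<Rightarrow> real"
  assumes "Cauchy d"
  obtains r :: "nat \<Rightarrow> nat" where "strict_mono r" "\<And>n. \<bar>d (r (Suc n)) - d (r n)\<bar> < (1/4)^n"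
proof -
  have "\<forall>n. \<exists>N. \<forall>i\<ge>N. \<forall>j\<ge>N. dist (d i) (d j) < (1/4)^n"
    using assms by (simp add: Cauchy_def)
  then obtain N where N: "\<And>n i j. N n \<le> i \<Longrightarrow> N n \<le> j \<Longrightarrow> dist (d i) (d j) < (1/4)^n"
    by metis
  define r where "r n = n + (\<Sum>k\<le>n. N k)" for n
  have ge: "N n \<le> r n" for n
    unfolding r_def using member_le_sum[of n "{..n}" N] by (simp add: trans_le_add2)
  have lt: "r n < r (Suc n)" for n by (simp add: r_def)
  show thesis
  proof
    show "strict_mono r" using lt by (simp add: strict_mono_Suc_iff)
    show "\<bar>d (r (Suc n)) - d (r n)\<bar> < (1/4)^n" for n
      using N[of n "r (Suc n)" "r n"] ge[of n] lt[of n] by (simp add: dist_real_def)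
  qed
qed

lemma ennreal_power2_le_imp_le:
  assumes "X\<^sup>2 \<le> (ennreal y)\<^sup>2" "0 \<le> y"
  shows "X \<le> ennreal y"
proof (cases X)
  case (real x)
  with assms have "x\<^sup>2 \<le> y\<^sup>2" by (simp add: ennreal_power ennreal_le_iff)
  then have "x \<le> y" using assms(2) by (rule power2_le_imp_le)
  with real show ?thesis by (simp add: ennreal_leI)
next
  case top
  with assms show ?thesis by (simp add: ennreal_power top_unique)
qed

lemma nn_integral_norm_interval_le:
  fixes f :: "real \<Rightarrow> 'a::euclidean_space"
  assumes [measurable]: "f \<in> borel_measurable borel" "S \<in> sets borel"
    and "S \<subseteq> {a..b}" "a \<le> b" "(\<integral>\<^sup>+x\<in>S. ennreal ((norm (f x))\<^sup>2) \<partial>lborel) \<le> ennreal c" "0 \<le> c"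
  shows "(\<integral>\<^sup>+x\<in>S. ennreal (norm (f x)) \<partial>lborel) \<le> ennreal (sqrt ((b - a) * c))"
proof -
  let ?I = "indicator S :: real \<Rightarrow> ennreal"
  have "(\<integral>\<^sup>+x. (ennreal (norm (f x)) * ?I x) * ?I x \<partial>lborel)\<^sup>2
      \<le> (\<integral>\<^sup>+x. (ennreal (norm (f x)) * ?I x)\<^sup>2 \<partial>lborel) * (\<integral>\<^sup>+x. (?I x)\<^sup>2 \<partial>lborel)"
    by (intro Cauchy_Schwarz_nn_integral) auto
  also have "(\<integral>\<^sup>+x. (ennreal (norm (f x)) * ?I x)\<^sup>2 \<partial>lborel) = (\<integral>\<^sup>+x\<in>S. ennreal ((norm (f x))\<^sup>2) \<partial>lborel)"
    by (intro nn_integral_cong) (auto simp: indicator_def ennreal_power)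
  also have "(\<integral>\<^sup>+x. (?I x)\<^sup>2 \<partial>lborel) = emeasure lborel S"
  proof -
    have "(?I x)\<^sup>2 = ?I x" for x by (simp add: indicator_def)
    then show ?thesis by simp
  qed
  also have "(\<integral>\<^sup>+x\<in>S. ennreal ((norm (f x))\<^sup>2) \<partial>lborel) * emeasure lborel S \<le> ennreal c * ennreal (b - a)"
  proof (intro mult_mono assms)
    have "emeasure lborel S \<le> emeasure lborel {a..b}" using assms by (intro emeasure_mono) auto
    then show "emeasure lborel S \<le> ennreal (b - a)" using assms by simp
  qed auto
  also have "\<dots> = (ennreal (sqrt ((b - a) * c)))\<^sup>2"
    using assms by (simp add: ennreal_power ennreal_mult[symmetric] mult.commute)
  also have "(\<integral>\<^sup>+x. (ennreal (norm (f x)) * ?I x) * ?I x \<partial>lborel) = (\<integral>\<^sup>+x\<in>S. ennreal (norm (f x)) \<partial>lborel)"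
    by (intro nn_integral_cong) (auto simp: indicator_def)
  finally show ?thesis
    using assms by (intro ennreal_power2_le_imp_le) auto
qed

text \<open>F. Riesz's criterion for a square integrable derivative: the dyadic quotients are a
  martingale bounded in \<open>L^2\<close>, and its limit is the derivative. The bound
  \<open>q\<close> is a superadditive interval function and not an integral, because in the
  compactness proof it arises as a lower limit of integrals.\<close>

theorem riesz_derivative:
  fixes F :: "real \<Rightarrow> 'a::euclidean_space"
  assumes super: "\<And>a b c. a \<le> b \<Longrightarrow> b \<le> c \<Longrightarrow> q a b + q b c \<le> q a c"
    and bound: "\<And>a b. a \<le> b \<Longrightarrow> ennreal ((norm (F b - F a))\<^sup>2) \<le> ennreal (b - a) * q a b"
    and K: "\<And>a b. a \<le> b \<Longrightarrow> q a b \<le> ennreal K"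
  obtains G where "G \<in> borel_measurable borel"
    "\<And>a b. a \<le> b \<Longrightarrow> set_integrable lborel {a..b} G"
    "\<And>a b. a \<le> b \<Longrightarrow> (LINT x:{a..b}|lborel. G x) = F b - F a"
    "\<And>k::nat. (\<integral>\<^sup>+x\<in>{- real k..<real k}. ennreal ((norm (G x))\<^sup>2) \<partial>lborel) \<le> q (- real k) (real k)"
proof -
  define N where "N n = (\<integral>\<^sup>+x. ennreal ((norm (grid_quot F n x))\<^sup>2) \<partial>lborel)" for n
  have win: "(\<integral>\<^sup>+x\<in>{- real k..<real k}. ennreal ((norm (grid_quot F n x))\<^sup>2) \<partial>lborel) \<le> q (- real k) (real k)"
    for k n :: nat
  proof -
    have 1: "- real k = of_int (- int k * 2^n) / 2^n" by simp
    have 2: "real k = (of_int (- int k * 2^n) + real (2 * k * 2^n)) / 2^n" by simp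
    show ?thesis
      using nn_integral_grid_quot_le[where q = q and F = F and i = "- int k * 2^n" and n = n and j = "2 * k * 2^n", OF super bound]
      unfolding 1[symmetric] 2[symmetric] by simp
  qed
  have NK: "N n \<le> ennreal K" for n
    unfolding N_def
    by (subst nn_integral_UNIV_eq_SUP) (auto intro!: SUP_least order_trans[OF win K])
  define d where "d n = enn2real (N n)" for n
  have Nd: "N n = ennreal (d n)" for n
  proof -
    have "N n < top" using NK[of n] ennreal_less_top by (rule order_le_less_trans)
    then show ?thesis by (simp add: d_def)
  qed
  have d0: "0 \<le> d n" for n by (simp add: d_def)
  \<comment> \<open>\<open>K\<close> carries no sign; \<open>ennreal K\<close> is 0 for negative
    \<open>K\<close>, hence the maximum.\<close>
  have dK: "d n \<le> max K 0" for n
    using NK[of n] unfolding Nd by (metis d0 ennreal_le_iff2 max.coboundedI1 max.coboundedI2)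
  define e where "e m n = (\<integral>\<^sup>+x. ennreal ((norm (grid_quot F m x - grid_quot F n x))\<^sup>2) \<partial>lborel)" for m n
  have pyth: "N m = N n + e m n" if "n \<le> m" for m n
    unfolding N_def e_def by (rule grid_quot_pythagoras[OF that])
  have e_eq: "e m n = ennreal (d m - d n) \<and> d n \<le> d m" if "n \<le> m" for m n
  proof -
    have "ennreal (d m) = ennreal (d n) + e m n" using pyth[OF that] by (simp add: Nd)
    then obtain z where z: "e m n = ennreal z" "0 \<le> z"
      by (cases "e m n") auto
    with \<open>ennreal (d m) = ennreal (d n) + e m n\<close> have "d m = d n + z"
      using d0[of n] d0[of m] by (simp flip: ennreal_plus)
    with z show ?thesis by simp
  qed
  have "incseq d" using e_eq by (auto simp: incseq_def)
  then have "convergent d"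
    using dK by (metis incseq_convergent convergent_def)
  \<comment> \<open>By orthogonality an increment of the squared norms is the squared norm of the
    difference. Squared norms below \<open>(1/4)^n\<close> mean norms below \<open>(1/2)^n\<close>,
    which are summable.\<close>
  then obtain r where r: "strict_mono r" "\<And>n. \<bar>d (r (Suc n)) - d (r n)\<bar> < (1/4)^n"
    using Cauchy_fast_subseq convergent_Cauchy by blast
  define H where "H n x = grid_quot F (r (Suc n)) x - grid_quot F (r n) x" for n x
  have H_meas [measurable]: "H n \<in> borel_measurable borel" for n
    unfolding H_def[abs_def] by measurable
  have H_L2: "(\<integral>\<^sup>+x. ennreal ((norm (H n x))\<^sup>2) \<partial>lborel) \<le> ennreal ((1/4)^n)" for n
  proof -
    have "r n \<le> r (Suc n)" using r(1) by (simp add: strict_mono_leD)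
    from e_eq[OF this] show ?thesis
      using r(2)[of n] unfolding H_def e_def[symmetric] by (simp add: ennreal_leI)
  qed
  have H_L1: "(\<integral>\<^sup>+x\<in>S. ennreal (norm (H n x)) \<partial>lborel) \<le> ennreal (sqrt (b - a) * (1/2)^n)"
    if "a \<le> b" "S \<in> sets borel" "S \<subseteq> {a..b}" for a b n S
  proof -
    have "(\<integral>\<^sup>+x\<in>S. ennreal ((norm (H n x))\<^sup>2) \<partial>lborel) \<le> (\<integral>\<^sup>+x. ennreal ((norm (H n x))\<^sup>2) \<partial>lborel)"
      by (intro nn_integral_mono) (auto simp: indicator_def)
    also note H_L2[of n]
    finally have "(\<integral>\<^sup>+x\<in>S. ennreal (norm (H n x)) \<partial>lborel) \<le> ennreal (sqrt ((b - a) * (1/4)^n))"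
      using that by (intro nn_integral_norm_interval_le) auto
    also have "sqrt ((b - a) * (1/4)^n) = sqrt (b - a) * (1/2)^n"
    proof -
      have "(1/4::real)^n = ((1/2)^n)\<^sup>2"
        by (simp add: power2_eq_square flip: power_mult_distrib)
      then show ?thesis by (simp add: real_sqrt_mult)
    qed
    finally show ?thesis .
  qed
  have tele: "(\<Sum>i<n. H i x) = grid_quot F (r n) x - grid_quot F (r 0) x" for n x
    unfolding H_def by (rule sum_lessThan_telescope[where f = "\<lambda>n. grid_quot F (r n) x"])
  have AE_sum: "AE x in lborel. summable (\<lambda>n. norm (H n x))"
  proof -
    have "AE x in lborel. x \<in> {- real k..real k} \<longrightarrow> summable (\<lambda>n. norm (H n x))" for k :: nat
    proof -
      let ?S = "{- real k..real k}"
      have "(\<integral>\<^sup>+x\<in>?S. (\<Sum>n. ennreal (norm (H n x))) \<partial>lborel) = (\<integral>\<^sup>+x. (\<Sum>n. ennreal (norm (H n x)) * indicator ?S x) \<partial>lborel)"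
        by (intro nn_integral_cong) (rule ennreal_suminf_multc[symmetric])
      also have "\<dots> = (\<Sum>n. \<integral>\<^sup>+x\<in>?S. ennreal (norm (H n x)) \<partial>lborel)"
        by (rule nn_integral_suminf) auto
      also have "\<dots> \<le> (\<Sum>n. ennreal (sqrt (2 * real k) * (1/2)^n))"
        using H_L1[of "- real k" "real k" ?S] by (intro suminf_le) auto
      also have "\<dots> < \<infinity>"
        by (subst suminf_ennreal2) (auto intro!: summable_mult summable_geometric)
      finally have "AE x in lborel. (\<Sum>n. ennreal (norm (H n x))) * indicator ?S x \<noteq> \<infinity>"
        by (intro nn_integral_PInf_AE) auto
      then show ?thesis
      proof eventually_elim
        case (elim x)
        then show ?case
          by (auto intro!: summable_suminf_not_top)
      qed
    qed
    then have "AE x in lborel. \<forall>k::nat. x \<in> {- real k..real k} \<longrightarrow> summable (\<lambda>n. norm (H n x))"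
      unfolding AE_all_countable by blast
    then show ?thesis
    proof eventually_elim
      case (elim x)
      obtain k :: nat where "\<bar>x\<bar> < real k" using reals_Archimedean2 by blast
      then have "x \<in> {- real k..real k}" by auto
      then show ?case using elim by blast
    qed
  qed
  \<comment> \<open>The limit along the subsequence, written as a telescoping series so that it is
    measurable everywhere and not only defined almost everywhere.\<close>
  define G where "G x = grid_quot F (r 0) x + (\<Sum>n. H n x)" for x
  have G_meas [measurable]: "G \<in> borel_measurable borel"
    unfolding G_def[abs_def] by measurable
  have AE_lim: "AE x in lborel. (\<lambda>n. grid_quot F (r n) x) \<longlonglongrightarrow> G x"
    using AE_sum
  proof eventually_elim
    case (elim x)
    then have "summable (\<lambda>n. H n x)" by (rule summable_norm_cancel)
    then have "(\<lambda>n. grid_quot F (r 0) x + (\<Sum>i<n. H i x)) \<longlonglongrightarrow> G x"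
      unfolding G_def by (rule tendsto_add[OF tendsto_const summable_LIMSEQ])
    then show ?case by (simp add: tele)
  qed
  have win_G: "(\<integral>\<^sup>+x\<in>S. ennreal ((norm (G x))\<^sup>2) \<partial>lborel) \<le> C"
    if "\<And>n. (\<integral>\<^sup>+x\<in>S. ennreal ((norm (grid_quot F n x))\<^sup>2) \<partial>lborel) \<le> C" and [measurable]: "S \<in> sets borel" for S C
  proof -
    have "(\<integral>\<^sup>+x\<in>S. ennreal ((norm (G x))\<^sup>2) \<partial>lborel) =
       (\<integral>\<^sup>+x. liminf (\<lambda>n. ennreal ((norm (grid_quot F (r n) x))\<^sup>2) * indicator S x) \<partial>lborel)"
    proof (rule nn_integral_cong_AE, use AE_lim in eventually_elim)
      case (elim x)
      then have "(\<lambda>n. ennreal ((norm (grid_quot F (r n) x))\<^sup>2) * indicator S x)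
        \<longlonglongrightarrow> ennreal ((norm (G x))\<^sup>2) * indicator S x"
        by (intro tendsto_mult_ennreal tendsto_ennrealI tendsto_power tendsto_norm tendsto_const) (auto simp: indicator_def)
      then show ?case using lim_imp_Liminf[OF sequentially_bot] by metis
    qed
    also have "\<dots> \<le> liminf (\<lambda>n. \<integral>\<^sup>+x\<in>S. ennreal ((norm (grid_quot F (r n) x))\<^sup>2) \<partial>lborel)"
      by (rule nn_integral_liminf) auto
    also have "\<dots> \<le> C"
      by (intro order_trans[OF Liminf_le_Limsup] Limsup_bounded always_eventually allI that(1)) simp
    finally show ?thesis .
  qed
  have sint: "set_integrable lborel S f"
    if [measurable]: "f \<in> borel_measurable borel" "S \<in> sets borel" and "S \<subseteq> {a..b}" "a \<le> b"
      and "(\<integral>\<^sup>+x\<in>S. ennreal ((norm (f x))\<^sup>2) \<partial>lborel) \<le> ennreal c" "0 \<le> c"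
    for f :: "real \<Rightarrow> 'a" and S a b c
  proof -
    have "(\<integral>\<^sup>+x. ennreal (norm (indicator S x *\<^sub>R f x)) \<partial>lborel) = (\<integral>\<^sup>+x\<in>S. ennreal (norm (f x)) \<partial>lborel)"
      by (intro nn_integral_cong) (auto simp: indicator_def)
    also have "\<dots> < \<infinity>"
      using nn_integral_norm_interval_le[OF that] by (metis ennreal_less_top infinity_ennreal_def order_le_less_trans)
    finally show ?thesis
      unfolding set_integrable_def by (intro integrableI_bounded) auto
  qed
  have grid_N: "(\<integral>\<^sup>+x\<in>S. ennreal ((norm (grid_quot F n x))\<^sup>2) \<partial>lborel) \<le> ennreal (max K 0)" for S n
  proof -
    have "(\<integral>\<^sup>+x\<in>S. ennreal ((norm (grid_quot F n x))\<^sup>2) \<partial>lborel) \<le> N n"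
      unfolding N_def by (intro nn_integral_mono) (auto simp: indicator_def)
    also have "\<dots> \<le> ennreal (max K 0)" using dK[of n] unfolding Nd by (rule ennreal_leI)
    finally show ?thesis .
  qed
  have grid_int: "set_integrable lborel S (grid_quot F n)" 
    and G_int: "set_integrable lborel S G" if "S \<in> sets borel" "S \<subseteq> {a..b}" "a \<le> b" for S n a b
    using that by (auto intro!: sint grid_N win_G[OF grid_N])
  have dyadic: "(LINT x:{a..<b}|lborel. G x) = F b - F a"
    if a: "a = of_int i / 2^nn" and b: "b = (of_int i + real j) / 2^nn" for a b i j nn
  proof -
    have ab: "a \<le> b" by (simp add: a b divide_right_mono)
    let ?S = "{a..<b}"
    have S: "?S \<in> sets borel" "?S \<subseteq> {a..b}" by auto
    note gi = grid_int[OF S ab]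
    have hi: "set_integrable lborel ?S (H n)" for n
      unfolding H_def[abs_def] by (intro set_integral_diff gi)
    have Hint: "(LINT x:?S|lborel. H n x) = (LINT x:?S|lborel. grid_quot F (r (Suc n)) x) - (LINT x:?S|lborel. grid_quot F (r n) x)" for n
      unfolding H_def[abs_def] by (intro set_integral_diff gi)
    define h where "h n x = indicator ?S x *\<^sub>R H n x" for n x
    have h_int: "integrable lborel (h n)" for n
      using hi[of n] by (simp add: set_integrable_def h_def[abs_def])
    have h_le: "(LINT x|lborel. norm (h n x)) \<le> sqrt (b - a) * (1/2)^n" for n
    proof -
      have "ennreal (LINT x|lborel. norm (h n x)) = (\<integral>\<^sup>+x. ennreal (norm (h n x)) \<partial>lborel)"
        using h_int by (intro nn_integral_eq_integral[symmetric]) auto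
      also have "\<dots> = (\<integral>\<^sup>+x\<in>?S. ennreal (norm (H n x)) \<partial>lborel)"
        by (intro nn_integral_cong) (auto simp: h_def indicator_def)
      also have "\<dots> \<le> ennreal (sqrt (b - a) * (1/2)^n)" by (rule H_L1[OF ab S])
      finally show ?thesis using ab by (simp add: ennreal_le_iff)
    qed
    have sm: "summable (\<lambda>n. LINT x|lborel. norm (h n x))"
      by (rule summable_comparison_test'[where g = "\<lambda>n. sqrt (b - a) * (1/2)^n"])
        (auto intro!: summable_mult summable_geometric h_le Bochner_Integration.integral_nonneg)
    have AE_h: "AE x in lborel. summable (\<lambda>n. norm (h n x))"
      using AE_sum by eventually_elim (auto simp: h_def indicator_def)
    have "(\<lambda>n. LINT x|lborel. h n x) sums (LINT x|lborel. (\<Sum>n. h n x))"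
      by (rule sums_integral[OF h_int AE_h sm])
    then have lim1: "(\<lambda>m. \<Sum>n<m. LINT x|lborel. h n x) \<longlonglongrightarrow> (LINT x|lborel. (\<Sum>n. h n x))"
      by (simp add: sums_def)
    have "(\<Sum>n<m. LINT x|lborel. h n x) = (LINT x:?S|lborel. grid_quot F (r m) x) - (LINT x:?S|lborel. grid_quot F (r 0) x)" for m
      using sum_lessThan_telescope[of "\<lambda>n. LINT x:?S|lborel. grid_quot F (r n) x" m]
      using Hint by (simp add: h_def set_lebesgue_integral_def)
    \<comment> \<open>Once the grid of level \<open>r m\<close> refines level \<open>nn\<close>, the
      quotient integrates exactly to the increment of \<open>F\<close>, so the partial sums are
      eventually constant.\<close>
    moreover have "(LINT x:?S|lborel. grid_quot F (r m) x) = F b - F a" if "nn \<le> m" for m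
    proof -
      have "nn \<le> r m" using that seq_suble[OF r(1), of m] by simp
      then show ?thesis unfolding a b by (rule grid_quot_integral)
    qed
    ultimately have "\<forall>\<^sub>F m in sequentially. (\<Sum>n<m. LINT x|lborel. h n x) = F b - F a - (LINT x:?S|lborel. grid_quot F (r 0) x)"
      by (auto simp: eventually_sequentially)
    then have lim2: "(\<lambda>m. \<Sum>n<m. LINT x|lborel. h n x) \<longlonglongrightarrow> F b - F a - (LINT x:?S|lborel. grid_quot F (r 0) x)"
      by (rule tendsto_eventually)
    have eq: "(LINT x|lborel. (\<Sum>n. h n x)) = F b - F a - (LINT x:?S|lborel. grid_quot F (r 0) x)"
      by (rule LIMSEQ_unique[OF lim1 lim2])
    have "(LINT x:?S|lborel. G x) = (LINT x:?S|lborel. grid_quot F (r 0) x) + (LINT x|lborel. (\<Sum>n. h n x))"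
    proof -
      have G': "indicator ?S x *\<^sub>R G x = indicator ?S x *\<^sub>R grid_quot F (r 0) x + (\<Sum>n. h n x)" for x
        by (auto simp: G_def h_def indicator_def)
      show ?thesis
        unfolding set_lebesgue_integral_def G'
        using gi[of "r 0"] integrable_suminf[OF h_int AE_h sm] unfolding set_integrable_def
        by (rule Bochner_Integration.integral_add)
    qed
    then show ?thesis by (simp add: eq)
  qed
  have contF: "(\<lambda>n. F (s n)) \<longlonglongrightarrow> F c" if s: "s \<longlonglongrightarrow> c" for s :: "nat \<Rightarrow> real" and c
  proof -
    have le: "(norm (F x - F c))\<^sup>2 \<le> \<bar>x - c\<bar> * max K 0" for x
    proof -
      have "ennreal ((norm (F b - F a))\<^sup>2) \<le> ennreal ((b - a) * max K 0)" if "a \<le> b" for a b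
      proof -
        have "ennreal ((norm (F b - F a))\<^sup>2) \<le> ennreal (b - a) * q a b" by (rule bound[OF that])
        also have "\<dots> \<le> ennreal (b - a) * ennreal (max K 0)"
          by (intro mult_left_mono order_trans[OF K[OF that]] ennreal_leI) auto
        finally show ?thesis using that by (simp add: ennreal_mult)
      qed
      then have gen: "(norm (F b - F a))\<^sup>2 \<le> (b - a) * max K 0" if "a \<le> b" for a b
        using that by (simp add: ennreal_le_iff)
      show ?thesis
        using gen[of x c] gen[of c x] by (cases "x \<le> c") (auto simp: norm_minus_commute)
    qed
    have "(\<lambda>n. \<bar>s n - c\<bar> * max K 0) \<longlonglongrightarrow> \<bar>c - c\<bar> * max K 0"
      using s by (intro tendsto_intros)
    then have lim0: "(\<lambda>n. \<bar>s n - c\<bar> * max K 0) \<longlonglongrightarrow> 0" by simp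
    have "(\<lambda>n. (norm (F (s n) - F c))\<^sup>2) \<longlonglongrightarrow> 0"
    proof (rule tendsto_sandwich[OF _ _ tendsto_const lim0])
      show "\<forall>\<^sub>F n in sequentially. 0 \<le> (norm (F (s n) - F c))\<^sup>2" by simp
      show "\<forall>\<^sub>F n in sequentially. (norm (F (s n) - F c))\<^sup>2 \<le> \<bar>s n - c\<bar> * max K 0"
        by (intro always_eventually allI le)
    qed
    then have "(\<lambda>n. norm (F (s n) - F c)) \<longlonglongrightarrow> 0"
      using tendsto_real_sqrt[of "\<lambda>n. (norm (F (s n) - F c))\<^sup>2" 0] by simp
    then have "(\<lambda>n. F (s n) - F c) \<longlonglongrightarrow> 0" by (rule tendsto_norm_zero_cancel)
    then show ?thesis by (rule LIM_zero_cancel)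
  qed
  have fl: "(\<lambda>n. of_int \<lfloor>2^n * x\<rfloor> / 2^n) \<longlonglongrightarrow> x" for x :: real
  proof -
    have "(\<lambda>n. x - (1/2)^n) \<longlonglongrightarrow> x - 0"
      by (intro tendsto_diff tendsto_const LIMSEQ_power_zero) auto
    then have 1: "(\<lambda>n. x - (1/2)^n) \<longlonglongrightarrow> x" by simp
    have "x - (1/2)^n \<le> of_int \<lfloor>2^n * x\<rfloor> / 2^n \<and> of_int \<lfloor>2^n * x\<rfloor> / 2^n \<le> x" for n
    proof -
      have p: "(2::real)^n > 0" by simp
      have "2^n * x - 1 \<le> of_int \<lfloor>2^n * x\<rfloor>" "of_int \<lfloor>2^n * x\<rfloor> \<le> 2^n * x" by linarith+
      then have "(2^n * x - 1) / 2^n \<le> of_int \<lfloor>2^n * x\<rfloor> / 2^n" "of_int \<lfloor>2^n * x\<rfloor> / 2^n \<le> (2^n * x) / 2^n"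
        using p by (simp_all only: divide_le_cancel) auto
      then show ?thesis by (simp add: diff_divide_distrib power_one_over)
    qed
    then show ?thesis
      by (intro tendsto_sandwich[OF _ _ 1 tendsto_const]) auto
  qed
  \<comment> \<open>General endpoints are rounded down to dyadic points. Rounding lowers a point by
    at most 1, so the single window \<open>{a - 1..b}\<close> dominates for all
    \<open>n\<close>.\<close>
  have gen: "(LINT x:{a..b}|lborel. G x) = F b - F a" if ab: "a \<le> b" for a b
  proof -
    define s where "s n x = (of_int \<lfloor>2^n * x\<rfloor> / 2^n :: real)" for n and x :: real
    have s_le: "s n x \<le> x" for n x
      by (simp add: s_def field_simps)
    have s_ge: "x - 1 \<le> s n x" for n x
    proof -
      have "2^n * x - 1 \<le> of_int \<lfloor>2^n * x\<rfloor>" by linarith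
      moreover have "2^n * (x - 1) \<le> 2^n * x - (1::real)" by (simp add: algebra_simps)
      ultimately have "2^n * (x - 1) \<le> of_int \<lfloor>2^n * x\<rfloor>" by linarith
      then have "2^n * (x - 1) / 2^n \<le> of_int \<lfloor>2^n * x\<rfloor> / 2^n" by (rule divide_right_mono) simp
      then show ?thesis unfolding s_def by simp
    qed
    have s_lim: "(\<lambda>n. s n x) \<longlonglongrightarrow> x" for x unfolding s_def by (rule fl)
    have 1: "(LINT x:{s n a..<s n b}|lborel. G x) = F (s n b) - F (s n a)" for n
    proof (rule dyadic[where nn = n and j = "nat (\<lfloor>2^n * b\<rfloor> - \<lfloor>2^n * a\<rfloor>)" and i = "\<lfloor>2^n * a\<rfloor>"])
      have "\<lfloor>2^n * a\<rfloor> \<le> \<lfloor>2^n * b\<rfloor>" using ab by (intro floor_mono) simp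
      then show "s n b = (of_int \<lfloor>2^n * a\<rfloor> + real (nat (\<lfloor>2^n * b\<rfloor> - \<lfloor>2^n * a\<rfloor>))) / 2^n"
        by (simp add: s_def)
    qed (simp add: s_def)
    have "(\<lambda>n. LINT x|lborel. indicator {s n a..<s n b} x *\<^sub>R G x) \<longlonglongrightarrow> (LINT x|lborel. indicator {a..<b} x *\<^sub>R G x)"
    proof (rule integral_dominated_convergence)
      show "integrable lborel (\<lambda>x. norm (indicator {a - 1..b} x *\<^sub>R G x))"
        using G_int[of "{a - 1..b}" "a - 1" b] ab unfolding set_integrable_def by (intro integrable_norm) auto
      show "AE x in lborel. (\<lambda>n. indicator {s n a..<s n b} x *\<^sub>R G x) \<longlonglongrightarrow> indicator {a..<b} x *\<^sub>R G x"
      proof (rule AE_I2, rule tendsto_scaleR[OF _ tendsto_const], rule tendsto_eventually)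
        fix x
        have e1: "\<forall>\<^sub>F n in sequentially. x < s n a" if "x < a"
          using s_lim[of a] that by (simp add: order_tendstoD(1))
        have e2: "\<forall>\<^sub>F n in sequentially. x < s n b" if "x < b"
          using s_lim[of b] that by (simp add: order_tendstoD(1))
        consider "x < a" | "a \<le> x" "x < b" | "b \<le> x" by linarith
        then show "\<forall>\<^sub>F n in sequentially. indicat_real {s n a..<s n b} x = indicator {a..<b} x"
        proof cases
          case 1
          show ?thesis using e1[OF 1] by eventually_elim (use 1 in \<open>auto simp: indicator_def\<close>)
        next
          case 2
          show ?thesis using e2[OF 2(2)] 
            by eventually_elim (use 2 order_trans[OF s_le[of _ a] 2(1)] in \<open>auto simp: indicator_def\<close>)
        next
          case 3
          show ?thesis using order_trans[OF s_le[of _ b] 3] 3 by (intro always_eventually) (auto simp: indicator_def not_less)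
        qed
      qed
      fix n
      have "{s n a..<s n b} \<subseteq> {a - 1..b}" using s_le[of n b] s_ge[of a n] by auto
      then show "AE x in lborel. norm (indicator {s n a..<s n b} x *\<^sub>R G x) \<le> norm (indicator {a - 1..b} x *\<^sub>R G x)"
        by (intro AE_I2) (auto simp: indicator_def)
    qed auto
    then have l1: "(\<lambda>n. F (s n b) - F (s n a)) \<longlonglongrightarrow> (LINT x:{a..<b}|lborel. G x)"
      using 1 by (simp add: set_lebesgue_integral_def)
    have l2: "(\<lambda>n. F (s n b) - F (s n a)) \<longlonglongrightarrow> F b - F a"
      by (intro tendsto_diff contF s_lim)
    have "(LINT x:{a..b}|lborel. G x) = (LINT x:{a..<b}|lborel. G x)"
      unfolding set_lebesgue_integral_def
    proof (rule integral_cong_AE)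
      have "AE x in lborel. x \<noteq> b" by (rule AE_lborel_singleton)
      then show "AE x in lborel. indicat_real {a..b} x *\<^sub>R G x = indicat_real {a..<b} x *\<^sub>R G x"
        by eventually_elim (auto simp: indicator_def)
    qed auto
    with LIMSEQ_unique[OF l1 l2] show ?thesis by simp
  qed
  show thesis
  proof (rule that)
    show "set_integrable lborel {a..b} G" if "a \<le> b" for a b
      using that by (intro G_int[of _ a b]) auto
  qed (use gen win_G[OF win] in auto)
qed

section \<open>Weak derivatives on the line\<close>

text \<open>A quadratic spline that is 0 up to 0 and 1 from 1 on. Its derivative is the tent of
  height 2 and integral 1 over \<open>[0, 1]\<close>; the function is exactly \<open>C^1\<close>,
  the regularity asked of test functions.\<close>

definition spline_step :: "real \<Rightarrow> real" where
  "spline_step u = 2 * ((max 0 u)\<^sup>2 - 2 * (max 0 (u - 1/2))\<^sup>2 + (max 0 (u - 1))\<^sup>2)"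

definition spline_hat :: "real \<Rightarrow> real" where
  "spline_hat u = 4 * (max 0 u - 2 * max 0 (u - 1/2) + max 0 (u - 1))"

lemma max_sq_deriv: "((\<lambda>u::real. (max 0 u)\<^sup>2) has_real_derivative 2 * max 0 u) (at u)"
proof -
  consider "u < 0" | "u = 0" | "u > 0" by linarith
  then show ?thesis
  proof cases
    case 1
    have "((\<lambda>u::real. 0) has_real_derivative 2 * max 0 u) (at u)" using 1 by (simp add: max_def)
    then show ?thesis
      by (rule DERIV_cong_ev[OF refl _ refl, THEN iffD1, rotated])
        (use eventually_nhds_in_open[of "{..<0}" u] 1 in \<open>auto elim!: eventually_mono simp: max_def\<close>)
  next
    case 2
    have "(\<lambda>h::real. (max 0 h)\<^sup>2 / h) \<midarrow>0\<rightarrow> 0"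
    proof (rule Lim_null_comparison)
      show "\<forall>\<^sub>F h in at (0::real). norm ((max 0 h)\<^sup>2 / h) \<le> \<bar>h\<bar>"
        by (intro always_eventually allI) (auto simp: max_def power2_eq_square)
      show "(\<lambda>h::real. \<bar>h\<bar>) \<midarrow>0\<rightarrow> 0" by (rule tendsto_rabs_zero[OF tendsto_ident_at])
    qed
    then show ?thesis unfolding 2 DERIV_def by simp
  next
    case 3
    have "((\<lambda>u::real. u\<^sup>2) has_real_derivative 2 * max 0 u) (at u)"
      using 3 by (auto intro!: derivative_eq_intros simp: max_def)
    then show ?thesis
      by (rule DERIV_cong_ev[OF refl _ refl, THEN iffD1, rotated])
        (use eventually_nhds_in_open[of "{0<..}" u] 3 in \<open>auto elim!: eventually_mono simp: max_def\<close>)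
  qed
qed

lemma spline_step_deriv: "(spline_step has_real_derivative spline_hat u) (at u)"
proof -
  have sh: "((\<lambda>u::real. (max 0 (u - c))\<^sup>2) has_real_derivative 2 * max 0 (u - c)) (at u)" for c
  proof -
    have "((\<lambda>u::real. (max 0 (u - c))\<^sup>2) has_real_derivative (2 * max 0 (u - c)) * 1) (at u)"
      by (rule DERIV_chain2[OF max_sq_deriv]) (auto intro!: derivative_eq_intros)
    then show ?thesis by simp
  qed
  show ?thesis
    unfolding spline_step_def[abs_def] spline_hat_def
    by (rule derivative_eq_intros max_sq_deriv sh refl | simp)+
qed

lemma spline_hat_cont: "continuous_on A spline_hat"
  unfolding spline_hat_def[abs_def] by (intro continuous_intros)

lemma spline_hat_measurable [measurable]: "spline_hat \<in> borel_measurable borel"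
  by (intro borel_measurable_continuous_onI spline_hat_cont)

lemma spline_hat_bounds: "0 \<le> spline_hat u" "spline_hat u \<le> 2"
  by (auto simp: spline_hat_def max_def)

lemma spline_hat_zero: "u \<le> 0 \<or> 1 \<le> u \<Longrightarrow> spline_hat u = 0"
  by (auto simp: spline_hat_def max_def)

lemma spline_step_zero: "u \<le> 0 \<Longrightarrow> spline_step u = 0"
  by (auto simp: spline_step_def max_def)

lemma spline_step_one: "1 \<le> u \<Longrightarrow> spline_step u = 1"
  by (auto simp: spline_step_def max_def power2_eq_square algebra_simps)

lemma spline_step_mono: "u \<le> v \<Longrightarrow> spline_step u \<le> spline_step v"
  by (rule DERIV_nonneg_imp_nondecreasing) (use spline_step_deriv spline_hat_bounds in blast)+

lemma spline_step_bounds: "0 \<le> spline_step u" "spline_step u \<le> 1"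
  using spline_step_mono[of "min u 0" u] spline_step_zero[of "min u 0"]
    spline_step_mono[of u "max u 1"] spline_step_one[of "max u 1"] by auto

lemma spline_hat_integral: "(LINT u|lborel. spline_hat u) = 1"
proof -
  have "(LINT u|lborel. indicator {0..1} u *\<^sub>R spline_hat u) = spline_step 1 - spline_step 0"
    by (intro integral_FTC_atLeastAtMost spline_hat_cont)
      (auto intro!: has_real_derivative_iff_has_vector_derivative[THEN iffD1] DERIV_subset[OF spline_step_deriv])
  moreover have "(\<lambda>u. indicator {0..1} u *\<^sub>R spline_hat u) = spline_hat"
    apply (rule ext)
    subgoal for u
      by (cases "0 \<le> u \<and> u \<le> 1") (auto simp: indicator_def spline_hat_zero)
    done
  ultimately show ?thesis by (simp only:) (simp add: spline_step_zero spline_step_one)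
qed

lemma spline_hat_integrable: "integrable lborel spline_hat"
  using spline_hat_integral not_integrable_integral_eq by force

text \<open>Rescaled tents are one-sided mollifiers. The substitution
  \<open>x = c + \<epsilon> n * u\<close> moves the scale into the argument of \<open>m\<close>, and
  since \<open>\<epsilon> n \<le> 1\<close> only values of \<open>m\<close> on
  \<open>[c, c + 1]\<close> enter, where \<open>m\<close> is bounded.\<close>

lemma spline_hat_average_tendsto:
  fixes m :: "real \<Rightarrow> 'a::euclidean_space"
  assumes m: "continuous_on UNIV m" and eps: "\<And>n. 0 < \<epsilon> n" "\<And>n. \<epsilon> n \<le> 1" "\<epsilon> \<longlonglongrightarrow> (0::real)"
  shows "(\<lambda>n. LINT x|lborel. (spline_hat ((x - c) / \<epsilon> n) / \<epsilon> n) *\<^sub>R m x) \<longlonglongrightarrow> m c"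
proof -
  have [measurable]: "m \<in> borel_measurable borel"
    by (rule borel_measurable_continuous_onI[OF m])
  have eq: "(LINT x|lborel. (spline_hat ((x - c) / \<epsilon> n) / \<epsilon> n) *\<^sub>R m x)
      = (LINT u|lborel. spline_hat u *\<^sub>R m (c + \<epsilon> n * u))" for n
    using eps(1)[of n] by (subst lborel_integral_real_affine[of "\<epsilon> n" _ c]) (auto simp flip: integral_scaleR_right)
  have "bounded (m ` {c..c+1})"
    by (intro compact_imp_bounded compact_continuous_image continuous_on_subset[OF m]) auto
  then obtain B where B: "\<forall>x\<in>{c..c+1}. norm (m x) \<le> B" unfolding bounded_iff by auto
  have "(\<lambda>n. LINT u|lborel. spline_hat u *\<^sub>R m (c + \<epsilon> n * u)) \<longlonglongrightarrow> (LINT u|lborel. spline_hat u *\<^sub>R m c)"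
  proof (rule integral_dominated_convergence)
    show "integrable lborel (\<lambda>u. 2 * B * indicator {0..1::real} u)"
      by (intro integrable_mult_right integrable_real_indicator) auto
    show "AE u in lborel. (\<lambda>n. spline_hat u *\<^sub>R m (c + \<epsilon> n * u)) \<longlonglongrightarrow> spline_hat u *\<^sub>R m c"
    proof (intro AE_I2 tendsto_scaleR tendsto_const)
      fix u :: real
      have "(\<lambda>n. c + \<epsilon> n * u) \<longlonglongrightarrow> c + 0 * u" by (intro tendsto_intros eps)
      then show "(\<lambda>n. m (c + \<epsilon> n * u)) \<longlonglongrightarrow> m c"
        using m isCont_tendsto_compose[of c m] by (simp add: continuous_on_eq_continuous_at)
    qed
    fix n
    show "AE u in lborel. norm (spline_hat u *\<^sub>R m (c + \<epsilon> n * u)) \<le> 2 * B * indicator {0..1} u"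
    proof (rule AE_I2)
      fix u :: real
      show "norm (spline_hat u *\<^sub>R m (c + \<epsilon> n * u)) \<le> 2 * B * indicator {0..1} u"
      proof (cases "0 \<le> u \<and> u \<le> 1")
        case True
        then have "\<epsilon> n * u \<le> 1 * 1" using eps(1)[of n] eps(2)[of n] by (intro mult_mono) auto
        then have "c + \<epsilon> n * u \<in> {c..c+1}" using True eps(1)[of n] by (simp add: less_imp_le)
        from bspec[OF B this] have "\<bar>spline_hat u\<bar> * norm (m (c + \<epsilon> n * u)) \<le> 2 * B"
          using spline_hat_bounds[of u] by (intro mult_mono) auto
        then show ?thesis using True by simp
      next
        case False
        then have "u \<le> 0 \<or> 1 \<le> u" by linarith
        then show ?thesis using False by (simp add: spline_hat_zero)
      qed
    qed
  qed measurable
  then show ?thesis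
    unfolding eq by (simp add: spline_hat_integral integral_scaleR_left[OF spline_hat_integrable])
qed

text \<open>Tested against \<open>C\<^sup>1\<close> approximations of the indicator function of an interval, a weak derivative
  yields the fundamental theorem of calculus.\<close>

lemma weak_derivative_imp_integral:
  fixes m :: "real \<Rightarrow> 'a::euclidean_space"
  assumes m: "continuous_on UNIV m" and w: "has_weak_derivative m g" and "a \<le> b"
  shows "(LINT x:{a..b}|lborel. g x) = m b - m a"
proof (cases "a = b")
  case True
  have "(LINT x:{b..b}|lborel. g x) = 0"
    unfolding set_lebesgue_integral_def
  proof (rule integral_eq_zero_AE)
    have "AE x in lborel. x \<noteq> b" by (rule AE_lborel_singleton)
    then show "AE x in lborel. indicat_real {b..b} x *\<^sub>R g x = 0"
      by eventually_elim auto
  qed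
  then show ?thesis using True by simp
next
  case False
  with \<open>a \<le> b\<close> have ab: "a < b" by simp
  define \<epsilon> where "\<epsilon> n = inverse (real (Suc n))" for n
  have eps: "\<And>n. 0 < \<epsilon> n" "\<And>n. \<epsilon> n \<le> 1" "\<epsilon> \<longlonglongrightarrow> 0"
    using LIMSEQ_inverse_real_of_nat by (auto simp: \<epsilon>_def[abs_def] field_simps)
  \<comment> \<open>A ramp up on \<open>[a, a + \<epsilon> n]\<close> and down on
    \<open>[b, b + \<epsilon> n]\<close>. Its limit is the indicator of the interval from
    \<open>a\<close> (excluded) to \<open>b\<close>, and its derivative is a difference of two
    mollifiers, so that testing against \<open>m\<close> gives \<open>m a - m b\<close> in the
    limit.\<close>
  define \<psi> where "\<psi> n x = spline_step ((x - a) / \<epsilon> n) - spline_step ((x - b) / \<epsilon> n)" for n x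
  have d: "(\<psi> n has_real_derivative (spline_hat ((x - a) / \<epsilon> n) / \<epsilon> n - spline_hat ((x - b) / \<epsilon> n) / \<epsilon> n)) (at x)" for n x
  proof -
    have "((\<lambda>x. spline_step ((x - c) / \<epsilon> n)) has_real_derivative spline_hat ((x - c) / \<epsilon> n) * (1 / \<epsilon> n)) (at x)" for c
      by (rule DERIV_chain2[OF spline_step_deriv]) (use eps(1)[of n] in \<open>auto intro!: derivative_eq_intros\<close>)
    from DERIV_diff[OF this[of a] this[of b]] show ?thesis
      unfolding \<psi>_def[abs_def] by simp
  qed
  have \<psi>_zero: "\<psi> n x = 0" if "x \<notin> {a..b+1}" for n x
  proof (cases "x < a")
    case True
    then have "(x - a) / \<epsilon> n \<le> 0" "(x - b) / \<epsilon> n \<le> 0"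
      using eps(1)[of n] ab by (auto intro!: divide_nonpos_pos)
    then show ?thesis by (simp add: \<psi>_def spline_step_zero)
  next
    case False
    then have "b + 1 < x" using that by auto
    then have "1 \<le> (x - a) / \<epsilon> n" "1 \<le> (x - b) / \<epsilon> n"
      using eps(1)[of n] eps(2)[of n] ab by (auto simp: pos_le_divide_eq)
    then show ?thesis by (simp add: \<psi>_def spline_step_one)
  qed
  have \<psi>_le: "\<bar>\<psi> n x\<bar> \<le> 1" for n x
    using spline_step_bounds[of "(x - a) / \<epsilon> n"] spline_step_bounds[of "(x - b) / \<epsilon> n"]
    unfolding \<psi>_def by linarith
  have test: "test_function (\<psi> n)" for n
    unfolding test_function_def
  proof
    show "\<psi> n C1_differentiable_on UNIV"
      unfolding C1_differentiable_on_def
    proof (intro exI conjI ballI)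
      show "(\<psi> n has_vector_derivative (spline_hat ((x - a) / \<epsilon> n) / \<epsilon> n - spline_hat ((x - b) / \<epsilon> n) / \<epsilon> n)) (at x)" for x
        using d has_real_derivative_iff_has_vector_derivative by blast
      show "continuous_on UNIV (\<lambda>x. spline_hat ((x - a) / \<epsilon> n) / \<epsilon> n - spline_hat ((x - b) / \<epsilon> n) / \<epsilon> n)"
        using eps(1)[of n]
        by (intro continuous_intros continuous_on_compose2[OF spline_hat_cont[of UNIV]]) auto
    qed
    have "{x. \<psi> n x \<noteq> 0} \<subseteq> {a..b+1}" using \<psi>_zero by blast
    then have "bounded {x. \<psi> n x \<noteq> 0}" by (rule bounded_subset[OF bounded_closed_interval])
    then show "compact (closure {x. \<psi> n x \<noteq> 0})" by (simp add: compact_closure)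
  qed
  have [measurable]: "m \<in> borel_measurable borel"
    by (rule borel_measurable_continuous_onI[OF m])
  have intm: "integrable lborel (\<lambda>x. (spline_hat ((x - c) / \<epsilon> n) / \<epsilon> n) *\<^sub>R m x)" for c n
  proof -
    have "integrable lborel (\<lambda>x. indicator {c..c+1} x *\<^sub>R ((spline_hat ((x - c) / \<epsilon> n) / \<epsilon> n) *\<^sub>R m x))"
      using eps(1)[of n]
      by (intro borel_integrable_compact continuous_intros continuous_on_compose2[OF spline_hat_cont[of UNIV]] 
          continuous_on_subset[OF m]) auto
    moreover have "indicator {c..c+1} x *\<^sub>R ((spline_hat ((x - c) / \<epsilon> n) / \<epsilon> n) *\<^sub>R m x) 
        = (spline_hat ((x - c) / \<epsilon> n) / \<epsilon> n) *\<^sub>R m x" for x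
    proof (cases "x \<in> {c..c+1}")
      case False
      then have "(x - c) / \<epsilon> n \<le> 0 \<or> 1 \<le> (x - c) / \<epsilon> n"
        using eps(1)[of n] eps(2)[of n] by (auto simp: pos_le_divide_eq divide_le_0_iff)
      then show ?thesis by (auto simp: spline_hat_zero)
    qed auto
    ultimately show ?thesis by (simp only:)
  qed
  have deq: "deriv (\<psi> n) x *\<^sub>R m x = (spline_hat ((x - a) / \<epsilon> n) / \<epsilon> n) *\<^sub>R m x - (spline_hat ((x - b) / \<epsilon> n) / \<epsilon> n) *\<^sub>R m x" for n x
    by (simp add: DERIV_imp_deriv[OF d] scaleR_diff_left)
  have "(LINT x|lborel. deriv (\<psi> n) x *\<^sub>R m x) = (LINT x|lborel. (spline_hat ((x - a) / \<epsilon> n) / \<epsilon> n) *\<^sub>R m x)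
      - (LINT x|lborel. (spline_hat ((x - b) / \<epsilon> n) / \<epsilon> n) *\<^sub>R m x)" for n
    unfolding deq by (rule Bochner_Integration.integral_diff[OF intm intm])
  then have "(\<lambda>n. LINT x|lborel. deriv (\<psi> n) x *\<^sub>R m x) \<longlonglongrightarrow> m a - m b"
    using tendsto_diff[OF spline_hat_average_tendsto[OF m eps, of a] spline_hat_average_tendsto[OF m eps, of b]] by simp
  moreover have "(LINT x|lborel. deriv (\<psi> n) x *\<^sub>R m x) = - (LINT x|lborel. \<psi> n x *\<^sub>R g x)" for n
    using w test[of n] unfolding has_weak_derivative_def by blast
  ultimately have "(\<lambda>n. - (LINT x|lborel. \<psi> n x *\<^sub>R g x)) \<longlonglongrightarrow> m a - m b" by simp
  then have l1: "(\<lambda>n. LINT x|lborel. \<psi> n x *\<^sub>R g x) \<longlonglongrightarrow> m b - m a"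
    using tendsto_minus[of "\<lambda>n. - (LINT x|lborel. \<psi> n x *\<^sub>R g x)" "m a - m b" sequentially] by simp
  define gg where "gg x = indicator {a..b+1} x *\<^sub>R g x" for x
  have gg_int: "integrable lborel gg"
    using w unfolding has_weak_derivative_def locally_integrable_def set_integrable_def gg_def[abs_def] by blast
  then have [measurable]: "gg \<in> borel_measurable borel" using borel_measurable_integrable by fastforce
  have \<psi>gg: "\<psi> n x *\<^sub>R g x = \<psi> n x *\<^sub>R gg x" for n x
    using \<psi>_zero[of x n] by (auto simp: gg_def indicator_def)
  have [measurable]: "\<psi> n \<in> borel_measurable borel" for n
    using d[of n] by (intro borel_measurable_continuous_onI) (auto simp: continuous_on_eq_continuous_at intro: DERIV_isCont)
  have "(\<lambda>n. LINT x|lborel. \<psi> n x *\<^sub>R gg x) \<longlonglongrightarrow> (LINT x|lborel. indicator {a..b} x *\<^sub>R gg x)"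
  proof (rule integral_dominated_convergence)
    show "integrable lborel (\<lambda>x. norm (gg x))" using gg_int by (rule integrable_norm)
    show "AE x in lborel. norm (\<psi> n x *\<^sub>R gg x) \<le> norm (gg x)" for n
      using \<psi>_le[of n] by (intro AE_I2) (simp add: mult_left_le_one_le)
    have "AE x in lborel. x \<noteq> a" by (rule AE_lborel_singleton)
    then show "AE x in lborel. (\<lambda>n. \<psi> n x *\<^sub>R gg x) \<longlonglongrightarrow> indicator {a..b} x *\<^sub>R gg x"
    proof eventually_elim
      case (elim x)
      have ev: "\<forall>\<^sub>F n in sequentially. 1 \<le> (x - c) / \<epsilon> n" if "c < x" for c
      proof -
        have "\<forall>\<^sub>F n in sequentially. \<epsilon> n < x - c"
          using order_tendstoD(2)[OF eps(3)] that by simp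
        then show ?thesis by eventually_elim (use eps(1) in \<open>simp add: pos_le_divide_eq less_imp_le\<close>)
      qed
      have ev0: "(x - c) / \<epsilon> n \<le> 0" if "x \<le> c" for c n
        using that eps(1)[of n] by (simp add: divide_le_0_iff)
      consider "x < a" | "a < x" "x \<le> b" | "b < x" using elim by linarith
      then have "\<forall>\<^sub>F n in sequentially. \<psi> n x = indicator {a..b} x"
      proof cases
        case 1
        then show ?thesis using ev0[of a] ev0[of b] ab by (intro always_eventually) (auto simp: \<psi>_def spline_step_zero)
      next
        case 2
        show ?thesis using ev[OF 2(1)] by eventually_elim (use 2 ev0[of b] in \<open>auto simp: \<psi>_def spline_step_zero spline_step_one\<close>)
      next
        case 3
        have "a < x" using 3 ab by simp
        show ?thesis using ev[OF 3] ev[OF \<open>a < x\<close>] by eventually_elim (use 3 in \<open>auto simp: \<psi>_def spline_step_one\<close>)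
      qed
      then have "(\<lambda>n. \<psi> n x) \<longlonglongrightarrow> indicator {a..b} x" by (rule tendsto_eventually)
      then show ?case by (intro tendsto_scaleR tendsto_const)
    qed
  qed measurable
  moreover have "indicator {a..b} x *\<^sub>R gg x = indicator {a..b} x *\<^sub>R g x" for x
    by (auto simp: gg_def indicator_def)
  ultimately have "(\<lambda>n. LINT x|lborel. \<psi> n x *\<^sub>R g x) \<longlonglongrightarrow> (LINT x:{a..b}|lborel. g x)"
    unfolding set_lebesgue_integral_def \<psi>gg by simp
  with l1 show ?thesis by (metis LIMSEQ_unique)
qed

text \<open>Write \<open>F x\<close> as \<open>F (- B)\<close> plus the integral of \<open>G\<close>
  and exchange the integrations over the triangle \<open>- B \<le> t \<le> x \<le> B\<close>: the
  integral of the derivative of \<open>\<psi>\<close> over \<open>[t, B]\<close> is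
  \<open>- \<psi> t\<close>.\<close>

lemma integral_imp_weak_derivative:
  fixes F :: "real \<Rightarrow> 'a::euclidean_space"
  assumes F: "continuous_on UNIV F" and G: "\<And>a b. a \<le> b \<Longrightarrow> set_integrable lborel {a..b} G"
    and meas: "G \<in> borel_measurable borel"
    and FG: "\<And>a b. a \<le> b \<Longrightarrow> (LINT x:{a..b}|lborel. G x) = F b - F a"
  shows "has_weak_derivative F G"
proof -
  have locG: "locally_integrable G"
    unfolding locally_integrable_def
  proof (intro allI)
    fix a b :: real
    show "set_integrable lborel {a..b} G" using G[of a b] by (cases "a \<le> b") (auto simp: set_integrable_def)
  qed
  have locF: "locally_integrable F"
    unfolding locally_integrable_def
    by (intro allI borel_integrable_atLeastAtMost' continuous_on_subset[OF F]) auto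
  note [measurable] = meas
  have "(LINT x|lborel. deriv \<psi> x *\<^sub>R F x) = - (LINT x|lborel. \<psi> x *\<^sub>R G x)" if \<psi>: "test_function \<psi>" for \<psi>
  proof -
    obtain D where D: "\<And>x. (\<psi> has_real_derivative D x) (at x)" and D_cont: "continuous_on UNIV D"
      using \<psi> unfolding test_function_def C1_differentiable_on_def has_real_derivative_iff_has_vector_derivative by auto
    have [measurable]: "D \<in> borel_measurable borel" by (rule borel_measurable_continuous_onI[OF D_cont])
    have "bounded {x. \<psi> x \<noteq> 0}"
      using \<psi> unfolding test_function_def by (meson bounded_subset closure_subset compact_imp_bounded)
    then obtain r where r: "\<And>x. \<psi> x \<noteq> 0 \<Longrightarrow> \<bar>x\<bar> \<le> r"
      unfolding bounded_iff by auto
    \<comment> \<open>The margin 1 makes \<open>\<psi>\<close> vanish at \<open>- B\<close> and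
      \<open>B\<close> themselves, which removes the boundary terms.\<close>
    define B where "B = max r 0 + 1"
    have \<psi>0: "\<psi> x = 0" if "B \<le> \<bar>x\<bar>" for x using r[of x] that by (cases "\<psi> x = 0") (auto simp: B_def)
    have D0: "D x = 0" if "B < \<bar>x\<bar>" for x
    proof -
      have "open {x. B < \<bar>x\<bar>}" by (intro open_Collect_less continuous_intros)
      then have "\<forall>\<^sub>F y in nhds x. y \<in> {x. B < \<bar>x\<bar>}" using that by (intro eventually_nhds_in_open) auto
      then have "\<forall>\<^sub>F y in nhds x. \<psi> y = 0" by eventually_elim (auto intro: \<psi>0)
      then have "((\<lambda>x. 0) has_real_derivative D x) (at x)"
        using D[of x] by (subst (asm) DERIV_cong_ev[OF refl _ refl]) auto
      then show ?thesis using DERIV_unique DERIV_const by blast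
    qed
    have B: "- B \<le> B" by (simp add: B_def)
    have FTC: "(LINT x:{a..b}|lborel. D x) = \<psi> b - \<psi> a" if "a \<le> b" for a b
      unfolding set_lebesgue_integral_def
      by (intro integral_FTC_atLeastAtMost that continuous_on_subset[OF D_cont])
        (auto intro!: has_real_derivative_iff_has_vector_derivative[THEN iffD1] DERIV_subset[OF D])
    have "bounded (D ` {-B..B})"
      by (intro compact_imp_bounded compact_continuous_image continuous_on_subset[OF D_cont]) auto
    then obtain C where C: "\<forall>x\<in>{-B..B}. \<bar>D x\<bar> \<le> C" unfolding bounded_iff by auto
    define k where "k x t = (indicator {-B..B} x * indicator {-B..x} t * D x) *\<^sub>R G t" for x t
    have ind_meas: "(\<lambda>(x, t). indicat_real {-B..x} t) \<in> borel_measurable (lborel \<Otimes>\<^sub>M lborel)"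
    proof -
      have "(\<lambda>(x, t). indicat_real {-B..x} t) = indicat_real {z. - B \<le> snd z \<and> snd z \<le> fst z}"
        by (auto simp: fun_eq_iff indicator_def)
      also have "\<dots> \<in> borel_measurable (lborel \<Otimes>\<^sub>M lborel)" by measurable
      finally show ?thesis .
    qed
    have k_meas [measurable]: "case_prod k \<in> borel_measurable (lborel \<Otimes>\<^sub>M lborel)"
      unfolding k_def[abs_def] using ind_meas by measurable
    have Dint: "integrable lborel (\<lambda>x. indicat_real {a..b} x *\<^sub>R D x)" for a b
      by (intro borel_integrable_compact continuous_on_subset[OF D_cont]) auto
    have C0: "0 \<le> C" using bspec[OF C, of B] B by auto
    have k_le: "norm (k x t) \<le> C * indicator {-B..B} x * norm (indicator {-B..B} t *\<^sub>R G t)" for x t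
      using C C0 by (auto simp: k_def indicator_def intro!: mult_right_mono)
    have gB: "integrable lborel (\<lambda>t. indicator {-B..B} t *\<^sub>R G t)"
      using G[OF B] by (simp add: set_integrable_def)
    have k_int: "integrable (lborel \<Otimes>\<^sub>M lborel) (case_prod k)"
    proof (rule integrableI_bounded)
      have "(\<integral>\<^sup>+z. ennreal (norm (case_prod k z)) \<partial>(lborel \<Otimes>\<^sub>M lborel)) = (\<integral>\<^sup>+x. \<integral>\<^sup>+t. ennreal (norm (k x t)) \<partial>lborel \<partial>lborel)"
        by (subst lborel.nn_integral_fst[symmetric]) auto
      also have "\<dots> \<le> (\<integral>\<^sup>+x. \<integral>\<^sup>+t. ennreal (C * indicator {-B..B} x) * ennreal (norm (indicator {-B..B} t *\<^sub>R G t)) \<partial>lborel \<partial>lborel)"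
        using C0 k_le by (intro nn_integral_mono) (auto simp flip: ennreal_mult intro!: ennreal_leI)
      also have "\<dots> = (\<integral>\<^sup>+x. ennreal (C * indicator {-B..B} x) \<partial>lborel) * (\<integral>\<^sup>+t. ennreal (norm (indicator {-B..B} t *\<^sub>R G t)) \<partial>lborel)"
        by (simp add: nn_integral_cmult nn_integral_multc)
      also have "\<dots> < \<infinity>"
      proof -
        have "integrable lborel (\<lambda>x. C * indicator {-B..B} x)"
          by (intro integrable_mult_right integrable_real_indicator) (auto simp: emeasure_lborel_Icc_eq)
        then have "(\<integral>\<^sup>+x. ennreal (norm (C * indicat_real {-B..B} x)) \<partial>lborel) < \<infinity>"
          unfolding integrable_iff_bounded by blast
        moreover have "norm (C * indicat_real {-B..B} x) = C * indicat_real {-B..B} x" for x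
          using C0 by simp
        ultimately have "(\<integral>\<^sup>+x. ennreal (C * indicat_real {-B..B} x) \<partial>lborel) < \<infinity>"
          by (simp only:)
        moreover have "(\<integral>\<^sup>+t. ennreal (norm (indicator {-B..B} t *\<^sub>R G t)) \<partial>lborel) < \<infinity>"
          using gB unfolding integrable_iff_bounded by blast
        ultimately show ?thesis by (simp add: ennreal_mult_less_top)
      qed
      finally show "(\<integral>\<^sup>+z. ennreal (norm (case_prod k z)) \<partial>(lborel \<Otimes>\<^sub>M lborel)) < \<infinity>" .
    qed measurable
    have "(LINT x|lborel. deriv \<psi> x *\<^sub>R F x) = (LINT x|lborel. indicator {-B..B} x *\<^sub>R (D x *\<^sub>R F (-B)) + (LINT t|lborel. k x t))"
    proof (rule Bochner_Integration.integral_cong[OF refl])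
      fix x :: real
      show "deriv \<psi> x *\<^sub>R F x = indicator {-B..B} x *\<^sub>R (D x *\<^sub>R F (-B)) + (LINT t|lborel. k x t)"
      proof (cases "x \<in> {-B..B}")
        case True
        have "(LINT t|lborel. k x t) = D x *\<^sub>R (LINT t:{-B..x}|lborel. G t)"
          using True unfolding k_def set_lebesgue_integral_def
          by (subst integral_scaleR_right[symmetric]) (simp add: mult.commute)
        also have "\<dots> = D x *\<^sub>R (F x - F (-B))" using FG[of "-B" x] True by simp
        finally show ?thesis using True by (simp add: DERIV_imp_deriv[OF D] algebra_simps)
      next
        case False
        then have "B < \<bar>x\<bar>" by auto
        then show ?thesis using False D0 by (simp add: DERIV_imp_deriv[OF D] k_def)
      qed
    qed
    also have "\<dots> = (LINT x|lborel. indicator {-B..B} x *\<^sub>R (D x *\<^sub>R F (-B))) + (LINT x|lborel. LINT t|lborel. k x t)"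
    proof (rule Bochner_Integration.integral_add)
      show "integrable lborel (\<lambda>x. indicat_real {- B..B} x *\<^sub>R D x *\<^sub>R F (- B))"
        by (intro borel_integrable_compact continuous_intros continuous_on_subset[OF D_cont]) auto
      show "integrable lborel (\<lambda>x. LINT t|lborel. k x t)"
        using lborel_pair.integrable_fst'[OF k_int] by simp
    qed
    also have "(LINT x|lborel. indicator {-B..B} x *\<^sub>R (D x *\<^sub>R F (-B))) = (LINT x:{-B..B}|lborel. D x) *\<^sub>R F (-B)"
      unfolding set_lebesgue_integral_def by (subst integral_scaleR_left[OF Dint, symmetric]) simp
    also have "(LINT x:{-B..B}|lborel. D x) = 0"
      using FTC[OF B] \<psi>0[of B] \<psi>0[of "-B"] B by simp
    also have "(LINT x|lborel. LINT t|lborel. k x t) = (LINT t|lborel. LINT x|lborel. k x t)"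
      by (rule lborel_pair.Fubini_integral[OF k_int, symmetric])
    also have "\<dots> = (LINT t|lborel. - (\<psi> t *\<^sub>R G t))"
    proof (rule Bochner_Integration.integral_cong[OF refl])
      fix t :: real
      show "(LINT x|lborel. k x t) = - (\<psi> t *\<^sub>R G t)"
      proof (cases "t \<in> {-B..B}")
        case True
        have "k x t = (indicator {t..B} x *\<^sub>R D x) *\<^sub>R G t" for x
          using True by (auto simp: k_def indicator_def)
        then have "(LINT x|lborel. k x t) = (LINT x:{t..B}|lborel. D x) *\<^sub>R G t"
          unfolding set_lebesgue_integral_def
          by (simp only: integral_scaleR_left[OF Dint])
        also have "\<dots> = - (\<psi> t *\<^sub>R G t)" using FTC[of t B] True \<psi>0[of B] B by simp
        finally show ?thesis .
      next
        case False
        then have "B \<le> \<bar>t\<bar>" by auto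
        moreover have "k x t = 0" for x using False by (auto simp: k_def indicator_def)
        ultimately show ?thesis using \<psi>0 by simp
      qed
    qed
    finally show ?thesis by simp
  qed
  with locF locG show ?thesis unfolding has_weak_derivative_def by blast
qed

text \<open>A Dynkin class argument: after restriction to \<open>[-k, k]\<close> the integrals
  vanish on half-lines, which are stable under intersection and generate the Borel sets; a density
  with vanishing integrals over all Borel sets is 0 almost everywhere.\<close>

lemma AE_zero_of_interval_integrals:
  fixes d :: "real \<Rightarrow> 'a::euclidean_space"
  assumes d: "\<And>a b. set_integrable lborel {a..b} d"
    and z: "\<And>a b. a \<le> b \<Longrightarrow> (LINT x:{a..b}|lborel. d x) = 0"
  shows "AE x in lborel. d x = 0"
proof -
  have "AE x in lborel. x \<in> {- real k..real k} \<longrightarrow> d x = 0" for k :: nat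
  proof -
    define f where "f x = indicator {- real k..real k} x *\<^sub>R d x" for x
    have f: "integrable lborel f" using d unfolding set_integrable_def f_def[abs_def] .
    have si: "set_integrable lborel A f" if "A \<in> sets borel" for A
      unfolding set_integrable_def using that by (intro integrable_mult_indicator f) auto
    have tot: "(LINT x|lborel. f x) = 0"
      using z[of "- real k" "real k"] unfolding f_def set_lebesgue_integral_def by simp
    have "set_lebesgue_integral lborel A f = 0" if "A \<in> sets lborel" for A
    proof -
      have A: "A \<in> sigma_sets UNIV (range (\<lambda>a::real. {..a}))"
        using that by (simp add: borel_eq_atMost)
      have bor: "B \<in> sets borel" if "B \<in> sigma_sets UNIV (range (\<lambda>a::real. {..a}))" for B
        using that by (simp add: borel_eq_atMost)
      have st: "Int_stable (range (\<lambda>a::real. {..a}))"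
        by (auto simp: Int_stable_def)
      have cl: "range (\<lambda>a::real. {..a}) \<subseteq> Pow UNIV" by simp
      from st cl A show ?thesis
      proof (induction rule: sigma_sets_induct_disjoint)
        case (basic B)
        then obtain a where B: "B = {..a}" by auto
        have eq: "indicator B x *\<^sub>R f x = indicator {- real k..min a (real k)} x *\<^sub>R d x" for x
          by (auto simp: B f_def indicator_def)
        show ?case
          using z[of "- real k" "min a (real k)"] unfolding set_lebesgue_integral_def eq
          by (cases "- real k \<le> min a (real k)") (auto simp: not_le)
      next
        case empty
        then show ?case by (simp add: set_lebesgue_integral_def)
      next
        case (compl B)
        have "(LINT x:UNIV|lborel. f x) = (LINT x:B|lborel. f x) + (LINT x:UNIV - B|lborel. f x)"
          using set_integral_Un[of B "UNIV - B" lborel f] si[OF bor[OF compl(1)]] si[of "UNIV - B"] bor[OF compl(1)]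
          by auto
        then show ?case using compl tot by (simp add: set_lebesgue_integral_def)
      next
        case (union B)
        have B: "B i \<in> sets borel" for i using union(2) by (intro bor) auto
        have "(LINT x:(\<Union>i. B i)|lborel. f x) = (\<Sum>i. LINT x:B i|lborel. f x)"
          using union(1) B by (intro lebesgue_integral_countable_add si) (auto simp: disjoint_family_on_def)
        then show ?case using union(3) by simp
      qed
    qed
    then have "AE x in lborel. f x = 0" by (rule sigma_finite_measure.density_zero[OF lborel.sigma_finite_measure_axioms f])
    then show ?thesis by eventually_elim (auto simp: f_def)
  qed
  then have "AE x in lborel. \<forall>k::nat. x \<in> {- real k..real k} \<longrightarrow> d x = 0"
    unfolding AE_all_countable by blast
  then show ?thesis
  proof eventually_elim
    case (elim x)
    obtain k :: nat where "\<bar>x\<bar> < real k" using reals_Archimedean2 by blast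
    then have "x \<in> {- real k..real k}" by auto
    then show ?case using elim by blast
  qed
qed

section \<open>Gradient bounds\<close>

text \<open>\<open>W\<close> is an upper bound for the squared derivative of \<open>F\<close>; working with such bounds instead of
  derivatives makes competitors easy to build, and the least bound is recovered by \<open>riesz_derivative\<close>.\<close>

definition grad_bound_on :: "real set \<Rightarrow> (real \<Rightarrow> 'a::real_normed_vector) \<Rightarrow> (real \<Rightarrow> ennreal) \<Rightarrow> bool" where
  "grad_bound_on S F W \<longleftrightarrow> W \<in> borel_measurable borel \<and>
    (\<forall>s\<in>S. \<forall>t\<in>S. s \<le> t \<longrightarrow> ennreal ((norm (F t - F s))\<^sup>2) \<le> ennreal (t - s) * (\<integral>\<^sup>+x\<in>{s..t}. W x \<partial>lborel))"

abbreviation grad_bound :: "(real \<Rightarrow> 'a::real_normed_vector) \<Rightarrow> (real \<Rightarrow> ennreal) \<Rightarrow> bool" where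
  "grad_bound \<equiv> grad_bound_on UNIV"

lemma grad_bound_on_measurable: "grad_bound_on S F W \<Longrightarrow> W \<in> borel_measurable borel"
  by (simp add: grad_bound_on_def)

lemma grad_bound_onD:
  "grad_bound_on S F W \<Longrightarrow> s \<in> S \<Longrightarrow> t \<in> S \<Longrightarrow> s \<le> t \<Longrightarrow>
    ennreal ((norm (F t - F s))\<^sup>2) \<le> ennreal (t - s) * (\<integral>\<^sup>+x\<in>{s..t}. W x \<partial>lborel)"
  by (simp add: grad_bound_on_def)

lemma nn_integral_Icc_split:
  fixes W :: "real \<Rightarrow> ennreal"
  assumes [measurable]: "W \<in> borel_measurable borel" and "a \<le> c" "c \<le> b"
  shows "(\<integral>\<^sup>+x\<in>{a..b}. W x \<partial>lborel) = (\<integral>\<^sup>+x\<in>{a..c}. W x \<partial>lborel) + (\<integral>\<^sup>+x\<in>{c..b}. W x \<partial>lborel)"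
proof -
  have "(\<integral>\<^sup>+x\<in>{a..b}. W x \<partial>lborel) = (\<integral>\<^sup>+x. W x * indicator {a..c} x + W x * indicator {c..b} x \<partial>lborel)"
  proof (rule nn_integral_cong_AE)
    have "AE x in lborel. x \<noteq> c" by (rule AE_lborel_singleton)
    then show "AE x in lborel. W x * indicator {a..b} x = W x * indicator {a..c} x + W x * indicator {c..b} x"
      by eventually_elim (use assms in \<open>auto simp: indicator_def\<close>)
  qed
  also have "\<dots> = (\<integral>\<^sup>+x\<in>{a..c}. W x \<partial>lborel) + (\<integral>\<^sup>+x\<in>{c..b}. W x \<partial>lborel)"
    by (rule nn_integral_add) auto
  finally show ?thesis .
qed

text \<open>Cauchy-Schwarz in the form in which bounds on adjacent intervals add up:
  \<open>u\<close> and \<open>v\<close> play the role of lengths, \<open>a\<close> and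
  \<open>b\<close> that of integrals of the gradient bound.\<close>

lemma sq_sum_le_mult_sum:
  fixes p q u v a b :: real
  assumes "p\<^sup>2 \<le> u * a" "q\<^sup>2 \<le> v * b" "0 \<le> u" "0 \<le> v" "0 \<le> a" "0 \<le> b"
  shows "(p + q)\<^sup>2 \<le> (u + v) * (a + b)"
proof -
  have "(p * q)\<^sup>2 \<le> (u * a) * (v * b)"
    unfolding power_mult_distrib using assms by (intro mult_mono) auto
  also have "\<dots> = (u * b) * (v * a)" by (simp add: mult_ac)
  also have "\<dots> \<le> ((u * b + v * a) / 2)\<^sup>2"
    using sum_squares_ge_zero[of "u * b - v * a" 0] by (simp add: power2_eq_square algebra_simps)
  finally have "\<bar>p * q\<bar> \<le> \<bar>(u * b + v * a) / 2\<bar>" by (simp only: abs_le_square_iff)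
  moreover have "0 \<le> u * b + v * a" using assms(3-6) by (intro add_nonneg_nonneg mult_nonneg_nonneg)
  ultimately have "\<bar>p * q\<bar> \<le> (u * b + v * a) / 2" by simp
  then have "p * q \<le> (u * b + v * a) / 2" using abs_ge_self[of "p * q"] by (rule order_trans[rotated])
  then have "2 * (p * q) \<le> u * b + v * a" by (simp add: field_simps)
  then show ?thesis using assms(1,2) by (simp add: power2_eq_square algebra_simps)
qed

lemma sq_sum_le_mult_sum_ennreal:
  fixes p q u v :: real
  assumes p: "ennreal (p\<^sup>2) \<le> ennreal u * A" and q: "ennreal (q\<^sup>2) \<le> ennreal v * B" and uv: "0 \<le> u" "0 \<le> v"
  shows "ennreal ((p + q)\<^sup>2) \<le> ennreal (u + v) * (A + B)"
proof (cases "A = \<infinity> \<or> B = \<infinity>")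
  case True
  show ?thesis
  proof (cases "u + v = 0")
    case True
    then have "u = 0" "v = 0" using uv by auto
    with p q have "p = 0" "q = 0" by simp_all
    then show ?thesis by simp
  next
    case False
    then have "0 < u + v" using uv by simp
    with True show ?thesis by (auto simp: ennreal_mult_top)
  qed
next
  case False
  then obtain a b where ab: "A = ennreal a" "B = ennreal b" "0 \<le> a" "0 \<le> b"
    by (cases A; cases B) auto
  then have "p\<^sup>2 \<le> u * a" "q\<^sup>2 \<le> v * b"
    using p q uv by (simp_all add: ennreal_mult[symmetric] ennreal_le_iff)
  from sq_sum_le_mult_sum[OF this uv ab(3,4)] show ?thesis
    using uv ab by (simp add: ennreal_mult[symmetric] ennreal_leI flip: ennreal_plus)
qed

text \<open>The first conclusion keeps the sum of the two norms. A truncation needs it in this form,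
  because there the two increments are multiplied by different factors before they are
  added.\<close>

lemma grad_bound_chain:
  fixes F :: "real \<Rightarrow> 'a::real_normed_vector"
  assumes W: "W \<in> borel_measurable borel" and st: "s \<le> c" "c \<le> t"
    and 1: "ennreal ((norm (F c - F s))\<^sup>2) \<le> ennreal (c - s) * (\<integral>\<^sup>+x\<in>{s..c}. W x \<partial>lborel)"
    and 2: "ennreal ((norm (F t - F c))\<^sup>2) \<le> ennreal (t - c) * (\<integral>\<^sup>+x\<in>{c..t}. W x \<partial>lborel)"
  shows "ennreal ((norm (F t - F c) + norm (F c - F s))\<^sup>2) \<le> ennreal (t - s) * (\<integral>\<^sup>+x\<in>{s..t}. W x \<partial>lborel)"
    "ennreal ((norm (F t - F s))\<^sup>2) \<le> ennreal (t - s) * (\<integral>\<^sup>+x\<in>{s..t}. W x \<partial>lborel)"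
proof -
  show *: "ennreal ((norm (F t - F c) + norm (F c - F s))\<^sup>2) \<le> ennreal (t - s) * (\<integral>\<^sup>+x\<in>{s..t}. W x \<partial>lborel)"
    using sq_sum_le_mult_sum_ennreal[OF 2 1] st by (simp add: nn_integral_Icc_split[OF W st] add.commute)
  have "norm (F t - F s) \<le> norm (F t - F c) + norm (F c - F s)"
    using norm_triangle_ineq[of "F t - F c" "F c - F s"] by simp
  then have "ennreal ((norm (F t - F s))\<^sup>2) \<le> ennreal ((norm (F t - F c) + norm (F c - F s))\<^sup>2)"
    by (intro ennreal_leI power_mono) auto
  also note *
  finally show "ennreal ((norm (F t - F s))\<^sup>2) \<le> ennreal (t - s) * (\<integral>\<^sup>+x\<in>{s..t}. W x \<partial>lborel)" .
qed

text \<open>Competitors are assembled piecewise with this rule: since \<open>c\<close> belongs to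
  both pieces, an increment across \<open>c\<close> is split at \<open>c\<close> and the two bounds
  are chained.\<close>

lemma grad_bound_on_glue:
  assumes 1: "grad_bound_on (S \<inter> {..c}) F W" and 2: "grad_bound_on (S \<inter> {c..}) F W" and "c \<in> S"
  shows "grad_bound_on S F W"
  unfolding grad_bound_on_def
proof (intro conjI ballI impI)
  show W: "W \<in> borel_measurable borel" using 1 by (rule grad_bound_on_measurable)
  fix s t assume st: "s \<in> S" "t \<in> S" "s \<le> t"
  consider "t \<le> c" | "c \<le> s" | "s \<le> c" "c \<le> t" by linarith
  then show "ennreal ((norm (F t - F s))\<^sup>2) \<le> ennreal (t - s) * (\<integral>\<^sup>+x\<in>{s..t}. W x \<partial>lborel)"
  proof cases
    case 1
    then show ?thesis using st by (intro grad_bound_onD[OF assms(1)]) auto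
  next
    case 2
    then show ?thesis using st by (intro grad_bound_onD[OF assms(2)]) auto
  next
    case 3
    then show ?thesis
      using st \<open>c \<in> S\<close> by (intro grad_bound_chain(2)[OF W 3] grad_bound_onD[OF assms(1)] grad_bound_onD[OF assms(2)]) auto
  qed
qed

lemma grad_bound_on_subset: "grad_bound_on S F W \<Longrightarrow> T \<subseteq> S \<Longrightarrow> grad_bound_on T F W"
  unfolding grad_bound_on_def by blast

lemma grad_bound_on_lipschitz:
  assumes F: "grad_bound_on S F W" and le: "\<And>s t. s \<in> S \<Longrightarrow> t \<in> S \<Longrightarrow> norm (G t - G s) \<le> norm (F t - F s)"
  shows "grad_bound_on S G W"
  unfolding grad_bound_on_def
proof (intro conjI ballI impI)
  show "W \<in> borel_measurable borel" using F by (rule grad_bound_on_measurable)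
  fix s t assume st: "s \<in> S" "t \<in> S" "s \<le> t"
  have "ennreal ((norm (G t - G s))\<^sup>2) \<le> ennreal ((norm (F t - F s))\<^sup>2)"
    using le[OF st(1,2)] by (intro ennreal_leI power_mono) auto
  also have "\<dots> \<le> ennreal (t - s) * (\<integral>\<^sup>+x\<in>{s..t}. W x \<partial>lborel)"
    by (rule grad_bound_onD[OF F st])
  finally show "ennreal ((norm (G t - G s))\<^sup>2) \<le> \<dots>" .
qed

lemma grad_bound_on_mono:
  assumes F: "grad_bound_on S F W" and S: "\<And>s t. s \<in> S \<Longrightarrow> t \<in> S \<Longrightarrow> {s..t} \<subseteq> S"
    and "\<And>x. x \<in> S \<Longrightarrow> W x \<le> V x" and "V \<in> borel_measurable borel"
  shows "grad_bound_on S F V"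
  unfolding grad_bound_on_def
proof (intro conjI ballI impI)
  fix s t assume st: "s \<in> S" "t \<in> S" "s \<le> t"
  have "ennreal ((norm (F t - F s))\<^sup>2) \<le> ennreal (t - s) * (\<integral>\<^sup>+x\<in>{s..t}. W x \<partial>lborel)"
    by (rule grad_bound_onD[OF F st])
  also have "\<dots> \<le> ennreal (t - s) * (\<integral>\<^sup>+x\<in>{s..t}. V x \<partial>lborel)"
    using S[OF st(1,2)] assms(3)
    by (intro mult_left_mono nn_integral_mono) (auto simp: indicator_def)
  finally show "ennreal ((norm (F t - F s))\<^sup>2) \<le> \<dots>" .
qed fact

text \<open>Bounds on short intervals chain to bounds on long ones. This serves estimates that hold
  only for small increments, such as the comparison of arc and chord.\<close>

lemma grad_bound_local:
  fixes F :: "real \<Rightarrow> 'a::real_normed_vector"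
  assumes W: "W \<in> borel_measurable borel" and "0 < r"
    and loc: "\<And>s t. s \<le> t \<Longrightarrow> t - s \<le> r \<Longrightarrow>
      ennreal ((norm (F t - F s))\<^sup>2) \<le> ennreal (t - s) * (\<integral>\<^sup>+x\<in>{s..t}. W x \<partial>lborel)"
  shows "grad_bound F W"
proof -
  have "ennreal ((norm (F t - F s))\<^sup>2) \<le> ennreal (t - s) * (\<integral>\<^sup>+x\<in>{s..t}. W x \<partial>lborel)"
    if "s \<le> t" "t - s \<le> real n * r" for s t n
    using that
  proof (induction n arbitrary: s t)
    case 0
    then show ?case by simp
  next
    case (Suc n)
    define c where "c = max s (t - r)"
    have c: "s \<le> c" "c \<le> t" "t - c \<le> r" using Suc.prems \<open>0 < r\<close> by (auto simp: c_def)
    have "c - s \<le> real n * r" using Suc.prems \<open>0 < r\<close> by (auto simp: c_def algebra_simps)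
    then show ?case using c by (intro grad_bound_chain(2)[OF W c(1,2)] Suc.IH loc)
  qed
  moreover have "\<exists>n. t - s \<le> real n * r" for s t :: real
    using reals_Archimedean3[OF \<open>0 < r\<close>, rule_format, of "t - s"] less_imp_le by blast
  ultimately show ?thesis
    unfolding grad_bound_on_def using W by blast
qed

lemma grad_bound_on_holder:
  fixes F :: "real \<Rightarrow> 'a::real_normed_vector"
  assumes F: "grad_bound_on S F W" and E: "(\<integral>\<^sup>+x\<in>S. W x \<partial>lborel) \<le> ennreal E"
    and S: "\<And>s t. s \<in> S \<Longrightarrow> t \<in> S \<Longrightarrow> {s..t} \<subseteq> S" and st: "s \<in> S" "t \<in> S" and "0 \<le> E"
  shows "(norm (F t - F s))\<^sup>2 \<le> E * \<bar>t - s\<bar>"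
proof -
  have main: "(norm (F t - F s))\<^sup>2 \<le> E * (t - s)" if "s \<le> t" "s \<in> S" "t \<in> S" for s t
  proof -
    have "ennreal ((norm (F t - F s))\<^sup>2) \<le> ennreal (t - s) * (\<integral>\<^sup>+x\<in>{s..t}. W x \<partial>lborel)"
      using that by (intro grad_bound_onD[OF F])
    also have "\<dots> \<le> ennreal (t - s) * ennreal E"
    proof (intro mult_left_mono)
      have "(\<integral>\<^sup>+x\<in>{s..t}. W x \<partial>lborel) \<le> (\<integral>\<^sup>+x\<in>S. W x \<partial>lborel)"
        using S[of s t] that by (intro nn_integral_mono) (auto simp: indicator_def)
      with E show "(\<integral>\<^sup>+x\<in>{s..t}. W x \<partial>lborel) \<le> ennreal E" by (rule order_trans[rotated])
    qed simp
    finally show ?thesis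
      using that \<open>0 \<le> E\<close> by (simp add: ennreal_mult[symmetric] ennreal_le_iff mult.commute)
  qed
  show ?thesis
    using main[of s t] main[of t s] st by (cases "s \<le> t") (auto simp: norm_minus_commute)
qed

lemma holder_continuous_on:
  fixes F :: "real \<Rightarrow> 'a::real_normed_vector"
  assumes "\<And>s t. (norm (F t - F s))\<^sup>2 \<le> E * \<bar>t - s\<bar>"
  shows "continuous_on A F"
proof (rule continuous_at_imp_continuous_on, intro ballI)
  fix s
  have "(F \<longlongrightarrow> F s) (at s)"
  proof (rule LIM_zero_cancel, rule tendsto_norm_zero_cancel)
    have "((\<lambda>t. sqrt (E * \<bar>t - s\<bar>)) \<longlongrightarrow> sqrt (E * \<bar>s - s\<bar>)) (at s)"
      by (intro tendsto_intros)
    then have lim: "((\<lambda>t. sqrt (E * \<bar>t - s\<bar>)) \<longlongrightarrow> 0) (at s)" by simp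
    have le: "norm (F t - F s) \<le> sqrt (E * \<bar>t - s\<bar>)" for t
      using assms[of t s] by (rule real_le_rsqrt)
    show "((\<lambda>t. norm (F t - F s)) \<longlongrightarrow> 0) (at s)"
      by (rule tendsto_sandwich[OF _ _ tendsto_const lim]) (intro always_eventually allI norm_ge_zero le)+
  qed
  then show "isCont F s" by (simp add: isCont_def)
qed

lemma grad_bound_continuous:
  fixes F :: "real \<Rightarrow> 'a::real_normed_vector"
  assumes F: "grad_bound F W" and fin: "(\<integral>\<^sup>+x. W x \<partial>lborel) < \<infinity>"
  shows "continuous_on A F"
proof -
  obtain E where E: "(\<integral>\<^sup>+x. W x \<partial>lborel) = ennreal E" "0 \<le> E"
    using fin by (cases "\<integral>\<^sup>+x. W x \<partial>lborel") auto
  show ?thesis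
    using grad_bound_on_holder[OF F, of E] E by (intro holder_continuous_on[where E = E]) auto
qed

section \<open>The polar angle as a function of the first component\<close>

lemma arccos_cos_le_abs: "arccos (cos y) \<le> \<bar>y\<bar>"
proof (cases "\<bar>y\<bar> \<le> pi")
  case True
  have "cos y = cos \<bar>y\<bar>" by (simp add: abs_if)
  then show ?thesis using arccos_cos[of "\<bar>y\<bar>"] True by simp
next
  case False
  then show ?thesis using arccos_ubound[of "cos y"] by simp
qed

text \<open>\<open>arccos (cos a)\<close> is the distance from \<open>a\<close> to the nearest
  multiple of \<open>2 * pi\<close>; rounding \<open>a / (2 * pi)\<close> finds that
  multiple.\<close>

lemma arccos_cos_eq_abs:
  obtains k :: int where "arccos (cos a) = \<bar>a - 2 * pi * of_int k\<bar>"
proof -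
  obtain k :: int where k: "\<bar>a - 2 * pi * of_int k\<bar> \<le> pi"
  proof
    let ?k = "\<lfloor>a / (2 * pi) + 1/2\<rfloor>"
    have "of_int ?k \<le> a / (2 * pi) + 1/2" "a / (2 * pi) + 1/2 < of_int ?k + 1" by linarith+
    then have "2 * pi * of_int ?k \<le> 2 * pi * (a / (2 * pi) + 1/2)"
      "2 * pi * (a / (2 * pi) + 1/2) \<le> 2 * pi * (of_int ?k + 1)"
      by (intro mult_left_mono; simp)+
    then show "\<bar>a - 2 * pi * of_int ?k\<bar> \<le> pi" by (simp add: algebra_simps abs_le_iff)
  qed
  have "cos a = cos (a - 2 * pi * of_int k)" by (simp add: cos_diff)
  also have "\<dots> = cos \<bar>a - 2 * pi * of_int k\<bar>" by (simp only: cos_abs_real)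
  finally have "arccos (cos a) = \<bar>a - 2 * pi * of_int k\<bar>" by (simp only: arccos_cos[OF abs_ge_zero k])
  then show thesis by (rule that)
qed

lemma arccos_cos_lipschitz: "\<bar>arccos (cos a) - arccos (cos b)\<bar> \<le> \<bar>a - b\<bar>"
proof -
  have main: "arccos (cos b) - arccos (cos a) \<le> \<bar>a - b\<bar>" for a b
  proof -
    obtain k :: int where k: "arccos (cos a) = \<bar>a - 2 * pi * of_int k\<bar>" by (rule arccos_cos_eq_abs)
    have "arccos (cos b) = arccos (cos (b - 2 * pi * of_int k))" by (simp add: cos_diff)
    also have "\<dots> \<le> \<bar>b - 2 * pi * of_int k\<bar>" by (rule arccos_cos_le_abs)
    finally show ?thesis using k by linarith
  qed
  show ?thesis using main[of a b] main[of b a] by (simp add: abs_le_iff abs_minus_commute)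
qed

text \<open>The inequality \<open>x \<le> tan x\<close> cleared of its denominator, which extends it
  to \<open>[0, pi]\<close>; the difference of the two sides has derivative
  \<open>x * sin x\<close>.\<close>

lemma sin_ge_mult_cos: "0 \<le> x \<Longrightarrow> x \<le> pi \<Longrightarrow> x * cos x \<le> sin (x::real)"
proof -
  assume x: "0 \<le> x" "x \<le> pi"
  have "(\<lambda>x. sin x - x * cos x) 0 \<le> (\<lambda>x. sin x - x * cos x) x"
  proof (rule DERIV_nonneg_imp_nondecreasing[OF x(1)])
    fix y assume y: "0 \<le> y" "y \<le> x"
    have "((\<lambda>x. sin x - x * cos x) has_real_derivative y * sin y) (at y)"
      by (auto intro!: derivative_eq_intros)
    moreover have "0 \<le> y * sin y" using x y by (simp add: sin_ge_zero)
    ultimately show "\<exists>d. ((\<lambda>x. sin x - x * cos x) has_real_derivative d) (at y) \<and> 0 \<le> d" by blast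
  qed
  then show ?thesis by simp
qed

text \<open>Let \<open>c\<close> be the angle between \<open>p\<close> and \<open>q\<close>. The
  chord is \<open>2 * sin (c / 2)\<close>, the factor \<open>1 - chord^2 / 4\<close> is the square
  of \<open>cos (c / 2)\<close>, and the left difference is at most \<open>c\<close>, so
  \<open>sin_ge_mult_cos\<close> at \<open>c / 2\<close> suffices. The factor tends to 1 for short
  chords.\<close>

lemma arccos_fst_diff_le:
  fixes p q :: "real \<times> real"
  assumes p: "norm p = 1" and q: "norm q = 1"
  shows "(arccos (fst p) - arccos (fst q))\<^sup>2 * (1 - (norm (p - q))\<^sup>2 / 4) \<le> (norm (p - q))\<^sup>2"
proof -
  have ex: "\<exists>a. r = (cos a, sin a)" if "norm r = 1" for r :: "real \<times> real"
  proof -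
    have "(fst r)\<^sup>2 + (snd r)\<^sup>2 = 1" using that by (simp add: norm_prod_def)
    from sincos_total_2pi[OF this] show ?thesis by (metis prod.collapse)
  qed
  obtain a b where ab: "p = (cos a, sin a)" "q = (cos b, sin b)" using ex p q by metis
  define c where "c = arccos (cos (a - b))"
  have c: "0 \<le> c" "c \<le> pi" by (auto simp: c_def arccos_lbound arccos_ubound)
  have cc: "cos c = cos (a - b)" by (simp add: c_def)
  obtain k :: int where k: "c = \<bar>a - b - 2 * pi * of_int k\<bar>"
    unfolding c_def by (rule arccos_cos_eq_abs)
  have "cos a = cos (a - 2 * pi * of_int k)" by (simp add: cos_diff)
  then have "\<bar>arccos (fst p) - arccos (fst q)\<bar> \<le> \<bar>a - 2 * pi * of_int k - b\<bar>"
    using arccos_cos_lipschitz[of "a - 2 * pi * of_int k" b] by (simp add: ab)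
  then have le: "\<bar>arccos (fst p) - arccos (fst q)\<bar> \<le> c" using k by (simp add: algebra_simps)
  have "(norm (p - q))\<^sup>2 = (cos a - cos b)\<^sup>2 + (sin a - sin b)\<^sup>2"
    by (simp add: ab norm_prod_def)
  also have "\<dots> = 2 - 2 * cos (a - b)"
    using sin_cos_squared_add[of a] sin_cos_squared_add[of b]
    by (simp add: cos_diff power2_eq_square algebra_simps)
  finally have n: "(norm (p - q))\<^sup>2 = 2 - 2 * cos c" by (simp add: cc)
  have half: "cos c = 1 - 2 * (sin (c/2))\<^sup>2" "cos c = 2 * (cos (c/2))\<^sup>2 - 1"
    using cos_double_sin[of "c/2"] cos_double_cos[of "c/2"] by simp_all
  have "0 \<le> c/2 * cos (c/2)" using c by (intro mult_nonneg_nonneg cos_ge_zero) auto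
  moreover have "c/2 * cos (c/2) \<le> sin (c/2)" using c by (intro sin_ge_mult_cos) auto
  ultimately have "(c/2 * cos (c/2))\<^sup>2 \<le> (sin (c/2))\<^sup>2" by (intro power_mono) auto
  then have main: "c\<^sup>2 * (cos (c/2))\<^sup>2 \<le> 4 * (sin (c/2))\<^sup>2" by (simp add: power_mult_distrib power_divide)
  have "(arccos (fst p) - arccos (fst q))\<^sup>2 \<le> c\<^sup>2"
    using le by (metis abs_ge_zero power2_abs power_mono)
  then have "(arccos (fst p) - arccos (fst q))\<^sup>2 * (cos (c/2))\<^sup>2 \<le> c\<^sup>2 * (cos (c/2))\<^sup>2"
    by (intro mult_right_mono) auto
  also note main
  finally have *: "(arccos (fst p) - arccos (fst q))\<^sup>2 * (cos (c/2))\<^sup>2 \<le> 4 * (sin (c/2))\<^sup>2" .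
  have "1 - (norm (p - q))\<^sup>2 / 4 = (cos (c/2))\<^sup>2" "(norm (p - q))\<^sup>2 = 4 * (sin (c/2))\<^sup>2" using n half by linarith+
  with * show ?thesis by (simp only:)
qed

text \<open>Arc and chord agree only infinitesimally. So the bound is first shown with a factor
  \<open>\<kappa> > 1\<close> on short intervals, then globally with the same factor, and finally
  \<open>\<kappa>\<close> tends to 1; no loss may remain, since the energies have to match.\<close>

lemma grad_bound_arccos_fst:
  fixes m :: "real \<Rightarrow> real \<times> real"
  assumes m: "grad_bound m W" and fin: "(\<integral>\<^sup>+x. W x \<partial>lborel) < \<infinity>" and unit: "\<And>x. norm (m x) = 1"
  shows "grad_bound (\<lambda>x. arccos (fst (m x))) W"
proof -
  let ?\<theta> = "\<lambda>x. arccos (fst (m x))"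
  have W [measurable]: "W \<in> borel_measurable borel" by (rule grad_bound_on_measurable[OF m])
  obtain E where E: "(\<integral>\<^sup>+x. W x \<partial>lborel) = ennreal E" "0 \<le> E"
    using fin by (cases "\<integral>\<^sup>+x. W x \<partial>lborel") auto
  have hold: "(norm (m t - m s))\<^sup>2 \<le> E * \<bar>t - s\<bar>" for s t
    using grad_bound_on_holder[OF m, of E s t] E by auto
  have gb: "grad_bound ?\<theta> (\<lambda>x. ennreal \<kappa> * W x)" if \<kappa>: "1 < \<kappa>" for \<kappa>
  proof -
    \<comment> \<open>By Hoelder continuity of \<open>m\<close>, chords over intervals of length at
      most \<open>r\<close> satisfy \<open>chord^2 / 4 \<le> 1 - 1 / \<kappa>\<close>.\<close>
    define r where "r = 4 * (1 - 1 / \<kappa>) / (E + 1)"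
    have "1 / \<kappa> < 1" using \<kappa> by simp
    then have r: "0 < r" unfolding r_def using E by (intro divide_pos_pos mult_pos_pos) auto
    show ?thesis
    proof (rule grad_bound_local[OF _ r])
      fix s t :: real assume st: "s \<le> t" "t - s \<le> r"
      have "E * \<bar>t - s\<bar> \<le> (E + 1) * r" using st E by (intro mult_mono) auto
      also have "\<dots> = 4 * (1 - 1 / \<kappa>)" using E by (simp add: r_def)
      finally have "(norm (m t - m s))\<^sup>2 / 4 \<le> 1 - 1 / \<kappa>" using hold[of t s] by simp
      then have "(?\<theta> t - ?\<theta> s)\<^sup>2 * (1 / \<kappa>) \<le> (?\<theta> t - ?\<theta> s)\<^sup>2 * (1 - (norm (m t - m s))\<^sup>2 / 4)"
        by (intro mult_left_mono) auto
      also have "\<dots> \<le> (norm (m t - m s))\<^sup>2" by (rule arccos_fst_diff_le) (simp_all add: unit)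
      finally have "(?\<theta> t - ?\<theta> s)\<^sup>2 \<le> \<kappa> * (norm (m t - m s))\<^sup>2"
        using \<kappa> by (simp add: field_simps)
      then have "ennreal ((norm (?\<theta> t - ?\<theta> s))\<^sup>2) \<le> ennreal \<kappa> * ennreal ((norm (m t - m s))\<^sup>2)"
        using \<kappa> by (simp add: ennreal_mult[symmetric] ennreal_leI)
      also have "\<dots> \<le> ennreal \<kappa> * (ennreal (t - s) * (\<integral>\<^sup>+x\<in>{s..t}. W x \<partial>lborel))"
        using st by (intro mult_left_mono grad_bound_onD[OF m]) auto
      also have "\<dots> = ennreal (t - s) * (\<integral>\<^sup>+x\<in>{s..t}. ennreal \<kappa> * W x \<partial>lborel)"
        by (simp add: nn_integral_cmult mult_ac)
      finally show "ennreal ((norm (?\<theta> t - ?\<theta> s))\<^sup>2) \<le> ennreal (t - s) * (\<integral>\<^sup>+x\<in>{s..t}. ennreal \<kappa> * W x \<partial>lborel)" .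
    qed simp
  qed
  show ?thesis
    unfolding grad_bound_on_def
  proof (intro conjI ballI impI W)
    fix s t :: real assume st: "s \<le> t"
    have "(\<integral>\<^sup>+x\<in>{s..t}. W x \<partial>lborel) \<le> (\<integral>\<^sup>+x. W x \<partial>lborel)"
      by (intro nn_integral_mono) (auto simp: indicator_def)
    also have "\<dots> < \<infinity>" by fact
    finally obtain w where w: "(\<integral>\<^sup>+x\<in>{s..t}. W x \<partial>lborel) = ennreal w" "0 \<le> w"
      by (cases "\<integral>\<^sup>+x\<in>{s..t}. W x \<partial>lborel") auto
    have le: "(norm (?\<theta> t - ?\<theta> s))\<^sup>2 \<le> \<kappa> * ((t - s) * w)" if "1 < \<kappa>" for \<kappa>
    proof -
      have "ennreal ((norm (?\<theta> t - ?\<theta> s))\<^sup>2) \<le> ennreal (t - s) * (\<integral>\<^sup>+x\<in>{s..t}. ennreal \<kappa> * W x \<partial>lborel)"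
        by (rule grad_bound_onD[OF gb[OF that]]) (use st in auto)
      also have "\<dots> = ennreal (\<kappa> * ((t - s) * w))"
        using st w that by (simp add: nn_integral_cmult mult_ac ennreal_mult[symmetric])
      finally show ?thesis using st w that by (simp add: ennreal_le_iff)
    qed
    have "(norm (?\<theta> t - ?\<theta> s))\<^sup>2 \<le> (t - s) * w"
    proof (rule tendsto_lowerbound[of "\<lambda>\<kappa>. \<kappa> * ((t - s) * w)" _ "at_right 1"])
      have "((\<lambda>\<kappa>. \<kappa> * ((t - s) * w)) \<longlongrightarrow> 1 * ((t - s) * w)) (at_right 1)" by (intro tendsto_intros)
      then show "((\<lambda>\<kappa>. \<kappa> * ((t - s) * w)) \<longlongrightarrow> (t - s) * w) (at_right 1)" by simp
      show "\<forall>\<^sub>F \<kappa> in at_right 1. (norm (?\<theta> t - ?\<theta> s))\<^sup>2 \<le> \<kappa> * ((t - s) * w)"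
        using le by (auto simp: eventually_at_filter intro!: always_eventually)
    qed simp
    then show "ennreal ((norm (?\<theta> t - ?\<theta> s))\<^sup>2) \<le> ennreal (t - s) * (\<integral>\<^sup>+x\<in>{s..t}. W x \<partial>lborel)"
      using st w by (simp add: ennreal_mult[symmetric] ennreal_leI)
  qed
qed

section \<open>Angle profiles\<close>

text \<open>Cauchy-Schwarz; this is the converse of \<open>riesz_derivative\<close>.\<close>

lemma grad_bound_of_integral:
  fixes F :: "real \<Rightarrow> 'a::euclidean_space"
  assumes [measurable]: "G \<in> borel_measurable borel"
    and Gi: "\<And>a b. a \<le> b \<Longrightarrow> set_integrable lborel {a..b} G"
    and FG: "\<And>a b. a \<le> b \<Longrightarrow> (LINT x:{a..b}|lborel. G x) = F b - F a"
    and fin: "(\<integral>\<^sup>+x. ennreal ((norm (G x))\<^sup>2) \<partial>lborel) < \<infinity>"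
  shows "grad_bound F (\<lambda>x. ennreal ((norm (G x))\<^sup>2))"
  unfolding grad_bound_on_def
proof (intro conjI ballI impI)
  show "(\<lambda>x. ennreal ((norm (G x))\<^sup>2)) \<in> borel_measurable borel" by measurable
  fix s t :: real assume st: "s \<le> t"
  let ?I = "\<integral>\<^sup>+x\<in>{s..t}. ennreal ((norm (G x))\<^sup>2) \<partial>lborel"
  have "?I \<le> (\<integral>\<^sup>+x. ennreal ((norm (G x))\<^sup>2) \<partial>lborel)"
    by (intro nn_integral_mono) (auto simp: indicator_def)
  then have "?I < \<infinity>" using fin by (rule order_le_less_trans)
  then obtain c where c: "?I = ennreal c" "0 \<le> c" by (cases ?I) auto
  have "ennreal (norm (F t - F s)) = ennreal (norm (LINT x:{s..t}|lborel. G x))"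
    using FG[OF st] by simp
  also have "\<dots> \<le> (\<integral>\<^sup>+x. ennreal (norm (indicat_real {s..t} x *\<^sub>R G x)) \<partial>lborel)"
    unfolding set_lebesgue_integral_def using Gi[OF st] unfolding set_integrable_def
    by (rule integral_norm_bound_ennreal)
  also have "\<dots> = (\<integral>\<^sup>+x\<in>{s..t}. ennreal (norm (G x)) \<partial>lborel)"
    by (intro nn_integral_cong) (auto simp: indicator_def)
  also have "\<dots> \<le> ennreal (sqrt ((t - s) * c))"
    using st c by (intro nn_integral_norm_interval_le) auto
  finally have "norm (F t - F s) \<le> sqrt ((t - s) * c)"
    using st c by (simp add: ennreal_le_iff)
  then have "(norm (F t - F s))\<^sup>2 \<le> (sqrt ((t - s) * c))\<^sup>2" by (intro power_mono) auto
  also have "\<dots> = (t - s) * c" using st c by simp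
  finally show "ennreal ((norm (F t - F s))\<^sup>2) \<le> ennreal (t - s) * ?I"
    using st c by (simp add: ennreal_mult[symmetric] ennreal_leI)
qed

lemma grad_bound_weak_deriv:
  assumes m: "m \<in> H1loc_circle" and fin: "L2_norm_sq (weak_deriv m) < \<infinity>"
  shows "grad_bound m (\<lambda>x. ennreal ((norm (weak_deriv m x))\<^sup>2))"
proof -
  define g where "g = weak_deriv m"
  have cont: "continuous_on UNIV m" using m by (simp add: H1loc_circle_def)
  have w: "has_weak_derivative m g"
  proof -
    obtain g' where "has_weak_derivative m g'" using m unfolding H1loc_circle_def by auto
    then show ?thesis unfolding g_def weak_deriv_def by (rule someI[of "has_weak_derivative m"])
  qed
  then have gi: "set_integrable lborel {a..b} g" for a b
    by (simp add: has_weak_derivative_def locally_integrable_def)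
  \<comment> \<open>The definition of a weak derivative speaks of bounded intervals only;
    measurability on the whole line comes from the truncations to \<open>[-n, n]\<close>.\<close>
  have g_meas [measurable]: "g \<in> borel_measurable borel"
  proof (rule borel_measurable_LIMSEQ_metric)
    show "(\<lambda>x. indicat_real {- real n..real n} x *\<^sub>R g x) \<in> borel_measurable borel" for n
      using borel_measurable_integrable[OF gi[unfolded set_integrable_def]] by simp
    fix x :: real
    have "\<forall>\<^sub>F n in sequentially. \<bar>x\<bar> \<le> real n"
      by (rule eventually_sequentiallyI[of "nat \<lceil>\<bar>x\<bar>\<rceil>"]) linarith
    then have "\<forall>\<^sub>F n in sequentially. indicat_real {- real n..real n} x *\<^sub>R g x = g x"
      by eventually_elim (auto simp: indicator_def)
    then show "(\<lambda>n. indicat_real {- real n..real n} x *\<^sub>R g x) \<longlonglongrightarrow> g x"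
      by (rule tendsto_eventually)
  qed
  have "grad_bound m (\<lambda>x. ennreal ((norm (g x))\<^sup>2))"
  proof (rule grad_bound_of_integral)
    show "(LINT x:{a..b}|lborel. g x) = m b - m a" if "a \<le> b" for a b
      using weak_derivative_imp_integral[OF cont w that] .
    show "(\<integral>\<^sup>+x. ennreal ((norm (g x))\<^sup>2) \<partial>lborel) < \<infinity>"
      using fin by (simp add: g_def L2_norm_sq_def)
  qed (simp_all add: gi)
  then show ?thesis by (simp add: g_def)
qed

text \<open>The chord is at most the phase difference, so \<open>m\<close> inherits \<open>W\<close>
  and \<open>riesz_derivative\<close> yields a derivative \<open>G\<close>. The chosen
  \<open>weak_deriv m\<close> equals \<open>G\<close> almost everywhere, because both have the same
  integrals over intervals.\<close>

lemma circle_of_phase: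
  fixes \<phi> :: "real \<Rightarrow> real"
  assumes gb: "grad_bound \<phi> W" and fin: "(\<integral>\<^sup>+x. W x \<partial>lborel) < \<infinity>"
  defines "m \<equiv> \<lambda>x. (cos (\<phi> x), sin (\<phi> x))"
  shows "m \<in> H1loc_circle" "L2_norm_sq (weak_deriv m) \<le> (\<integral>\<^sup>+x. W x \<partial>lborel)"
proof -
  have W [measurable]: "W \<in> borel_measurable borel" by (rule grad_bound_on_measurable[OF gb])
  have gbm: "grad_bound m W"
  proof (rule grad_bound_on_lipschitz[OF gb])
    fix s t
    have half: "cos y = 1 - 2 * (sin (y / 2))\<^sup>2" for y :: real
      using cos_double_sin[of "y / 2"] by simp
    have "(norm (m t - m s))\<^sup>2 = (cos (\<phi> t) - cos (\<phi> s))\<^sup>2 + (sin (\<phi> t) - sin (\<phi> s))\<^sup>2"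
      by (simp add: m_def norm_prod_def)
    also have "\<dots> = 2 - 2 * cos (\<phi> t - \<phi> s)"
      using sin_cos_squared_add[of "\<phi> t"] sin_cos_squared_add[of "\<phi> s"]
      by (simp add: cos_diff power2_eq_square algebra_simps)
    also have "\<dots> = (2 * sin ((\<phi> t - \<phi> s) / 2))\<^sup>2"
      unfolding half[of "\<phi> t - \<phi> s"] by (simp add: power_mult_distrib)
    finally have "norm (m t - m s) = \<bar>2 * sin ((\<phi> t - \<phi> s) / 2)\<bar>"
      by (metis abs_norm_cancel power2_eq_iff_nonneg abs_ge_zero power2_abs)
    also have "\<dots> \<le> \<bar>\<phi> t - \<phi> s\<bar>"
      using abs_sin_x_le_abs_x[of "(\<phi> t - \<phi> s) / 2"] by (simp add: abs_mult)
    finally show "norm (m t - m s) \<le> norm (\<phi> t - \<phi> s)" by simp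
  qed
  have contm: "continuous_on UNIV m" by (rule grad_bound_continuous[OF gbm fin])
  then have [measurable]: "m \<in> borel_measurable borel" by (rule borel_measurable_continuous_onI)
  obtain K where K: "(\<integral>\<^sup>+x. W x \<partial>lborel) = ennreal K" "0 \<le> K"
    using fin by (cases "\<integral>\<^sup>+x. W x \<partial>lborel") auto
  have WK: "(\<integral>\<^sup>+x\<in>S. W x \<partial>lborel) \<le> ennreal K" for S
    unfolding K(1)[symmetric] by (intro nn_integral_mono) (auto simp: indicator_def)
  obtain G where G: "G \<in> borel_measurable borel"
    "\<And>a b. a \<le> b \<Longrightarrow> set_integrable lborel {a..b} G"
    "\<And>a b. a \<le> b \<Longrightarrow> (LINT x:{a..b}|lborel. G x) = m b - m a"
    "\<And>k::nat. (\<integral>\<^sup>+x\<in>{- real k..<real k}. ennreal ((norm (G x))\<^sup>2) \<partial>lborel) \<le> (\<integral>\<^sup>+x\<in>{- real k..real k}. W x \<partial>lborel)"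
  proof (rule riesz_derivative[of "\<lambda>a b. \<integral>\<^sup>+x\<in>{a..b}. W x \<partial>lborel" m K])
    show "(\<integral>\<^sup>+x\<in>{a..b}. W x \<partial>lborel) + (\<integral>\<^sup>+x\<in>{b..c}. W x \<partial>lborel) \<le> (\<integral>\<^sup>+x\<in>{a..c}. W x \<partial>lborel)"
      if "a \<le> b" "b \<le> c" for a b c using nn_integral_Icc_split[OF W that] by simp
    show "ennreal ((norm (m b - m a))\<^sup>2) \<le> ennreal (b - a) * (\<integral>\<^sup>+x\<in>{a..b}. W x \<partial>lborel)" if "a \<le> b" for a b
      using that by (intro grad_bound_onD[OF gbm]) auto
    show "(\<integral>\<^sup>+x\<in>{a..b}. W x \<partial>lborel) \<le> ennreal K" for a b by (rule WK)
  qed blast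
  note [measurable] = G(1)
  have "(\<integral>\<^sup>+x\<in>{- real k..<real k}. ennreal ((norm (G x))\<^sup>2) \<partial>lborel) \<le> ennreal K" for k :: nat
    using G(4)[of k] WK by (rule order_trans)
  then have GK: "(\<integral>\<^sup>+x. ennreal ((norm (G x))\<^sup>2) \<partial>lborel) \<le> ennreal K"
    by (subst nn_integral_UNIV_eq_SUP) (auto intro!: SUP_least)
  have wG: "has_weak_derivative m G"
    by (rule integral_imp_weak_derivative[OF contm G(2) G(1) G(3)])
  have sqG: "locally_square_integrable G"
    unfolding locally_square_integrable_def
  proof (intro conjI allI G(1))
    fix a b
    have "(\<integral>\<^sup>+x. ennreal (norm (indicat_real {a..b} x *\<^sub>R (norm (G x))\<^sup>2)) \<partial>lborel) \<le> (\<integral>\<^sup>+x. ennreal ((norm (G x))\<^sup>2) \<partial>lborel)"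
      by (intro nn_integral_mono) (auto simp: indicator_def)
    also have "\<dots> < \<infinity>" using GK by (rule order_le_less_trans) simp
    finally show "set_integrable lborel {a..b} (\<lambda>x. (norm (G x))\<^sup>2)"
      unfolding set_integrable_def by (intro integrableI_bounded) auto
  qed
  have unit: "norm (m x) = 1" for x by (simp add: m_def norm_prod_def)
  have "locally_square_integrable m"
    unfolding locally_square_integrable_def
    by (auto intro!: borel_integrable_atLeastAtMost' continuous_intros simp: unit)
  then show "m \<in> H1loc_circle"
    unfolding H1loc_circle_def using contm unit wG sqG by auto
  define g where "g = weak_deriv m"
  have w: "has_weak_derivative m g"
    unfolding g_def weak_deriv_def using wG by (rule someI[of "has_weak_derivative m"])
  have gi: "set_integrable lborel {a..b} g" for a b
    using w by (simp add: has_weak_derivative_def locally_integrable_def)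
  have Gi: "set_integrable lborel {a..b} G" for a b
    using wG by (simp add: has_weak_derivative_def locally_integrable_def)
  have "AE x in lborel. g x - G x = 0"
  proof (rule AE_zero_of_interval_integrals)
    show "set_integrable lborel {a..b} (\<lambda>x. g x - G x)" for a b
      by (intro set_integral_diff gi Gi)
    show "(LINT x:{a..b}|lborel. g x - G x) = 0" if "a \<le> b" for a b
      using that by (simp add: set_integral_diff(2)[OF gi Gi] weak_derivative_imp_integral[OF contm w] G(3))
  qed
  then have "L2_norm_sq g = (\<integral>\<^sup>+x. ennreal ((norm (G x))\<^sup>2) \<partial>lborel)"
    unfolding L2_norm_sq_def by (intro nn_integral_cong_AE) (auto elim!: eventually_mono)
  then show "L2_norm_sq (weak_deriv m) \<le> (\<integral>\<^sup>+x. W x \<partial>lborel)"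
    using GK by (simp add: g_def K)
qed

section \<open>The energy as a functional of the angle\<close>

definition pair_kernel :: "(real \<Rightarrow> real) \<Rightarrow> real \<times> real \<Rightarrow> real" where
  "pair_kernel u z = (u (fst z) - u (snd z))\<^sup>2 / (fst z - snd z)\<^sup>2 / (2 * pi)"

text \<open>Twice the energy of \<open>(cos \<theta>, \<plusminus> sin \<theta>)\<close>, localized to \<open>S\<close>.\<close>

definition energy2 :: "real \<Rightarrow> (real \<Rightarrow> real) \<Rightarrow> (real \<Rightarrow> ennreal) \<Rightarrow> real set \<Rightarrow> ennreal" where
  "energy2 h \<theta> W S = (\<integral>\<^sup>+x\<in>S. W x \<partial>lborel) +
     (\<integral>\<^sup>+z\<in>S \<times> S. ennreal (pair_kernel (\<lambda>x. cos (\<theta> x)) z) \<partial>lborel) +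
     (\<integral>\<^sup>+x\<in>S. ennreal ((cos (\<theta> x) - h)\<^sup>2) \<partial>lborel)"

definition touches :: "nat \<Rightarrow> (real \<Rightarrow> real) \<Rightarrow> (nat \<Rightarrow> real) \<Rightarrow> bool" where
  "touches l \<theta> p \<longleftrightarrow> (\<forall>i<2 * l - 1. \<theta> (p i) = (if even i then pi else 0)) \<and>
     (\<forall>i. Suc i < 2 * l - 1 \<longrightarrow> p i < p (Suc i))"

text \<open>The energy only sees \<open>m\<^sub>1 = cos \<theta>\<close>, and a map of degree \<open>l - \<alpha> / \<pi>\<close> is recovered from
  \<open>\<theta> = arccos m\<^sub>1\<close> as soon as \<open>\<theta>\<close> takes the values \<open>\<pi>, 0, \<pi>, \<dots>, 0, \<pi>\<close> (\<open>2l - 1\<close> of them) in this order.\<close>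

definition profile :: "nat \<Rightarrow> (real \<Rightarrow> real) \<Rightarrow> (real \<Rightarrow> ennreal) \<Rightarrow> (nat \<Rightarrow> real) \<Rightarrow> bool" where
  "profile l \<theta> W p \<longleftrightarrow> continuous_on UNIV \<theta> \<and> (\<forall>x. 0 \<le> \<theta> x \<and> \<theta> x \<le> pi) \<and> grad_bound \<theta> W \<and> touches l \<theta> p"

lemma pair_kernel_measurable [measurable]:
  assumes "u \<in> borel_measurable borel"
  shows "pair_kernel u \<in> borel_measurable borel"
  using assms unfolding pair_kernel_def[abs_def] borel_prod[symmetric] by measurable

lemma pair_kernel_nonneg: "0 \<le> pair_kernel u z"
  by (simp add: pair_kernel_def)

lemma H_half_seminorm_sq_eq:
  assumes [measurable]: "u \<in> borel_measurable borel"
  shows "H_half_seminorm_sq (\<lambda>x. u x - c) = (\<integral>\<^sup>+z. ennreal (pair_kernel u z) \<partial>lborel)"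
proof -
  have "ennreal (pair_kernel u (s, t)) = ennreal (1 / (2 * pi)) * ennreal (\<bar>(u s - c) - (u t - c)\<bar>\<^sup>2 / \<bar>s - t\<bar>\<^sup>2)" for s t
    unfolding pair_kernel_def by (subst ennreal_mult[symmetric]) (auto simp: field_simps)
  then have "(\<integral>\<^sup>+z. ennreal (pair_kernel u z) \<partial>(lborel \<Otimes>\<^sub>M lborel)) =
    (\<integral>\<^sup>+t. \<integral>\<^sup>+s. ennreal (1 / (2 * pi)) * ennreal (\<bar>(u s - c) - (u t - c)\<bar>\<^sup>2 / \<bar>s - t\<bar>\<^sup>2) \<partial>lborel \<partial>lborel)"
    by (subst lborel_pair.nn_integral_snd[symmetric]) (simp_all add: pair_kernel_measurable lborel_prod)
  also have "\<dots> = H_half_seminorm_sq (\<lambda>x. u x - c)"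
    unfolding H_half_seminorm_sq_def
    by (subst nn_integral_cmult, measurable)+
  finally show ?thesis by (simp add: lborel_prod)
qed

lemma energy_eq:
  assumes "\<And>x. fst (m x) = cos (\<theta> x)" and \<theta>: "continuous_on UNIV \<theta>"
  shows "energy h m = ennreal (1/2) * (L2_norm_sq (weak_deriv m) +
     (\<integral>\<^sup>+z. ennreal (pair_kernel (\<lambda>x. cos (\<theta> x)) z) \<partial>lborel) +
     (\<integral>\<^sup>+x. ennreal ((cos (\<theta> x) - h)\<^sup>2) \<partial>lborel))"
proof -
  have [measurable]: "\<theta> \<in> borel_measurable borel" using \<theta> by (rule borel_measurable_continuous_onI)
  show ?thesis
    unfolding energy_def assms(1) by (subst H_half_seminorm_sq_eq) (auto simp: L2_norm_sq_def)
qed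

text \<open>A large value of \<open>u\<close> persists on an interval of fixed length by Hoelder
  continuity, and infinitely many such intervals would make the integral of the square
  diverge.\<close>

lemma holder_square_integrable_tendsto_0:
  fixes u :: "real \<Rightarrow> real"
  assumes hold: "\<And>s t. (u t - u s)\<^sup>2 \<le> E * \<bar>t - s\<bar>" and "0 \<le> E"
    and fin: "(\<integral>\<^sup>+x. ennreal ((u x)\<^sup>2) \<partial>lborel) < \<infinity>"
  shows "(u \<longlongrightarrow> 0) at_top" "(u \<longlongrightarrow> 0) at_bot"
proof -
  have top: "(u \<longlongrightarrow> 0) at_top"
    if hold: "\<And>s t. (u t - u s)\<^sup>2 \<le> E * \<bar>t - s\<bar>" and fin: "(\<integral>\<^sup>+x. ennreal ((u x)\<^sup>2) \<partial>lborel) < \<infinity>"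
    for u :: "real \<Rightarrow> real"
  proof (rule tendstoI)
    fix e :: real assume "0 < e"
    have "continuous_on UNIV u" using hold by (intro holder_continuous_on[where E = E]) simp
    then have [measurable]: "u \<in> borel_measurable borel" by (rule borel_measurable_continuous_onI)
    have int: "integrable lborel (\<lambda>x. (u x)\<^sup>2)" using fin by (intro integrableI_bounded) auto
    define P where "P y = (LINT x|lborel. indicator {..y} x *\<^sub>R (u x)\<^sup>2)" for y
    \<comment> \<open>Over a length \<open>\<rho>\<close> the function \<open>u\<close> varies by at
      most \<open>e / 2\<close>. A value of size \<open>e\<close> at \<open>s\<close> then adds at
      least \<open>\<rho> * (e^2 / 4)\<close>, which is \<open>2 * \<delta>\<close>, to
      \<open>P\<close> between \<open>s\<close> and \<open>s + \<rho>\<close>, while both values of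
      \<open>P\<close> are within \<open>\<delta>\<close> of the limit.\<close>
    define \<rho> where "\<rho> = e\<^sup>2 / (4 * (E + 1))"
    have \<rho>: "0 < \<rho>" using \<open>0 < e\<close> \<open>0 \<le> E\<close> by (simp add: \<rho>_def)
    define \<delta> where "\<delta> = \<rho> * (e\<^sup>2 / 4) / 2"
    have \<delta>: "0 < \<delta>" using \<rho> \<open>0 < e\<close> by (simp add: \<delta>_def)
    have "(P \<longlongrightarrow> (LINT x|lborel. (u x)\<^sup>2)) at_top"
      unfolding P_def by (rule tendsto_integral_at_top[OF _ int]) simp
    then have "\<forall>\<^sub>F y in at_top. dist (P y) (LINT x|lborel. (u x)\<^sup>2) < \<delta>" using \<delta> by (rule tendstoD)
    then obtain Y where Y: "\<And>y. Y \<le> y \<Longrightarrow> dist (P y) (LINT x|lborel. (u x)\<^sup>2) < \<delta>"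
      by (auto simp: eventually_at_top_linorder)
    show "\<forall>\<^sub>F s in at_top. dist (u s) 0 < e"
      unfolding eventually_at_top_linorder
    proof (intro exI[of _ Y] allI impI, rule ccontr)
      fix s assume s: "Y \<le> s" and "\<not> dist (u s) 0 < e"
      then have us: "e \<le> \<bar>u s\<bar>" by simp
      have ge: "e / 2 \<le> \<bar>u x\<bar>" if "x \<in> {s<..s+\<rho>}" for x
      proof -
        have "(u x - u s)\<^sup>2 \<le> E * \<bar>x - s\<bar>" by (rule hold)
        also have "\<dots> \<le> (E + 1) * \<rho>" using that \<open>0 \<le> E\<close> by (intro mult_mono) auto
        also have "\<dots> = (e / 2)\<^sup>2" using \<open>0 \<le> E\<close> by (simp add: \<rho>_def power_divide field_simps)
        finally have "\<bar>u x - u s\<bar> \<le> e / 2"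
          using \<open>0 < e\<close> by (simp flip: abs_le_square_iff)
        then show ?thesis using us by linarith
      qed
      have "\<rho> * (e\<^sup>2 / 4) = (LINT x|lborel. (e\<^sup>2 / 4) * indicator {s<..s+\<rho>} x)"
        using \<rho> by simp
      also have "\<dots> \<le> (LINT x|lborel. indicator {..s+\<rho>} x *\<^sub>R (u x)\<^sup>2 - indicator {..s} x *\<^sub>R (u x)\<^sup>2)"
      proof (rule integral_mono)
        show "integrable lborel (\<lambda>x. (e\<^sup>2 / 4) * indicat_real {s<..s+\<rho>} x)"
          using \<rho> by (intro integrable_mult_right integrable_real_indicator) auto
        show "integrable lborel (\<lambda>x. indicat_real {..s + \<rho>} x *\<^sub>R (u x)\<^sup>2 - indicat_real {..s} x *\<^sub>R (u x)\<^sup>2)"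
          by (intro Bochner_Integration.integrable_diff integrable_mult_indicator int) auto
        fix x :: real
        show "(e\<^sup>2 / 4) * indicat_real {s<..s+\<rho>} x \<le> indicat_real {..s + \<rho>} x *\<^sub>R (u x)\<^sup>2 - indicat_real {..s} x *\<^sub>R (u x)\<^sup>2"
        proof (cases "x \<in> {s<..s+\<rho>}")
          case True
          have "(e / 2)\<^sup>2 \<le> (u x)\<^sup>2" using power_mono[OF ge[OF True], of 2] \<open>0 < e\<close> by simp
          then show ?thesis using True by (simp add: power_divide)
        next
          case False
          then show ?thesis using \<rho> by (auto simp: indicator_def)
        qed
      qed
      also have "\<dots> = P (s + \<rho>) - P s"
        unfolding P_def by (intro Bochner_Integration.integral_diff integrable_mult_indicator int) auto
      also have "\<dots> < 2 * \<delta>"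
        using Y[of "s + \<rho>"] Y[of s] s \<rho> unfolding dist_real_def by linarith
      finally show False by (simp add: \<delta>_def)
    qed
  qed
  show "(u \<longlongrightarrow> 0) at_top" by (rule top[OF hold fin])
  have "((\<lambda>x. u (- x)) \<longlongrightarrow> 0) at_top"
  proof (rule top)
    show "(u (- t) - u (- s))\<^sup>2 \<le> E * \<bar>t - s\<bar>" for s t
      using hold[of "- t" "- s"] by (simp add: abs_minus_commute)
    have [measurable]: "u \<in> borel_measurable borel"
      using hold by (intro borel_measurable_continuous_onI holder_continuous_on[where E = E]) simp
    have "(\<integral>\<^sup>+x. ennreal ((u (- x))\<^sup>2) \<partial>lborel) = (\<integral>\<^sup>+x. ennreal ((u x)\<^sup>2) \<partial>lborel)"
      by (subst nn_integral_real_affine[of _ "-1" 0]) auto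
    then show "(\<integral>\<^sup>+x. ennreal ((u (- x))\<^sup>2) \<partial>lborel) < \<infinity>" using fin by simp
  qed
  then show "(u \<longlongrightarrow> 0) at_bot" by (simp add: filterlim_at_bot_mirror)
qed

lemma abs_cos_diff_le: "\<bar>cos a - cos b\<bar> \<le> \<bar>a - b\<bar>" for a b :: real
proof -
  have "\<bar>cos a - cos b\<bar> = 2 * \<bar>sin ((a + b) / 2)\<bar> * \<bar>sin ((b - a) / 2)\<bar>"
    by (simp add: cos_diff_cos abs_mult)
  also have "\<dots> \<le> 2 * 1 * \<bar>(b - a) / 2\<bar>"
    by (intro mult_mono abs_sin_x_le_abs_x) auto
  finally show ?thesis by (simp add: abs_minus_commute)
qed

lemma energy2_finite_cos_tendsto:
  assumes gb: "grad_bound \<theta> W" and fin: "energy2 h \<theta> W UNIV < \<infinity>"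
  shows "((\<lambda>x. cos (\<theta> x)) \<longlongrightarrow> h) at_top" "((\<lambda>x. cos (\<theta> x)) \<longlongrightarrow> h) at_bot"
proof -
  have Wf: "(\<integral>\<^sup>+x. W x \<partial>lborel) < \<infinity>" and uf: "(\<integral>\<^sup>+x. ennreal ((cos (\<theta> x) - h)\<^sup>2) \<partial>lborel) < \<infinity>"
    using fin by (auto simp: energy2_def)
  obtain E where E: "(\<integral>\<^sup>+x. W x \<partial>lborel) = ennreal E" "0 \<le> E"
    using Wf by (cases "\<integral>\<^sup>+x. W x \<partial>lborel") auto
  have "((cos (\<theta> t) - h) - (cos (\<theta> s) - h))\<^sup>2 \<le> E * \<bar>t - s\<bar>" for s t
  proof -
    have "((cos (\<theta> t) - h) - (cos (\<theta> s) - h))\<^sup>2 = (cos (\<theta> t) - cos (\<theta> s))\<^sup>2" by simp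
    also have "\<dots> \<le> (\<theta> t - \<theta> s)\<^sup>2"
      using abs_cos_diff_le[of "\<theta> t" "\<theta> s"] by (simp only: abs_le_square_iff)
    also have "\<dots> \<le> E * \<bar>t - s\<bar>"
      using grad_bound_on_holder[OF gb, of E s t] E by simp
    finally show ?thesis .
  qed
  note lim = holder_square_integrable_tendsto_0[OF this E(2) uf]
  show "((\<lambda>x. cos (\<theta> x)) \<longlongrightarrow> h) at_top" "((\<lambda>x. cos (\<theta> x)) \<longlongrightarrow> h) at_bot"
    using LIM_zero_cancel[OF lim(1)] LIM_zero_cancel[OF lim(2)] by auto
qed

lemma ivt_sequence:
  fixes \<phi> :: "real \<Rightarrow> real"
  assumes \<phi>: "continuous_on UNIV \<phi>" and ab: "a \<le> b"
    and lo: "\<phi> a < lev 0" and hi: "\<And>i. i < n \<Longrightarrow> lev i \<le> \<phi> b" and incr: "\<And>i. lev i < lev (Suc i)"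
  shows "\<exists>p. (\<forall>i<n. \<phi> (p i) = lev i \<and> a \<le> p i \<and> p i \<le> b) \<and> (\<forall>i. Suc i < n \<longrightarrow> p i < p (Suc i))"
  using hi
proof (induction n)
  case 0
  then show ?case by simp
next
  case (Suc n)
  then obtain p where p: "\<forall>i<n. \<phi> (p i) = lev i \<and> a \<le> p i \<and> p i \<le> b" "\<forall>i. Suc i < n \<longrightarrow> p i < p (Suc i)"
    by auto
  define c where "c = (if n = 0 then a else p (n - 1))"
  have c: "a \<le> c" "c \<le> b" "\<phi> c < lev n"
    using p(1) lo ab incr[of "n - 1"] by (auto simp: c_def)
  have "\<exists>x\<ge>c. x \<le> b \<and> \<phi> x = lev n"
    using c Suc.prems[of n] by (intro IVT' continuous_on_subset[OF \<phi>]) auto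
  then obtain x where x: "c \<le> x" "x \<le> b" "\<phi> x = lev n" by blast
  then have "c < x" using c(3) by (cases "c = x") auto
  have "(\<forall>i<Suc n. \<phi> ((p(n := x)) i) = lev i \<and> a \<le> (p(n := x)) i \<and> (p(n := x)) i \<le> b) \<and>
      (\<forall>i. Suc i < Suc n \<longrightarrow> (p(n := x)) i < (p(n := x)) (Suc i))"
  proof (intro conjI allI impI)
    fix i assume "i < Suc n"
    then show "\<phi> ((p(n := x)) i) = lev i" "a \<le> (p(n := x)) i" "(p(n := x)) i \<le> b"
      using p(1) x c(1) by (auto simp: less_Suc_eq)
  next
    fix i assume i: "Suc i < Suc n"
    show "(p(n := x)) i < (p(n := x)) (Suc i)"
    proof (cases "Suc i = n")
      case True
      then show ?thesis using \<open>c < x\<close> by (auto simp: c_def)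
    next
      case False
      then show ?thesis using p(2) i by auto
    qed
  qed
  then show ?case by blast
qed

text \<open>The limits of \<open>\<phi>\<close> need not be identified: \<open>cos \<phi> \<rightarrow> h\<close> at both ends and the value of the degree
  force \<open>\<phi>(- x)\<close> to be close to \<open>\<alpha>\<close> modulo \<open>2 \<pi>\<close>.\<close>

lemma touches_of_degree:
  fixes \<phi> :: "real \<Rightarrow> real"
  assumes \<phi>: "continuous_on UNIV \<phi>" and h: "0 < h" "h \<le> 1" and l: "1 \<le> l"
    and top: "((\<lambda>x. cos (\<phi> x)) \<longlongrightarrow> h) at_top" and bot: "((\<lambda>x. cos (\<phi> x)) \<longlongrightarrow> h) at_bot"
    and deg: "((\<lambda>x. (\<phi> x - \<phi> (- x)) / (2 * pi)) \<longlongrightarrow> real l - arccos h / pi) at_top"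
  shows "\<exists>p. touches l (\<lambda>x. arccos (cos (\<phi> x))) p"
proof -
  define \<alpha> where "\<alpha> = arccos h"
  have \<alpha>: "cos \<alpha> = h" "0 \<le> \<alpha>" "\<alpha> < pi / 2"
    using h arccos_less_arccos[of 0 h] by (auto simp: \<alpha>_def arccos_lbound cos_arccos)
  define L where "L = 2 * pi * real l - 2 * \<alpha>"
  have "((\<lambda>x. (2 * pi) * ((\<phi> x - \<phi> (- x)) / (2 * pi))) \<longlongrightarrow> (2 * pi) * (real l - arccos h / pi)) at_top"
    by (intro tendsto_mult tendsto_const deg)
  moreover have "(2 * pi) * (y / (2 * pi)) = y" for y by simp
  moreover have "(2 * pi) * (real l - arccos h / pi) = L" by (simp add: L_def \<alpha>_def right_diff_distrib)
  ultimately have \<Delta>: "((\<lambda>x. \<phi> x - \<phi> (- x)) \<longlongrightarrow> L) at_top" by (simp only:)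
  have cb: "((\<lambda>x. cos (\<phi> (- x))) \<longlongrightarrow> h) at_top"
    using bot by (simp add: filterlim_at_bot_mirror)
  \<comment> \<open>The total phase change tends to \<open>L\<close>, and \<open>L\<close> equals
    \<open>- 2 * \<alpha>\<close> modulo \<open>2 * pi\<close>.\<close>
  have "((\<lambda>x. cos (\<phi> x) - cos (\<phi> (- x) - 2 * \<alpha>)) \<longlongrightarrow> 0) at_top"
  proof (rule Lim_null_comparison)
    have e: "cos (\<phi> (- x) - 2 * \<alpha>) = cos (\<phi> (- x) + L)" for x
    proof -
      have "cos (\<phi> (- x) + L) = cos ((\<phi> (- x) - 2 * \<alpha>) + 2 * pi * real l)" by (simp add: L_def algebra_simps)
      also have "\<dots> = cos (\<phi> (- x) - 2 * \<alpha>)"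
        using cos_2npi[of l] sin_2npi[of l] by (simp only: cos_add mult_ac)
      finally show ?thesis by simp
    qed
    have "\<bar>cos (\<phi> x) - cos (\<phi> (- x) - 2 * \<alpha>)\<bar> \<le> \<bar>(\<phi> x - \<phi> (- x)) - L\<bar>" for x
      unfolding e using abs_cos_diff_le[of "\<phi> x" "\<phi> (- x) + L"] by (simp only: diff_diff_eq)
    then show "\<forall>\<^sub>F x in at_top. norm (cos (\<phi> x) - cos (\<phi> (- x) - 2 * \<alpha>)) \<le> \<bar>(\<phi> x - \<phi> (- x)) - L\<bar>"
      by simp
    show "((\<lambda>x. \<bar>(\<phi> x - \<phi> (- x)) - L\<bar>) \<longlongrightarrow> 0) at_top"
      using \<Delta> by (intro tendsto_rabs_zero LIM_zero)
  qed
  from tendsto_diff[OF tendsto_add[OF top cb] this]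
  have "((\<lambda>x. cos (\<phi> (- x)) + cos (\<phi> (- x) - 2 * \<alpha>)) \<longlongrightarrow> 2 * h) at_top" by simp
  \<comment> \<open>The sum of cosines turns the two limits into one:
    \<open>2 * h * cos (\<phi> (- x) - \<alpha>)\<close> tends to \<open>2 * h\<close>. As
    \<open>h > 0\<close>, the phase at the left end is near \<open>\<alpha>\<close> modulo
    \<open>2 * pi\<close>, and \<open>- \<alpha>\<close> is excluded unless it is the same
    point.\<close>
  moreover have "cos (\<phi> (- x)) + cos (\<phi> (- x) - 2 * \<alpha>) = 2 * h * cos (\<phi> (- x) - \<alpha>)" for x
  proof -
    have e: "\<phi> (- x) = (\<phi> (- x) - \<alpha>) + \<alpha>" "\<phi> (- x) - 2 * \<alpha> = (\<phi> (- x) - \<alpha>) - \<alpha>" by simp_all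
    have "cos (\<phi> (- x)) + cos (\<phi> (- x) - 2 * \<alpha>) = cos ((\<phi> (- x) - \<alpha>) + \<alpha>) + cos ((\<phi> (- x) - \<alpha>) - \<alpha>)"
      by simp
    also have "\<dots> = 2 * cos \<alpha> * cos (\<phi> (- x) - \<alpha>)"
      unfolding cos_add cos_diff[of "\<phi> (- x) - \<alpha>" \<alpha>] by simp
    finally show ?thesis by (simp add: \<alpha>)
  qed
  ultimately have "((\<lambda>x. 2 * h * cos (\<phi> (- x) - \<alpha>)) \<longlongrightarrow> 2 * h) at_top" by simp
  then have "((\<lambda>x. (2 * h * cos (\<phi> (- x) - \<alpha>)) / (2 * h)) \<longlongrightarrow> (2 * h) / (2 * h)) at_top"
    using h by (intro tendsto_divide tendsto_const) auto
  then have "((\<lambda>x. cos (\<phi> (- x) - \<alpha>)) \<longlongrightarrow> 1) at_top" using h by simp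
  then have "\<forall>\<^sub>F x in at_top. cos (pi / 4) < cos (\<phi> (- x) - \<alpha>)"
    by (rule order_tendstoD) (simp add: cos_45 real_less_rsqrt sqrt2_less_2)
  moreover have "\<forall>\<^sub>F x in at_top. dist (\<phi> x - \<phi> (- x)) L < pi / 4"
    using \<Delta> by (rule tendstoD) simp
  ultimately have "\<forall>\<^sub>F x in at_top. cos (pi / 4) < cos (\<phi> (- x) - \<alpha>) \<and> dist (\<phi> x - \<phi> (- x)) L < pi / 4 \<and> (0::real) \<le> x"
    by (intro eventually_conj eventually_ge_at_top)
  then obtain x where x: "cos (pi / 4) < cos (\<phi> (- x) - \<alpha>)" "dist (\<phi> x - \<phi> (- x)) L < pi / 4" "0 \<le> x"
    using eventually_happens'[OF trivial_limit_at_top_linorder] by blast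
  obtain k :: int where k: "arccos (cos (\<phi> (- x) - \<alpha>)) = \<bar>\<phi> (- x) - \<alpha> - 2 * pi * of_int k\<bar>"
    by (rule arccos_cos_eq_abs)
  have "arccos (cos (\<phi> (- x) - \<alpha>)) < arccos (cos (pi / 4))"
    using x(1) by (intro arccos_less_arccos) auto
  also have "\<dots> = pi / 4" by (intro arccos_cos) auto
  finally have near: "\<bar>\<phi> (- x) - \<alpha> - 2 * pi * of_int k\<bar> < pi / 4" using k by simp
  \<comment> \<open>The consecutive multiples of \<open>pi\<close> from
    \<open>(2 * k + 1) * pi\<close> on. The two tolerances \<open>pi / 4\<close> fit because
    \<open>\<alpha> < pi / 2\<close>: the phase starts below
    \<open>2 * pi * k + \<alpha> + pi / 4\<close>, hence below the first level, and ends above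
    \<open>2 * pi * (k + l) - \<alpha> - pi / 2\<close>, hence above the last level
    \<open>2 * pi * (k + l) - pi\<close>.\<close>
  define lev where "lev i = 2 * pi * of_int k + pi * (real i + 1)" for i :: nat
  have "lev 0 = 2 * pi * of_int k + pi" by (simp add: lev_def)
  then have "\<phi> (- x) < lev 0" using near \<alpha>(2,3) unfolding abs_less_iff by linarith
  moreover have "lev i \<le> \<phi> x" if "i < 2 * l - 1" for i
  proof -
    have "lev i \<le> 2 * pi * of_int k + pi * (2 * real l - 1)"
      using that unfolding lev_def by (intro add_left_mono mult_left_mono) auto
    also have "\<dots> = 2 * pi * of_int k + 2 * pi * real l - pi" by (simp add: algebra_simps)
    also have "\<dots> \<le> \<phi> x"
      using near x(2) \<alpha> unfolding dist_real_def L_def abs_less_iff by linarith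
    finally show ?thesis .
  qed
  moreover have "lev i < lev (Suc i)" for i by (simp add: lev_def)
  ultimately obtain p where p: "\<forall>i<2 * l - 1. \<phi> (p i) = lev i" "\<forall>i. Suc i < 2 * l - 1 \<longrightarrow> p i < p (Suc i)"
    using ivt_sequence[OF \<phi>, of "- x" x lev "2 * l - 1"] x(3) by auto
  have "arccos (cos (lev i)) = (if even i then pi else 0)" for i
  proof -
    have "cos (lev i) = cos (pi * real (Suc i))"
      using cos_int_2pin[of k] sin_int_2pin[of k] by (simp add: lev_def cos_add add.commute)
    also have "\<dots> = (-1) ^ Suc i" by (subst mult.commute) (rule cos_npi)
    finally show ?thesis by (cases "even i") auto
  qed
  then have "touches l (\<lambda>x. arccos (cos (\<phi> x))) p" using p by (simp add: touches_def)
  then show ?thesis by blast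
qed

lemma half_mult_less_top: "ennreal (1/2) * X < \<infinity> \<longleftrightarrow> X < \<infinity>"
proof -
  have gen: "c * X < top \<longleftrightarrow> X < top" if "c \<noteq> 0" "c < top" for c :: ennreal
    using that by (auto simp: ennreal_mult_less_top)
  have "ennreal (1/2) \<noteq> 0" by (simp only: ennreal_eq_0_iff)
  with gen[OF this ennreal_less_top] show ?thesis by (simp only: infinity_ennreal_def)
qed

lemma profile_of_admissible:
  assumes h: "0 < h" "h \<le> 1" and l: "1 \<le> l" and m: "m \<in> admissible h (real l - arccos h / pi)"
  shows "\<exists>\<theta> W p. profile l \<theta> W p \<and> energy h m = ennreal (1/2) * energy2 h \<theta> W UNIV"
proof -
  have m1: "m \<in> H1loc_circle" and fin: "energy h m < \<infinity>" and deg: "has_degree m (real l - arccos h / pi)"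
    using m by (auto simp: admissible_def)
  define \<theta> where "\<theta> x = arccos (fst (m x))" for x
  define W where "W x = ennreal ((norm (weak_deriv m x))\<^sup>2)" for x
  have unit: "norm (m x) = 1" for x using m1 by (simp add: H1loc_circle_def)
  have "\<bar>fst (m x)\<bar> \<le> 1" for x
    using norm_fst_le[of "fst (m x)" "snd (m x)"] unit[of x] by simp
  then have cos\<theta>: "cos (\<theta> x) = fst (m x)" and \<theta>b: "0 \<le> \<theta> x" "\<theta> x \<le> pi" for x
    using arccos_lbound[of "fst (m x)"] arccos_ubound[of "fst (m x)"]
    by (auto simp: \<theta>_def cos_arccos_abs abs_le_iff minus_le_iff)
  have L2: "L2_norm_sq (weak_deriv m) < \<infinity>"
  proof -
    have "L2_norm_sq (weak_deriv m) + H_half_seminorm_sq (\<lambda>x. fst (m x) - h) + L2_norm_sq (\<lambda>x. fst (m x) - h) < \<infinity>"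
      using fin unfolding energy_def half_mult_less_top .
    then show ?thesis by (rule order_le_less_trans[rotated]) (simp add: add.assoc)
  qed
  have Wint: "(\<integral>\<^sup>+x. W x \<partial>lborel) = L2_norm_sq (weak_deriv m)" by (simp add: W_def L2_norm_sq_def)
  have gbm: "grad_bound m W" unfolding W_def by (rule grad_bound_weak_deriv[OF m1 L2])
  have gb: "grad_bound \<theta> W"
    unfolding \<theta>_def[abs_def] using gbm L2 by (intro grad_bound_arccos_fst unit) (simp_all add: Wint)
  have cont: "continuous_on UNIV \<theta>" by (rule grad_bound_continuous[OF gb]) (use L2 in \<open>simp add: Wint\<close>)
  have en: "energy h m = ennreal (1/2) * energy2 h \<theta> W UNIV"
    using energy_eq[of m \<theta> h] cos\<theta> cont by (simp add: energy2_def Wint)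
  then have "energy2 h \<theta> W UNIV < \<infinity>" using fin by (simp only: half_mult_less_top)
  note lim = energy2_finite_cos_tendsto[OF gb this]
  obtain \<phi> where \<phi>: "continuous_on UNIV \<phi>" "\<And>x. m x = (cos (\<phi> x), sin (\<phi> x))"
    "((\<lambda>x. (\<phi> x - \<phi> (- x)) / (2 * pi)) \<longlongrightarrow> real l - arccos h / pi) at_top"
    using deg by (auto simp: has_degree_def is_lifting_def)
  have "cos (\<theta> x) = cos (\<phi> x)" for x by (simp add: cos\<theta> \<phi>)
  with lim have "((\<lambda>x. cos (\<phi> x)) \<longlongrightarrow> h) at_top" "((\<lambda>x. cos (\<phi> x)) \<longlongrightarrow> h) at_bot" by auto
  from touches_of_degree[OF \<phi>(1) h l this \<phi>(3)] obtain p where "touches l (\<lambda>x. arccos (cos (\<phi> x))) p" by blast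
  moreover have "\<theta> = (\<lambda>x. arccos (cos (\<phi> x)))" by (simp add: \<theta>_def \<phi> fun_eq_iff)
  ultimately have "touches l \<theta> p" by (simp only:)
  with cont \<theta>b gb en show ?thesis unfolding profile_def by blast
qed

text \<open>Unfolding \<open>\<theta>\<close> at the points \<open>p 0 < p 1 < \<dots>\<close>: after \<open>k\<close> of them the phase is \<open>k \<pi> + \<theta>\<close> or
  \<open>(k + 1) \<pi> - \<theta>\<close> according to the parity of \<open>k\<close>.\<close>

fun unfold_phase :: "(real \<Rightarrow> real) \<Rightarrow> (nat \<Rightarrow> real) \<Rightarrow> nat \<Rightarrow> real \<Rightarrow> real" where
  "unfold_phase \<theta> p 0 x = \<theta> x"
| "unfold_phase \<theta> p (Suc k) x = (if x \<le> p k then unfold_phase \<theta> p k x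
     else if even (Suc k) then real (Suc k) * pi + \<theta> x else (real (Suc k) + 1) * pi - \<theta> x)"

lemma cos_unfold_phase: "cos (unfold_phase \<theta> p k x) = cos (\<theta> x)"
proof (induction k)
  case (Suc k)
  have e: "cos (real (Suc k) * pi + \<theta> x) = cos (\<theta> x)" if "even (Suc k)"
    using that by (simp only: cos_add cos_npi sin_npi) simp
  have o: "cos ((real (Suc k) + 1) * pi - \<theta> x) = cos (\<theta> x)" if "odd (Suc k)"
  proof -
    have "(real (Suc k) + 1) * pi - \<theta> x = real (Suc (Suc k)) * pi - \<theta> x" by simp
    then show ?thesis using that by (simp only: cos_diff cos_npi sin_npi) simp
  qed
  show ?case using Suc e o by auto
qed simp

lemma unfold_phase_right:
  assumes "k = 0 \<or> p (k - 1) < x"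
  shows "unfold_phase \<theta> p k x = (if even k then real k * pi + \<theta> x else (real k + 1) * pi - \<theta> x)"
  using assms by (cases k) auto

lemma unfold_phase_left:
  assumes "\<And>i. i < k \<Longrightarrow> x \<le> p i"
  shows "unfold_phase \<theta> p k x = \<theta> x"
  using assms by (induction k) auto

text \<open>At \<open>p k\<close> the old and the new branch agree, since
  \<open>\<theta> (p k)\<close> is \<open>pi\<close> for even and 0 for odd \<open>k\<close>. Each
  branch is a constant plus or minus \<open>\<theta>\<close>, so the pieces glue with the same
  \<open>W\<close>.\<close>

lemma grad_bound_unfold_phase:
  assumes gb: "grad_bound \<theta> W" and t: "touches l \<theta> p" and "k \<le> 2 * l - 1"
  shows "grad_bound (unfold_phase \<theta> p k) W"
  using assms(3)
proof (induction k)
  case 0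
  then show ?case using gb by (simp add: grad_bound_on_def)
next
  case (Suc k)
  define \<psi> where "\<psi> x = (if even (Suc k) then real (Suc k) * pi + \<theta> x else (real (Suc k) + 1) * pi - \<theta> x)" for x
  have \<theta>p: "\<theta> (p k) = (if even k then pi else 0)" using t Suc.prems by (simp add: touches_def)
  have prev: "k = 0 \<or> p (k - 1) < p k"
    using t Suc.prems by (cases k) (auto simp: touches_def)
  have at_p: "unfold_phase \<theta> p k (p k) = \<psi> (p k)"
    unfolding unfold_phase_right[of k p "p k", OF prev] \<psi>_def using \<theta>p by (auto simp: algebra_simps)
  show ?case
  proof (rule grad_bound_on_glue[where c = "p k"])
    have "grad_bound_on (UNIV \<inter> {..p k}) (unfold_phase \<theta> p k) W"
      by (rule grad_bound_on_subset[OF Suc.IH[OF Suc_leD[OF Suc.prems]]]) simp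
    then show "grad_bound_on (UNIV \<inter> {..p k}) (unfold_phase \<theta> p (Suc k)) W"
      by (rule grad_bound_on_lipschitz) auto
    have "grad_bound_on (UNIV \<inter> {p k..}) \<theta> W"
      by (rule grad_bound_on_subset[OF gb]) simp
    then show "grad_bound_on (UNIV \<inter> {p k..}) (unfold_phase \<theta> p (Suc k)) W"
    proof (rule grad_bound_on_lipschitz)
      have eq: "unfold_phase \<theta> p (Suc k) x = \<psi> x" if "p k \<le> x" for x
        using that at_p by (cases "x = p k") (auto simp: \<psi>_def)
      fix s t assume "s \<in> UNIV \<inter> {p k..}" "t \<in> UNIV \<inter> {p k..}"
      then show "norm (unfold_phase \<theta> p (Suc k) t - unfold_phase \<theta> p (Suc k) s) \<le> norm (\<theta> t - \<theta> s)"
        using eq[of s] eq[of t] by (simp add: \<psi>_def abs_minus_commute)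
    qed
  qed simp
qed

lemma admissible_of_profile:
  assumes h: "0 \<le> h" "h \<le> 1" and l: "1 \<le> l" and pr: "profile l \<theta> W p" and fin: "energy2 h \<theta> W UNIV < \<infinity>"
  shows "\<exists>m \<in> admissible h (real l - arccos h / pi). energy h m \<le> ennreal (1/2) * energy2 h \<theta> W UNIV"
proof -
  have cont: "continuous_on UNIV \<theta>" and \<theta>b: "\<And>x. 0 \<le> \<theta> x" "\<And>x. \<theta> x \<le> pi"
    and gb: "grad_bound \<theta> W" and t: "touches l \<theta> p"
    using pr by (auto simp: profile_def)
  \<comment> \<open>An odd number of reflections: on the far right the phase is
    \<open>2 * pi * l - \<theta>\<close>, on the far left it is \<open>\<theta>\<close>. Both ends
    thus contribute \<open>- arccos h\<close> to the total change of phase, which gives degree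
    \<open>l - arccos h / pi\<close>.\<close>
  define N where "N = 2 * l - 1"
  define \<phi> where "\<phi> = unfold_phase \<theta> p N"
  define m where "m x = (cos (\<phi> x), sin (\<phi> x))" for x
  have Wf: "(\<integral>\<^sup>+x. W x \<partial>lborel) < \<infinity>" using fin by (auto simp: energy2_def)
  have gb\<phi>: "grad_bound \<phi> W" unfolding \<phi>_def N_def by (rule grad_bound_unfold_phase[OF gb t]) simp
  have cont\<phi>: "continuous_on UNIV \<phi>" by (rule grad_bound_continuous[OF gb\<phi> Wf])
  have m1: "m \<in> H1loc_circle" and mL: "L2_norm_sq (weak_deriv m) \<le> (\<integral>\<^sup>+x. W x \<partial>lborel)"
    using circle_of_phase[OF gb\<phi> Wf] unfolding m_def[abs_def] by auto
  have fst_m: "fst (m x) = cos (\<theta> x)" for x by (simp add: m_def \<phi>_def cos_unfold_phase)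
  have en: "energy h m \<le> ennreal (1/2) * energy2 h \<theta> W UNIV"
    unfolding energy_eq[OF fst_m cont] energy2_def
    using mL by (intro mult_left_mono add_mono) auto
  have lim: "((\<lambda>x. cos (\<theta> x)) \<longlongrightarrow> h) at_top" "((\<lambda>x. cos (\<theta> x)) \<longlongrightarrow> h) at_bot"
    by (rule energy2_finite_cos_tendsto[OF gb fin])+
  have arc: "((\<lambda>x. \<theta> x) \<longlongrightarrow> arccos h) F" if "((\<lambda>x. cos (\<theta> x)) \<longlongrightarrow> h) F" for F
  proof -
    have "((\<lambda>x. arccos (cos (\<theta> x))) \<longlongrightarrow> arccos h) F"
      by (rule continuous_on_tendsto_compose[OF continuous_on_arccos' that]) (use h in auto)
    then show ?thesis using \<theta>b by (simp add: arccos_cos)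
  qed
  have "\<forall>\<^sub>F x in at_top. p (N - 1) < x" by (rule eventually_gt_at_top)
  then have "\<forall>\<^sub>F x in at_top. 2 * pi * real l - \<theta> x = \<phi> x"
  proof eventually_elim
    case (elim x)
    have "odd N" "real N + 1 = 2 * real l" using l by (auto simp: N_def)
    then show ?case using unfold_phase_right[of N p x \<theta>] elim by (simp add: \<phi>_def)
  qed
  moreover have "((\<lambda>x. 2 * pi * real l - \<theta> x) \<longlongrightarrow> 2 * pi * real l - arccos h) at_top"
    by (intro tendsto_diff tendsto_const arc lim)
  ultimately have l1: "(\<phi> \<longlongrightarrow> 2 * pi * real l - arccos h) at_top"
    by (rule Lim_transform_eventually[rotated])
  define q where "q = Min (p ` {..<N})"
  have "\<forall>\<^sub>F x in at_bot. x \<le> q" by (rule eventually_le_at_bot)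
  then have "\<forall>\<^sub>F x in at_bot. \<theta> x = \<phi> x"
  proof eventually_elim
    case (elim x)
    have "x \<le> p i" if "i < N" for i
    proof -
      have "q \<le> p i" unfolding q_def using that by (intro Min_le) auto
      then show ?thesis using elim by simp
    qed
    then show ?case using unfold_phase_left[of N x p \<theta>] by (simp add: \<phi>_def)
  qed
  then have "(\<phi> \<longlongrightarrow> arccos h) at_bot"
    using arc[OF lim(2)] by (rule Lim_transform_eventually[rotated])
  then have l2: "((\<lambda>x. \<phi> (- x)) \<longlongrightarrow> arccos h) at_top" by (simp add: filterlim_at_bot_mirror)
  have "((\<lambda>x. (\<phi> x - \<phi> (- x)) / (2 * pi)) \<longlongrightarrow> ((2 * pi * real l - arccos h) - arccos h) / (2 * pi)) at_top"
    by (intro tendsto_divide tendsto_diff tendsto_const l1 l2) simp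
  moreover have "((2 * pi * real l - arccos h) - arccos h) / (2 * pi) = real l - arccos h / pi"
    by (simp add: field_simps)
  ultimately have "has_degree m (real l - arccos h / pi)"
    unfolding has_degree_def is_lifting_def using cont\<phi> m_def by (intro exI[of _ \<phi>]) auto
  moreover have "energy h m < \<infinity>"
    using fin by (intro order_le_less_trans[OF en]) (simp only: half_mult_less_top)
  ultimately show ?thesis using m1 en unfolding admissible_def by blast
qed

lemma attains_infimum_of_profile:
  assumes h: "0 < h" "h \<le> 1" and l: "1 \<le> l" and pr: "profile l \<theta> W p" and fin: "energy2 h \<theta> W UNIV < \<infinity>"
    and min: "\<And>\<theta>' W' p'. profile l \<theta>' W' p' \<Longrightarrow> energy2 h \<theta> W UNIV \<le> energy2 h \<theta>' W' UNIV"
  shows "attains_infimum h (real l - arccos h / pi)"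
proof -
  let ?A = "admissible h (real l - arccos h / pi)"
  obtain m where m: "m \<in> ?A" "energy h m \<le> ennreal (1/2) * energy2 h \<theta> W UNIV"
    using admissible_of_profile[OF less_imp_le[OF h(1)] h(2) l pr fin] by blast
  have "energy h m \<le> energy h u" if u: "u \<in> ?A" for u
  proof -
    obtain \<theta>' W' p' where pr': "profile l \<theta>' W' p'" and "energy h u = ennreal (1/2) * energy2 h \<theta>' W' UNIV"
      using profile_of_admissible[OF h l u] by blast
    then show ?thesis using order_trans[OF m(2) mult_left_mono[OF min[OF pr']]] by simp
  qed
  then have "energy h m = (INF u \<in> ?A. energy h u)"
    using m(1) by (intro antisym INF_greatest INF_lower) auto
  then show ?thesis unfolding attains_infimum_def using m(1) by blast
qed

section \<open>Compactness of profiles\<close>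

lemma liminf_add_le_ennreal:
  fixes f g :: "nat \<Rightarrow> ennreal"
  shows "liminf f + liminf g \<le> liminf (\<lambda>n. f n + g n)"
proof -
  have inc: "incseq (\<lambda>n. INF m\<in>{n..}. u m)" for u :: "nat \<Rightarrow> ennreal"
    by (auto simp: incseq_def intro!: INF_superset_mono)
  have "liminf f + liminf g = (SUP n. (INF m\<in>{n..}. f m) + (INF m\<in>{n..}. g m))"
    unfolding liminf_SUP_INF by (rule ennreal_SUP_add[OF inc inc, symmetric])
  also have "\<dots> \<le> (SUP n. INF m\<in>{n..}. f m + g m)"
    by (intro SUP_mono' INF_greatest add_mono INF_lower)
  finally show ?thesis unfolding liminf_SUP_INF .
qed

lemma energy2_mono:
  assumes "S \<subseteq> T"
  shows "energy2 h \<theta> W S \<le> energy2 h \<theta> W T"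
  unfolding energy2_def using assms
  by (intro add_mono nn_integral_mono) (auto simp: indicator_def)

lemma energy2_superadditive:
  assumes "S \<inter> T = {}" "S \<union> T \<subseteq> U" and [measurable]: "S \<in> sets borel" "T \<in> sets borel"
    and [measurable]: "\<theta> \<in> borel_measurable borel" "W \<in> borel_measurable borel"
  shows "energy2 h \<theta> W S + energy2 h \<theta> W T \<le> energy2 h \<theta> W U"
proof -
  have k [measurable]: "pair_kernel (\<lambda>x. cos (\<theta> x)) \<in> borel_measurable borel" by measurable
  have SS [measurable]: "S \<times> S \<in> sets borel" "T \<times> T \<in> sets borel"
    unfolding borel_prod[symmetric] by (auto intro!: pair_measureI)
  have gen: "(\<integral>\<^sup>+x\<in>A. f x \<partial>lborel) + (\<integral>\<^sup>+x\<in>B. f x \<partial>lborel) \<le> (\<integral>\<^sup>+x\<in>C. f x \<partial>lborel)"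
    if "A \<inter> B = {}" "A \<union> B \<subseteq> C" "A \<in> sets borel" "B \<in> sets borel" "f \<in> borel_measurable borel"
    for A B C and f :: "'b::euclidean_space \<Rightarrow> ennreal"
    using that by (subst nn_integral_add[symmetric]) (auto intro!: nn_integral_mono simp: indicator_def)
  have "(\<integral>\<^sup>+x\<in>S. W x \<partial>lborel) + (\<integral>\<^sup>+x\<in>T. W x \<partial>lborel) \<le> (\<integral>\<^sup>+x\<in>U. W x \<partial>lborel)"
    using assms by (intro gen) auto
  moreover have "(\<integral>\<^sup>+z\<in>S \<times> S. ennreal (pair_kernel (\<lambda>x. cos (\<theta> x)) z) \<partial>lborel)
      + (\<integral>\<^sup>+z\<in>T \<times> T. ennreal (pair_kernel (\<lambda>x. cos (\<theta> x)) z) \<partial>lborel)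
      \<le> (\<integral>\<^sup>+z\<in>U \<times> U. ennreal (pair_kernel (\<lambda>x. cos (\<theta> x)) z) \<partial>lborel)"
    using assms(1,2) SS by (intro gen) auto
  moreover have "(\<integral>\<^sup>+x\<in>S. ennreal ((cos (\<theta> x) - h)\<^sup>2) \<partial>lborel) + (\<integral>\<^sup>+x\<in>T. ennreal ((cos (\<theta> x) - h)\<^sup>2) \<partial>lborel)
      \<le> (\<integral>\<^sup>+x\<in>U. ennreal ((cos (\<theta> x) - h)\<^sup>2) \<partial>lborel)"
    using assms by (intro gen) auto
  moreover have "(a + b + c) + (a' + b' + c') \<le> A + B + C"
    if "a + a' \<le> A" "b + b' \<le> B" "c + c' \<le> C" for a b c a' b' c' A B C :: ennreal
    using add_mono[OF add_mono[OF that(1,2)] that(3)] by (simp add: ac_simps)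
  ultimately show ?thesis
    unfolding energy2_def by blast
qed

lemma nn_integral_shift:
  fixes f :: "'a::euclidean_space \<Rightarrow> ennreal"
  assumes [measurable]: "f \<in> borel_measurable borel"
  shows "(\<integral>\<^sup>+x. f (c + x) \<partial>lborel) = (\<integral>\<^sup>+x. f x \<partial>lborel)"
proof -
  have "(\<integral>\<^sup>+x. f x \<partial>lborel) = (\<integral>\<^sup>+x. f x \<partial>distr lborel borel ((+) c))"
    by (simp add: lborel_distr_plus)
  also have "\<dots> = (\<integral>\<^sup>+x. f (c + x) \<partial>lborel)"
    by (subst nn_integral_distr) auto
  finally show ?thesis ..
qed

lemma energy2_shift:
  assumes [measurable]: "\<theta> \<in> borel_measurable borel" "W \<in> borel_measurable borel" and S [measurable]: "S \<in> sets borel"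
  shows "energy2 h (\<lambda>x. \<theta> (c + x)) (\<lambda>x. W (c + x)) {x. c + x \<in> S} = energy2 h \<theta> W S"
proof -
  have SS [measurable]: "S \<times> S \<in> sets borel"
    unfolding borel_prod[symmetric] by (auto intro!: pair_measureI)
  have ind: "indicator {x. c + x \<in> S} x = (indicator S (c + x) :: ennreal)" for x
    by (simp add: indicator_def)
  have 1: "(\<integral>\<^sup>+x\<in>{x. c + x \<in> S}. W (c + x) \<partial>lborel) = (\<integral>\<^sup>+x\<in>S. W x \<partial>lborel)"
    unfolding ind by (rule nn_integral_shift[of "\<lambda>x. W x * indicator S x"]) measurable
  have 2: "(\<integral>\<^sup>+x\<in>{x. c + x \<in> S}. ennreal ((cos (\<theta> (c + x)) - h)\<^sup>2) \<partial>lborel) = (\<integral>\<^sup>+x\<in>S. ennreal ((cos (\<theta> x) - h)\<^sup>2) \<partial>lborel)"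
    unfolding ind by (rule nn_integral_shift[of "\<lambda>x. ennreal ((cos (\<theta> x) - h)\<^sup>2) * indicator S x"]) measurable
  let ?u = "\<lambda>x. cos (\<theta> x)"
  have e: "ennreal (pair_kernel (\<lambda>x. cos (\<theta> (c + x))) z) * indicator ({x. c + x \<in> S} \<times> {x. c + x \<in> S}) z
      = ennreal (pair_kernel ?u ((c, c) + z)) * indicator (S \<times> S) ((c, c) + z)" for z
    by (auto simp: pair_kernel_def indicator_def plus_prod_def mem_Times_iff)
  have k [measurable]: "pair_kernel ?u \<in> borel_measurable borel" by measurable
  have "(\<lambda>z. ennreal (pair_kernel ?u z) * indicator (S \<times> S) z) \<in> borel_measurable borel" by measurable
  from nn_integral_shift[OF this, of "(c, c)"] have 3: "(\<integral>\<^sup>+z\<in>{x. c + x \<in> S} \<times> {x. c + x \<in> S}. ennreal (pair_kernel (\<lambda>x. cos (\<theta> (c + x))) z) \<partial>lborel)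
     = (\<integral>\<^sup>+z\<in>S \<times> S. ennreal (pair_kernel ?u z) \<partial>lborel)"
    unfolding e .
  show ?thesis unfolding energy2_def 1 2 3 ..
qed

lemma grad_bound_shift:
  assumes gb: "grad_bound F W"
  shows "grad_bound (\<lambda>x. F (c + x)) (\<lambda>x. W (c + x))"
  unfolding grad_bound_on_def
proof (intro conjI ballI impI)
  have [measurable]: "W \<in> borel_measurable borel" using gb by (rule grad_bound_on_measurable)
  show "(\<lambda>x. W (c + x)) \<in> borel_measurable borel" by measurable
  fix s t :: real assume st: "s \<le> t"
  have ind: "indicator {s..t} x = (indicator {c + s..c + t} (c + x) :: ennreal)" for x
    by (simp add: indicator_def)
  have "(\<integral>\<^sup>+x\<in>{s..t}. W (c + x) \<partial>lborel) = (\<integral>\<^sup>+x\<in>{c + s..c + t}. W x \<partial>lborel)"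
    unfolding ind by (rule nn_integral_shift[of "\<lambda>x. W x * indicator {c + s..c + t} x"]) measurable
  then show "ennreal ((norm (F (c + t) - F (c + s)))\<^sup>2) \<le> ennreal (t - s) * (\<integral>\<^sup>+x\<in>{s..t}. W (c + x) \<partial>lborel)"
    using grad_bound_onD[OF gb, of "c + s" "c + t"] st by simp
qed

lemma profile_measurable:
  assumes "profile l \<theta> W p"
  shows "\<theta> \<in> borel_measurable borel" "W \<in> borel_measurable borel"
  using assms by (auto simp: profile_def grad_bound_on_def intro: borel_measurable_continuous_onI)

lemma profile_shift:
  assumes "profile l \<theta> W p"
  shows "profile l (\<lambda>x. \<theta> (c + x)) (\<lambda>x. W (c + x)) (\<lambda>i. p i - c)"
  using assms unfolding profile_def touches_def
  by (auto intro!: grad_bound_shift continuous_intros elim: continuous_on_compose2)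

lemma touches_mono:
  assumes t: "touches l \<theta> p" and "i \<le> j" "j < 2 * l - 1"
  shows "p i \<le> p j"
  using assms(2,3)
proof (induction j)
  case (Suc j)
  show ?case
  proof (cases "i = Suc j")
    case False
    then have "p i \<le> p j" using Suc by auto
    also have "p j < p (Suc j)" using t Suc.prems by (simp add: touches_def)
    finally show ?thesis by simp
  qed simp
qed simp

text \<open>Fatou for integrands restricted to windows that exhaust the space; \<open>i\<close>
  stands for the indicator functions of the windows.\<close>

lemma nn_integral_liminf_localized:
  fixes v :: "nat \<Rightarrow> 'b::euclidean_space \<Rightarrow> real" and i :: "nat \<Rightarrow> 'b \<Rightarrow> ennreal"
  assumes [measurable]: "\<And>n. v n \<in> borel_measurable borel" "\<And>n. i n \<in> borel_measurable borel"
    and v: "\<And>x. (\<lambda>n. v n x) \<longlonglongrightarrow> w x" and i: "\<And>x. (\<lambda>n. i n x) \<longlonglongrightarrow> 1"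
  shows "(\<integral>\<^sup>+x. ennreal (w x) \<partial>lborel) \<le> liminf (\<lambda>n. \<integral>\<^sup>+x. ennreal (v n x) * i n x \<partial>lborel)"
proof -
  have "(\<lambda>n. ennreal (v n x) * i n x) \<longlonglongrightarrow> ennreal (w x) * 1" for x
    by (intro tendsto_mult_ennreal tendsto_ennrealI v i) auto
  then have "liminf (\<lambda>n. ennreal (v n x) * i n x) = ennreal (w x) * 1" for x
    by (intro lim_imp_Liminf sequentially_bot)
  then have "(\<integral>\<^sup>+x. ennreal (w x) \<partial>lborel) = (\<integral>\<^sup>+x. liminf (\<lambda>n. ennreal (v n x) * i n x) \<partial>lborel)" by simp
  also have "\<dots> \<le> liminf (\<lambda>n. \<integral>\<^sup>+x. ennreal (v n x) * i n x \<partial>lborel)"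
    by (rule nn_integral_liminf) auto
  finally show ?thesis .
qed

text \<open>Energies are controlled on growing windows only, so the profiles are equi-Hoelder inside
  these windows and converge pointwise along a subsequence. The gradient term of the limit is
  bounded through \<open>riesz_derivative\<close> applied to lower limits of integrals, the two
  other terms by Fatou.\<close>

lemma profile_compactness_aux:
  fixes h R :: "nat \<Rightarrow> real"
  assumes pr: "\<And>n. profile l (\<theta> n) (W n) (p n)" and h: "h \<longlonglongrightarrow> h'" and R: "filterlim R at_top sequentially"
    and pts: "\<And>n i. i < 2 * l - 1 \<Longrightarrow> 0 \<le> p n i \<and> p n i \<le> L"
    and en: "\<And>n. energy2 (h n) (\<theta> n) (W n) {- R n..R n} \<le> ennreal (e n)"
    and e: "e \<longlonglongrightarrow> c" "\<And>n. e n \<le> E" and E: "0 \<le> E"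
  shows "\<exists>\<theta>' W' p'. profile l \<theta>' W' p' \<and> energy2 h' \<theta>' W' UNIV \<le> ennreal c"
proof -
  \<comment> \<open>Touching points (\<open>Inl\<close>) and values at rational points
    (\<open>Inr\<close>) share one countable index set, so a single diagonal extraction handles
    both. Indices beyond the last touching point get 0, which keeps every sequence bounded.\<close>
  define f where "f n z = (case z of Inl i \<Rightarrow> if i < 2 * l - 1 then p n i else 0 | Inr x \<Rightarrow> \<theta> n x)" for n and z :: "nat + real"
  have bnd: "0 \<le> \<theta> n x" "\<theta> n x \<le> pi" for n x using pr[of n] by (auto simp: profile_def)
  obtain r where r: "strict_mono r" and conv: "\<And>z. z \<in> Inl ` UNIV \<union> Inr ` \<rat> \<Longrightarrow> \<exists>c. (\<lambda>n. f (r n) z) \<longlonglongrightarrow> c"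
  proof (rule function_convergent_subsequence[of "Inl ` UNIV \<union> Inr ` \<rat>" f "pi + \<bar>L\<bar>"])
    show "countable (Inl ` UNIV \<union> Inr ` \<rat> :: (nat + real) set)"
      by (intro countable_Un countable_image countable_rat) auto
    show "norm (f n z) \<le> pi + \<bar>L\<bar>" for n z
    proof (cases z)
      case (Inl i)
      have "\<bar>p n i\<bar> \<le> pi + \<bar>L\<bar>" if "i < 2 * l - 1" using pts[OF that, of n] pi_gt_zero by linarith
      then show ?thesis using pi_gt_zero by (auto simp: Inl f_def)
    next
      case (Inr x)
      then show ?thesis using bnd[of n x] by (simp add: f_def)
    qed
  qed blast
  define \<Theta> where "\<Theta> n = \<theta> (r n)" for n
  define V where "V n = W (r n)" for n
  define \<rho> where "\<rho> n = R (r n)" for n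
  have \<rho>: "filterlim \<rho> at_top sequentially"
    unfolding \<rho>_def using R filterlim_subseq[OF r] by (rule filterlim_compose)
  have ev_in: "\<forall>\<^sub>F n in sequentially. x \<in> {- \<rho> n..\<rho> n}" for x
  proof -
    have "\<forall>\<^sub>F n in sequentially. \<bar>x\<bar> \<le> \<rho> n" using \<rho> by (simp add: filterlim_at_top)
    then show ?thesis by eventually_elim auto
  qed
  have V_meas [measurable]: "V n \<in> borel_measurable borel" and \<Theta>_meas [measurable]: "\<Theta> n \<in> borel_measurable borel" for n
    using profile_measurable[OF pr] by (auto simp: V_def \<Theta>_def)
  have gb: "grad_bound (\<Theta> n) (V n)" for n using pr[of "r n"] by (simp add: profile_def \<Theta>_def V_def)
  define A where "A n = (\<integral>\<^sup>+x\<in>{- \<rho> n..\<rho> n}. V n x \<partial>lborel)" for n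
  define B where "B n = (\<integral>\<^sup>+z\<in>{- \<rho> n..\<rho> n} \<times> {- \<rho> n..\<rho> n}. ennreal (pair_kernel (\<lambda>x. cos (\<Theta> n x)) z) \<partial>lborel)" for n
  define C where "C n = (\<integral>\<^sup>+x\<in>{- \<rho> n..\<rho> n}. ennreal ((cos (\<Theta> n x) - h (r n))\<^sup>2) \<partial>lborel)" for n
  have ABC: "A n + B n + C n \<le> ennreal (e (r n))" for n
    using en[of "r n"] by (simp add: A_def B_def C_def energy2_def V_def \<Theta>_def \<rho>_def)
  have AE: "A n \<le> ennreal E" for n
    using order_trans[OF ABC[of n] ennreal_leI[OF e(2)]] by (rule order_trans[rotated]) (simp add: add.assoc)
  have hold: "(\<Theta> n t - \<Theta> n s)\<^sup>2 \<le> E * \<bar>t - s\<bar>" if "s \<in> {- \<rho> n..\<rho> n}" "t \<in> {- \<rho> n..\<rho> n}" for n s t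
    using grad_bound_on_holder[OF grad_bound_on_subset[OF gb[of n] subset_UNIV], of "{- \<rho> n..\<rho> n}" E s t] AE[of n] that E
    by (auto simp: A_def)
  have hold': "\<bar>\<Theta> n t - \<Theta> n s\<bar> \<le> sqrt (E * \<bar>t - s\<bar>)" if "s \<in> {- \<rho> n..\<rho> n}" "t \<in> {- \<rho> n..\<rho> n}" for n s t
    using hold[OF that] by (intro real_le_rsqrt) simp
  have "convergent (\<lambda>n. \<Theta> n x)" for x
  proof (rule Cauchy_convergent, rule CauchyI)
    fix \<epsilon> :: real assume "0 < \<epsilon>"
    \<comment> \<open>Within distance \<open>\<delta>\<close> the Hoelder bound allows an
      oscillation of at most \<open>\<epsilon> / 3\<close>; the rational point \<open>y\<close>
      transfers convergence to \<open>x\<close>.\<close>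
    define \<delta> where "\<delta> = \<epsilon>\<^sup>2 / (9 * (E + 1))"
    have "0 < \<delta>" using \<open>0 < \<epsilon>\<close> E by (simp add: \<delta>_def)
    then obtain y where y: "y \<in> \<rat>" "x < y" "y < x + \<delta>" using Rats_dense_in_real[of x "x + \<delta>"] by auto
    have "E * \<bar>x - y\<bar> \<le> (E + 1) * \<delta>" using y E by (intro mult_mono) auto
    also have "\<dots> = (\<epsilon> / 3)\<^sup>2" using E by (simp add: \<delta>_def power_divide field_simps)
    finally have "sqrt (E * \<bar>x - y\<bar>) \<le> sqrt ((\<epsilon> / 3)\<^sup>2)" by (rule real_sqrt_le_mono)
    then have sq: "sqrt (E * \<bar>x - y\<bar>) \<le> \<epsilon> / 3" using \<open>0 < \<epsilon>\<close> by simp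
    have "\<exists>c. (\<lambda>n. f (r n) (Inr y)) \<longlonglongrightarrow> c" using y(1) by (intro conv) auto
    then have "Cauchy (\<lambda>n. \<Theta> n y)" by (auto simp: f_def \<Theta>_def intro: LIMSEQ_imp_Cauchy)
    then obtain N1 where N1: "\<And>m n. N1 \<le> m \<Longrightarrow> N1 \<le> n \<Longrightarrow> norm (\<Theta> m y - \<Theta> n y) < \<epsilon> / 3"
      using \<open>0 < \<epsilon>\<close> CauchyD[of "\<lambda>n. \<Theta> n y" "\<epsilon> / 3"] by auto
    have "\<forall>\<^sub>F n in sequentially. x \<in> {- \<rho> n..\<rho> n} \<and> y \<in> {- \<rho> n..\<rho> n}" by (intro eventually_conj ev_in)
    then obtain N2 where N2: "\<And>n. N2 \<le> n \<Longrightarrow> x \<in> {- \<rho> n..\<rho> n} \<and> y \<in> {- \<rho> n..\<rho> n}"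
      by (auto simp: eventually_sequentially)
    show "\<exists>M. \<forall>m\<ge>M. \<forall>n\<ge>M. norm (\<Theta> m x - \<Theta> n x) < \<epsilon>"
    proof (intro exI[of _ "max N1 N2"] allI impI)
      fix m n assume mn: "max N1 N2 \<le> m" "max N1 N2 \<le> n"
      have "\<bar>\<Theta> m x - \<Theta> m y\<bar> \<le> \<epsilon> / 3" "\<bar>\<Theta> n x - \<Theta> n y\<bar> \<le> \<epsilon> / 3"
        using hold'[of y m x] hold'[of y n x] N2[of m] N2[of n] mn sq by auto
      then show "norm (\<Theta> m x - \<Theta> n x) < \<epsilon>" using N1[of m n] mn unfolding real_norm_def by linarith
    qed
  qed
  then obtain \<theta>' where lim: "\<And>x. (\<lambda>n. \<Theta> n x) \<longlonglongrightarrow> \<theta>' x" unfolding convergent_def by metis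
  have bnd': "0 \<le> \<theta>' x" "\<theta>' x \<le> pi" for x
    using LIMSEQ_le_const[OF lim, of 0 x] LIMSEQ_le_const2[OF lim, of x pi] bnd by (auto simp: \<Theta>_def)
  have "\<exists>c. (\<lambda>n. p (r n) i) \<longlonglongrightarrow> c" if "i < 2 * l - 1" for i
    using conv[of "Inl i"] that by (auto simp: f_def)
  then obtain p' where p': "\<And>i. i < 2 * l - 1 \<Longrightarrow> (\<lambda>n. p (r n) i) \<longlonglongrightarrow> p' i" by metis
  have val: "\<theta>' (p' i) = (if even i then pi else 0)" if i: "i < 2 * l - 1" for i
  proof -
    have ev: "\<forall>\<^sub>F n in sequentially. p' i \<in> {- \<rho> n..\<rho> n} \<and> - \<bar>L\<bar> \<in> {- \<rho> n..\<rho> n} \<and> \<bar>L\<bar> \<in> {- \<rho> n..\<rho> n}"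
      by (intro eventually_conj ev_in)
    have "(\<lambda>n. \<Theta> n (p (r n) i) - \<Theta> n (p' i)) \<longlonglongrightarrow> 0"
    proof (rule Lim_null_comparison)
      show "\<forall>\<^sub>F n in sequentially. norm (\<Theta> n (p (r n) i) - \<Theta> n (p' i)) \<le> sqrt (E * \<bar>p (r n) i - p' i\<bar>)"
        using ev
      proof eventually_elim
        case (elim n)
        then show ?case using pts[OF i, of "r n"] hold'[of "p' i" n "p (r n) i"] by auto
      qed
      have "(\<lambda>n. sqrt (E * \<bar>p (r n) i - p' i\<bar>)) \<longlonglongrightarrow> sqrt (E * \<bar>p' i - p' i\<bar>)"
        by (intro tendsto_intros p' i)
      then show "(\<lambda>n. sqrt (E * \<bar>p (r n) i - p' i\<bar>)) \<longlonglongrightarrow> 0" by simp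
    qed
    from tendsto_add[OF this lim[of "p' i"]] have "(\<lambda>n. \<Theta> n (p (r n) i)) \<longlonglongrightarrow> \<theta>' (p' i)" by simp
    moreover have "\<Theta> n (p (r n) i) = (if even i then pi else 0)" for n
      using pr[of "r n"] i by (simp add: profile_def touches_def \<Theta>_def)
    ultimately show ?thesis by (simp add: LIMSEQ_const_iff)
  qed
  have t': "touches l \<theta>' p'"
    unfolding touches_def
  proof (intro conjI allI impI val)
    fix i assume i: "Suc i < 2 * l - 1"
    have "p (r n) i \<le> p (r n) (Suc i)" for n
      using pr[of "r n"] i by (auto simp: profile_def touches_def less_imp_le)
    then have "p' i \<le> p' (Suc i)" using i by (intro LIMSEQ_le[OF p'[of i] p'[of "Suc i"]]) auto
    \<comment> \<open>Neighbouring touching points cannot merge in the limit, because the limit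
      profile takes the values \<open>pi\<close> and 0 there.\<close>
    moreover have "p' i \<noteq> p' (Suc i)" using val[of i] val[of "Suc i"] i by (auto split: if_splits)
    ultimately show "p' i < p' (Suc i)" by simp
  qed
  \<comment> \<open>A lower limit of additive interval functions is superadditive, which is the
    property \<open>riesz_derivative\<close> works with.\<close>
  define q where "q a b = liminf (\<lambda>n. \<integral>\<^sup>+x\<in>{a..b}. V n x \<partial>lborel)" for a b
  have qA: "q a b \<le> liminf A" for a b
    unfolding q_def
  proof (rule Liminf_mono)
    have "\<forall>\<^sub>F n in sequentially. a \<in> {- \<rho> n..\<rho> n} \<and> b \<in> {- \<rho> n..\<rho> n}" by (intro eventually_conj ev_in)
    then show "\<forall>\<^sub>F n in sequentially. (\<integral>\<^sup>+x\<in>{a..b}. V n x \<partial>lborel) \<le> A n"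
    proof eventually_elim
      case (elim n)
      then show ?case unfolding A_def by (intro nn_integral_mono) (auto simp: indicator_def)
    qed
  qed
  have lim_le: "liminf u \<le> c" if "\<And>n. u n \<le> c" for u :: "nat \<Rightarrow> ennreal" and c
    by (intro order_trans[OF Liminf_le_Limsup] Limsup_bounded always_eventually allI that) simp
  obtain G where G: "G \<in> borel_measurable borel"
    "\<And>a b. a \<le> b \<Longrightarrow> set_integrable lborel {a..b} G"
    "\<And>a b. a \<le> b \<Longrightarrow> (LINT x:{a..b}|lborel. G x) = \<theta>' b - \<theta>' a"
    "\<And>k::nat. (\<integral>\<^sup>+x\<in>{- real k..<real k}. ennreal ((norm (G x))\<^sup>2) \<partial>lborel) \<le> q (- real k) (real k)"
  proof (rule riesz_derivative[of q \<theta>' E])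
    show "q a b + q b c \<le> q a c" if "a \<le> b" "b \<le> c" for a b c
      using liminf_add_le_ennreal[of "\<lambda>n. \<integral>\<^sup>+x\<in>{a..b}. V n x \<partial>lborel" "\<lambda>n. \<integral>\<^sup>+x\<in>{b..c}. V n x \<partial>lborel"]
      unfolding q_def nn_integral_Icc_split[OF V_meas that] .
    show "q a b \<le> ennreal E" for a b using qA lim_le[of A "ennreal E", OF AE] by (rule order_trans)
    show "ennreal ((norm (\<theta>' b - \<theta>' a))\<^sup>2) \<le> ennreal (b - a) * q a b" if "a \<le> b" for a b
    proof (cases "a = b")
      case False
      with that have ab: "0 < b - a" by simp
      have le: "ennreal ((\<Theta> n b - \<Theta> n a)\<^sup>2 / (b - a)) \<le> (\<integral>\<^sup>+x\<in>{a..b}. V n x \<partial>lborel)" for n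
      proof -
        have "ennreal ((\<Theta> n b - \<Theta> n a)\<^sup>2) \<le> ennreal (b - a) * (\<integral>\<^sup>+x\<in>{a..b}. V n x \<partial>lborel)"
          using grad_bound_onD[OF gb[of n], of a b] that by simp
        then have "ennreal (1 / (b - a)) * ennreal ((\<Theta> n b - \<Theta> n a)\<^sup>2) \<le> ennreal (1 / (b - a)) * (ennreal (b - a) * (\<integral>\<^sup>+x\<in>{a..b}. V n x \<partial>lborel))"
          by (intro mult_left_mono) auto
        also have "\<dots> = (\<integral>\<^sup>+x\<in>{a..b}. V n x \<partial>lborel)"
          using ab by (simp add: mult.assoc[symmetric] ennreal_mult[symmetric])
        finally show ?thesis using ab by (simp add: ennreal_mult[symmetric])
      qed
      have "(\<lambda>n. ennreal ((\<Theta> n b - \<Theta> n a)\<^sup>2 / (b - a))) \<longlonglongrightarrow> ennreal ((\<theta>' b - \<theta>' a)\<^sup>2 / (b - a))"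
        using ab by (intro tendsto_ennrealI tendsto_intros lim) auto
      then have "ennreal ((\<theta>' b - \<theta>' a)\<^sup>2 / (b - a)) = liminf (\<lambda>n. ennreal ((\<Theta> n b - \<Theta> n a)\<^sup>2 / (b - a)))"
        by (rule lim_imp_Liminf[OF sequentially_bot, symmetric])
      also have "\<dots> \<le> q a b" unfolding q_def by (intro Liminf_mono always_eventually allI le)
      finally have "ennreal (b - a) * ennreal ((\<theta>' b - \<theta>' a)\<^sup>2 / (b - a)) \<le> ennreal (b - a) * q a b"
        by (intro mult_left_mono) auto
      then show ?thesis using ab by (simp add: ennreal_mult[symmetric])
    qed simp
  qed blast
  define W' where "W' x = ennreal ((norm (G x))\<^sup>2)" for x
  have [measurable]: "G \<in> borel_measurable borel" by (rule G)
  have W'A: "(\<integral>\<^sup>+x. W' x \<partial>lborel) \<le> liminf A"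
  proof -
    have m: "(\<lambda>x. ennreal ((norm (G x))\<^sup>2)) \<in> borel_measurable borel" by measurable
    show ?thesis
      unfolding W'_def nn_integral_UNIV_eq_SUP[OF m] by (intro SUP_least order_trans[OF G(4) qA])
  qed
  also have "\<dots> \<le> ennreal E" by (rule lim_le[OF AE])
  finally have W'fin: "(\<integral>\<^sup>+x. W' x \<partial>lborel) < \<infinity>" by (rule order_le_less_trans) simp
  have gb': "grad_bound \<theta>' W'"
    unfolding W'_def[abs_def] using W'fin by (intro grad_bound_of_integral G) (simp_all add: W'_def)
  have cont': "continuous_on UNIV \<theta>'" by (rule grad_bound_continuous[OF gb' W'fin])
  then have [measurable]: "\<theta>' \<in> borel_measurable borel" by (rule borel_measurable_continuous_onI)
  have ind1: "(\<lambda>n. indicator {- \<rho> n..\<rho> n} x :: ennreal) \<longlonglongrightarrow> 1" for x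
    by (rule tendsto_eventually, use ev_in[of x] in eventually_elim) simp
  have ind2: "(\<lambda>n. indicator ({- \<rho> n..\<rho> n} \<times> {- \<rho> n..\<rho> n}) z :: ennreal) \<longlonglongrightarrow> 1" for z
  proof (rule tendsto_eventually)
    have "\<forall>\<^sub>F n in sequentially. fst z \<in> {- \<rho> n..\<rho> n} \<and> snd z \<in> {- \<rho> n..\<rho> n}" by (intro eventually_conj ev_in)
    then show "\<forall>\<^sub>F n in sequentially. indicator ({- \<rho> n..\<rho> n} \<times> {- \<rho> n..\<rho> n}) z = (1 :: ennreal)"
      by eventually_elim (auto simp: indicator_def mem_Times_iff)
  qed
  have Ble: "(\<integral>\<^sup>+z. ennreal (pair_kernel (\<lambda>x. cos (\<theta>' x)) z) \<partial>lborel) \<le> liminf B"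
    unfolding B_def
  proof (rule nn_integral_liminf_localized)
    show "pair_kernel (\<lambda>x. cos (\<Theta> n x)) \<in> borel_measurable borel" for n by measurable
    have "{- \<rho> n..\<rho> n} \<times> {- \<rho> n..\<rho> n} \<in> sets borel" for n
      unfolding borel_prod[symmetric] by (auto intro!: pair_measureI)
    then show "indicator ({- \<rho> n..\<rho> n} \<times> {- \<rho> n..\<rho> n}) \<in> borel_measurable borel" for n
      by (rule borel_measurable_indicator)
    fix z
    have eq: "pair_kernel u z = (u (fst z) - u (snd z))\<^sup>2 * (1 / (fst z - snd z)\<^sup>2 / (2 * pi))" for u
      by (simp add: pair_kernel_def)
    show "(\<lambda>n. pair_kernel (\<lambda>x. cos (\<Theta> n x)) z) \<longlonglongrightarrow> pair_kernel (\<lambda>x. cos (\<theta>' x)) z"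
      unfolding eq by (intro tendsto_mult tendsto_power tendsto_diff tendsto_cos lim tendsto_const)
  qed (use ind2 in auto)
  have Cle: "(\<integral>\<^sup>+x. ennreal ((cos (\<theta>' x) - h')\<^sup>2) \<partial>lborel) \<le> liminf C"
    unfolding C_def
  proof (rule nn_integral_liminf_localized)
    show "(\<lambda>n. (cos (\<Theta> n x) - h (r n))\<^sup>2) \<longlonglongrightarrow> (cos (\<theta>' x) - h')\<^sup>2" for x
      using LIMSEQ_subseq_LIMSEQ[OF h r] by (intro tendsto_power tendsto_diff tendsto_cos lim) (simp add: o_def)
  qed (use ind1 in \<open>auto intro!: borel_measurable_indicator\<close>)
  have "energy2 h' \<theta>' W' UNIV \<le> liminf A + liminf B + liminf C"
    using W'A Ble Cle by (simp add: energy2_def add_mono)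
  also have "\<dots> \<le> liminf (\<lambda>n. A n + B n) + liminf C"
    by (intro add_right_mono liminf_add_le_ennreal)
  also have "\<dots> \<le> liminf (\<lambda>n. A n + B n + C n)" by (rule liminf_add_le_ennreal)
  also have "\<dots> \<le> liminf (\<lambda>n. ennreal (e (r n)))"
    by (intro Liminf_mono always_eventually allI ABC)
  also have "\<dots> = ennreal c"
    using LIMSEQ_subseq_LIMSEQ[OF e(1) r] by (intro lim_imp_Liminf sequentially_bot tendsto_ennrealI) (simp add: o_def)
  finally have "energy2 h' \<theta>' W' UNIV \<le> ennreal c" .
  moreover have "profile l \<theta>' W' p'" using cont' bnd' gb' t' by (simp add: profile_def)
  ultimately show ?thesis by blast
qed

text \<open>Translation puts the first touching point at 0; the bound on the spread then confines
  all of them to \<open>[0, L]\<close>.\<close>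

lemma profile_compactness:
  fixes h R :: "nat \<Rightarrow> real"
  assumes l: "1 \<le> l" and pr: "\<And>n. profile l (\<theta> n) (W n) (p n)" and h: "h \<longlonglongrightarrow> h'" and R: "filterlim R at_top sequentially"
    and spread: "\<And>n. p n (2 * l - 2) - p n 0 \<le> L"
    and en: "\<And>n. energy2 (h n) (\<theta> n) (W n) {p n 0 - R n..p n (2 * l - 2) + R n} \<le> ennreal (e n)"
    and e: "e \<longlonglongrightarrow> c" "\<And>n. e n \<le> E" and E: "0 \<le> E"
  shows "\<exists>\<theta>' W' p'. profile l \<theta>' W' p' \<and> energy2 h' \<theta>' W' UNIV \<le> ennreal c"
proof (rule profile_compactness_aux[where \<theta> = "\<lambda>n x. \<theta> n (p n 0 + x)" and W = "\<lambda>n x. W n (p n 0 + x)"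
      and p = "\<lambda>n i. p n i - p n 0" and L = L, OF profile_shift[OF pr] h R _ _ e E])
  fix n
  have t: "touches l (\<theta> n) (p n)" using pr[of n] by (simp add: profile_def)
  show "0 \<le> p n i - p n 0 \<and> p n i - p n 0 \<le> L" if "i < 2 * l - 1" for i
  proof -
    have "i \<le> 2 * l - 2" "2 * l - 2 < 2 * l - 1" using that l by auto
    then have "p n i \<le> p n (2 * l - 2)" by (rule touches_mono[OF t])
    then show ?thesis using touches_mono[OF t, of 0 i] that spread[of n] by auto
  qed
  have "0 \<le> p n (2 * l - 2) - p n 0" using touches_mono[OF t, of 0 "2 * l - 2"] l by auto
  then have sub: "{p n 0 - R n..p n 0 + R n} \<subseteq> {p n 0 - R n..p n (2 * l - 2) + R n}" by auto
  have eqS: "{x. p n 0 + x \<in> {p n 0 - R n..p n 0 + R n}} = {- R n..R n}" by auto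
  have "energy2 (h n) (\<lambda>x. \<theta> n (p n 0 + x)) (\<lambda>x. W n (p n 0 + x)) {- R n..R n}
     = energy2 (h n) (\<theta> n) (W n) {p n 0 - R n..p n 0 + R n}"
    using energy2_shift[OF profile_measurable[OF pr[of n]], of "{p n 0 - R n..p n 0 + R n}" "h n" "p n 0"]
    unfolding eqS by simp
  also have "\<dots> \<le> energy2 (h n) (\<theta> n) (W n) {p n 0 - R n..p n (2 * l - 2) + R n}"
    by (rule energy2_mono[OF sub])
  also note en[of n]
  finally show "energy2 (h n) (\<lambda>x. \<theta> n (p n 0 + x)) (\<lambda>x. W n (p n 0 + x)) {- R n..R n} \<le> ennreal (e n)" .
qed

section \<open>Minimal energies and splitting\<close>

text \<open>Twice the minimal energy, as \<open>energy2\<close> is twice the energy. The gradient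
  bound \<open>W\<close> is minimised over together with \<open>\<theta>\<close>.\<close>

definition min_energy :: "real \<Rightarrow> nat \<Rightarrow> ennreal" where
  "min_energy h l = (INF (\<theta>, W, p) \<in> {(\<theta>, W, p). profile l \<theta> W p}. energy2 h \<theta> W UNIV)"

lemma min_energy_le: "profile l \<theta> W p \<Longrightarrow> min_energy h l \<le> energy2 h \<theta> W UNIV"
  unfolding min_energy_def by (rule INF_lower2[of "(\<theta>, W, p)"]) auto

lemma min_energy_less: "min_energy h l < c \<Longrightarrow> \<exists>\<theta> W p. profile l \<theta> W p \<and> energy2 h \<theta> W UNIV < c"
  unfolding min_energy_def INF_less_iff by auto

definition window :: "nat \<Rightarrow> (nat \<Rightarrow> real) \<Rightarrow> real \<Rightarrow> real set" where
  "window l p R = {p 0 - R..p (2 * l - 2) + R}"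

text \<open>Lower semicontinuity for \<open>h\<close> tending to 1 in a localised form: a window
  reaching \<open>R\<close> beyond the outer touching points already accounts for almost all of the
  minimal energy at \<open>h = 1\<close>, with \<open>R\<close> independent of the profile. The
  localisation allows two distant groups to be bounded separately.\<close>

definition window_bound :: "nat \<Rightarrow> bool" where
  "window_bound l \<longleftrightarrow> (\<forall>\<epsilon>>0. \<exists>R H. H < 1 \<and> (\<forall>h \<theta> W p. H \<le> h \<and> h \<le> 1 \<and> profile l \<theta> W p \<longrightarrow>
     min_energy 1 l \<le> energy2 h \<theta> W (window l p R) + ennreal \<epsilon>))"

text \<open>The touching point with index \<open>2 * j - 1\<close>, where \<open>\<theta>\<close> is
  0, separates the groups and belongs to neither.\<close>

lemma profile_split:
  assumes pr: "profile l \<theta> W p" and j: "1 \<le> j" "j < l"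
  shows "profile j \<theta> W p" "profile (l - j) \<theta> W (\<lambda>i. p (i + 2 * j))"
proof -
  have "touches l \<theta> p" using pr by (simp add: profile_def)
  then have "touches j \<theta> p" "touches (l - j) \<theta> (\<lambda>i. p (i + 2 * j))"
    unfolding touches_def using j by auto
  then show "profile j \<theta> W p" "profile (l - j) \<theta> W (\<lambda>i. p (i + 2 * j))"
    using pr by (auto simp: profile_def)
qed

text \<open>A wide gap between the last \<open>pi\<close> of the first group and the first
  \<open>pi\<close> of the second makes their windows disjoint, and then the energies add up by
  \<open>energy2_superadditive\<close>.\<close>

lemma gap_energy:
  assumes wj: "window_bound j" and wl: "window_bound (l - j)" and j: "1 \<le> j" "j < l" and \<epsilon>: "0 < \<epsilon>"
  shows "\<exists>R H. H < 1 \<and> (\<forall>h \<theta> W p R'. H \<le> h \<and> h \<le> 1 \<and> profile l \<theta> W p \<and> R \<le> R' \<and> 2 * R' < p (2 * j) - p (2 * j - 2) \<longrightarrow>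
     min_energy 1 j + min_energy 1 (l - j) \<le> energy2 h \<theta> W (window l p R') + ennreal \<epsilon>)"
proof -
  obtain R1 H1 where 1: "H1 < 1" "\<And>h \<theta> W p. H1 \<le> h \<Longrightarrow> h \<le> 1 \<Longrightarrow> profile j \<theta> W p \<Longrightarrow>
      min_energy 1 j \<le> energy2 h \<theta> W (window j p R1) + ennreal (\<epsilon> / 2)"
    using wj \<epsilon> unfolding window_bound_def by (meson half_gt_zero)
  obtain R2 H2 where 2: "H2 < 1" "\<And>h \<theta> W p. H2 \<le> h \<Longrightarrow> h \<le> 1 \<Longrightarrow> profile (l - j) \<theta> W p \<Longrightarrow>
      min_energy 1 (l - j) \<le> energy2 h \<theta> W (window (l - j) p R2) + ennreal (\<epsilon> / 2)"
    using wl \<epsilon> unfolding window_bound_def by (meson half_gt_zero)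
  have "min_energy 1 j + min_energy 1 (l - j) \<le> energy2 h \<theta> W (window l p R') + ennreal \<epsilon>"
    if h: "max H1 H2 \<le> h" "h \<le> 1" and pr: "profile l \<theta> W p" and R': "max R1 R2 \<le> R'" and gap: "2 * R' < p (2 * j) - p (2 * j - 2)"
    for h \<theta> W p R'
  proof -
    note sp = profile_split[OF pr j]
    have t: "touches l \<theta> p" using pr by (simp add: profile_def)
    have m: "p 0 \<le> p (2 * j - 2)" "p (2 * j) \<le> p (2 * l - 2)" "p (2 * j - 2) \<le> p (2 * j)" using j by (intro touches_mono[OF t]; simp)+
    let ?A = "window j p R1" and ?B = "window (l - j) (\<lambda>i. p (i + 2 * j)) R2"
    have "2 * (l - j) - 2 + 2 * j = 2 * l - 2" using j by arith
    then have B: "?B = {p (2 * j) - R2..p (2 * l - 2) + R2}" by (simp only: window_def) simp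
    have "?A \<inter> ?B = {}" using gap R' unfolding B by (auto simp: window_def)
    moreover have "?A \<union> ?B \<subseteq> window l p R'" using gap R' m j unfolding B by (auto simp: window_def)
    ultimately have "energy2 h \<theta> W ?A + energy2 h \<theta> W ?B \<le> energy2 h \<theta> W (window l p R')"
      using profile_measurable[OF pr] by (intro energy2_superadditive) (auto simp: window_def)
    have "min_energy 1 j + min_energy 1 (l - j) \<le> (energy2 h \<theta> W ?A + ennreal (\<epsilon> / 2)) + (energy2 h \<theta> W ?B + ennreal (\<epsilon> / 2))"
      using h by (intro add_mono 1(2) 2(2) sp) auto
    also have "\<dots> = (energy2 h \<theta> W ?A + energy2 h \<theta> W ?B) + (ennreal (\<epsilon> / 2) + ennreal (\<epsilon> / 2))"
      by (simp only: ac_simps)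
    also have "ennreal (\<epsilon> / 2) + ennreal (\<epsilon> / 2) = ennreal \<epsilon>" using \<epsilon> by (simp flip: ennreal_plus)
    also have "(energy2 h \<theta> W ?A + energy2 h \<theta> W ?B) + ennreal \<epsilon> \<le> energy2 h \<theta> W (window l p R') + ennreal \<epsilon>"
      by (intro add_right_mono) fact
    finally show ?thesis .
  qed
  then show ?thesis using 1(1) 2(1) by (intro exI[of _ "max R1 R2"] exI[of _ "max H1 H2"]) auto
qed

text \<open>The threshold \<open>2 * R\<close> for the gap stays fixed while the radius
  \<open>R'\<close> of the window is free. Along a sequence with \<open>R'\<close> tending to
  infinity the gaps are therefore still bounded.\<close>

lemma gap_energy_uniform:
  assumes w: "\<And>j. 1 \<le> j \<Longrightarrow> j < l \<Longrightarrow> window_bound j" and \<epsilon>: "0 < \<epsilon>"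
  shows "\<exists>R H. H < 1 \<and> 0 \<le> R \<and> (\<forall>h \<theta> W p R' j. H \<le> h \<and> h \<le> 1 \<and> profile l \<theta> W p \<and> R \<le> R' \<and>
      1 \<le> j \<and> j < l \<and> 2 * R < p (2 * j) - p (2 * j - 2) \<longrightarrow>
     min_energy 1 j + min_energy 1 (l - j) \<le> energy2 h \<theta> W (window l p R') + ennreal \<epsilon>)"
proof -
  have "\<forall>j\<in>{1..<l}. \<exists>R H. H < 1 \<and> (\<forall>h \<theta> W p R'. H \<le> h \<and> h \<le> 1 \<and> profile l \<theta> W p \<and> R \<le> R' \<and> 2 * R' < p (2 * j) - p (2 * j - 2) \<longrightarrow>
     min_energy 1 j + min_energy 1 (l - j) \<le> energy2 h \<theta> W (window l p R') + ennreal \<epsilon>)"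
    using w \<epsilon> by (intro ballI gap_energy) auto
  then obtain Rf Hf where RH: "\<And>j. j \<in> {1..<l} \<Longrightarrow> Hf j < 1" "\<And>j h \<theta> W p R'. j \<in> {1..<l} \<Longrightarrow> Hf j \<le> h \<Longrightarrow> h \<le> 1 \<Longrightarrow> profile l \<theta> W p \<Longrightarrow>
     Rf j \<le> R' \<Longrightarrow> 2 * R' < p (2 * j) - p (2 * j - 2) \<Longrightarrow>
     min_energy 1 j + min_energy 1 (l - j) \<le> energy2 h \<theta> W (window l p R') + ennreal \<epsilon>"
    by metis
  define R where "R = Max (insert 0 (Rf ` {1..<l}))"
  define H where "H = Max (insert 0 (Hf ` {1..<l}))"
  have R: "0 \<le> R" "\<And>j. j \<in> {1..<l} \<Longrightarrow> Rf j \<le> R" unfolding R_def by (intro Max_ge; simp)+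
  have H: "H < 1" unfolding H_def using RH(1) by (subst Max_less_iff) auto
  have HH: "Hf j \<le> H" if "j \<in> {1..<l}" for j unfolding H_def using that by (intro Max_ge) auto
  have "min_energy 1 j + min_energy 1 (l - j) \<le> energy2 h \<theta> W (window l p R') + ennreal \<epsilon>"
    if "H \<le> h" "h \<le> 1" "profile l \<theta> W p" "R \<le> R'" "1 \<le> j" "j < l" "2 * R < p (2 * j) - p (2 * j - 2)" for h \<theta> W p R' j
  proof -
    have j: "j \<in> {1..<l}" using that by simp
    have "min_energy 1 j + min_energy 1 (l - j) \<le> energy2 h \<theta> W (window l p R) + ennreal \<epsilon>"
      using that R(2)[OF j] HH[OF j] by (intro RH(2)[OF j]) auto
    also have "\<dots> \<le> energy2 h \<theta> W (window l p R') + ennreal \<epsilon>"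
      using that by (intro add_right_mono energy2_mono) (auto simp: window_def)
    finally show ?thesis .
  qed
  then show ?thesis using R(1) H by (intro exI[of _ R] exI[of _ H]) auto
qed

lemma spread_le:
  assumes "1 \<le> l" and gap: "\<And>j. 1 \<le> j \<Longrightarrow> j < l \<Longrightarrow> p (2 * j) - p (2 * j - 2) \<le> (D::real)"
  shows "p (2 * l - 2) - p 0 \<le> real (l - 1) * D"
proof -
  have "p (2 * j) - p 0 \<le> real j * D" if "j < l" for j
    using that
  proof (induction j)
    case (Suc j)
    have "p (2 * Suc j) - p (2 * Suc j - 2) \<le> D" using Suc.prems by (intro gap) auto
    then show ?case using Suc by (simp add: algebra_simps)
  qed simp
  from this[of "l - 1"] show ?thesis using assms(1) by (simp add: diff_mult_distrib2)
qed

text \<open>Otherwise there are profiles with \<open>h\<close> tending to 1 and radii tending to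
  infinity whose window energy stays \<open>\<epsilon>\<close> below \<open>min_energy 1 l\<close>.
  A wide gap would lift that energy to at least
  \<open>min_energy 1 j + min_energy 1 (l - j) - \<epsilon>\<close>, which subadditivity forbids. So
  the spread is bounded, and compactness produces a profile for \<open>h = 1\<close> below the
  minimum.\<close>

lemma window_bound_step:
  assumes l: "1 \<le> l" and w: "\<And>j. 1 \<le> j \<Longrightarrow> j < l \<Longrightarrow> window_bound j"
    and sub: "\<And>j. 1 \<le> j \<Longrightarrow> j < l \<Longrightarrow> min_energy 1 l \<le> min_energy 1 j + min_energy 1 (l - j)"
    and fin: "min_energy 1 l < \<infinity>"
  shows "window_bound l"
  unfolding window_bound_def
proof (intro allI impI, rule ccontr)
  fix \<epsilon> :: real assume \<epsilon>: "0 < \<epsilon>"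
  assume "\<not> (\<exists>R H. H < 1 \<and> (\<forall>h \<theta> W p. H \<le> h \<and> h \<le> 1 \<and> profile l \<theta> W p \<longrightarrow>
     min_energy 1 l \<le> energy2 h \<theta> W (window l p R) + ennreal \<epsilon>))"
  then have ex: "\<exists>h \<theta> W p. H \<le> h \<and> h \<le> 1 \<and> profile l \<theta> W p \<and> energy2 h \<theta> W (window l p R) + ennreal \<epsilon> < min_energy 1 l"
    if "H < 1" for R H using that by (meson not_le)
  obtain R0 H0 where RH: "H0 < 1" "0 \<le> R0" "\<And>h \<theta> W p R' j. H0 \<le> h \<Longrightarrow> h \<le> 1 \<Longrightarrow> profile l \<theta> W p \<Longrightarrow> R0 \<le> R' \<Longrightarrow>
      1 \<le> j \<Longrightarrow> j < l \<Longrightarrow> 2 * R0 < p (2 * j) - p (2 * j - 2) \<Longrightarrow>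
     min_energy 1 j + min_energy 1 (l - j) \<le> energy2 h \<theta> W (window l p R') + ennreal \<epsilon>"
    using gap_energy_uniform[of l \<epsilon>, OF w \<epsilon>] by blast
  \<comment> \<open>\<open>Rn\<close> tends to infinity and never falls below \<open>R0\<close>, as
    the gap bound requires; \<open>Hn\<close> forces \<open>h\<close> to tend to 1.\<close>
  define Rn where "Rn n = R0 + real n" for n
  define Hn where "Hn n = max H0 (1 - 1 / real (Suc n))" for n
  have Hn: "Hn n < 1" for n using RH(1) by (simp add: Hn_def)
  define Q where "Q n h \<theta> W p \<longleftrightarrow> Hn n \<le> h \<and> h \<le> 1 \<and> profile l \<theta> W p \<and>
    energy2 h \<theta> W (window l p (Rn n)) + ennreal \<epsilon> < min_energy 1 l" for n h \<theta> W p
  have "\<forall>n. \<exists>h \<theta> W p. Q n h \<theta> W p"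
    unfolding Q_def by (intro allI ex Hn)
  then obtain h where "\<forall>n. \<exists>\<theta> W p. Q n (h n) \<theta> W p" by (rule choice[THEN exE])
  then obtain \<theta> where "\<forall>n. \<exists>W p. Q n (h n) (\<theta> n) W p" by (rule choice[THEN exE])
  then obtain W where "\<forall>n. \<exists>p. Q n (h n) (\<theta> n) (W n) p" by (rule choice[THEN exE])
  then obtain p where "\<forall>n. Q n (h n) (\<theta> n) (W n) (p n)" by (rule choice[THEN exE])
  then have seq: "\<And>n. Hn n \<le> h n" "\<And>n. h n \<le> 1" "\<And>n. profile l (\<theta> n) (W n) (p n)"
    "\<And>n. energy2 (h n) (\<theta> n) (W n) (window l (p n) (Rn n)) + ennreal \<epsilon> < min_energy 1 l"
    unfolding Q_def by blast+
  obtain a where a: "min_energy 1 l = ennreal a" "0 \<le> a" using fin by (cases "min_energy 1 l") auto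
  have spread: "p n (2 * l - 2) - p n 0 \<le> real (l - 1) * (2 * R0)" for n
  proof (rule spread_le[OF l], rule ccontr)
    fix j assume j: "1 \<le> j" "j < l" and "\<not> p n (2 * j) - p n (2 * j - 2) \<le> 2 * R0"
    then have "min_energy 1 j + min_energy 1 (l - j) \<le> energy2 (h n) (\<theta> n) (W n) (window l (p n) (Rn n)) + ennreal \<epsilon>"
      using seq(1,2)[of n] by (intro RH(3)[OF _ _ seq(3)]) (auto simp: Hn_def Rn_def)
    also have "\<dots> < min_energy 1 l" by (rule seq(4))
    finally show False using sub[OF j] by simp
  qed
  have en: "energy2 (h n) (\<theta> n) (W n) {p n 0 - Rn n..p n (2 * l - 2) + Rn n} \<le> ennreal (a - \<epsilon>) \<and> \<epsilon> < a" for n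
  proof -
    let ?X = "energy2 (h n) (\<theta> n) (W n) (window l (p n) (Rn n))"
    have lt: "?X + ennreal \<epsilon> < ennreal a" using seq(4)[of n] a by simp
    then obtain x where x: "?X = ennreal x" "0 \<le> x" by (cases ?X) auto
    then have "x + \<epsilon> < a" using lt \<epsilon> a by (simp add: ennreal_less_iff flip: ennreal_plus)
    then show ?thesis using x by (simp add: window_def ennreal_leI)
  qed
  have "\<exists>\<theta>' W' p'. profile l \<theta>' W' p' \<and> energy2 1 \<theta>' W' UNIV \<le> ennreal (a - \<epsilon>)"
  proof (rule profile_compactness[where e = "\<lambda>n. a - \<epsilon>" and E = "a - \<epsilon>" and R = Rn, OF l seq(3) _ _ spread])
    have "(\<lambda>n. 1 - 1 / real (Suc n)) \<longlonglongrightarrow> 1 - 0"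
      by (intro tendsto_diff tendsto_const LIMSEQ_Suc lim_1_over_n)
    then have l1: "(\<lambda>n. 1 - 1 / real (Suc n)) \<longlonglongrightarrow> 1" by simp
    show "h \<longlonglongrightarrow> 1"
      using seq(1,2) by (intro tendsto_sandwich[OF _ _ l1 tendsto_const]) (auto simp: Hn_def)
    show "filterlim Rn at_top sequentially"
      unfolding Rn_def by (rule filterlim_tendsto_add_at_top[OF tendsto_const filterlim_real_sequentially])
  qed (use en in \<open>auto intro: less_imp_le\<close>)
  then obtain \<theta>' W' p' where "profile l \<theta>' W' p'" "energy2 1 \<theta>' W' UNIV \<le> ennreal (a - \<epsilon>)" by blast
  then have "ennreal a \<le> ennreal (a - \<epsilon>)" using min_energy_le[of l \<theta>' W' p' 1] a by simp
  then show False using \<epsilon> en[of 0] a by (simp add: ennreal_le_iff)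
qed

text \<open>For \<open>h\<close> near 1 a minimising sequence has energy at most
  \<open>a + \<delta> / 2\<close>, where \<open>\<delta>\<close> is a lower bound for the excess of
  any splitting at \<open>h = 1\<close>. A wide gap would force \<open>a + \<delta>\<close> to be at
  most \<open>a + \<delta> / 2 + \<delta> / 4\<close>. Hence the touching points stay together and
  the sequence converges after translations.\<close>

lemma minimizer_near_one:
  assumes l: "1 \<le> l" and w: "\<And>j. 1 \<le> j \<Longrightarrow> j < l \<Longrightarrow> window_bound j"
    and sub: "\<And>j. 1 \<le> j \<Longrightarrow> j < l \<Longrightarrow> min_energy 1 l < min_energy 1 j + min_energy 1 (l - j)"
    and fin: "min_energy 1 l < \<infinity>"
    and upper: "\<And>\<epsilon>. 0 < \<epsilon> \<Longrightarrow> \<exists>H<1. \<forall>h. H \<le> h \<and> h \<le> 1 \<longrightarrow> min_energy h l \<le> min_energy 1 l + ennreal \<epsilon>"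
  shows "\<exists>H. 0 < H \<and> H < 1 \<and> (\<forall>h. H < h \<and> h \<le> 1 \<longrightarrow>
    (\<exists>\<theta> W p. profile l \<theta> W p \<and> energy2 h \<theta> W UNIV = min_energy h l \<and> min_energy h l < \<infinity>))"
proof -
  obtain a where a: "min_energy 1 l = ennreal a" "0 \<le> a" using fin by (cases "min_energy 1 l") auto
  have "\<forall>j\<in>{1..<l}. \<exists>d>0. ennreal (a + d) \<le> min_energy 1 j + min_energy 1 (l - j)"
  proof
    fix j assume "j \<in> {1..<l}"
    then have lt: "ennreal a < min_energy 1 j + min_energy 1 (l - j)" using sub[of j] a by simp
    show "\<exists>d>0. ennreal (a + d) \<le> min_energy 1 j + min_energy 1 (l - j)"
    proof (cases "min_energy 1 j + min_energy 1 (l - j)")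
      case (real b)
      then show ?thesis using lt a by (intro exI[of _ "b - a"]) (auto simp: ennreal_less_iff)
    next
      case top
      then show ?thesis by (intro exI[of _ 1]) auto
    qed
  qed
  then obtain d where d: "\<And>j. j \<in> {1..<l} \<Longrightarrow> 0 < d j" "\<And>j. j \<in> {1..<l} \<Longrightarrow> ennreal (a + d j) \<le> min_energy 1 j + min_energy 1 (l - j)"
    by metis
  \<comment> \<open>The extra 1 keeps the set nonempty for \<open>l = 1\<close>, where no splitting
    exists.\<close>
  define \<delta> where "\<delta> = Min (insert 1 (d ` {1..<l}))"
  have \<delta>: "0 < \<delta>" unfolding \<delta>_def using d(1) by (subst Min_gr_iff) auto
  have \<delta>sub: "ennreal (a + \<delta>) \<le> min_energy 1 j + min_energy 1 (l - j)" if j: "1 \<le> j" "j < l" for j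
  proof -
    have "\<delta> \<le> d j" unfolding \<delta>_def using j by (intro Min_le) auto
    then have "ennreal (a + \<delta>) \<le> ennreal (a + d j)" by (intro ennreal_leI) simp
    also have "\<dots> \<le> min_energy 1 j + min_energy 1 (l - j)" using j by (intro d) simp
    finally show ?thesis .
  qed
  obtain H1 where H1: "H1 < 1" "\<And>h. H1 \<le> h \<Longrightarrow> h \<le> 1 \<Longrightarrow> min_energy h l \<le> min_energy 1 l + ennreal (\<delta> / 4)"
    using upper[of "\<delta> / 4"] \<delta> by auto
  obtain R0 H0 where RH: "H0 < 1" "0 \<le> R0" "\<And>h \<theta> W p R' j. H0 \<le> h \<Longrightarrow> h \<le> 1 \<Longrightarrow> profile l \<theta> W p \<Longrightarrow> R0 \<le> R' \<Longrightarrow>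
      1 \<le> j \<Longrightarrow> j < l \<Longrightarrow> 2 * R0 < p (2 * j) - p (2 * j - 2) \<Longrightarrow>
     min_energy 1 j + min_energy 1 (l - j) \<le> energy2 h \<theta> W (window l p R') + ennreal (\<delta> / 4)"
  proof -
    have "0 < \<delta> / 4" using \<delta> by simp
    from gap_energy_uniform[of l "\<delta> / 4", OF w this] show thesis using that by blast
  qed
  \<comment> \<open>The entry \<open>1/2\<close> makes \<open>H\<close> positive.\<close>
  define H where "H = max (1/2) (max H0 H1)"
  have "\<exists>\<theta> W p. profile l \<theta> W p \<and> energy2 h \<theta> W UNIV = min_energy h l \<and> min_energy h l < \<infinity>"
    if h: "H < h" "h \<le> 1" for h
  proof -
    have le: "min_energy h l \<le> ennreal (a + \<delta> / 4)"
      using H1(2)[of h] h a \<delta> by (simp add: H_def flip: ennreal_plus)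
    then have "min_energy h l < \<infinity>" by (rule order_le_less_trans) simp
    then obtain b where b: "min_energy h l = ennreal b" "0 \<le> b" by (cases "min_energy h l") auto
    have ba: "b \<le> a + \<delta> / 4" using le a \<delta> unfolding b(1) by (subst (asm) ennreal_le_iff) auto
    define e where "e n = b + (\<delta> / 4) * (1 / real (Suc n))" for n
    have "min_energy h l < ennreal (e n)" for n using b \<delta> by (simp add: e_def ennreal_less_iff)
    then have "\<forall>n. \<exists>\<theta> W p. profile l \<theta> W p \<and> energy2 h \<theta> W UNIV < ennreal (e n)" using min_energy_less by blast
    then obtain \<theta> W p where seq: "\<And>n. profile l (\<theta> n) (W n) (p n)" "\<And>n. energy2 h (\<theta> n) (W n) UNIV < ennreal (e n)"
      by metis
    have e_le: "e n \<le> b + \<delta> / 4" for n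
      using \<delta> mult_left_mono[of "1 / real (Suc n)" 1 "\<delta> / 4"] by (simp add: e_def)
    have win: "energy2 h (\<theta> n) (W n) (window l (p n) R') \<le> ennreal (e n)" for n R'
      using energy2_mono[of "window l (p n) R'" UNIV] seq(2)[of n] by (meson less_imp_le order_trans subset_UNIV)
    have spread: "p n (2 * l - 2) - p n 0 \<le> real (l - 1) * (2 * R0)" for n
    proof (rule spread_le[OF l], rule ccontr)
      fix j assume j: "1 \<le> j" "j < l" and "\<not> p n (2 * j) - p n (2 * j - 2) \<le> 2 * R0"
      then have "min_energy 1 j + min_energy 1 (l - j) \<le> energy2 h (\<theta> n) (W n) (window l (p n) R0) + ennreal (\<delta> / 4)"
        using h by (intro RH(3)[OF _ _ seq(1)]) (auto simp: H_def)
      also have "\<dots> \<le> ennreal (e n) + ennreal (\<delta> / 4)" by (intro add_right_mono win)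
      also have "\<dots> \<le> ennreal (a + \<delta> / 4 + \<delta> / 4) + ennreal (\<delta> / 4)"
        using e_le[of n] ba by (intro add_right_mono ennreal_leI) linarith
      also have "\<dots> < ennreal (a + \<delta>)" using a \<delta> by (simp add: ennreal_less_iff flip: ennreal_plus)
      finally show False using \<delta>sub[OF j] by simp
    qed
    have "\<exists>\<theta>' W' p'. profile l \<theta>' W' p' \<and> energy2 h \<theta>' W' UNIV \<le> ennreal b"
    proof (rule profile_compactness[where e = e and E = "b + \<delta> / 4" and R = real and h = "\<lambda>_. h", OF l seq(1) tendsto_const filterlim_real_sequentially spread])
      show "energy2 h (\<theta> n) (W n) {p n 0 - real n..p n (2 * l - 2) + real n} \<le> ennreal (e n)" for n
        using win[of n "real n"] by (simp add: window_def)
      have "e \<longlonglongrightarrow> b + (\<delta> / 4) * 0"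
        unfolding e_def[abs_def] by (intro tendsto_intros LIMSEQ_Suc lim_1_over_n)
      then show "e \<longlonglongrightarrow> b" by simp
    qed (use e_le b \<delta> in auto)
    then obtain \<theta>' W' p' where pr: "profile l \<theta>' W' p'" and le': "energy2 h \<theta>' W' UNIV \<le> ennreal b" by blast
    then have "energy2 h \<theta>' W' UNIV = min_energy h l"
      using min_energy_le[OF pr, of h] b by (intro antisym) simp_all
    then show ?thesis using pr \<open>min_energy h l < \<infinity>\<close> by blast
  qed
  then show ?thesis using RH(1) H1(1) by (intro exI[of _ H]) (auto simp: H_def)
qed

section \<open>Minimal energies as \<open>h\<close> tends to 1\<close>

text \<open>The kernel \<open>1 / r^2\<close> capped at height \<open>1 / x^2\<close>. It dominates
  interactions of pairs at distance at least \<open>x\<close>, and squared difference quotients of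
  functions with values in \<open>[0, 1]\<close> and Lipschitz constant
  \<open>1 / x\<close>.\<close>

definition cut_kernel :: "real \<Rightarrow> real \<Rightarrow> real" where
  "cut_kernel x r = (if \<bar>r\<bar> \<le> x then 1 / x\<^sup>2 else 1 / r\<^sup>2)"

lemma cut_kernel_measurable [measurable]: "cut_kernel x \<in> borel_measurable borel"
  unfolding cut_kernel_def[abs_def] by measurable

lemma cut_kernel_nonneg: "0 \<le> cut_kernel x r"
  by (simp add: cut_kernel_def)

text \<open>The plateau contributes \<open>2 / x\<close> and each tail \<open>1 / x\<close>.\<close>

lemma nn_integral_cut_kernel:
  assumes x: "0 < x"
  shows "(\<integral>\<^sup>+r. ennreal (cut_kernel x r) \<partial>lborel) \<le> ennreal (4 / x)"
proof -
  have right: "(\<integral>\<^sup>+r\<in>{x..}. ennreal (1 / r\<^sup>2) \<partial>lborel) = ennreal (0 - (- inverse x))"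
  proof (rule nn_integral_FTC_atLeast)
    have "((\<lambda>r::real. inverse r) \<longlongrightarrow> 0) at_top"
      by (rule tendsto_inverse_0_at_top[OF filterlim_ident])
    from tendsto_minus[OF this] show "((\<lambda>r::real. - inverse r) \<longlongrightarrow> 0) at_top" by simp
    show "((\<lambda>r. - inverse r) has_real_derivative 1 / r\<^sup>2) (at r)" if "x \<le> r" for r
      using that x by (auto intro!: derivative_eq_intros simp: power2_eq_square field_simps)
  qed auto
  have right': "(\<integral>\<^sup>+r\<in>{x..}. ennreal (1 / r\<^sup>2) \<partial>lborel) = ennreal (1 / x)"
    unfolding right by (simp add: inverse_eq_divide)
  have left: "(\<integral>\<^sup>+r\<in>{..- x}. ennreal (1 / r\<^sup>2) \<partial>lborel) = (\<integral>\<^sup>+r\<in>{x..}. ennreal (1 / r\<^sup>2) \<partial>lborel)"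
    by (subst nn_integral_real_affine[of _ "-1" 0]) (auto intro!: nn_integral_cong simp: indicator_def)
  have mid: "(\<integral>\<^sup>+r\<in>{-x..x}. ennreal (1 / x\<^sup>2) \<partial>lborel) = ennreal (2 / x)"
    using x by (subst nn_integral_cmult_indicator) (auto simp: ennreal_mult[symmetric] power2_eq_square)
  have "(\<integral>\<^sup>+r. ennreal (cut_kernel x r) \<partial>lborel) \<le>
    (\<integral>\<^sup>+r. ennreal (1 / x\<^sup>2) * indicator {-x..x} r + (ennreal (1 / r\<^sup>2) * indicator {x..} r + ennreal (1 / r\<^sup>2) * indicator {..-x} r) \<partial>lborel)"
    by (intro nn_integral_mono) (auto simp: cut_kernel_def indicator_def)
  also have "\<dots> = ennreal (2 / x) + (ennreal (1 / x) + ennreal (1 / x))"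
    by (simp add: nn_integral_add mid left right')
  also have "\<dots> = ennreal (4 / x)" using x by (simp flip: ennreal_plus)
  finally show ?thesis .
qed

lemma plane_convolution:
  fixes f k :: "real \<Rightarrow> ennreal"
  assumes [measurable]: "f \<in> borel_measurable borel" "k \<in> borel_measurable borel"
  shows "(\<integral>\<^sup>+z. f (fst z) * k (fst z - snd z) \<partial>lborel) = (\<integral>\<^sup>+x. f x \<partial>lborel) * (\<integral>\<^sup>+x. k x \<partial>lborel)"
    "(\<integral>\<^sup>+z. f (snd z) * k (fst z - snd z) \<partial>lborel) = (\<integral>\<^sup>+x. f x \<partial>lborel) * (\<integral>\<^sup>+x. k x \<partial>lborel)"
proof -
  have m: "(\<lambda>z. f (fst z) * k (fst z - snd z)) \<in> borel_measurable (lborel \<Otimes>\<^sub>M lborel)"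
    "(\<lambda>z. f (snd z) * k (fst z - snd z)) \<in> borel_measurable (lborel \<Otimes>\<^sub>M lborel)" by measurable
  have k1: "(\<integral>\<^sup>+t. k (s - t) \<partial>lborel) = (\<integral>\<^sup>+x. k x \<partial>lborel)" for s
    using nn_integral_real_affine[of k "-1" s] by simp
  have k2: "(\<integral>\<^sup>+s. k (s - t) \<partial>lborel) = (\<integral>\<^sup>+x. k x \<partial>lborel)" for t
    using nn_integral_real_affine[of k 1 "- t"] by simp
  have "(\<integral>\<^sup>+z. f (fst z) * k (fst z - snd z) \<partial>lborel) = (\<integral>\<^sup>+s. \<integral>\<^sup>+t. f s * k (s - t) \<partial>lborel \<partial>lborel)"
    using lborel.nn_integral_fst[OF m(1)] by (simp add: lborel_prod)
  also have "\<dots> = (\<integral>\<^sup>+x. f x \<partial>lborel) * (\<integral>\<^sup>+x. k x \<partial>lborel)"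
    by (simp add: nn_integral_cmult k1 nn_integral_multc)
  finally show "(\<integral>\<^sup>+z. f (fst z) * k (fst z - snd z) \<partial>lborel) = (\<integral>\<^sup>+x. f x \<partial>lborel) * (\<integral>\<^sup>+x. k x \<partial>lborel)" .
  have "(\<integral>\<^sup>+z. f (snd z) * k (fst z - snd z) \<partial>lborel) = (\<integral>\<^sup>+t. \<integral>\<^sup>+s. f t * k (s - t) \<partial>lborel \<partial>lborel)"
    using lborel_pair.nn_integral_snd[OF m(2)] by (simp add: lborel_prod)
  also have "\<dots> = (\<integral>\<^sup>+x. f x \<partial>lborel) * (\<integral>\<^sup>+x. k x \<partial>lborel)"
    by (simp add: nn_integral_cmult k2 nn_integral_multc)
  finally show "(\<integral>\<^sup>+z. f (snd z) * k (fst z - snd z) \<partial>lborel) = (\<integral>\<^sup>+x. f x \<partial>lborel) * (\<integral>\<^sup>+x. k x \<partial>lborel)" .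
qed

lemma plane_product:
  fixes f k :: "real \<Rightarrow> ennreal"
  assumes [measurable]: "f \<in> borel_measurable borel" "k \<in> borel_measurable borel"
  shows "(\<integral>\<^sup>+z. f (fst z) * k (snd z) \<partial>lborel) = (\<integral>\<^sup>+x. f x \<partial>lborel) * (\<integral>\<^sup>+x. k x \<partial>lborel)"
proof -
  have m: "(\<lambda>z. f (fst z) * k (snd z)) \<in> borel_measurable (lborel \<Otimes>\<^sub>M lborel)" by measurable
  have "(\<integral>\<^sup>+z. f (fst z) * k (snd z) \<partial>lborel) = (\<integral>\<^sup>+s. \<integral>\<^sup>+t. f s * k t \<partial>lborel \<partial>lborel)"
    using lborel.nn_integral_fst[OF m] by (simp add: lborel_prod)
  also have "\<dots> = (\<integral>\<^sup>+x. f x \<partial>lborel) * (\<integral>\<^sup>+x. k x \<partial>lborel)"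
    by (simp add: nn_integral_cmult nn_integral_multc)
  finally show ?thesis .
qed

lemma sq_le_sq_of_abs_le: "\<bar>x\<bar> \<le> \<bar>y\<bar> \<Longrightarrow> x\<^sup>2 \<le> (y::real)\<^sup>2"
  by (simp add: abs_le_square_iff)

text \<open>An almost minimiser for \<open>h = 1\<close> is changed outside the hull
  \<open>[a, b]\<close> of its touching points: the angle is raised to at least
  \<open>\<alpha>\<close>, so its cosine is capped at \<open>h\<close> and gets the right limit,
  while inside the value 0 must be kept. Capping enlarges a difference only between a point inside
  and a point outside whose cosines both exceed \<open>h\<close>. Near \<open>a\<close> and
  \<open>b\<close> the cosine is negative, so such pairs are at least \<open>d\<close> apart, and
  the cost has order \<open>(1 - h)^2\<close>.\<close>

lemma min_energy_upper:
  assumes l: "1 \<le> l" and fin: "min_energy 1 l < \<infinity>" and \<epsilon>: "0 < \<epsilon>"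
  shows "\<exists>H<1. \<forall>h. H \<le> h \<and> h \<le> 1 \<longrightarrow> min_energy h l \<le> min_energy 1 l + ennreal \<epsilon>"
proof -
  have "min_energy 1 l < min_energy 1 l + ennreal (\<epsilon> / 2)"
    using fin \<epsilon> by (cases "min_energy 1 l") (auto simp: ennreal_less_iff simp flip: ennreal_plus)
  then obtain \<theta> W p where pr: "profile l \<theta> W p" and en: "energy2 1 \<theta> W UNIV < min_energy 1 l + ennreal (\<epsilon> / 2)"
    using min_energy_less by blast
  define a where "a = p 0"
  define b where "b = p (2 * l - 2)"
  have t: "touches l \<theta> p" and cont: "continuous_on UNIV \<theta>" and bnd: "\<And>x. 0 \<le> \<theta> x" "\<And>x. \<theta> x \<le> pi"
    and gb: "grad_bound \<theta> W" using pr by (auto simp: profile_def)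
  note [measurable] = profile_measurable[OF pr]
  have ab: "a \<le> b" unfolding a_def b_def using l by (intro touches_mono[OF t]) auto
  have \<theta>ab: "\<theta> a = pi" "\<theta> b = pi" using t l by (auto simp: touches_def a_def b_def)
  have "\<exists>d>0. \<forall>s. \<bar>s - c\<bar> < d \<longrightarrow> cos (\<theta> s) < 0" if "\<theta> c = pi" for c
  proof -
    have "isCont (\<lambda>s. cos (\<theta> s)) c"
      using cont by (auto simp: continuous_on_eq_continuous_at intro!: continuous_intros)
    then obtain d where d: "0 < d" "\<And>s. \<bar>s - c\<bar> < d \<Longrightarrow> \<bar>cos (\<theta> s) - cos (\<theta> c)\<bar> < 1"
      unfolding continuous_at_eps_delta dist_real_def by (metis zero_less_one)
    have "cos (\<theta> s) < 0" if "\<bar>s - c\<bar> < d" for s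
      using d(2)[OF that] \<open>\<theta> c = pi\<close> by simp
    then show ?thesis using d(1) by blast
  qed
  then obtain d1 d2 where d12: "0 < d1" "\<And>s. \<bar>s - a\<bar> < d1 \<Longrightarrow> cos (\<theta> s) < 0" "0 < d2" "\<And>s. \<bar>s - b\<bar> < d2 \<Longrightarrow> cos (\<theta> s) < 0"
    using \<theta>ab by meson
  define d where "d = min d1 d2"
  have d: "0 < d" "\<And>s. \<bar>s - a\<bar> < d \<Longrightarrow> cos (\<theta> s) < 0" "\<And>s. \<bar>s - b\<bar> < d \<Longrightarrow> cos (\<theta> s) < 0"
    using d12 by (auto simp: d_def)
  \<comment> \<open>The coefficient of \<open>(1 - h)^2\<close> in the extra energy: mixed pairs in
    either order cost \<open>(b - a) * (4 / d)\<close> each, and the local term costs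
    \<open>b - a\<close>.\<close>
  define K where "K = (b - a) * (4 / d) + (b - a) * (4 / d) + (b - a)"
  have K0: "0 \<le> K" using ab d by (simp add: K_def)
  define H where "H = max 0 (1 - \<epsilon> / (2 * (K + 1)))"
  have H: "H < 1" using \<epsilon> K0 by (simp add: H_def)
  have "min_energy h l \<le> min_energy 1 l + ennreal \<epsilon>" if h: "H \<le> h" "h \<le> 1" for h
  proof -
    define \<alpha> where "\<alpha> = arccos h"
    have h0: "0 \<le> h" using h by (simp add: H_def)
    have \<alpha>: "cos \<alpha> = h" "0 \<le> \<alpha>" "\<alpha> \<le> pi"
      using h0 h by (auto simp: \<alpha>_def arccos_lbound arccos_ubound)
    define \<theta>' where "\<theta>' x = (if x \<in> {a..b} then \<theta> x else max (\<theta> x) \<alpha>)" for x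
    have bnd': "0 \<le> \<theta>' x" "\<theta>' x \<le> pi" for x using bnd[of x] \<alpha> by (auto simp: \<theta>'_def)
    have out: "\<theta>' x = max (\<theta> x) \<alpha>" if "x \<le> a \<or> b \<le> x" for x
      using that \<theta>ab \<alpha> ab by (auto simp: \<theta>'_def)
    have Lip: "grad_bound_on S \<theta>' W" if "(\<forall>x\<in>S. x \<le> a \<or> b \<le> x) \<or> S \<subseteq> {a..b}" for S
    proof (rule grad_bound_on_lipschitz[OF grad_bound_on_subset[OF gb subset_UNIV]])
      fix s t assume st: "s \<in> S" "t \<in> S"
      show "norm (\<theta>' t - \<theta>' s) \<le> norm (\<theta> t - \<theta> s)"
      proof (cases "S \<subseteq> {a..b}")
        case True
        then have "\<theta>' s = \<theta> s" "\<theta>' t = \<theta> t" using st by (auto simp: \<theta>'_def)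
        then show ?thesis by simp
      next
        case False
        then have "\<theta>' s = max (\<theta> s) \<alpha>" "\<theta>' t = max (\<theta> t) \<alpha>" using st that out by auto
        then show ?thesis by auto
      qed
    qed
    have gb': "grad_bound \<theta>' W"
    proof (rule grad_bound_on_glue[where c = a])
      show "grad_bound_on (UNIV \<inter> {..a}) \<theta>' W" by (intro Lip) auto
      show "grad_bound_on (UNIV \<inter> {a..}) \<theta>' W"
      proof (rule grad_bound_on_glue[where c = b])
        show "grad_bound_on (UNIV \<inter> {a..} \<inter> {..b}) \<theta>' W" by (intro Lip) auto
        show "grad_bound_on (UNIV \<inter> {a..} \<inter> {b..}) \<theta>' W" by (intro Lip) auto
      qed (use ab in auto)
    qed simp
    have Wf: "(\<integral>\<^sup>+x. W x \<partial>lborel) < \<infinity>"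
    proof -
      have "(\<integral>\<^sup>+x. W x \<partial>lborel) \<le> energy2 1 \<theta> W UNIV" by (simp add: energy2_def add.assoc)
      also note en
      also have "min_energy 1 l + ennreal (\<epsilon> / 2) \<le> \<infinity>" by simp
      finally show ?thesis .
    qed
    have cont': "continuous_on UNIV \<theta>'" by (rule grad_bound_continuous[OF gb' Wf])
    then have [measurable]: "\<theta>' \<in> borel_measurable borel" by (rule borel_measurable_continuous_onI)
    have "p i \<in> {a..b}" if "i < 2 * l - 1" for i
    proof -
      have "i \<le> 2 * l - 2" "2 * l - 2 < 2 * l - 1" using that l by auto
      then show ?thesis
        using touches_mono[OF t, of 0 i] touches_mono[OF t, of i "2 * l - 2"] that by (simp add: a_def b_def)
    qed
    then have "touches l \<theta>' p" using t by (simp add: touches_def \<theta>'_def)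
    then have pr': "profile l \<theta>' W p" using cont' bnd' gb' by (simp add: profile_def)
    define \<eta> where "\<eta> = 1 - h"
    have \<eta>: "0 \<le> \<eta>" "\<eta> \<le> 1" "\<eta> * K \<le> \<epsilon> / 2"
    proof -
      show "0 \<le> \<eta>" "\<eta> \<le> 1" using h h0 by (auto simp: \<eta>_def)
      have "\<eta> \<le> \<epsilon> / (2 * (K + 1))" using h by (simp add: \<eta>_def H_def)
      then have "\<eta> * (K + 1) \<le> \<epsilon> / (2 * (K + 1)) * (K + 1)" using K0 by (intro mult_right_mono) auto
      also have "\<dots> = \<epsilon> / 2" using K0 by (simp add: field_simps)
      finally show "\<eta> * K \<le> \<epsilon> / 2" using \<open>0 \<le> \<eta>\<close> by (simp add: algebra_simps)
    qed
    have cout: "cos (\<theta>' x) = min (cos (\<theta> x)) h" if "x \<notin> {a..b}" for x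
      using that \<alpha> bnd[of x] cos_mono_le_eq[of "\<theta> x" \<alpha>] cos_mono_le_eq[of \<alpha> "\<theta> x"]
      by (auto simp: \<theta>'_def max_def min_def)
    have cin: "cos (\<theta>' x) = cos (\<theta> x)" if "x \<in> {a..b}" for x using that by (simp add: \<theta>'_def)
    have mixed: "(cos (\<theta>' s) - cos (\<theta>' t))\<^sup>2 / (s - t)\<^sup>2 / (2 * pi) \<le> (cos (\<theta> s) - cos (\<theta> t))\<^sup>2 / (s - t)\<^sup>2 / (2 * pi) + \<eta>\<^sup>2 * cut_kernel d (s - t)"
      if st: "s \<in> {a..b}" "t \<notin> {a..b}" for s t
    proof (cases "h < cos (\<theta> s) \<and> h < cos (\<theta> t)")
      case True
      have "d \<le> \<bar>s - t\<bar>"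
      proof (rule ccontr)
        assume "\<not> d \<le> \<bar>s - t\<bar>"
        then have "\<bar>s - a\<bar> < d \<or> \<bar>s - b\<bar> < d" using st by auto
        then show False using d(2,3)[of s] True h0 by auto
      qed
      then have ck: "1 / (s - t)\<^sup>2 \<le> cut_kernel d (s - t)"
        using d(1) by (auto simp: cut_kernel_def)
      have "cos (\<theta>' s) - cos (\<theta>' t) = cos (\<theta> s) - h" using True st by (simp add: cin cout min_def)
      moreover have "(cos (\<theta> s) - h)\<^sup>2 \<le> \<eta>\<^sup>2" using True by (intro power_mono) (auto simp: \<eta>_def)
      ultimately have "(cos (\<theta>' s) - cos (\<theta>' t))\<^sup>2 / (s - t)\<^sup>2 / (2 * pi) \<le> \<eta>\<^sup>2 / (s - t)\<^sup>2 / (2 * pi)"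
        by (intro divide_right_mono) auto
      also have "\<dots> \<le> \<eta>\<^sup>2 / (s - t)\<^sup>2 / 1"
        using pi_gt3 by (intro divide_left_mono) auto
      also have "\<dots> \<le> \<eta>\<^sup>2 * cut_kernel d (s - t)" using mult_left_mono[OF ck, of "\<eta>\<^sup>2"] by simp
      finally show ?thesis by (rule add_increasing[rotated]) simp
    next
      case False
      then have "\<bar>cos (\<theta>' s) - cos (\<theta>' t)\<bar> \<le> \<bar>cos (\<theta> s) - cos (\<theta> t)\<bar>"
        using st by (auto simp: cin cout min_def)
      then have "(cos (\<theta>' s) - cos (\<theta>' t))\<^sup>2 / (s - t)\<^sup>2 / (2 * pi) \<le> (cos (\<theta> s) - cos (\<theta> t))\<^sup>2 / (s - t)\<^sup>2 / (2 * pi)"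
        by (intro divide_right_mono sq_le_sq_of_abs_le) auto
      then show ?thesis using cut_kernel_nonneg[of d "s - t"] by (simp add: add_increasing2)
    qed
    have pk: "pair_kernel (\<lambda>x. cos (\<theta>' x)) z \<le> pair_kernel (\<lambda>x. cos (\<theta> x)) z +
        \<eta>\<^sup>2 * (indicator {a..b} (fst z) * cut_kernel d (fst z - snd z) + indicator {a..b} (snd z) * cut_kernel d (fst z - snd z))" for z
    proof -
      have sym: "cut_kernel d (t - s) = cut_kernel d (s - t)" "(t - s)\<^sup>2 = (s - t)\<^sup>2" for s t
        by (auto simp: cut_kernel_def abs_minus_commute power2_commute)
      consider "fst z \<in> {a..b} \<longleftrightarrow> snd z \<in> {a..b}" | "fst z \<in> {a..b}" "snd z \<notin> {a..b}" | "fst z \<notin> {a..b}" "snd z \<in> {a..b}" by blast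
      then show ?thesis
      proof cases
        case 1
        then have "\<bar>cos (\<theta>' (fst z)) - cos (\<theta>' (snd z))\<bar> \<le> \<bar>cos (\<theta> (fst z)) - cos (\<theta> (snd z))\<bar>"
          by (cases "snd z \<in> {a..b}") (auto simp: cin cout min_def)
        then have "pair_kernel (\<lambda>x. cos (\<theta>' x)) z \<le> pair_kernel (\<lambda>x. cos (\<theta> x)) z"
          unfolding pair_kernel_def by (intro divide_right_mono sq_le_sq_of_abs_le) auto
        then show ?thesis using cut_kernel_nonneg by (simp add: add_increasing2)
      next
        case 2
        then show ?thesis using mixed[of "fst z" "snd z"] by (simp add: pair_kernel_def)
      next
        case 3
        then show ?thesis using mixed[of "snd z" "fst z"] sym[of "snd z" "fst z"]
          by (simp add: pair_kernel_def power2_commute[of "cos (\<theta>' (snd z))"] power2_commute[of "cos (\<theta> (snd z))"])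
      qed
    qed
    have l2: "(cos (\<theta>' x) - h)\<^sup>2 \<le> (cos (\<theta> x) - 1)\<^sup>2 + \<eta>\<^sup>2 * indicator {a..b} x" for x
    proof (cases "x \<in> {a..b} \<and> h < cos (\<theta> x)")
      case True
      have "(cos (\<theta> x) - h)\<^sup>2 \<le> \<eta>\<^sup>2" using True by (intro power_mono) (auto simp: \<eta>_def)
      then show ?thesis using True by (simp add: cin add_increasing)
    next
      case False
      then have "\<bar>cos (\<theta>' x) - h\<bar> \<le> \<bar>cos (\<theta> x) - 1\<bar>"
        using h by (cases "x \<in> {a..b}") (auto simp: cin cout min_def)
      then have "(cos (\<theta>' x) - h)\<^sup>2 \<le> (cos (\<theta> x) - 1)\<^sup>2" by (rule sq_le_sq_of_abs_le)
      then show ?thesis by (simp add: add_increasing2)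
    qed
    let ?I = "\<lambda>x. indicator {a..b} x :: real"
    have I1: "(\<integral>\<^sup>+x. ennreal (?I x) \<partial>lborel) = ennreal (b - a)"
      using ab by (simp add: ennreal_indicator)
    have k4: "(\<integral>\<^sup>+r. ennreal (cut_kernel d r) \<partial>lborel) \<le> ennreal (4 / d)" by (rule nn_integral_cut_kernel[OF d(1)])
    have m1 [measurable]: "(\<lambda>z::real\<times>real. ennreal (?I (fst z)) * ennreal (cut_kernel d (fst z - snd z))) \<in> borel_measurable borel"
      "(\<lambda>z::real\<times>real. ennreal (?I (snd z)) * ennreal (cut_kernel d (fst z - snd z))) \<in> borel_measurable borel"
      unfolding borel_prod[symmetric] by measurable
    have [measurable]: "pair_kernel (\<lambda>x. cos (\<theta> x)) \<in> borel_measurable borel" by measurable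
    have "(\<integral>\<^sup>+z. ennreal (pair_kernel (\<lambda>x. cos (\<theta>' x)) z) \<partial>lborel) \<le>
      (\<integral>\<^sup>+z. ennreal (pair_kernel (\<lambda>x. cos (\<theta> x)) z) + ennreal (\<eta>\<^sup>2) * (ennreal (?I (fst z)) * ennreal (cut_kernel d (fst z - snd z))
        + ennreal (?I (snd z)) * ennreal (cut_kernel d (fst z - snd z))) \<partial>lborel)"
      using pk pair_kernel_nonneg cut_kernel_nonneg
      by (intro nn_integral_mono) (simp add: ennreal_mult[symmetric] ennreal_leI flip: ennreal_plus)
    also have "\<dots> = (\<integral>\<^sup>+z. ennreal (pair_kernel (\<lambda>x. cos (\<theta> x)) z) \<partial>lborel) + ennreal (\<eta>\<^sup>2) *
       (ennreal (b - a) * (\<integral>\<^sup>+r. ennreal (cut_kernel d r) \<partial>lborel) + ennreal (b - a) * (\<integral>\<^sup>+r. ennreal (cut_kernel d r) \<partial>lborel))"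
      using plane_convolution[of "\<lambda>x. ennreal (?I x)" "\<lambda>r. ennreal (cut_kernel d r)"]
      by (simp add: nn_integral_add nn_integral_cmult I1)
    also have "\<dots> \<le> (\<integral>\<^sup>+z. ennreal (pair_kernel (\<lambda>x. cos (\<theta> x)) z) \<partial>lborel) + ennreal (\<eta>\<^sup>2) *
       (ennreal (b - a) * ennreal (4 / d) + ennreal (b - a) * ennreal (4 / d))"
      by (intro add_left_mono mult_left_mono add_mono k4) auto
    finally have P: "(\<integral>\<^sup>+z. ennreal (pair_kernel (\<lambda>x. cos (\<theta>' x)) z) \<partial>lborel) \<le>
       (\<integral>\<^sup>+z. ennreal (pair_kernel (\<lambda>x. cos (\<theta> x)) z) \<partial>lborel) + ennreal (\<eta>\<^sup>2 * ((b - a) * (4 / d) + (b - a) * (4 / d)))"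
      using ab d by (simp add: ennreal_mult[symmetric] flip: ennreal_plus)
    have "(\<integral>\<^sup>+x. ennreal ((cos (\<theta>' x) - h)\<^sup>2) \<partial>lborel) \<le> (\<integral>\<^sup>+x. ennreal ((cos (\<theta> x) - 1)\<^sup>2) + ennreal (\<eta>\<^sup>2) * ennreal (?I x) \<partial>lborel)"
      using l2 by (intro nn_integral_mono) (simp add: ennreal_mult[symmetric] ennreal_leI flip: ennreal_plus)
    also have "\<dots> = (\<integral>\<^sup>+x. ennreal ((cos (\<theta> x) - 1)\<^sup>2) \<partial>lborel) + ennreal (\<eta>\<^sup>2 * (b - a))"
      using ab by (simp add: nn_integral_add nn_integral_cmult I1 ennreal_mult)
    finally have L: "(\<integral>\<^sup>+x. ennreal ((cos (\<theta>' x) - h)\<^sup>2) \<partial>lborel) \<le> (\<integral>\<^sup>+x. ennreal ((cos (\<theta> x) - 1)\<^sup>2) \<partial>lborel) + ennreal (\<eta>\<^sup>2 * (b - a))" .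
    have arr: "A + B' + C' \<le> (A + B + C) + (x + y)" if "B' \<le> B + x" "C' \<le> C + y" for A B B' C C' x y :: ennreal
      using add_mono[OF add_mono[OF order_refl[of A] that(1)] that(2)] by (simp add: ac_simps)
    have "energy2 h \<theta>' W UNIV \<le> energy2 1 \<theta> W UNIV + (ennreal (\<eta>\<^sup>2 * ((b - a) * (4 / d) + (b - a) * (4 / d))) + ennreal (\<eta>\<^sup>2 * (b - a)))"
      unfolding energy2_def using arr[OF P L] by simp
    also have "ennreal (\<eta>\<^sup>2 * ((b - a) * (4 / d) + (b - a) * (4 / d))) + ennreal (\<eta>\<^sup>2 * (b - a)) = ennreal (\<eta>\<^sup>2 * K)"
    proof -
      have "0 \<le> \<eta>\<^sup>2 * ((b - a) * (4 / d) + (b - a) * (4 / d))" "0 \<le> \<eta>\<^sup>2 * (b - a)"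
        using ab d(1) by (intro mult_nonneg_nonneg add_nonneg_nonneg; simp)+
      then show ?thesis by (simp only: ennreal_plus[symmetric]) (simp add: K_def algebra_simps)
    qed
    also have "ennreal (\<eta>\<^sup>2 * K) \<le> ennreal (\<epsilon> / 2)"
    proof (rule ennreal_leI)
      have "\<eta>\<^sup>2 * K \<le> \<eta> * K" using \<eta> K0 by (intro mult_right_mono) (auto simp: power2_eq_square mult_left_le)
      then show "\<eta>\<^sup>2 * K \<le> \<epsilon> / 2" using \<eta>(3) by simp
    qed
    also have "energy2 1 \<theta> W UNIV + ennreal (\<epsilon> / 2) \<le> (min_energy 1 l + ennreal (\<epsilon> / 2)) + ennreal (\<epsilon> / 2)"
      using en by (intro add_right_mono) simp
    also have "\<dots> = min_energy 1 l + ennreal \<epsilon>" using \<epsilon> by (simp add: add.assoc flip: ennreal_plus)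
    finally have "energy2 h \<theta>' W UNIV \<le> min_energy 1 l + ennreal \<epsilon>" by (simp add: add_left_mono)
    then show ?thesis using min_energy_le[OF pr', of h] by (rule order_trans[rotated])
  qed
  then show ?thesis using H by blast
qed

section \<open>Truncation of minimisers\<close>

lemma one_minus_cos_half: "1 - cos x = 2 * (sin (x / 2))\<^sup>2" for x :: real
  using cos_double_sin[of "x / 2"] by simp

text \<open>The constant would be 2 at the origin; 3 covers \<open>[0, 1]\<close>. There
  \<open>sin (x / 2) \<ge> (7 / 16) * x\<close>, and 6 times the square of \<open>7 / 16\<close>
  exceeds 1.\<close>

lemma sq_le_three_one_minus_cos:
  assumes "0 \<le> x" "x \<le> (1::real)"
  shows "x\<^sup>2 \<le> 3 * (1 - cos x)"
proof -
  have "1 - cos (x / 2) = 2 * (sin (x / 4))\<^sup>2" using one_minus_cos_half[of "x / 2"] by simp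
  also have "\<dots> \<le> 2 * (x / 4)\<^sup>2"
    using assms sin_x_le_x[of "x / 4"] sin_ge_zero[of "x / 4"] pi_gt3 by (intro mult_left_mono power_mono) auto
  also have "\<dots> \<le> 2 * (1 / 4)\<^sup>2" using assms by (intro mult_left_mono power_mono) auto
  finally have c: "7 / 8 \<le> cos (x / 2)" by (simp add: power2_eq_square)
  have "x / 2 * (7 / 8) \<le> x / 2 * cos (x / 2)" using assms c by (intro mult_left_mono) auto
  also have "\<dots> \<le> sin (x / 2)" using assms pi_gt3 by (intro sin_ge_mult_cos) auto
  finally have "(x * (7 / 16))\<^sup>2 \<le> (sin (x / 2))\<^sup>2" using assms by (intro power_mono) auto
  then have "x\<^sup>2 * (49 / 256) \<le> (sin (x / 2))\<^sup>2" by (simp add: power_mult_distrib power2_eq_square)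
  then have "x\<^sup>2 \<le> 6 * (sin (x / 2))\<^sup>2" using zero_le_power2[of x] by linarith
  then show ?thesis by (simp add: one_minus_cos_half)
qed

text \<open>A common factor contracts differences of cosines, since
  \<open>cos (c * t) - cos t\<close> increases in \<open>t\<close>: on \<open>[0, 1]\<close>, below
  \<open>pi / 2\<close>, the sine increases and hence
  \<open>c * sin (c * t) \<le> sin t\<close>.\<close>

lemma cos_scale_diff_le:
  assumes c: "0 \<le> c" "c \<le> 1" and x: "0 \<le> x" "x \<le> 1" and y: "0 \<le> y" "y \<le> (1::real)"
  shows "\<bar>cos (c * x) - cos (c * y)\<bar> \<le> \<bar>cos x - cos y\<bar>"
proof -
  have main: "\<bar>cos (c * x) - cos (c * y)\<bar> \<le> \<bar>cos x - cos y\<bar>" if xy: "0 \<le> x" "x \<le> y" "y \<le> 1" for x y :: real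
  proof -
    have "(\<lambda>t. cos (c * t) - cos t) x \<le> (\<lambda>t. cos (c * t) - cos t) y"
    proof (rule DERIV_nonneg_imp_nondecreasing[OF xy(2)])
      fix t assume t: "x \<le> t" "t \<le> y"
      have "((\<lambda>t. cos (c * t) - cos t) has_real_derivative (sin t - c * sin (c * t))) (at t)"
        by (auto intro!: derivative_eq_intros)
      moreover have "c * sin (c * t) \<le> 1 * sin t"
      proof (rule mult_mono)
        have "c * t \<le> 1 * t" using c t xy by (intro mult_right_mono) auto
        moreover have "0 \<le> c * t" using c t xy by auto
        ultimately show "sin (c * t) \<le> sin t" using t xy pi_gt3 by (intro sin_monotone_2pi_le) auto
        show "0 \<le> sin (c * t)" using \<open>0 \<le> c * t\<close> \<open>c * t \<le> 1 * t\<close> t xy pi_gt3 by (intro sin_ge_zero) auto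
      qed (use c in auto)
      ultimately show "\<exists>d. ((\<lambda>t. cos (c * t) - cos t) has_real_derivative d) (at t) \<and> 0 \<le> d" by force
    qed
    moreover have "cos (c * y) \<le> cos (c * x)"
    proof (rule cos_monotone_0_pi_le)
      show "0 \<le> c * x" using c xy by simp
      show "c * x \<le> c * y" using c xy by (intro mult_left_mono) auto
      have "c * y \<le> 1 * 1" using c xy by (intro mult_mono) auto
      then show "c * y \<le> pi" using pi_gt3 by simp
    qed
    ultimately show ?thesis by simp
  qed
  show ?thesis using main[of x y] main[of y x] x y by (cases "x \<le> y") (auto simp: abs_minus_commute)
qed

text \<open>A change of the factor costs in proportion to \<open>1 - cos y\<close>. The resulting
  error is thus square integrable along the tail of a profile, which a constant bound would not
  give.\<close>

lemma cos_scale_diff_factor_le: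
  assumes c: "0 \<le> c" "c \<le> 1" "0 \<le> d" "d \<le> 1" and y: "0 \<le> y" "y \<le> (1::real)"
  shows "\<bar>cos (c * y) - cos (d * y)\<bar> \<le> 3 * \<bar>c - d\<bar> * (1 - cos y)"
proof -
  have "\<bar>cos (c * y) - cos (d * y)\<bar> = 2 * \<bar>sin ((c * y + d * y) / 2)\<bar> * \<bar>sin ((d * y - c * y) / 2)\<bar>"
    by (simp add: cos_diff_cos abs_mult)
  also have "\<dots> \<le> 2 * \<bar>(c * y + d * y) / 2\<bar> * \<bar>(d * y - c * y) / 2\<bar>"
    by (intro mult_mono abs_sin_x_le_abs_x) auto
  also have "\<dots> = (c + d) / 2 * (\<bar>c - d\<bar> * y\<^sup>2)"
  proof -
    have "c * y + d * y = (c + d) * y" "d * y - c * y = (d - c) * y" by (simp_all add: algebra_simps)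
    then show ?thesis using c y by (simp add: abs_mult power2_eq_square abs_minus_commute)
  qed
  also have "\<dots> \<le> 1 * (\<bar>c - d\<bar> * (3 * (1 - cos y)))"
    using c sq_le_three_one_minus_cos[OF y] by (intro mult_mono mult_left_mono) auto
  also have "\<dots> = 3 * \<bar>c - d\<bar> * (1 - cos y)" by (simp only: mult_ac mult_1)
  finally show ?thesis .
qed

lemma sq_add_le:
  fixes a b \<eta> :: real
  assumes "0 < \<eta>"
  shows "(a + b)\<^sup>2 \<le> (1 + \<eta>) * a\<^sup>2 + (1 + 1 / \<eta>) * b\<^sup>2"
proof -
  have "0 \<le> (\<eta> * a - b)\<^sup>2 / \<eta>" using assms by simp
  also have "\<dots> = \<eta> * a\<^sup>2 - 2 * a * b + b\<^sup>2 / \<eta>"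
    using assms by (simp add: power2_eq_square field_simps)
  finally show ?thesis by (simp add: power2_eq_square algebra_simps)
qed

section \<open>Truncation of an angle and its gradient bound\<close>

definition cutoff :: "real \<Rightarrow> real \<Rightarrow> real" where
  "cutoff x s = max 0 (min 1 (2 - \<bar>s\<bar> / x))"

lemma cutoff_bounds: "0 \<le> cutoff x s" "cutoff x s \<le> 1"
  by (auto simp: cutoff_def)

lemma cutoff_one: "0 < x \<Longrightarrow> \<bar>s\<bar> \<le> x \<Longrightarrow> cutoff x s = 1"
  by (auto simp: cutoff_def field_simps)

lemma cutoff_zero: "0 < x \<Longrightarrow> 2 * x \<le> \<bar>s\<bar> \<Longrightarrow> cutoff x s = 0"
  by (auto simp: cutoff_def field_simps)

lemma cutoff_lipschitz:
  assumes "0 < x"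
  shows "\<bar>cutoff x s - cutoff x t\<bar> \<le> \<bar>s - t\<bar> / x"
proof -
  have "\<bar>max 0 (min 1 (2 - a)) - max 0 (min 1 (2 - b))\<bar> \<le> \<bar>b - a\<bar>" for a b :: real
    by linarith
  then have "\<bar>cutoff x s - cutoff x t\<bar> \<le> \<bar>\<bar>t\<bar> / x - \<bar>s\<bar> / x\<bar>" unfolding cutoff_def .
  also have "\<dots> = \<bar>\<bar>t\<bar> - \<bar>s\<bar>\<bar> / x" using assms by (simp add: diff_divide_distrib[symmetric])
  also have "\<dots> \<le> \<bar>s - t\<bar> / x" using assms by (intro divide_right_mono) auto
  finally show ?thesis .
qed

text \<open>At distances up to \<open>x\<close> the Lipschitz constant \<open>1 / x\<close> decides,
  beyond that the range \<open>[0, 1]\<close>.\<close>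

lemma cutoff_cut_kernel:
  assumes "0 < x"
  shows "(cutoff x s - cutoff x t)\<^sup>2 / (s - t)\<^sup>2 \<le> cut_kernel x (s - t)"
proof (cases "s = t")
  case False
  have "(cutoff x s - cutoff x t)\<^sup>2 \<le> (\<bar>s - t\<bar> / x)\<^sup>2"
    using cutoff_lipschitz[OF assms, of s t] assms by (intro sq_le_sq_of_abs_le) auto
  then have 1: "(cutoff x s - cutoff x t)\<^sup>2 / (s - t)\<^sup>2 \<le> (\<bar>s - t\<bar> / x)\<^sup>2 / (s - t)\<^sup>2"
    by (rule divide_right_mono) simp
  have "\<bar>cutoff x s - cutoff x t\<bar> \<le> 1" using cutoff_bounds[of x s] cutoff_bounds[of x t] by auto
  then have "(cutoff x s - cutoff x t)\<^sup>2 \<le> 1\<^sup>2" by (intro sq_le_sq_of_abs_le) auto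
  then have 2: "(cutoff x s - cutoff x t)\<^sup>2 / (s - t)\<^sup>2 \<le> 1 / (s - t)\<^sup>2"
    by (intro divide_right_mono) auto
  show ?thesis using 1 2 False by (auto simp: cut_kernel_def power_divide)
qed (simp add: cut_kernel_nonneg)

lemma cutoff_continuous: "continuous_on A (cutoff x)"
  unfolding cutoff_def[abs_def] by (cases "x = 0") (auto intro!: continuous_intros)

text \<open>The increment of the product is split at a point \<open>r\<close> where \<open>\<theta>\<close> is minimal, so that
  \<open>\<theta>(r)\<^sup>2 (t - s)\<close> is controlled by the integral of \<open>\<theta>\<^sup>2\<close>.\<close>

lemma grad_bound_cutoff:
  fixes \<theta> :: "real \<Rightarrow> real"
  assumes gb: "grad_bound \<theta> W" and cont: "continuous_on UNIV \<theta>" and pos: "\<And>s. 0 \<le> \<theta> s" and x: "0 < x" and \<eta>: "0 < \<eta>"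
  shows "grad_bound (\<lambda>s. cutoff x s * \<theta> s)
    (\<lambda>v. ennreal (1 + \<eta>) * W v + ennreal ((1 + 1 / \<eta>) / x\<^sup>2) * ennreal ((\<theta> v)\<^sup>2))"
    (is "grad_bound ?F ?V")
  unfolding grad_bound_on_def
proof (intro conjI ballI impI)
  have [measurable]: "W \<in> borel_measurable borel" by (rule grad_bound_on_measurable[OF gb])
  have [measurable]: "\<theta> \<in> borel_measurable borel" by (rule borel_measurable_continuous_onI[OF cont])
  show "?V \<in> borel_measurable borel" by measurable
  fix s t :: real assume st: "s \<le> t"
  obtain r where r: "r \<in> {s..t}" "\<And>v. v \<in> {s..t} \<Longrightarrow> \<theta> r \<le> \<theta> v"
    using continuous_attains_inf[of "{s..t}" \<theta>] continuous_on_subset[OF cont subset_UNIV] st by auto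
  define A where "A = \<bar>\<theta> t - \<theta> r\<bar> + \<bar>\<theta> r - \<theta> s\<bar>"
  define B where "B = \<theta> r * \<bar>cutoff x t - cutoff x s\<bar>"
  have "?F t - ?F s = (cutoff x t * (\<theta> t - \<theta> r) + cutoff x s * (\<theta> r - \<theta> s)) + \<theta> r * (cutoff x t - cutoff x s)"
    by (simp add: algebra_simps)
  also have "\<bar>\<dots>\<bar> \<le> (\<bar>cutoff x t * (\<theta> t - \<theta> r)\<bar> + \<bar>cutoff x s * (\<theta> r - \<theta> s)\<bar>) + \<bar>\<theta> r * (cutoff x t - cutoff x s)\<bar>"
    by linarith
  also have "\<dots> \<le> (1 * \<bar>\<theta> t - \<theta> r\<bar> + 1 * \<bar>\<theta> r - \<theta> s\<bar>) + B"
    unfolding abs_mult B_def using pos[of r] cutoff_bounds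
    by (intro add_mono mult_mono) auto
  finally have le: "\<bar>?F t - ?F s\<bar> \<le> A + B" by (simp add: A_def)
  have "(norm (?F t - ?F s))\<^sup>2 \<le> (A + B)\<^sup>2" using le by (intro power_mono) auto
  also have "\<dots> \<le> (1 + \<eta>) * A\<^sup>2 + (1 + 1 / \<eta>) * B\<^sup>2" by (rule sq_add_le[OF \<eta>])
  finally have main: "ennreal ((norm (?F t - ?F s))\<^sup>2) \<le> ennreal (1 + \<eta>) * ennreal (A\<^sup>2) + ennreal (1 + 1 / \<eta>) * ennreal (B\<^sup>2)"
    using \<eta> by (simp add: ennreal_mult[symmetric] ennreal_leI flip: ennreal_plus)
  have Ale: "ennreal (A\<^sup>2) \<le> ennreal (t - s) * (\<integral>\<^sup>+v\<in>{s..t}. W v \<partial>lborel)"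
    using grad_bound_chain(1)[OF grad_bound_on_measurable[OF gb], of s r t \<theta>] r(1) grad_bound_onD[OF gb]
    by (simp add: A_def)
  have "B\<^sup>2 \<le> (\<theta> r)\<^sup>2 * ((t - s) / x)\<^sup>2"
    unfolding B_def power_mult_distrib using cutoff_lipschitz[OF x, of t s] st
    by (intro mult_left_mono power_mono) auto
  also have "\<dots> = ((t - s) / x\<^sup>2) * ((\<theta> r)\<^sup>2 * (t - s))"
    by (simp add: power_divide power2_eq_square)
  finally have "ennreal (B\<^sup>2) \<le> ennreal (((t - s) / x\<^sup>2) * ((\<theta> r)\<^sup>2 * (t - s)))" by (rule ennreal_leI)
  also have "\<dots> = ennreal ((t - s) / x\<^sup>2) * (ennreal ((\<theta> r)\<^sup>2) * ennreal (t - s))"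
    using st by (subst ennreal_mult, simp, simp, subst ennreal_mult) auto
  also have "ennreal ((\<theta> r)\<^sup>2) * ennreal (t - s) = (\<integral>\<^sup>+v\<in>{s..t}. ennreal ((\<theta> r)\<^sup>2) \<partial>lborel)"
    using st by (subst nn_integral_cmult_indicator) auto
  also have "\<dots> \<le> (\<integral>\<^sup>+v\<in>{s..t}. ennreal ((\<theta> v)\<^sup>2) \<partial>lborel)"
    using r(2) pos by (intro nn_integral_mono) (auto simp: indicator_def intro!: ennreal_leI power_mono)
  finally have Ble: "ennreal (B\<^sup>2) \<le> ennreal ((t - s) / x\<^sup>2) * (\<integral>\<^sup>+v\<in>{s..t}. ennreal ((\<theta> v)\<^sup>2) \<partial>lborel)"
    by (simp add: mult_left_mono)
  have "ennreal ((norm (?F t - ?F s))\<^sup>2) \<le> ennreal (1 + \<eta>) * (ennreal (t - s) * (\<integral>\<^sup>+v\<in>{s..t}. W v \<partial>lborel))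
     + ennreal (1 + 1 / \<eta>) * (ennreal ((t - s) / x\<^sup>2) * (\<integral>\<^sup>+v\<in>{s..t}. ennreal ((\<theta> v)\<^sup>2) \<partial>lborel))"
    by (rule order_trans[OF main]) (intro add_mono mult_left_mono Ale Ble; simp)
  also have "ennreal (1 + 1 / \<eta>) * (ennreal ((t - s) / x\<^sup>2) * X) = ennreal (t - s) * (ennreal ((1 + 1 / \<eta>) / x\<^sup>2) * X)" for X
  proof -
    have "0 \<le> 1 + 1 / \<eta>" using \<eta> by simp
    then have "ennreal (1 + 1 / \<eta>) * ennreal ((t - s) / x\<^sup>2) = ennreal ((1 + 1 / \<eta>) * ((t - s) / x\<^sup>2))"
      using st by (intro ennreal_mult[symmetric]) auto
    also have "(1 + 1 / \<eta>) * ((t - s) / x\<^sup>2) = (t - s) * ((1 + 1 / \<eta>) / x\<^sup>2)" by simp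
    also have "ennreal \<dots> = ennreal (t - s) * ennreal ((1 + 1 / \<eta>) / x\<^sup>2)"
      using st \<open>0 \<le> 1 + 1 / \<eta>\<close> by (intro ennreal_mult) auto
    finally show ?thesis by (simp only: mult.assoc[symmetric])
  qed
  also have "ennreal (1 + \<eta>) * (ennreal (t - s) * (\<integral>\<^sup>+v\<in>{s..t}. W v \<partial>lborel)) + ennreal (t - s) * (ennreal ((1 + 1 / \<eta>) / x\<^sup>2) * (\<integral>\<^sup>+v\<in>{s..t}. ennreal ((\<theta> v)\<^sup>2) \<partial>lborel))
     = ennreal (t - s) * (ennreal (1 + \<eta>) * (\<integral>\<^sup>+v\<in>{s..t}. W v \<partial>lborel) + ennreal ((1 + 1 / \<eta>) / x\<^sup>2) * (\<integral>\<^sup>+v\<in>{s..t}. ennreal ((\<theta> v)\<^sup>2) \<partial>lborel))"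
    by (simp only: distrib_left mult_ac)
  also have "ennreal (1 + \<eta>) * (\<integral>\<^sup>+v\<in>{s..t}. W v \<partial>lborel) + ennreal ((1 + 1 / \<eta>) / x\<^sup>2) * (\<integral>\<^sup>+v\<in>{s..t}. ennreal ((\<theta> v)\<^sup>2) \<partial>lborel)
     = (\<integral>\<^sup>+v\<in>{s..t}. ?V v \<partial>lborel)"
    by (simp only: distrib_right mult.assoc) (simp add: nn_integral_add nn_integral_cmult)
  finally show "ennreal ((norm (?F t - ?F s))\<^sup>2) \<le> ennreal (t - s) * (\<integral>\<^sup>+v\<in>{s..t}. ?V v \<partial>lborel)" .
qed

text \<open>The factor \<open>1 + \<eta>\<close> and the term with the square of
  \<open>\<theta>\<close> are charged on the two ramps only; the bound is unchanged on the core and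
  vanishes beyond the support.\<close>

definition cutoff_bound :: "real \<Rightarrow> real \<Rightarrow> (real \<Rightarrow> real) \<Rightarrow> (real \<Rightarrow> ennreal) \<Rightarrow> real \<Rightarrow> ennreal" where
  "cutoff_bound x \<eta> \<theta> W v = (if \<bar>v\<bar> \<le> x then W v
     else if \<bar>v\<bar> < 2 * x then ennreal (1 + \<eta>) * W v + ennreal ((1 + 1 / \<eta>) / x\<^sup>2) * ennreal ((\<theta> v)\<^sup>2) else 0)"

lemma grad_bound_on_AE_mono:
  assumes F: "grad_bound_on S F W" and S: "\<And>s t. s \<in> S \<Longrightarrow> t \<in> S \<Longrightarrow> {s..t} \<subseteq> S"
    and le: "\<And>v. v \<in> S \<Longrightarrow> v \<noteq> c \<Longrightarrow> v \<noteq> d \<Longrightarrow> W v \<le> V v" and V: "V \<in> borel_measurable borel"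
  shows "grad_bound_on S F V"
  unfolding grad_bound_on_def
proof (intro conjI ballI impI V)
  fix s t assume st: "s \<in> S" "t \<in> S" "s \<le> t"
  have "(\<integral>\<^sup>+x\<in>{s..t}. W x \<partial>lborel) \<le> (\<integral>\<^sup>+x\<in>{s..t}. V x \<partial>lborel)"
  proof (rule nn_integral_mono_AE)
    have "AE x in lborel. x \<noteq> c \<and> x \<noteq> d" by (intro AE_conjI AE_lborel_singleton)
    then show "AE x in lborel. W x * indicator {s..t} x \<le> V x * indicator {s..t} x"
      by eventually_elim (use S[OF st(1,2)] le in \<open>auto simp: indicator_def\<close>)
  qed
  then have "ennreal (t - s) * (\<integral>\<^sup>+x\<in>{s..t}. W x \<partial>lborel) \<le> ennreal (t - s) * (\<integral>\<^sup>+x\<in>{s..t}. V x \<partial>lborel)"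
    by (rule mult_left_mono) simp
  then show "ennreal ((norm (F t - F s))\<^sup>2) \<le> ennreal (t - s) * (\<integral>\<^sup>+x\<in>{s..t}. V x \<partial>lborel)"
    using grad_bound_onD[OF F st] by (rule order_trans[rotated])
qed

lemma grad_bound_cutoff_bound:
  fixes \<theta> :: "real \<Rightarrow> real"
  assumes gb: "grad_bound \<theta> W" and cont: "continuous_on UNIV \<theta>" and pos: "\<And>s. 0 \<le> \<theta> s" and x: "0 < x" and \<eta>: "0 < \<eta>"
  shows "grad_bound (\<lambda>s. cutoff x s * \<theta> s) (cutoff_bound x \<eta> \<theta> W)"
proof -
  have [measurable]: "W \<in> borel_measurable borel" by (rule grad_bound_on_measurable[OF gb])
  have [measurable]: "\<theta> \<in> borel_measurable borel" by (rule borel_measurable_continuous_onI[OF cont])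
  have V: "cutoff_bound x \<eta> \<theta> W \<in> borel_measurable borel" unfolding cutoff_bound_def[abs_def] by measurable
  let ?F = "\<lambda>s. cutoff x s * \<theta> s"
  have zero: "grad_bound_on S ?F (cutoff_bound x \<eta> \<theta> W)" if "\<And>s. s \<in> S \<Longrightarrow> 2 * x \<le> \<bar>s\<bar>" for S
    unfolding grad_bound_on_def using V that cutoff_zero[OF x] by auto
  have ramp: "grad_bound_on {a..b} ?F (cutoff_bound x \<eta> \<theta> W)" if "(a = x \<and> b = 2 * x) \<or> (a = - (2 * x) \<and> b = - x)" for a b
    using grad_bound_on_subset[OF grad_bound_cutoff[OF gb cont pos x \<eta>] subset_UNIV]
  proof (rule grad_bound_on_AE_mono[where c = a and d = b])
    fix v assume "v \<in> {a..b}" "v \<noteq> a" "v \<noteq> b"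
    then have "\<not> \<bar>v\<bar> \<le> x" "\<bar>v\<bar> < 2 * x" using that x by auto
    then show "ennreal (1 + \<eta>) * W v + ennreal ((1 + 1 / \<eta>) / x\<^sup>2) * ennreal ((\<theta> v)\<^sup>2) \<le> cutoff_bound x \<eta> \<theta> W v"
      by (simp add: cutoff_bound_def)
  qed (use V in auto)
  have mid: "grad_bound_on {- x..x} ?F (cutoff_bound x \<eta> \<theta> W)"
  proof (rule grad_bound_on_mono[where W = W])
    show "grad_bound_on {- x..x} ?F W"
      by (rule grad_bound_on_lipschitz[OF grad_bound_on_subset[OF gb subset_UNIV]]) (auto simp: cutoff_one[OF x])
    show "W v \<le> cutoff_bound x \<eta> \<theta> W v" if "v \<in> {- x..x}" for v
    proof -
      have "\<bar>v\<bar> \<le> x" using that by auto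
      then show ?thesis by (simp add: cutoff_bound_def)
    qed
  qed (use V in auto)
  have s: "UNIV \<inter> {- (2 * x)..} \<inter> {..- x} = {- (2 * x)..- x}" "UNIV \<inter> {- (2 * x)..} \<inter> {- x..} \<inter> {..x} = {- x..x}"
    "UNIV \<inter> {- (2 * x)..} \<inter> {- x..} \<inter> {x..} \<inter> {..2 * x} = {x..2 * x}" using x by auto
  show ?thesis
  proof (rule grad_bound_on_glue[where c = "- (2 * x)"])
    show "grad_bound_on (UNIV \<inter> {..- (2 * x)}) ?F (cutoff_bound x \<eta> \<theta> W)" by (rule zero) (use x in auto)
    show "grad_bound_on (UNIV \<inter> {- (2 * x)..}) ?F (cutoff_bound x \<eta> \<theta> W)"
    proof (rule grad_bound_on_glue[where c = "- x"])
      show "grad_bound_on (UNIV \<inter> {- (2 * x)..} \<inter> {..- x}) ?F (cutoff_bound x \<eta> \<theta> W)" unfolding s by (rule ramp) simp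
      show "grad_bound_on (UNIV \<inter> {- (2 * x)..} \<inter> {- x..}) ?F (cutoff_bound x \<eta> \<theta> W)"
      proof (rule grad_bound_on_glue[where c = x])
        show "grad_bound_on (UNIV \<inter> {- (2 * x)..} \<inter> {- x..} \<inter> {..x}) ?F (cutoff_bound x \<eta> \<theta> W)" unfolding s by (rule mid)
        show "grad_bound_on (UNIV \<inter> {- (2 * x)..} \<inter> {- x..} \<inter> {x..}) ?F (cutoff_bound x \<eta> \<theta> W)"
        proof (rule grad_bound_on_glue[where c = "2 * x"])
          show "grad_bound_on (UNIV \<inter> {- (2 * x)..} \<inter> {- x..} \<inter> {x..} \<inter> {..2 * x}) ?F (cutoff_bound x \<eta> \<theta> W)"
            unfolding s by (rule ramp) simp
          show "grad_bound_on (UNIV \<inter> {- (2 * x)..} \<inter> {- x..} \<inter> {x..} \<inter> {2 * x..}) ?F (cutoff_bound x \<eta> \<theta> W)"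
            by (rule zero) auto
        qed (use x in auto)
      qed (use x in auto)
    qed (use x in auto)
  qed simp
qed

text \<open>The angle is changed first, at a fixed cutoff factor, and then the factor, at the fixed
  angle \<open>\<theta> t\<close>. The constant 18 is the 9 from the squared bound for the factor
  change times the 2 in \<open>1 + 1 / \<eta> \<le> 2 / \<eta>\<close>.\<close>

lemma cutoff_pair_near:
  fixes \<theta> :: "real \<Rightarrow> real"
  assumes \<theta>: "0 \<le> \<theta> s" "\<theta> s \<le> 1" "0 \<le> \<theta> t" "\<theta> t \<le> 1" and x: "0 < x" and \<eta>: "0 < \<eta>" "\<eta> \<le> 1"
  shows "pair_kernel (\<lambda>s. cos (cutoff x s * \<theta> s)) (s, t) \<le> (1 + \<eta>) * pair_kernel (\<lambda>s. cos (\<theta> s)) (s, t) +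
    18 / \<eta> * (1 - cos (\<theta> t))\<^sup>2 * cut_kernel x (s - t)"
proof -
  define A where "A = \<bar>cos (\<theta> s) - cos (\<theta> t)\<bar>"
  define B where "B = 3 * \<bar>cutoff x s - cutoff x t\<bar> * (1 - cos (\<theta> t))"
  have "\<bar>cos (cutoff x s * \<theta> s) - cos (cutoff x t * \<theta> t)\<bar> \<le>
      \<bar>cos (cutoff x s * \<theta> s) - cos (cutoff x s * \<theta> t)\<bar> + \<bar>cos (cutoff x s * \<theta> t) - cos (cutoff x t * \<theta> t)\<bar>"
    by linarith
  also have "\<dots> \<le> A + B"
    unfolding A_def B_def using \<theta> cutoff_bounds
    by (intro add_mono cos_scale_diff_le cos_scale_diff_factor_le) auto
  finally have "(cos (cutoff x s * \<theta> s) - cos (cutoff x t * \<theta> t))\<^sup>2 \<le> (A + B)\<^sup>2"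
    by (intro sq_le_sq_of_abs_le) auto
  also have "\<dots> \<le> (1 + \<eta>) * A\<^sup>2 + (1 + 1 / \<eta>) * B\<^sup>2" by (rule sq_add_le[OF \<eta>(1)])
  finally have "(cos (cutoff x s * \<theta> s) - cos (cutoff x t * \<theta> t))\<^sup>2 / (s - t)\<^sup>2 / (2 * pi)
     \<le> ((1 + \<eta>) * A\<^sup>2 + (1 + 1 / \<eta>) * B\<^sup>2) / (s - t)\<^sup>2 / (2 * pi)"
    by (intro divide_right_mono) auto
  also have "\<dots> = (1 + \<eta>) * (A\<^sup>2 / (s - t)\<^sup>2 / (2 * pi)) + (1 + 1 / \<eta>) * (B\<^sup>2 / (s - t)\<^sup>2) / (2 * pi)"
    by (simp only: add_divide_distrib times_divide_eq_right)
  also have "(1 + 1 / \<eta>) * (B\<^sup>2 / (s - t)\<^sup>2) / (2 * pi) \<le> 18 / \<eta> * (1 - cos (\<theta> t))\<^sup>2 * cut_kernel x (s - t)"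
  proof -
    have "B\<^sup>2 / (s - t)\<^sup>2 = 9 * (1 - cos (\<theta> t))\<^sup>2 * ((cutoff x s - cutoff x t)\<^sup>2 / (s - t)\<^sup>2)"
      by (simp add: B_def power_mult_distrib)
    also have "\<dots> \<le> 9 * (1 - cos (\<theta> t))\<^sup>2 * cut_kernel x (s - t)"
      by (intro mult_left_mono cutoff_cut_kernel x) auto
    finally have b: "B\<^sup>2 / (s - t)\<^sup>2 \<le> 9 * (1 - cos (\<theta> t))\<^sup>2 * cut_kernel x (s - t)" .
    have "(1 + 1 / \<eta>) * (B\<^sup>2 / (s - t)\<^sup>2) / (2 * pi) \<le> (1 + 1 / \<eta>) * (B\<^sup>2 / (s - t)\<^sup>2) / 1"
      using \<eta> pi_gt3 by (intro divide_left_mono mult_nonneg_nonneg) auto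
    also have "\<dots> \<le> (2 / \<eta>) * (9 * (1 - cos (\<theta> t))\<^sup>2 * cut_kernel x (s - t))"
    proof -
      have "1 + 1 / \<eta> \<le> 2 / \<eta>" using \<eta> by (simp add: field_simps)
      then have "(1 + 1 / \<eta>) * (B\<^sup>2 / (s - t)\<^sup>2) \<le> (2 / \<eta>) * (9 * (1 - cos (\<theta> t))\<^sup>2 * cut_kernel x (s - t))"
        using b \<eta> by (intro mult_mono) auto
      then show ?thesis by simp
    qed
    finally show ?thesis by simp
  qed
  finally show ?thesis by (simp add: pair_kernel_def A_def)
qed

text \<open>Lowering \<open>b\<close> to \<open>b'\<close> raises \<open>(a - b)^2\<close> by at
  most \<open>2 * a * b\<close>, and \<open>(s - t)^2\<close> is at least \<open>t^2 / 4\<close>.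
  Young's inequality splits the resulting \<open>8 * b / t^2\<close> with a weight involving
  \<open>M\<close>, so that integrating \<open>a\<close> to at most \<open>M\<close> leaves exactly
  \<open>\<eta>\<close> in front of \<open>b^2\<close>.\<close>

lemma cutoff_pair_far:
  fixes g k M \<eta> x s t :: real
  assumes s: "\<bar>s\<bar> \<le> x / 2" and t: "x < \<bar>t\<bar>" and x: "0 < x" and \<eta>: "0 < \<eta>" and M: "0 < M"
    and a: "0 \<le> a" and b: "0 \<le> b'" "b' \<le> b"
  shows "(a - b')\<^sup>2 / (s - t)\<^sup>2 / (2 * pi) \<le> (a - b)\<^sup>2 / (s - t)\<^sup>2 / (2 * pi) +
    a * (\<eta> / M * b\<^sup>2 + 16 * M / (\<eta> * x\<^sup>2) * cut_kernel x t)"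
proof -
  have "(a - b')\<^sup>2 = (a - b)\<^sup>2 + (b - b') * (2 * a - b - b')" by (simp add: power2_eq_square algebra_simps)
  also have "(b - b') * (2 * a - b - b') \<le> (b - b') * (2 * a)" using b by (intro mult_left_mono) auto
  also have "\<dots> \<le> b * (2 * a)" using a b by (intro mult_right_mono) auto
  finally have 1: "(a - b')\<^sup>2 \<le> (a - b)\<^sup>2 + 2 * a * b" by (simp only: mult_ac)
  have t0: "0 < t\<^sup>2" using t x by auto
  have "\<bar>t\<bar> / 2 \<le> \<bar>s - t\<bar>" using s t by linarith
  then have "(\<bar>t\<bar> / 2)\<^sup>2 \<le> (s - t)\<^sup>2" by (intro sq_le_sq_of_abs_le) auto
  then have st: "t\<^sup>2 / 4 \<le> (s - t)\<^sup>2" by (simp add: power_divide)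
  then have st0: "0 < (s - t)\<^sup>2" using t0 by linarith
  have inv: "1 / (s - t)\<^sup>2 \<le> 4 / t\<^sup>2" using st st0 t0 by (simp add: field_simps)
  have "0 \<le> \<eta> / M * (b - 4 * M / (\<eta> * t\<^sup>2))\<^sup>2" using \<eta> M by simp
  also have "\<dots> = \<eta> / M * b\<^sup>2 - 8 * b / t\<^sup>2 + 16 * M / (\<eta> * t\<^sup>2) * (1 / t\<^sup>2)"
  proof -
    have "\<eta> / M * (b - 4 * M / (\<eta> * r))\<^sup>2 = \<eta> / M * b\<^sup>2 - 8 * b / r + 16 * M / (\<eta> * r) * (1 / r)" if "0 < r" for r
      using \<eta> M that by (simp add: power2_eq_square field_simps)
    from this[OF t0] show ?thesis .
  qed
  finally have am: "8 * b / t\<^sup>2 \<le> \<eta> / M * b\<^sup>2 + 16 * M / (\<eta> * t\<^sup>2) * (1 / t\<^sup>2)" by simp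
  have "x\<^sup>2 \<le> t\<^sup>2" using t x by (intro sq_le_sq_of_abs_le) auto
  then have "16 * M / (\<eta> * t\<^sup>2) \<le> 16 * M / (\<eta> * x\<^sup>2)"
    using \<eta> M x t0 by (intro divide_left_mono mult_left_mono mult_pos_pos) auto
  then have "16 * M / (\<eta> * t\<^sup>2) * (1 / t\<^sup>2) \<le> 16 * M / (\<eta> * x\<^sup>2) * cut_kernel x t"
    using t by (intro mult_mono) (use \<eta> M in \<open>auto simp: cut_kernel_def\<close>)
  with am have am': "8 * b / t\<^sup>2 \<le> \<eta> / M * b\<^sup>2 + 16 * M / (\<eta> * x\<^sup>2) * cut_kernel x t" by linarith
  have "(a - b')\<^sup>2 / (s - t)\<^sup>2 / (2 * pi) \<le> ((a - b)\<^sup>2 + 2 * a * b) / (s - t)\<^sup>2 / (2 * pi)"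
    using 1 by (intro divide_right_mono) auto
  also have "\<dots> = (a - b)\<^sup>2 / (s - t)\<^sup>2 / (2 * pi) + 2 * a * b * (1 / (s - t)\<^sup>2) / (2 * pi)"
    by (simp add: add_divide_distrib)
  also have "2 * a * b * (1 / (s - t)\<^sup>2) / (2 * pi) \<le> 2 * a * b * (1 / (s - t)\<^sup>2) / 1"
    using a b pi_gt3 by (intro divide_left_mono mult_nonneg_nonneg) auto
  also have "\<dots> \<le> 2 * a * b * (4 / t\<^sup>2)"
    using mult_left_mono[OF inv, of "2 * a * b"] a b by simp
  also have "\<dots> = a * (8 * b / t\<^sup>2)" by simp
  also have "\<dots> \<le> a * (\<eta> / M * b\<^sup>2 + 16 * M / (\<eta> * x\<^sup>2) * cut_kernel x t)" by (intro mult_left_mono am' a)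
  finally show ?thesis by simp
qed

section \<open>The energy balance of a truncation\<close>

context
  fixes \<theta> :: "real \<Rightarrow> real" and W :: "real \<Rightarrow> ennreal" and x \<eta> M :: real
  assumes bnd: "\<And>s. 0 \<le> \<theta> s" "\<And>s. \<theta> s \<le> pi" and x: "0 < x" and \<eta>: "0 < \<eta>" "\<eta> \<le> 1" and M: "0 < M"
    and small: "\<And>s. x / 2 \<le> \<bar>s\<bar> \<Longrightarrow> \<theta> s \<le> 1"
    and \<theta>_meas [measurable]: "\<theta> \<in> borel_measurable borel" and W_meas [measurable]: "W \<in> borel_measurable borel"
    and mass: "(\<integral>\<^sup>+s\<in>{-x..x}. ennreal (1 - cos (\<theta> s)) \<partial>lborel) \<le> ennreal M"
begin

text \<open>On the outer region \<open>X\<close> the angle is at most 1, so the small angle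
  estimates apply; on \<open>Y\<close> the truncated angle vanishes. Points outside \<open>X\<close>
  keep distance at least \<open>x / 2\<close> from the ramps.\<close>

private definition "X = {s::real. x / 2 < \<bar>s\<bar>}"
private definition "Y = {s::real. 2 * x < \<bar>s\<bar>}"
private lemma mem_X [simp]: "s \<in> X \<longleftrightarrow> x / 2 < \<bar>s\<bar>" by (simp add: X_def)
private lemma mem_Y [simp]: "s \<in> Y \<longleftrightarrow> 2 * x < \<bar>s\<bar>" by (simp add: Y_def)
private abbreviation (input) "\<theta>c \<equiv> \<lambda>s. cutoff x s * \<theta> s"
private abbreviation (input) "g \<equiv> \<lambda>s. 1 - cos (\<theta> s)"

lemma cutoff_cos_bounds: "0 \<le> 1 - cos (cutoff x s * \<theta> s)" "1 - cos (cutoff x s * \<theta> s) \<le> 1 - cos (\<theta> s)"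
proof -
  have "cutoff x s * \<theta> s \<le> 1 * \<theta> s" using bnd cutoff_bounds by (intro mult_right_mono) auto
  then have "cos (\<theta> s) \<le> cos (cutoff x s * \<theta> s)"
    using bnd cutoff_bounds by (intro cos_monotone_0_pi_le) auto
  then show "0 \<le> 1 - cos (cutoff x s * \<theta> s)" "1 - cos (cutoff x s * \<theta> s) \<le> 1 - cos (\<theta> s)" by auto
qed

text \<open>The right factor of \<open>cutoff_pair_far\<close> for
  \<open>b = 1 - cos (\<theta> t)\<close>; the indicator of \<open>X\<close> lets its first part
  integrate to tail energy.\<close>

private definition "q t = \<eta> / M * (indicator X t * (g t)\<^sup>2) + 16 * M / (\<eta> * x\<^sup>2) * cut_kernel x t" for t

private lemma q_nonneg: "0 \<le> q t"
  using \<eta> M x cut_kernel_nonneg[of x t] by (auto simp: q_def intro!: add_nonneg_nonneg mult_nonneg_nonneg)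

private lemma pair_far:
  assumes s: "s \<notin> X"
  shows "pair_kernel (\<lambda>s. cos (\<theta>c s)) (s, t) + indicator (Y \<times> Y) (s, t) * pair_kernel (\<lambda>s. cos (\<theta> s)) (s, t)
    \<le> pair_kernel (\<lambda>s. cos (\<theta> s)) (s, t) + indicator {-x..x} s * g s * q t"
proof (cases "\<bar>t\<bar> \<le> x")
  case True
  then have "cutoff x t = 1" "cutoff x s = 1" "t \<notin> Y" using s x by (auto intro!: cutoff_one)
  then have "pair_kernel (\<lambda>s. cos (\<theta>c s)) (s, t) + indicator (Y \<times> Y) (s, t) * pair_kernel (\<lambda>s. cos (\<theta> s)) (s, t)
      = pair_kernel (\<lambda>s. cos (\<theta> s)) (s, t)"
    by (simp add: pair_kernel_def)
  moreover have "0 \<le> indicator {-x..x} s * g s * q t" using q_nonneg[of t] by simp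
  ultimately show ?thesis by linarith
next
  case False
  then have t: "t \<in> X" and s': "s \<in> {-x..x}" "s \<notin> Y" "cutoff x s = 1" using s x by (auto intro!: cutoff_one)
  have "pair_kernel (\<lambda>s. cos (\<theta>c s)) (s, t) = (g s - (1 - cos (\<theta>c t)))\<^sup>2 / (s - t)\<^sup>2 / (2 * pi)"
    using s'(3) by (simp add: pair_kernel_def power2_commute[of "cos (\<theta> s)"])
  also have "\<dots> \<le> (g s - g t)\<^sup>2 / (s - t)\<^sup>2 / (2 * pi) + g s * (\<eta> / M * (g t)\<^sup>2 + 16 * M / (\<eta> * x\<^sup>2) * cut_kernel x t)"
    using s False cutoff_cos_bounds[of t] by (intro cutoff_pair_far x \<eta> M) auto
  also have "\<dots> = pair_kernel (\<lambda>s. cos (\<theta> s)) (s, t) + indicator {-x..x} s * g s * q t"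
    using t s' by (simp add: pair_kernel_def q_def power2_commute[of "cos (\<theta> s)"])
  finally show ?thesis using s'(2) by simp
qed

private lemma pair_sym: "pair_kernel u (s, t) = pair_kernel u (t, s)"
  by (simp add: pair_kernel_def power2_commute)

text \<open>The \<open>Y \<times> Y\<close> term stands on the left because the truncated pair
  energy vanishes there: it is what the truncation saves. The error terms on the right stem from
  pairs within \<open>X\<close> and from pairs of a core point and an outer point, the latter in
  both orders.\<close>

private lemma pair_total:
  "pair_kernel (\<lambda>s. cos (\<theta>c s)) (s, t) + indicator (Y \<times> Y) (s, t) * pair_kernel (\<lambda>s. cos (\<theta> s)) (s, t)
    \<le> pair_kernel (\<lambda>s. cos (\<theta> s)) (s, t) + \<eta> * (indicator (X \<times> X) (s, t) * pair_kernel (\<lambda>s. cos (\<theta> s)) (s, t))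
      + 18 / \<eta> * ((indicator X t * (g t)\<^sup>2) * cut_kernel x (s - t))
      + indicator {-x..x} s * g s * q t + indicator {-x..x} t * g t * q s"
proof -
  let ?P = "pair_kernel (\<lambda>s. cos (\<theta> s)) (s, t)"
  have P0: "0 \<le> ?P" by (rule pair_kernel_nonneg)
  have n1: "0 \<le> \<eta> * (indicator (X \<times> X) (s, t) * ?P)" using \<eta> P0 by simp
  have n2: "0 \<le> 18 / \<eta> * ((indicator X t * (g t)\<^sup>2) * cut_kernel x (s - t))" using \<eta> cut_kernel_nonneg[of x "s - t"] by simp
  have n3: "0 \<le> indicator {-x..x} s * g s * q t" "0 \<le> indicator {-x..x} t * g t * q s"
    using q_nonneg by simp_all
  consider "s \<notin> X" | "t \<notin> X" | "s \<in> X" "t \<in> X" "s \<in> Y" "t \<in> Y" | "s \<in> X" "t \<in> X" "(s, t) \<notin> Y \<times> Y" by blast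
  then show ?thesis
  proof cases
    case 1
    show ?thesis using pair_far[OF 1, of t] n1 n2 n3 by linarith
  next
    case 2
    have ind: "indicator (Y \<times> Y) (t, s) = (indicator (Y \<times> Y) (s, t) :: real)" by (auto simp: indicator_def)
    show ?thesis using pair_far[OF 2, of s] n1 n2 n3 unfolding pair_sym[of _ t s] ind by linarith
  next
    case 3
    then have "cutoff x s = 0" "cutoff x t = 0" using x by (auto intro!: cutoff_zero)
    then have "pair_kernel (\<lambda>s. cos (\<theta>c s)) (s, t) = 0" by (simp add: pair_kernel_def)
    moreover have "indicator (Y \<times> Y) (s, t) * ?P \<le> 1 * ?P" using P0 by (intro mult_right_mono) (auto simp: indicator_def)
    ultimately show ?thesis using n1 n2 n3 by linarith
  next
    case 4
    have "pair_kernel (\<lambda>s. cos (\<theta>c s)) (s, t) \<le> (1 + \<eta>) * ?P + 18 / \<eta> * (g t)\<^sup>2 * cut_kernel x (s - t)"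
      using 4 small[of s] small[of t] by (intro cutoff_pair_near bnd x \<eta>) auto
    moreover have "(1 + \<eta>) * ?P = ?P + \<eta> * ?P" by (simp add: algebra_simps)
    moreover have "indicator (Y \<times> Y) (s, t) = (0::real)" "indicator (X \<times> X) (s, t) = (1::real)" "indicator X t = (1::real)"
      using 4 by (auto simp: indicator_def)
    ultimately show ?thesis using n3 by simp
  qed
qed

private definition "TL = (\<integral>\<^sup>+s\<in>X. ennreal ((cos (\<theta> s) - 1)\<^sup>2) \<partial>lborel)"
private definition "TN = (\<integral>\<^sup>+z\<in>X \<times> X. ennreal (pair_kernel (\<lambda>s. cos (\<theta> s)) z) \<partial>lborel)"
private definition "TW = (\<integral>\<^sup>+s\<in>X. W s \<partial>lborel)"

private lemma g_TL: "(\<integral>\<^sup>+s. ennreal (indicator X s * (g s)\<^sup>2) \<partial>lborel) = TL"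
  unfolding TL_def by (intro nn_integral_cong) (auto simp: indicator_def power2_commute)

private lemma XY_meas [measurable]: "X \<in> sets borel" "Y \<in> sets borel" "X \<times> X \<in> sets borel" "Y \<times> Y \<in> sets borel"
proof -
  show X: "X \<in> sets borel" and Y: "Y \<in> sets borel" unfolding X_def Y_def by measurable
  show "X \<times> X \<in> sets borel" "Y \<times> Y \<in> sets borel"
    unfolding borel_prod[symmetric] using X Y by (auto intro!: pair_measureI)
qed

text \<open>The weight \<open>M\<close> in \<open>q\<close> cancels against the mass of the core in
  the first term. In the second, 64 is 16 times the 4 from the integral of
  \<open>cut_kernel\<close>.\<close>

private lemma q_int: "(\<integral>\<^sup>+s. ennreal (indicator {-x..x} s * g s) \<partial>lborel) * (\<integral>\<^sup>+t. ennreal (q t) \<partial>lborel)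
    \<le> ennreal \<eta> * TL + ennreal (64 * M\<^sup>2 / (\<eta> * x^3))"
proof -
  have "(\<integral>\<^sup>+s. ennreal (indicator {-x..x} s * g s) \<partial>lborel) = (\<integral>\<^sup>+s\<in>{-x..x}. ennreal (g s) \<partial>lborel)"
    by (intro nn_integral_cong) (auto simp: indicator_def)
  then have m: "(\<integral>\<^sup>+s. ennreal (indicator {-x..x} s * g s) \<partial>lborel) \<le> ennreal M" using mass by simp
  have "(\<integral>\<^sup>+t. ennreal (q t) \<partial>lborel) = (\<integral>\<^sup>+t. ennreal (\<eta> / M) * ennreal (indicator X t * (g t)\<^sup>2) + ennreal (16 * M / (\<eta> * x\<^sup>2)) * ennreal (cut_kernel x t) \<partial>lborel)"
    using \<eta> M x cut_kernel_nonneg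
    by (intro nn_integral_cong) (simp add: q_def ennreal_mult[symmetric] flip: ennreal_plus)
  also have "\<dots> = ennreal (\<eta> / M) * TL + ennreal (16 * M / (\<eta> * x\<^sup>2)) * (\<integral>\<^sup>+t. ennreal (cut_kernel x t) \<partial>lborel)"
    by (simp add: nn_integral_add nn_integral_cmult g_TL)
  also have "\<dots> \<le> ennreal (\<eta> / M) * TL + ennreal (16 * M / (\<eta> * x\<^sup>2)) * ennreal (4 / x)"
    by (intro add_left_mono mult_left_mono nn_integral_cut_kernel x) auto
  finally have qi: "(\<integral>\<^sup>+t. ennreal (q t) \<partial>lborel) \<le> \<dots>" .
  have "(\<integral>\<^sup>+s. ennreal (indicator {-x..x} s * g s) \<partial>lborel) * (\<integral>\<^sup>+t. ennreal (q t) \<partial>lborel)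
    \<le> ennreal M * (ennreal (\<eta> / M) * TL + ennreal (16 * M / (\<eta> * x\<^sup>2)) * ennreal (4 / x))"
    by (intro mult_mono m qi) auto
  also have "\<dots> = ennreal \<eta> * TL + ennreal (64 * M\<^sup>2 / (\<eta> * x^3))"
  proof -
    have "ennreal M * (ennreal (\<eta> / M) * TL) = ennreal \<eta> * TL"
      using \<eta> M by (simp add: mult.assoc[symmetric] ennreal_mult[symmetric])
    moreover have "ennreal M * (ennreal (16 * M / (\<eta> * x\<^sup>2)) * ennreal (4 / x)) = ennreal (64 * M\<^sup>2 / (\<eta> * x^3))"
      using \<eta> M x by (simp add: ennreal_mult[symmetric] power2_eq_square power3_eq_cube mult_ac)
    ultimately show ?thesis by (simp add: distrib_left)
  qed
  finally show ?thesis .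
qed

text \<open>Integrated over the plane, the pairs in the tails give \<open>18 / \<eta>\<close> times
  \<open>4 / x\<close>, and the two orders of the pairs between core and tail double the bound of
  \<open>q_int\<close>.\<close>

private lemma pair_int:
  "(\<integral>\<^sup>+z. ennreal (pair_kernel (\<lambda>s. cos (\<theta>c s)) z) \<partial>lborel) + (\<integral>\<^sup>+z\<in>Y \<times> Y. ennreal (pair_kernel (\<lambda>s. cos (\<theta> s)) z) \<partial>lborel)
   \<le> (\<integral>\<^sup>+z. ennreal (pair_kernel (\<lambda>s. cos (\<theta> s)) z) \<partial>lborel) + ennreal \<eta> * TN
     + ennreal (72 / (\<eta> * x) + 2 * \<eta>) * TL + ennreal (128 * M\<^sup>2 / (\<eta> * x^3))"
proof -
  have c [measurable]: "cutoff x \<in> borel_measurable borel"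
    by (rule borel_measurable_continuous_onI[OF cutoff_continuous])
  have pm [measurable]: "pair_kernel (\<lambda>s. cos (\<theta> s)) \<in> borel_measurable borel"
    "pair_kernel (\<lambda>s. cos (\<theta>c s)) \<in> borel_measurable borel" by (rule pair_kernel_measurable, measurable)+
  have qm [measurable]: "q \<in> borel_measurable borel" unfolding q_def[abs_def] by measurable
  let ?f = "\<lambda>t. ennreal (indicator X t * (g t)\<^sup>2)" and ?b = "\<lambda>s. ennreal (indicator {-x..x} s * g s)"
    and ?q = "\<lambda>s. ennreal (q s)" and ?k = "\<lambda>r. ennreal (cut_kernel x r)"
    and ?P = "\<lambda>z. ennreal (pair_kernel (\<lambda>s. cos (\<theta> s)) z)"
  have em [measurable]: "(\<lambda>z::real\<times>real. ?f (snd z) * ?k (fst z - snd z)) \<in> borel_measurable borel"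
    "(\<lambda>z::real\<times>real. ?b (fst z) * ?q (snd z)) \<in> borel_measurable borel"
    "(\<lambda>z::real\<times>real. ?q (fst z) * ?b (snd z)) \<in> borel_measurable borel"
    unfolding borel_prod[symmetric] by measurable
  have "(\<integral>\<^sup>+z. ennreal (pair_kernel (\<lambda>s. cos (\<theta>c s)) z) \<partial>lborel) + (\<integral>\<^sup>+z\<in>Y \<times> Y. ?P z \<partial>lborel)
    = (\<integral>\<^sup>+z. ennreal (pair_kernel (\<lambda>s. cos (\<theta>c s)) z) + ?P z * indicator (Y \<times> Y) z \<partial>lborel)"
    by (rule nn_integral_add[symmetric]) auto
  also have "\<dots> \<le> (\<integral>\<^sup>+z. ?P z + ennreal \<eta> * (?P z * indicator (X \<times> X) z) + ennreal (18 / \<eta>) * (?f (snd z) * ?k (fst z - snd z))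
      + ?b (fst z) * ?q (snd z) + ?q (fst z) * ?b (snd z) \<partial>lborel)"
  proof (rule nn_integral_mono)
    fix z :: "real \<times> real"
    have ind: "?P z * indicator S z = ennreal (indicator S z * pair_kernel (\<lambda>s. cos (\<theta> s)) z)" for S
      by (simp add: indicator_def)
    have g0: "0 \<le> g s" for s by simp
    have "ennreal (pair_kernel (\<lambda>s. cos (\<theta>c s)) z) + ?P z * indicator (Y \<times> Y) z
      = ennreal (pair_kernel (\<lambda>s. cos (\<theta>c s)) z + indicator (Y \<times> Y) z * pair_kernel (\<lambda>s. cos (\<theta> s)) z)"
      unfolding ind by (rule ennreal_plus[symmetric]) (auto simp: pair_kernel_nonneg)
    also have "\<dots> \<le> ennreal (pair_kernel (\<lambda>s. cos (\<theta> s)) z + \<eta> * (indicator (X \<times> X) z * pair_kernel (\<lambda>s. cos (\<theta> s)) z)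
      + 18 / \<eta> * ((indicator X (snd z) * (g (snd z))\<^sup>2) * cut_kernel x (fst z - snd z))
      + indicator {-x..x} (fst z) * g (fst z) * q (snd z) + indicator {-x..x} (snd z) * g (snd z) * q (fst z))"
      using pair_total[of "fst z" "snd z"] by (intro ennreal_leI) simp
    also have "\<dots> = ?P z + ennreal \<eta> * (?P z * indicator (X \<times> X) z) + ennreal (18 / \<eta>) * (?f (snd z) * ?k (fst z - snd z))
      + ?b (fst z) * ?q (snd z) + ?q (fst z) * ?b (snd z)"
      unfolding ind using \<eta> x g0 q_nonneg pair_kernel_nonneg cut_kernel_nonneg
      by (simp add: ennreal_mult[symmetric] mult_ac flip: ennreal_plus)
    finally show "ennreal (pair_kernel (\<lambda>s. cos (\<theta>c s)) z) + ?P z * indicator (Y \<times> Y) z \<le> \<dots>" .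
  qed
  also have "\<dots> = (\<integral>\<^sup>+z. ?P z \<partial>lborel) + ennreal \<eta> * TN + ennreal (18 / \<eta>) * (TL * (\<integral>\<^sup>+r. ?k r \<partial>lborel))
     + (\<integral>\<^sup>+s. ?b s \<partial>lborel) * (\<integral>\<^sup>+s. ?q s \<partial>lborel) + (\<integral>\<^sup>+s. ?b s \<partial>lborel) * (\<integral>\<^sup>+s. ?q s \<partial>lborel)"
  proof -
    have gen: "(\<integral>\<^sup>+z. A z + c * B z + d * C z + D z + E z \<partial>lborel) =
      (\<integral>\<^sup>+z. A z \<partial>lborel) + c * (\<integral>\<^sup>+z. B z \<partial>lborel) + d * (\<integral>\<^sup>+z. C z \<partial>lborel) + (\<integral>\<^sup>+z. D z \<partial>lborel) + (\<integral>\<^sup>+z. E z \<partial>lborel)"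
      if [measurable]: "A \<in> borel_measurable borel" "B \<in> borel_measurable borel" "C \<in> borel_measurable borel"
        "D \<in> borel_measurable borel" "E \<in> borel_measurable borel"
      for A B C D E :: "real \<times> real \<Rightarrow> ennreal" and c d
      by (simp add: nn_integral_add nn_integral_cmult)
    have m: "?f \<in> borel_measurable borel" "?k \<in> borel_measurable borel" "?b \<in> borel_measurable borel" "?q \<in> borel_measurable borel"
      by measurable
    have P: "?P \<in> borel_measurable borel" "(\<lambda>z. ?P z * indicator (X \<times> X) z) \<in> borel_measurable borel"
      by measurable
    show ?thesis
      unfolding gen[OF P em] plane_convolution(2)[OF m(1,2)] plane_product[OF m(3,4)] plane_product[OF m(4,3)] g_TL TN_def
        mult.commute[of "\<integral>\<^sup>+s. ?q s \<partial>lborel"] ..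
  qed
  also have "\<dots> \<le> (\<integral>\<^sup>+z. ?P z \<partial>lborel) + ennreal \<eta> * TN + ennreal (18 / \<eta>) * (TL * ennreal (4 / x))
     + (ennreal \<eta> * TL + ennreal (64 * M\<^sup>2 / (\<eta> * x^3))) + (ennreal \<eta> * TL + ennreal (64 * M\<^sup>2 / (\<eta> * x^3)))"
    by (intro add_mono mult_left_mono q_int nn_integral_cut_kernel x order_refl) auto
  also have "\<dots> = (\<integral>\<^sup>+z. ?P z \<partial>lborel) + ennreal \<eta> * TN + (ennreal (18 / \<eta>) * ennreal (4 / x) + ennreal \<eta> + ennreal \<eta>) * TL
     + (ennreal (64 * M\<^sup>2 / (\<eta> * x^3)) + ennreal (64 * M\<^sup>2 / (\<eta> * x^3)))"
    by (simp only: distrib_left distrib_right ac_simps)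
  also have "ennreal (18 / \<eta>) * ennreal (4 / x) + ennreal \<eta> + ennreal \<eta> = ennreal (72 / (\<eta> * x) + 2 * \<eta>)"
    using \<eta> x by (simp add: ennreal_mult[symmetric] flip: ennreal_plus)
  also have "ennreal (64 * M\<^sup>2 / (\<eta> * x^3)) + ennreal (64 * M\<^sup>2 / (\<eta> * x^3)) = ennreal (128 * M\<^sup>2 / (\<eta> * x^3))"
    using \<eta> x by (subst ennreal_plus[symmetric]) auto
  finally show ?thesis .
qed

text \<open>On the ramps the product rule leaves a multiple of the square of \<open>\<theta>\<close>
  over \<open>x^2\<close>, which is linear in \<open>1 - cos \<theta>\<close>. Completing the square
  turns it into \<open>\<eta> * (1 - cos \<theta>)^2\<close>, part of the tail energy, plus the
  constant \<open>9 / (\<eta>^3 * x^4)\<close>, integrated over a length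
  \<open>4 * x\<close>.\<close>

private lemma W_int:
  "(\<integral>\<^sup>+v. cutoff_bound x \<eta> \<theta> W v \<partial>lborel) + (\<integral>\<^sup>+v\<in>Y. W v \<partial>lborel)
    \<le> (\<integral>\<^sup>+v. W v \<partial>lborel) + ennreal \<eta> * TW + ennreal \<eta> * TL + ennreal (36 / (\<eta>^3 * x^3))"
proof -
  have [measurable]: "cutoff_bound x \<eta> \<theta> W \<in> borel_measurable borel" unfolding cutoff_bound_def[abs_def] by measurable
  let ?c = "9 / (\<eta>^3 * x^4)"
  have pt: "cutoff_bound x \<eta> \<theta> W v + W v * indicator Y v \<le> W v + ennreal \<eta> * (W v * indicator X v)
      + ennreal \<eta> * ennreal (indicator X v * (g v)\<^sup>2) + ennreal ?c * indicator {- 2 * x..2 * x} v" for v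
  proof -
    consider "\<bar>v\<bar> \<le> x" | "x < \<bar>v\<bar>" "\<bar>v\<bar> < 2 * x" | "2 * x \<le> \<bar>v\<bar>" by linarith
    then show ?thesis
    proof cases
      case 1
      then have "v \<notin> Y" using x by auto
      then show ?thesis using 1 by (simp add: cutoff_bound_def add.assoc)
    next
      case 2
      then have v: "v \<in> X" "v \<notin> Y" "v \<in> {- 2 * x..2 * x}" using x by auto
      have "(\<theta> v)\<^sup>2 \<le> 3 * g v" using small[of v] 2 x bnd by (intro sq_le_three_one_minus_cos) auto
      moreover have "1 + 1 / \<eta> \<le> 2 / \<eta>" using \<eta> by (simp add: field_simps)
      ultimately have "(1 + 1 / \<eta>) / x\<^sup>2 * (\<theta> v)\<^sup>2 \<le> (2 / \<eta>) / x\<^sup>2 * (3 * g v)"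
        using \<eta> x by (intro mult_mono divide_right_mono) auto
      also have "\<dots> \<le> \<eta> * (g v)\<^sup>2 + ?c"
      proof -
        have "0 \<le> \<eta> * (g v - 3 / (\<eta>\<^sup>2 * x\<^sup>2))\<^sup>2" using \<eta> by simp
        also have "\<dots> = \<eta> * (g v)\<^sup>2 - (2 / \<eta>) / x\<^sup>2 * (3 * g v) + ?c"
        proof -
          have e: "(G - 3 / (\<eta>\<^sup>2 * x\<^sup>2))\<^sup>2 * \<eta> = \<eta> * G\<^sup>2 - (2 / \<eta>) / x\<^sup>2 * (3 * G) + ?c" for G
            using \<eta> x by (simp add: power2_eq_square power3_eq_cube power4_eq_xxxx field_simps)
          show ?thesis using e[of "g v"] by (simp only: mult.commute)
        qed
        finally show ?thesis by simp
      qed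
      finally have "ennreal ((1 + 1 / \<eta>) / x\<^sup>2) * ennreal ((\<theta> v)\<^sup>2) \<le> ennreal \<eta> * ennreal ((g v)\<^sup>2) + ennreal ?c"
        using \<eta> x by (simp add: ennreal_mult[symmetric] ennreal_leI flip: ennreal_plus)
      then have "ennreal (1 + \<eta>) * W v + ennreal ((1 + 1 / \<eta>) / x\<^sup>2) * ennreal ((\<theta> v)\<^sup>2) \<le> (W v + ennreal \<eta> * W v) + (ennreal \<eta> * ennreal ((g v)\<^sup>2) + ennreal ?c)"
        using \<eta> by (intro add_mono) (simp_all add: distrib_right)
      then show ?thesis using 2 v by (simp add: cutoff_bound_def add.assoc)
    next
      case 3
      have "W v * indicator Y v \<le> W v" by (simp add: indicator_def)
      then show ?thesis using 3 x by (simp add: cutoff_bound_def add.assoc add_increasing2)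
    qed
  qed
  have "(\<integral>\<^sup>+v. cutoff_bound x \<eta> \<theta> W v \<partial>lborel) + (\<integral>\<^sup>+v\<in>Y. W v \<partial>lborel)
     = (\<integral>\<^sup>+v. cutoff_bound x \<eta> \<theta> W v + W v * indicator Y v \<partial>lborel)"
    by (rule nn_integral_add[symmetric]) auto
  also have "\<dots> \<le> (\<integral>\<^sup>+v. W v + ennreal \<eta> * (W v * indicator X v)
      + ennreal \<eta> * ennreal (indicator X v * (g v)\<^sup>2) + ennreal ?c * indicator {- 2 * x..2 * x} v \<partial>lborel)"
    by (intro nn_integral_mono pt)
  also have "\<dots> = (\<integral>\<^sup>+v. W v \<partial>lborel) + ennreal \<eta> * TW + ennreal \<eta> * TL + ennreal ?c * ennreal (4 * x)"
    using x by (simp add: nn_integral_add nn_integral_cmult g_TL TW_def nn_integral_cmult_indicator)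
  also have "ennreal ?c * ennreal (4 * x) = ennreal (36 / (\<eta>^3 * x^3))"
    using \<eta> x by (subst ennreal_mult[symmetric]) (auto simp: power3_eq_cube power4_eq_xxxx)
  finally show ?thesis .
qed

private lemma L_int:
  "(\<integral>\<^sup>+s. ennreal ((cos (\<theta>c s) - 1)\<^sup>2) \<partial>lborel) + (\<integral>\<^sup>+s\<in>Y. ennreal ((cos (\<theta> s) - 1)\<^sup>2) \<partial>lborel)
    \<le> (\<integral>\<^sup>+s. ennreal ((cos (\<theta> s) - 1)\<^sup>2) \<partial>lborel)"
proof -
  have c [measurable]: "cutoff x \<in> borel_measurable borel"
    by (rule borel_measurable_continuous_onI[OF cutoff_continuous])
  have "ennreal ((cos (\<theta>c s) - 1)\<^sup>2) + ennreal ((cos (\<theta> s) - 1)\<^sup>2) * indicator Y s \<le> ennreal ((cos (\<theta> s) - 1)\<^sup>2)" for s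
  proof (cases "s \<in> Y")
    case True
    then have "cutoff x s = 0" using x by (auto intro!: cutoff_zero)
    then show ?thesis using True by simp
  next
    case False
    have "(cos (\<theta>c s) - 1)\<^sup>2 \<le> (cos (\<theta> s) - 1)\<^sup>2"
      using cutoff_cos_bounds[of s] by (intro sq_le_sq_of_abs_le) auto
    then show ?thesis using False by (simp add: ennreal_leI)
  qed
  then show ?thesis
    by (subst nn_integral_add[symmetric]) (auto intro!: nn_integral_mono)
qed

text \<open>The energy beyond \<open>2 * x\<close> on the left is the yield of the truncation. For a
  minimiser the truncated energy cannot fall below the original one, so this becomes a bound of the
  tail beyond \<open>2 * x\<close> by a small multiple of the tail beyond
  \<open>x / 2\<close>.\<close>

lemma cutoff_energy:
  "energy2 1 (\<lambda>s. cutoff x s * \<theta> s) (cutoff_bound x \<eta> \<theta> W) UNIV + energy2 1 \<theta> W {s. 2 * x < \<bar>s\<bar>}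
    \<le> energy2 1 \<theta> W UNIV + ennreal (3 * \<eta> + 72 / (\<eta> * x)) * energy2 1 \<theta> W {s. x / 2 < \<bar>s\<bar>}
      + ennreal ((36 / \<eta>^3 + 128 * M\<^sup>2 / \<eta>) / x^3)"
proof -
  let ?\<kappa> = "72 / (\<eta> * x) + 2 * \<eta>"
  have k: "0 \<le> ?\<kappa>" using \<eta> x by simp
  have arr: "(a' + b' + c') + (a1 + b1 + c1) \<le> (a + b + c) + (h * tw + h * tn + h * tl + k * tl) + (k1 + k2)"
    if "a' + a1 \<le> a + h * tw + h * tl + k1" "b' + b1 \<le> b + h * tn + k * tl + k2" "c' + c1 \<le> c"
    for a b c a' b' c' a1 b1 c1 h k tw tn tl k1 k2 :: ennreal
    using add_mono[OF add_mono[OF that(1,2)] that(3)] by (simp only: ac_simps)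
  have "energy2 1 (\<lambda>s. cutoff x s * \<theta> s) (cutoff_bound x \<eta> \<theta> W) UNIV + energy2 1 \<theta> W Y
    \<le> energy2 1 \<theta> W UNIV + (ennreal \<eta> * TW + ennreal \<eta> * TN + ennreal \<eta> * TL + ennreal ?\<kappa> * TL)
      + (ennreal (36 / (\<eta>^3 * x^3)) + ennreal (128 * M\<^sup>2 / (\<eta> * x^3)))"
    unfolding energy2_def using arr[OF W_int pair_int L_int] by (simp only: UNIV_Times_UNIV indicator_UNIV mult_1_right)
  also have "\<dots> \<le> energy2 1 \<theta> W UNIV + ennreal (3 * \<eta> + 72 / (\<eta> * x)) * energy2 1 \<theta> W X
      + ennreal ((36 / \<eta>^3 + 128 * M\<^sup>2 / \<eta>) / x^3)"
  proof (intro add_mono order_refl)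
    have "ennreal \<eta> * TW + ennreal \<eta> * TN + ennreal \<eta> * TL + ennreal ?\<kappa> * TL
       \<le> ennreal \<eta> * (TW + TN + TL) + ennreal ?\<kappa> * (TW + TN + TL)"
      by (intro add_mono mult_left_mono) (auto simp: distrib_left add_increasing)
    also have "\<dots> = (ennreal \<eta> + ennreal ?\<kappa>) * (TW + TN + TL)" by (simp only: distrib_right)
    also have "ennreal \<eta> + ennreal ?\<kappa> = ennreal (3 * \<eta> + 72 / (\<eta> * x))"
      using \<eta> k by (subst ennreal_plus[symmetric]) (auto simp: algebra_simps)
    finally show "ennreal \<eta> * TW + ennreal \<eta> * TN + ennreal \<eta> * TL + ennreal ?\<kappa> * TL
       \<le> ennreal (3 * \<eta> + 72 / (\<eta> * x)) * energy2 1 \<theta> W X"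
      by (simp add: energy2_def TW_def TN_def TL_def)
    have "(36 / \<eta>^3 + 128 * M\<^sup>2 / \<eta>) / x^3 = 36 / (\<eta>^3 * x^3) + 128 * M\<^sup>2 / (\<eta> * x^3)"
      by (simp add: add_divide_distrib)
    then show "ennreal (36 / (\<eta>^3 * x^3)) + ennreal (128 * M\<^sup>2 / (\<eta> * x^3)) \<le> ennreal ((36 / \<eta>^3 + 128 * M\<^sup>2 / \<eta>) / x^3)"
      using \<eta> x by (simp flip: ennreal_plus)
  qed
  finally show ?thesis unfolding X_def Y_def .
qed

end

section \<open>Mass and tail energy of a minimiser\<close>

lemma contraction_decay:
  fixes T :: "real \<Rightarrow> real"
  assumes y0: "0 < y0" and bd: "\<And>y. T y \<le> E" "\<And>y. 0 \<le> T y"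
    and step: "\<And>y. y0 \<le> y \<Longrightarrow> T (4 * y) \<le> T y / 32 + C / y\<^sup>2"
  shows "\<exists>K\<ge>0. \<forall>y\<ge>y0. T y \<le> K / y\<^sup>2"
proof -
  \<comment> \<open>From \<open>y\<close> to \<open>4 * y\<close> the factor \<open>y^2\<close>
    grows by 16, while \<open>T\<close> shrinks by 32 up to the error; so \<open>y^2 * T y\<close>
    is halved up to an additive \<open>16 * C\<close>. The second entry makes \<open>K\<close>
    stable under this map, the first covers the initial scale \<open>y < 4 * y0\<close>.\<close>
  define K where "K = max (16 * y0\<^sup>2 * E) (32 * C)"
  have E: "0 \<le> E" using bd(1,2)[of 0] by linarith
  have K: "0 \<le> K" "32 * C \<le> K" "16 * y0\<^sup>2 * E \<le> K" using E by (auto simp: K_def le_max_iff_disj)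
  have main: "y\<^sup>2 * T y \<le> K" if "y0 \<le> y" "y < y0 * 4 ^ Suc n" for n y
    using that
  proof (induction n arbitrary: y)
    case 0
    then have "y\<^sup>2 \<le> (4 * y0)\<^sup>2" using y0 by (intro power_mono) auto
    then have "y\<^sup>2 * T y \<le> (4 * y0)\<^sup>2 * E" using bd[of y] E by (intro mult_mono) auto
    then show ?case using K(3) by (simp add: power_mult_distrib)
  next
    case (Suc n)
    show ?case
    proof (cases "y < y0 * 4 ^ Suc n")
      case True
      then show ?thesis using Suc by blast
    next
      case False
      define z where "z = y / 4"
      have "y0 * 4 \<le> y0 * 4 ^ Suc n" using y0 by simp
      then have z: "y0 \<le> z" "z < y0 * 4 ^ Suc n" using False Suc.prems by (auto simp: z_def)
      have z0: "0 < z\<^sup>2" using z y0 by simp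
      have "y\<^sup>2 * T y = 16 * z\<^sup>2 * T (4 * z)" by (simp add: z_def power_divide)
      also have "\<dots> \<le> 16 * z\<^sup>2 * (T z / 32 + C / z\<^sup>2)" by (intro mult_left_mono step z) auto
      also have "\<dots> = z\<^sup>2 * T z / 2 + 16 * C" using z0 by (simp add: field_simps)
      also have "\<dots> \<le> K / 2 + K / 2" using Suc.IH[OF z] K(2) by linarith
      finally show ?thesis by simp
    qed
  qed
  have "T y \<le> K / y\<^sup>2" if y: "y0 \<le> y" for y
  proof -
    obtain n where "y / y0 < 4 ^ n" using real_arch_pow[of 4 "y / y0"] by auto
    also have "(4::real) ^ n \<le> 4 ^ Suc n" by simp
    finally have "y < y0 * 4 ^ Suc n" using y0 by (simp add: field_simps)
    from main[OF y this] show ?thesis using y y0 by (simp add: field_simps)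
  qed
  then show ?thesis using K(1) by blast
qed

lemma cutoff_profile:
  assumes pr: "profile a \<theta> W p" and x: "0 < x" and \<eta>: "0 < \<eta>" and p: "\<And>i. i < 2 * a - 1 \<Longrightarrow> \<bar>p i\<bar> \<le> x"
  shows "profile a (\<lambda>s. cutoff x s * \<theta> s) (cutoff_bound x \<eta> \<theta> W) p"
proof -
  have cont: "continuous_on UNIV \<theta>" and bnd: "\<And>x. 0 \<le> \<theta> x" "\<And>x. \<theta> x \<le> pi"
    and gb: "grad_bound \<theta> W" and t: "touches a \<theta> p" using pr by (auto simp: profile_def)
  have "cutoff x s * \<theta> s \<le> 1 * pi" for s using bnd cutoff_bounds by (intro mult_mono) auto
  moreover have "touches a (\<lambda>s. cutoff x s * \<theta> s) p"
    using t p cutoff_one[OF x] by (simp add: touches_def)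
  ultimately show ?thesis
    unfolding profile_def using bnd cutoff_bounds grad_bound_cutoff_bound[OF gb cont bnd(1) x \<eta>]
    by (auto intro!: continuous_intros cutoff_continuous cont)
qed

text \<open>The quantity that governs the attraction: two profiles at a distance of order
  \<open>x\<close> interact with strength about the product of their masses over \<open>x^2\<close>.
  It depends on \<open>x\<close> because integrability of \<open>1 - cos \<theta>\<close> on the
  whole line is not known.\<close>

definition mass :: "(real \<Rightarrow> real) \<Rightarrow> real \<Rightarrow> real" where
  "mass \<theta> x = enn2real (\<integral>\<^sup>+s\<in>{-x..x}. ennreal (1 - cos (\<theta> s)) \<partial>lborel)"

lemma mass_eq:
  assumes "0 \<le> x"
  shows "(\<integral>\<^sup>+s\<in>{-x..x}. ennreal (1 - cos (\<theta> s)) \<partial>lborel) = ennreal (mass \<theta> x)"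
proof -
  have "(\<integral>\<^sup>+s\<in>{-x..x}. ennreal (1 - cos (\<theta> s)) \<partial>lborel) \<le> (\<integral>\<^sup>+s\<in>{-x..x}. ennreal 2 \<partial>lborel)"
  proof (intro nn_integral_mono mult_right_mono ennreal_leI)
    show "1 - cos (\<theta> s) \<le> 2" for s using cos_ge_minus_one[of "\<theta> s"] by linarith
  qed simp
  also have "\<dots> = ennreal 2 * ennreal (2 * x)"
    using assms by (subst nn_integral_cmult_indicator) auto
  also have "\<dots> < top" by (simp add: ennreal_mult_less_top)
  finally show ?thesis by (simp add: mass_def)
qed

lemma mass_nonneg: "0 \<le> mass \<theta> x"
  by (simp add: mass_def)

text \<open>The angle is \<open>pi\<close> at \<open>p 0\<close>. By Hoelder continuity it drops by
  at most 1 on an interval of length \<open>1 / (E + 1)\<close>, so it stays above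
  \<open>pi / 2\<close> there and the integrand is at least 1.\<close>

lemma mass_lower_bound:
  assumes pr: "profile a \<theta> W p" and a: "1 \<le> a" and E: "(\<integral>\<^sup>+s. W s \<partial>lborel) \<le> ennreal E" "0 \<le> E"
    and x: "\<bar>p 0\<bar> + 1 \<le> x"
  shows "1 / (E + 1) \<le> mass \<theta> x"
proof -
  have gb: "grad_bound \<theta> W" and p0: "\<theta> (p 0) = pi" and bnd: "\<And>x. 0 \<le> \<theta> x" "\<And>x. \<theta> x \<le> pi"
    using pr a by (auto simp: profile_def touches_def)
  define \<rho> where "\<rho> = 1 / (E + 1)"
  have \<rho>: "0 < \<rho>" "\<rho> \<le> 1" using E by (auto simp: \<rho>_def)
  have ge: "1 \<le> 1 - cos (\<theta> s)" if "s \<in> {p 0..p 0 + \<rho>}" for s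
  proof -
    have "(\<theta> s - \<theta> (p 0))\<^sup>2 \<le> E * \<bar>s - p 0\<bar>"
      using grad_bound_on_holder[OF gb, of E "p 0" s] E by simp
    also have "\<dots> \<le> E * \<rho>" using that E by (intro mult_left_mono) auto
    also have "\<dots> \<le> 1\<^sup>2" using E by (simp add: \<rho>_def)
    finally have "\<bar>\<theta> s - pi\<bar> \<le> 1" unfolding p0 by (simp only: abs_le_square_iff[symmetric])
    then have "pi / 2 \<le> \<theta> s" using pi_gt3 by linarith
    then have "cos (\<theta> s) \<le> cos (pi / 2)" using bnd by (intro cos_monotone_0_pi_le) auto
    then show ?thesis by simp
  qed
  have "ennreal \<rho> = (\<integral>\<^sup>+s. indicator {p 0..p 0 + \<rho>} s \<partial>lborel)" using \<rho> by simp
  also have "\<dots> \<le> (\<integral>\<^sup>+s\<in>{-x..x}. ennreal (1 - cos (\<theta> s)) \<partial>lborel)"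
  proof (rule nn_integral_mono)
    fix s
    show "indicator {p 0..p 0 + \<rho>} s \<le> ennreal (1 - cos (\<theta> s)) * indicator {-x..x} s"
    proof (cases "s \<in> {p 0..p 0 + \<rho>}")
      case True
      then have "s \<in> {-x..x}" using x \<rho> by auto
      then show ?thesis using True ennreal_leI[OF ge[OF True]] by simp
    qed simp
  qed
  also have "\<dots> = ennreal (mass \<theta> x)" using x by (intro mass_eq) linarith
  finally show ?thesis by (simp add: \<rho>_def ennreal_le_iff mass_nonneg)
qed

text \<open>Cauchy-Schwarz on \<open>[-x, x]\<close>. This growth turns the error
  \<open>mass^2 / x^3\<close> of a truncation into one of order \<open>1 / x^2\<close>, the decay
  rate obtained for the tail.\<close>

lemma mass_upper_bound:
  assumes [measurable]: "\<theta> \<in> borel_measurable borel" and x: "0 \<le> x" and E: "0 \<le> E"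
    and L: "(\<integral>\<^sup>+s. ennreal ((cos (\<theta> s) - 1)\<^sup>2) \<partial>lborel) \<le> ennreal E"
  shows "(mass \<theta> x)\<^sup>2 \<le> 2 * E * x"
proof -
  have n: "norm (1 - cos (\<theta> s)) = 1 - cos (\<theta> s)" for s by simp
  have "(\<integral>\<^sup>+s\<in>{-x..x}. ennreal (norm (1 - cos (\<theta> s))) \<partial>lborel) \<le> ennreal (sqrt ((x - (- x)) * E))"
  proof (rule nn_integral_norm_interval_le)
    have "(\<integral>\<^sup>+s\<in>{-x..x}. ennreal ((norm (1 - cos (\<theta> s)))\<^sup>2) \<partial>lborel) \<le> (\<integral>\<^sup>+s. ennreal ((cos (\<theta> s) - 1)\<^sup>2) \<partial>lborel)"
      by (intro nn_integral_mono) (auto simp: indicator_def power2_commute)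
    also note L
    finally show "(\<integral>\<^sup>+s\<in>{-x..x}. ennreal ((norm (1 - cos (\<theta> s)))\<^sup>2) \<partial>lborel) \<le> ennreal E" .
  qed (use x E in auto)
  then have "ennreal (mass \<theta> x) \<le> ennreal (sqrt ((x - (- x)) * E))" unfolding n mass_eq[OF x] .
  then have "mass \<theta> x \<le> sqrt (2 * x * E)" using x E by (simp add: ennreal_le_iff)
  then have "(mass \<theta> x)\<^sup>2 \<le> (sqrt (2 * x * E))\<^sup>2" using mass_nonneg by (intro power_mono) auto
  then show ?thesis using x E by (simp add: mult_ac)
qed

text \<open>Comparing a minimiser with its own truncations gives quadratic decay of the tail energy; after
  that, truncating at distance \<open>x\<close> costs less than any multiple of the interaction \<open>mass / x\<^sup>2\<close>.\<close>

lemma minimizer_cutoff: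
  assumes a: "1 \<le> a" and pr: "profile a \<theta> W p" and min: "energy2 1 \<theta> W UNIV = min_energy 1 a" and fin: "min_energy 1 a < \<infinity>"
  shows "\<exists>\<mu>>0. \<forall>\<epsilon>>0. \<exists>x1>0. \<forall>x\<ge>x1. \<exists>W'. profile a (\<lambda>s. cutoff x s * \<theta> s) W' p \<and> \<mu> \<le> mass \<theta> x \<and>
    energy2 1 (\<lambda>s. cutoff x s * \<theta> s) W' UNIV \<le> min_energy 1 a + ennreal (\<epsilon> * mass \<theta> x / x\<^sup>2)"
proof -
  note [measurable] = profile_measurable[OF pr]
  have gb: "grad_bound \<theta> W" and bnd: "\<And>x. 0 \<le> \<theta> x" "\<And>x. \<theta> x \<le> pi"
    using pr by (auto simp: profile_def)
  obtain E where E: "min_energy 1 a = ennreal E" "0 \<le> E" using fin by (cases "min_energy 1 a") auto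
  have eE: "energy2 1 \<theta> W UNIV = ennreal E" using min E by simp
  have WE: "(\<integral>\<^sup>+s. W s \<partial>lborel) \<le> ennreal E"
    unfolding eE[symmetric] energy2_def by (simp add: add.assoc)
  have LE: "(\<integral>\<^sup>+s. ennreal ((cos (\<theta> s) - 1)\<^sup>2) \<partial>lborel) \<le> ennreal E"
    unfolding eE[symmetric] energy2_def by (simp add: add_increasing)
  have efin: "energy2 1 \<theta> W UNIV < \<infinity>" by (simp add: eE)
  have c1: "cos 1 < (1::real)" using cos_monotone_0_pi[of 0 1] pi_gt3 by simp
  have "\<forall>\<^sub>F s in at_top. cos 1 < cos (\<theta> s)" "\<forall>\<^sub>F s in at_bot. cos 1 < cos (\<theta> s)"
    using order_tendstoD(1)[OF energy2_finite_cos_tendsto(1)[OF gb efin] c1]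
      order_tendstoD(1)[OF energy2_finite_cos_tendsto(2)[OF gb efin] c1] .
  then obtain A B where AB: "\<And>s. A \<le> s \<Longrightarrow> cos 1 < cos (\<theta> s)" "\<And>s. s \<le> B \<Longrightarrow> cos 1 < cos (\<theta> s)"
    by (auto simp: eventually_at_top_linorder eventually_at_bot_linorder)
  have le1: "\<theta> s \<le> 1" if "cos 1 < cos (\<theta> s)" for s
  proof (rule ccontr)
    assume "\<not> \<theta> s \<le> 1"
    then have "cos (\<theta> s) \<le> cos 1" using bnd by (intro cos_monotone_0_pi_le) auto
    then show False using that by simp
  qed
  define P where "P = Max (insert 0 ((\<lambda>i. \<bar>p i\<bar>) ` {..<2 * a - 1}))"
  have P: "\<bar>p i\<bar> \<le> P" if "i < 2 * a - 1" for i unfolding P_def using that by (intro Max_ge) auto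
  \<comment> \<open>For \<open>x \<ge> x0\<close> the angles beyond \<open>x / 2\<close> are at most
    1, and all touching points lie in \<open>[-x, x]\<close> with a margin of 1, so truncation at
    \<open>x\<close> leaves them intact.\<close>
  define x0 where "x0 = max (2 * (\<bar>A\<bar> + \<bar>B\<bar>)) (P + 1)"
  have P0: "0 \<le> P" unfolding P_def by (intro Max_ge) auto
  have x0: "1 \<le> x0" "\<And>i. i < 2 * a - 1 \<Longrightarrow> \<bar>p i\<bar> + 1 \<le> x0" using P P0 by (auto simp: x0_def le_max_iff_disj)
  have small: "\<theta> s \<le> 1" if "x0 \<le> x" "x / 2 \<le> \<bar>s\<bar>" for x s
  proof -
    have "\<bar>A\<bar> + \<bar>B\<bar> \<le> \<bar>s\<bar>" using that by (auto simp: x0_def)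
    then have "A \<le> s \<or> s \<le> B" by linarith
    then show ?thesis using AB le1 by blast
  qed
  define \<mu> where "\<mu> = 1 / (E + 1)"
  have \<mu>: "0 < \<mu>" using E by (simp add: \<mu>_def)
  define M where "M x = mass \<theta> x" for x
  have M\<mu>: "\<mu> \<le> M x" if "x0 \<le> x" for x
    unfolding \<mu>_def M_def using x0(2)[of 0] that a by (intro mass_lower_bound[OF pr a WE E(2)]) auto
  have M2: "(M x)\<^sup>2 \<le> 2 * E * x" if "x0 \<le> x" for x
    unfolding M_def using that x0(1) by (intro mass_upper_bound E LE) auto
  define T where "T y = enn2real (energy2 1 \<theta> W {s. y < \<bar>s\<bar>})" for y
  have TE': "energy2 1 \<theta> W {s. y < \<bar>s\<bar>} \<le> ennreal E" for y unfolding eE[symmetric] by (rule energy2_mono) simp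
  have T_eq: "energy2 1 \<theta> W {s. y < \<bar>s\<bar>} = ennreal (T y)" for y
  proof -
    have "energy2 1 \<theta> W {s. y < \<bar>s\<bar>} < top" using TE'[of y] by (rule order_le_less_trans) simp
    then show ?thesis by (simp add: T_def)
  qed
  have T: "0 \<le> T y" "T y \<le> E" for y
    using TE'[of y] E unfolding T_eq by (simp_all add: T_def ennreal_le_iff)
  \<comment> \<open>The excess on the right of \<open>cutoff_energy\<close>.\<close>
  define cost where "cost \<eta> x = (3 * \<eta> + 72 / (\<eta> * x)) * T (x / 2) + (36 / \<eta>^3 + 128 * (M x)\<^sup>2 / \<eta>) / x^3" for \<eta> x
  have cut: "profile a (\<lambda>s. cutoff x s * \<theta> s) (cutoff_bound x \<eta> \<theta> W) p \<and>
      energy2 1 (\<lambda>s. cutoff x s * \<theta> s) (cutoff_bound x \<eta> \<theta> W) UNIV \<le> ennreal (E + cost \<eta> x) \<and> T (2 * x) \<le> cost \<eta> x"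
    if x: "x0 \<le> x" and \<eta>: "0 < \<eta>" "\<eta> \<le> 1" for x \<eta>
  proof -
    have xp: "0 < x" using x x0(1) by linarith
    have Mp: "0 < M x" using M\<mu>[OF x] \<mu> by linarith
    let ?\<theta> = "\<lambda>s. cutoff x s * \<theta> s" and ?W = "cutoff_bound x \<eta> \<theta> W"
    have pr': "profile a ?\<theta> ?W p"
    proof (rule cutoff_profile[OF pr xp \<eta>(1)])
      show "\<bar>p i\<bar> \<le> x" if "i < 2 * a - 1" for i using x0(2)[OF that] x by linarith
    qed
    have c0: "0 \<le> cost \<eta> x" using \<eta> xp T by (simp add: cost_def)
    have "energy2 1 ?\<theta> ?W UNIV + energy2 1 \<theta> W {s. 2 * x < \<bar>s\<bar>}
      \<le> energy2 1 \<theta> W UNIV + ennreal (3 * \<eta> + 72 / (\<eta> * x)) * energy2 1 \<theta> W {s. x / 2 < \<bar>s\<bar>}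
      + ennreal ((36 / \<eta>^3 + 128 * (M x)\<^sup>2 / \<eta>) / x^3)"
    proof (rule cutoff_energy[OF bnd xp \<eta> Mp])
      show "(\<integral>\<^sup>+s\<in>{-x..x}. ennreal (1 - cos (\<theta> s)) \<partial>lborel) \<le> ennreal (M x)"
        using mass_eq[of x \<theta>] xp by (simp add: M_def)
    qed (use small[OF x] in auto)
    also have "\<dots> = ennreal E + (ennreal ((3 * \<eta> + 72 / (\<eta> * x)) * T (x / 2)) + ennreal ((36 / \<eta>^3 + 128 * (M x)\<^sup>2 / \<eta>) / x^3))"
      unfolding T_eq eE using \<eta> xp T by (simp add: ennreal_mult add.assoc)
    also have "ennreal ((3 * \<eta> + 72 / (\<eta> * x)) * T (x / 2)) + ennreal ((36 / \<eta>^3 + 128 * (M x)\<^sup>2 / \<eta>) / x^3) = ennreal (cost \<eta> x)"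
      unfolding cost_def using \<eta> xp T by (intro ennreal_plus[symmetric]) auto
    also have "ennreal E + ennreal (cost \<eta> x) = ennreal (E + cost \<eta> x)" using E c0 by (simp add: ennreal_plus)
    finally have sum: "energy2 1 ?\<theta> ?W UNIV + ennreal (T (2 * x)) \<le> ennreal (E + cost \<eta> x)" unfolding T_eq .
    then have le: "energy2 1 ?\<theta> ?W UNIV \<le> ennreal (E + cost \<eta> x)"
      by (rule order_trans[rotated]) simp
    then obtain e where e: "energy2 1 ?\<theta> ?W UNIV = ennreal e" "0 \<le> e"
      by (cases "energy2 1 ?\<theta> ?W UNIV") (auto simp: top_unique)
    \<comment> \<open>Minimality enters here: the truncated profile is a competitor, so the
      discarded tail energy is at most \<open>cost\<close>.\<close>
    have "ennreal E \<le> ennreal e" using min_energy_le[OF pr', of 1] E e by simp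
    then have "E \<le> e" using e by (simp add: ennreal_le_iff)
    moreover have "e + T (2 * x) \<le> E + cost \<eta> x"
      using sum e T[of "2 * x"] E c0 by (simp add: ennreal_le_iff flip: ennreal_plus)
    ultimately have "T (2 * x) \<le> cost \<eta> x" by linarith
    then show ?thesis using pr' le by blast
  qed
  \<comment> \<open>With \<open>\<eta> = 1 / 192\<close> below, \<open>3 * \<eta>\<close> is
    \<open>1 / 64\<close>, and \<open>72 / (\<eta> * x)\<close>, that is \<open>13824 / x\<close>,
    is at most \<open>1 / 64\<close> for \<open>x \<ge> 884736\<close>. Together they give the
    factor \<open>1 / 32\<close> of \<open>contraction_decay\<close>. Truncating at
    \<open>x = 2 * y\<close> relates the tails beyond \<open>4 * y\<close> and
    \<open>y\<close>.\<close>
  have "\<exists>K\<ge>0. \<forall>y\<ge>max x0 884736. T y \<le> K / y\<^sup>2"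
  proof (rule contraction_decay)
    show "0 < max x0 884736" by simp
    show "T y \<le> E" "0 \<le> T y" for y using T by auto
    fix y assume y: "max x0 884736 \<le> y"
    define x where "x = 2 * y"
    have x: "x0 \<le> x" "884736 \<le> x" using y by (auto simp: x_def)
    define \<eta> :: real where "\<eta> = 1 / 192"
    have "T (4 * y) \<le> cost \<eta> x" using cut[OF x(1), of \<eta>] by (simp add: x_def \<eta>_def)
    also have "\<dots> \<le> (1 / 32) * T y + (36 / \<eta>^3 + 128 * (2 * E) / \<eta>) / y\<^sup>2"
      unfolding cost_def
    proof (rule add_mono)
      have "3 * \<eta> + 72 / (\<eta> * x) \<le> 1 / 32" using x by (simp add: \<eta>_def field_simps)
      then have "(3 * \<eta> + 72 / (\<eta> * x)) * T (x / 2) \<le> (1 / 32) * T (x / 2)" by (intro mult_right_mono T)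
      then show "(3 * \<eta> + 72 / (\<eta> * x)) * T (x / 2) \<le> (1 / 32) * T y" by (simp add: x_def)
      have "(36 / \<eta>^3 + 128 * (M x)\<^sup>2 / \<eta>) \<le> (36 / \<eta>^3 * x + 128 * (2 * E * x) / \<eta>)"
      proof (rule add_mono)
        show "36 / \<eta>^3 \<le> 36 / \<eta>^3 * x" using x mult_left_mono[of 1 x "36 / \<eta>^3"] by (simp add: \<eta>_def)
        show "128 * (M x)\<^sup>2 / \<eta> \<le> 128 * (2 * E * x) / \<eta>"
          using M2[OF x(1)] by (intro divide_right_mono mult_left_mono) (auto simp: \<eta>_def)
      qed
      also have "\<dots> = (36 / \<eta>^3 + 128 * (2 * E) / \<eta>) * x" by (simp add: algebra_simps)
      finally have "(36 / \<eta>^3 + 128 * (M x)\<^sup>2 / \<eta>) / x^3 \<le> (36 / \<eta>^3 + 128 * (2 * E) / \<eta>) * x / x^3"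
        using x by (intro divide_right_mono) auto
      also have "\<dots> = (36 / \<eta>^3 + 128 * (2 * E) / \<eta>) / x\<^sup>2" using x by (simp add: power2_eq_square power3_eq_cube)
      also have "\<dots> \<le> (36 / \<eta>^3 + 128 * (2 * E) / \<eta>) / y\<^sup>2"
        using x y E by (intro divide_left_mono) (auto simp: x_def \<eta>_def power2_eq_square intro!: mult_mono)
      finally show "(36 / \<eta>^3 + 128 * (M x)\<^sup>2 / \<eta>) / x^3 \<le> (36 / \<eta>^3 + 128 * (2 * E) / \<eta>) / y\<^sup>2" .
    qed
    finally show "T (4 * y) \<le> T y / 32 + (36 / (1/192)^3 + 128 * (2 * E) / (1/192)) / y\<^sup>2" by (simp add: \<eta>_def)
  qed
  then obtain K where K: "0 \<le> K" "\<And>y. max x0 884736 \<le> y \<Longrightarrow> T y \<le> K / y\<^sup>2" by blast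
  have "\<exists>x1>0. \<forall>x\<ge>x1. \<exists>W'. profile a (\<lambda>s. cutoff x s * \<theta> s) W' p \<and> \<mu> \<le> mass \<theta> x \<and>
    energy2 1 (\<lambda>s. cutoff x s * \<theta> s) W' UNIV \<le> min_energy 1 a + ennreal (\<epsilon> * mass \<theta> x / x\<^sup>2)" if \<epsilon>: "0 < \<epsilon>" for \<epsilon>
  proof -
    \<comment> \<open>The cost multiplied by \<open>x^2\<close> has four terms, each of which may
      use \<open>\<epsilon> * M x / 4\<close>. For the three terms without \<open>M\<close> the
      lower bound \<open>\<mu> \<le> M x\<close> reduces this to \<open>\<delta>\<close>.\<close>
    define \<delta> where "\<delta> = \<epsilon> * \<mu> / 4"
    have \<delta>: "0 < \<delta>" using \<epsilon> \<mu> by (simp add: \<delta>_def)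
    define \<eta> where "\<eta> = min 1 (\<delta> / (12 * (K + 1)))"
    have \<eta>: "0 < \<eta>" "\<eta> \<le> 1" using \<delta> K by (auto simp: \<eta>_def)
    have "\<eta> \<le> \<delta> / (12 * (K + 1))" by (simp add: \<eta>_def)
    then have "\<eta> * (12 * (K + 1)) \<le> \<delta>" using K(1) by (simp only: pos_le_divide_eq[of "12 * (K + 1)"] mult_pos_pos)
    then have \<eta>K: "12 * \<eta> * K \<le> \<delta>" using \<eta> by (simp add: algebra_simps)
    \<comment> \<open>The first entry puts \<open>x / 2\<close> into the range of the decay
      estimate; the others settle the remaining terms of the cost. The last one makes
      \<open>512 * M x \<le> \<epsilon> * \<eta> * x\<close>, given that the square of
      \<open>M x\<close> is at most \<open>2 * E * x\<close>.\<close>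
    define x1 where "x1 = Max {2 * max x0 884736, 288 * K / (\<eta> * \<delta>), 36 / (\<eta>^3 * \<delta>), 2 * E * (512 / (\<epsilon> * \<eta>))\<^sup>2}"
    have x1: "2 * max x0 884736 \<le> x1" "288 * K / (\<eta> * \<delta>) \<le> x1" "36 / (\<eta>^3 * \<delta>) \<le> x1" "2 * E * (512 / (\<epsilon> * \<eta>))\<^sup>2 \<le> x1"
      unfolding x1_def by (intro Max_ge; simp)+
    have goal: "\<exists>W'. profile a (\<lambda>s. cutoff x s * \<theta> s) W' p \<and> \<mu> \<le> mass \<theta> x \<and>
      energy2 1 (\<lambda>s. cutoff x s * \<theta> s) W' UNIV \<le> min_energy 1 a + ennreal (\<epsilon> * mass \<theta> x / x\<^sup>2)" if x: "x1 \<le> x" for x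
    proof -
      have xx: "x0 \<le> x" "0 < x" "max x0 884736 \<le> x / 2" using x1(1) x x0(1) by auto
      have M0: "\<mu> \<le> M x" "0 < M x" using M\<mu>[OF xx(1)] \<mu> by auto
      have \<delta>M: "\<delta> \<le> \<epsilon> * M x / 4" using M0 \<epsilon> by (simp add: \<delta>_def)
      have "(3 * \<eta> + 72 / (\<eta> * x)) * T (x / 2) \<le> (3 * \<eta> + 72 / (\<eta> * x)) * (K / (x / 2)\<^sup>2)"
        using \<eta> xx by (intro mult_left_mono K) auto
      also have "\<dots> = (12 * \<eta> * K + 288 * K / (\<eta> * x)) / x\<^sup>2" by (simp add: power_divide algebra_simps add_divide_distrib)
      finally have 1: "(3 * \<eta> + 72 / (\<eta> * x)) * T (x / 2) \<le> (12 * \<eta> * K + 288 * K / (\<eta> * x)) / x\<^sup>2" .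
      have 2: "288 * K / (\<eta> * x) \<le> \<delta>" using order_trans[OF x1(2) x] \<eta> \<delta> xx by (simp add: field_simps)
      have 3: "36 / \<eta>^3 / x \<le> \<delta>" using order_trans[OF x1(3) x] \<eta> \<delta> xx by (simp add: field_simps)
      have 4: "128 * (M x)\<^sup>2 / \<eta> / x \<le> \<epsilon> * M x / 4"
      proof -
        have "(M x * 512)\<^sup>2 \<le> 2 * E * x * 512\<^sup>2" using M2[OF xx(1)] by (simp add: power_mult_distrib)
        also have "\<dots> = (2 * E * (512 / (\<epsilon> * \<eta>))\<^sup>2) * (\<epsilon> * \<eta>)\<^sup>2 * x" using \<epsilon> \<eta> by (simp add: power_divide)
        also have "\<dots> \<le> x * (\<epsilon> * \<eta>)\<^sup>2 * x" using x1(4) x xx by (intro mult_right_mono) auto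
        also have "\<dots> = (\<epsilon> * \<eta> * x)\<^sup>2" by (simp add: power2_eq_square)
        finally have "M x * 512 \<le> \<epsilon> * \<eta> * x" by (rule power2_le_imp_le) (use \<epsilon> \<eta> xx in auto)
        then have "M x * (M x * 512) \<le> M x * (\<epsilon> * \<eta> * x)" using M0 by (intro mult_left_mono) auto
        then show ?thesis using \<eta> xx by (simp add: field_simps power2_eq_square)
      qed
      have "(36 / \<eta>^3 + 128 * (M x)\<^sup>2 / \<eta>) / x^3 = (36 / \<eta>^3 / x + 128 * (M x)\<^sup>2 / \<eta> / x) / x\<^sup>2"
        by (simp add: add_divide_distrib power2_eq_square power3_eq_cube)
      then have "cost \<eta> x \<le> (12 * \<eta> * K + 288 * K / (\<eta> * x)) / x\<^sup>2 + (36 / \<eta>^3 / x + 128 * (M x)\<^sup>2 / \<eta> / x) / x\<^sup>2"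
        unfolding cost_def using 1 by linarith
      also have "\<dots> = (12 * \<eta> * K + 288 * K / (\<eta> * x) + 36 / \<eta>^3 / x + 128 * (M x)\<^sup>2 / \<eta> / x) / x\<^sup>2"
        by (simp add: add_divide_distrib)
      also have "\<dots> \<le> \<epsilon> * M x / x\<^sup>2"
        using \<eta>K 2 3 4 \<delta>M by (intro divide_right_mono) auto
      finally have "ennreal (E + cost \<eta> x) \<le> ennreal (E + \<epsilon> * M x / x\<^sup>2)" by (intro ennreal_leI) simp
      also have "\<dots> = min_energy 1 a + ennreal (\<epsilon> * mass \<theta> x / x\<^sup>2)"
        using E \<epsilon> M0 by (simp add: M_def ennreal_plus)
      finally show ?thesis using cut[OF xx(1) \<eta>] M0(1) unfolding M_def by (meson order_trans)
    qed
    show ?thesis using goal x1(1) by (intro exI[of _ x1]) auto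
  qed
  then show ?thesis using \<mu> by blast
qed

section \<open>Strict subadditivity\<close>

text \<open>Two far apart bumps attract each other: the cross term \<open>-2 g\<^sub>1(s) g\<^sub>2(t) / (s - t)\<^sup>2\<close> of the nonlocal
  energy is negative because \<open>1 - cos \<theta>\<close> has a sign.\<close>

lemma two_bumps:
  assumes pr1: "profile a \<theta>1 W1 p1" and pr2: "profile b \<theta>2 W2 p2" and ab: "1 \<le> a" "1 \<le> b" and x: "0 < x"
    and z1: "\<And>s. 2 * x \<le> \<bar>s\<bar> \<Longrightarrow> \<theta>1 s = 0" and z2: "\<And>s. 2 * x \<le> \<bar>s\<bar> \<Longrightarrow> \<theta>2 s = 0"
  shows "\<exists>\<theta> W p. profile (a + b) \<theta> W p \<and>
    energy2 1 \<theta> W UNIV + ennreal (mass \<theta>1 x * mass \<theta>2 x / (36 * pi * x\<^sup>2)) \<le> energy2 1 \<theta>1 W1 UNIV + energy2 1 \<theta>2 W2 UNIV"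
proof -
  note [measurable] = profile_measurable[OF pr1] profile_measurable[OF pr2]
  \<comment> \<open>The shift by \<open>4 * x\<close> moves the second support to
    \<open>[2 * x, 6 * x]\<close>, so the two supports meet only in \<open>2 * x\<close>.\<close>
  define \<tau> V where "\<tau> = (\<lambda>s. \<theta>2 (- 4 * x + s))" and "V = (\<lambda>s. W2 (- 4 * x + s))"
  have pr3: "profile b \<tau> V (\<lambda>i. p2 i - (- 4 * x))"
    unfolding \<tau>_def V_def by (rule profile_shift[OF pr2])
  note [measurable] = profile_measurable[OF pr3]
  have en3: "energy2 1 \<tau> V UNIV = energy2 1 \<theta>2 W2 UNIV"
    using energy2_shift[of \<theta>2 W2 UNIV 1 "- 4 * x"] by (simp add: \<tau>_def V_def)
  have z\<tau>: "\<tau> s = 0" if "s \<le> 2 * x" for s using z2[of "- 4 * x + s"] that x by (simp add: \<tau>_def)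
  have z1': "\<theta>1 s = 0" if "2 * x \<le> s" for s using z1[of s] that x by simp
  define \<theta> W where "\<theta> = (\<lambda>s. \<theta>1 s + \<tau> s)" and "W = (\<lambda>s. W1 s + V s)"
  have t1: "touches a \<theta>1 p1" and t2: "touches b \<theta>2 p2" using pr1 pr2 by (auto simp: profile_def)
  have q1: "p1 i < 2 * x" if "i < 2 * a - 1" for i
  proof -
    have "\<theta>1 (p1 (2 * a - 2)) = pi" using t1 ab by (auto simp: touches_def)
    then have "p1 (2 * a - 2) < 2 * x" using z1'[of "p1 (2 * a - 2)"] by force
    moreover have "p1 i \<le> p1 (2 * a - 2)" using that ab by (intro touches_mono[OF t1]) auto
    ultimately show ?thesis by simp
  qed
  have q2: "- 2 * x < p2 i" if "i < 2 * b - 1" for i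
  proof -
    have "\<theta>2 (p2 0) = pi" using t2 ab by (auto simp: touches_def)
    then have "- 2 * x < p2 0" using z2[of "p2 0"] x by force
    moreover have "p2 0 \<le> p2 i" using that by (intro touches_mono[OF t2]) auto
    ultimately show ?thesis by simp
  qed
  \<comment> \<open>At \<open>2 * x\<close> both bumps vanish; this is the zero required between the
    last \<open>pi\<close> of the first and the first \<open>pi\<close> of the second. Hence
    \<open>(2 * a - 1) + 1 + (2 * b - 1) = 2 * (a + b) - 1\<close> points.\<close>
  define q where "q i = (if i < 2 * a - 1 then p1 i else if i = 2 * a - 1 then 2 * x else p2 (i - 2 * a) + 4 * x)" for i
  have touch: "touches (a + b) \<theta> q"
    unfolding touches_def
  proof (intro conjI allI impI)
    fix i assume i: "i < 2 * (a + b) - 1"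
    consider "i < 2 * a - 1" | "i = 2 * a - 1" | "2 * a \<le> i" by linarith
    then show "\<theta> (q i) = (if even i then pi else 0)"
    proof cases
      case 1 then show ?thesis using t1 q1[OF 1] z\<tau>[of "p1 i"] by (auto simp: q_def \<theta>_def touches_def)
    next
      case 2 then show ?thesis using ab z\<tau>[of "2 * x"] z1'[of "2 * x"] by (auto simp: q_def \<theta>_def)
    next
      case 3
      then have j: "i - 2 * a < 2 * b - 1" using i ab 3 by presburger
      have e: "even (i - 2 * a) = even i" using 3 by simp
      show ?thesis using t2 j q2[OF j] z1'[of "p2 (i - 2 * a) + 4 * x"] 3 ab e
        by (auto simp: q_def \<theta>_def touches_def \<tau>_def)
    qed
  next
    fix i assume i: "Suc i < 2 * (a + b) - 1"
    consider "Suc i < 2 * a - 1" | "Suc i = 2 * a - 1" | "i = 2 * a - 1" | "2 * a \<le> i" by linarith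
    then show "q i < q (Suc i)"
    proof cases
      case 1 then show ?thesis using t1 by (auto simp: q_def touches_def)
    next
      case 2 then show ?thesis using q1[of i] by (auto simp: q_def)
    next
      case 3 then show ?thesis using q2[of 0] ab by (auto simp: q_def)
    next
      case 4
      then have "Suc (i - 2 * a) < 2 * b - 1" using i ab by presburger
      then have "p2 (i - 2 * a) < p2 (Suc (i - 2 * a))" using t2 by (auto simp: touches_def)
      then show ?thesis using 4 ab by (auto simp: q_def Suc_diff_le)
    qed
  qed
  have gb: "grad_bound \<theta> W"
  proof (rule grad_bound_on_glue[where c = "2 * x"])
    have W: "W \<in> borel_measurable borel" unfolding W_def by measurable
    have gb1: "grad_bound \<theta>1 W1" and gb3: "grad_bound \<tau> V" using pr1 pr3 by (auto simp: profile_def)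
    have "grad_bound_on (UNIV \<inter> {..2 * x}) \<theta>1 W"
      by (rule grad_bound_on_mono[OF grad_bound_on_subset[OF gb1]]) (auto simp: W_def[abs_def] intro: W[unfolded W_def])
    then show "grad_bound_on (UNIV \<inter> {..2 * x}) \<theta> W"
      by (rule grad_bound_on_lipschitz) (simp add: \<theta>_def z\<tau>)
    have "grad_bound_on (UNIV \<inter> {2 * x..}) \<tau> W"
      by (rule grad_bound_on_mono[OF grad_bound_on_subset[OF gb3]]) (auto simp: W_def[abs_def] intro: W[unfolded W_def])
    then show "grad_bound_on (UNIV \<inter> {2 * x..}) \<theta> W"
      by (rule grad_bound_on_lipschitz) (simp add: \<theta>_def z1')
  qed simp
  have bnd: "0 \<le> \<theta> s \<and> \<theta> s \<le> pi" for s
    using pr1 pr3 z\<tau>[of s] z1'[of s] by (cases "s \<le> 2 * x") (auto simp: \<theta>_def profile_def)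
  have cont: "continuous_on UNIV \<theta>"
    using pr1 pr3 unfolding \<theta>_def profile_def by (intro continuous_on_add) auto
  have pr: "profile (a + b) \<theta> W q" using cont bnd gb touch by (simp add: profile_def)
  note [measurable] = profile_measurable[OF pr]
  define g1 g2 where "g1 = (\<lambda>s. 1 - cos (\<theta>1 s))" and "g2 = (\<lambda>s. 1 - cos (\<tau> s))"
  have g_nn: "0 \<le> g1 s" "0 \<le> g2 s" for s by (auto simp: g1_def g2_def)
  have g_prod: "g1 s * g2 s = 0" for s
    using z\<tau>[of s] z1'[of s] by (cases "s \<le> 2 * x") (auto simp: g1_def g2_def)
  have cos_eq: "cos (\<theta> s) = 1 - g1 s - g2 s" for s
    using z\<tau>[of s] z1'[of s] by (cases "s \<le> 2 * x") (auto simp: g1_def g2_def \<theta>_def)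
  \<comment> \<open>For \<open>s\<close> in \<open>[-x, x]\<close> and \<open>t\<close> in
    \<open>[3 * x, 5 * x]\<close> the distance is at most \<open>6 * x\<close>, and the cross term
    has the factor \<open>2 / (2 * pi)\<close>. The opposite order of \<open>s\<close> and
    \<open>t\<close> is simply discarded.\<close>
  define m where "m = 1 / (36 * pi * x\<^sup>2)"
  have m0: "0 \<le> m" by (simp add: m_def)
  define f1 f2 where "f1 = (\<lambda>s. ennreal (1 - cos (\<theta>1 s)) * indicator {-x..x} s)"
    and "f2 = (\<lambda>s. ennreal (1 - cos (\<theta>2 s)) * indicator {-x..x} s)"
  have [measurable]: "f1 \<in> borel_measurable borel" "f2 \<in> borel_measurable borel"
    unfolding f1_def f2_def by measurable
  have pair: "ennreal (pair_kernel (\<lambda>s. cos (\<theta> s)) z) + ennreal m * (f1 (fst z) * f2 (- 4 * x + snd z))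
      \<le> ennreal (pair_kernel (\<lambda>s. cos (\<theta>1 s)) z) + ennreal (pair_kernel (\<lambda>s. cos (\<tau> s)) z)" for z
  proof -
    obtain s t where z: "z = (s, t)" by (cases z)
    have "(cos (\<theta> s) - cos (\<theta> t))\<^sup>2 + 2 * (g1 s * g2 t) + 2 * (g1 t * g2 s) =
        (cos (\<theta>1 s) - cos (\<theta>1 t))\<^sup>2 + (cos (\<tau> s) - cos (\<tau> t))\<^sup>2 + 2 * (g1 s * g2 s) + 2 * (g1 t * g2 t)"
      unfolding cos_eq by (simp add: g1_def g2_def power2_eq_square algebra_simps)
    then have "(cos (\<theta> s) - cos (\<theta> t))\<^sup>2 + 2 * (g1 s * g2 t) \<le> (cos (\<theta>1 s) - cos (\<theta>1 t))\<^sup>2 + (cos (\<tau> s) - cos (\<tau> t))\<^sup>2"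
      using g_prod[of s] g_prod[of t] mult_nonneg_nonneg[OF g_nn(1)[of t] g_nn(2)[of s]] by linarith
    then have "((cos (\<theta> s) - cos (\<theta> t))\<^sup>2 + 2 * (g1 s * g2 t)) / (s - t)\<^sup>2 / (2 * pi)
        \<le> ((cos (\<theta>1 s) - cos (\<theta>1 t))\<^sup>2 + (cos (\<tau> s) - cos (\<tau> t))\<^sup>2) / (s - t)\<^sup>2 / (2 * pi)"
      by (intro divide_right_mono) auto
    then have main: "pair_kernel (\<lambda>s. cos (\<theta> s)) z + g1 s * g2 t / (s - t)\<^sup>2 / pi
        \<le> pair_kernel (\<lambda>s. cos (\<theta>1 s)) z + pair_kernel (\<lambda>s. cos (\<tau> s)) z"
      by (simp add: pair_kernel_def z add_divide_distrib)
    have sum_nn: "0 \<le> pair_kernel (\<lambda>s. cos (\<theta> s)) z" "0 \<le> pair_kernel (\<lambda>s. cos (\<theta>1 s)) z" "0 \<le> pair_kernel (\<lambda>s. cos (\<tau> s)) z"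
      by (rule pair_kernel_nonneg)+
    show ?thesis
    proof (cases "s \<in> {-x..x} \<and> - 4 * x + t \<in> {-x..x}")
      case True
      then have st: "2 * x \<le> t - s" "t - s \<le> 6 * x" by auto
      have "(t - s)\<^sup>2 \<le> (6 * x)\<^sup>2" using st x by (intro power_mono) auto
      then have "(s - t)\<^sup>2 \<le> 36 * x\<^sup>2" by (simp add: power2_commute power_mult_distrib)
      moreover have "0 < (s - t)\<^sup>2" using st x by simp
      ultimately have "g1 s * g2 t / (36 * x\<^sup>2) \<le> g1 s * g2 t / (s - t)\<^sup>2"
        using g_nn x by (intro divide_left_mono) auto
      then have "g1 s * g2 t / (36 * x\<^sup>2) / pi \<le> g1 s * g2 t / (s - t)\<^sup>2 / pi" by (intro divide_right_mono) auto
      then have "m * (g1 s * g2 t) \<le> g1 s * g2 t / (s - t)\<^sup>2 / pi" by (simp add: m_def mult_ac)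
      then have "pair_kernel (\<lambda>s. cos (\<theta> s)) z + m * (g1 s * g2 t)
          \<le> pair_kernel (\<lambda>s. cos (\<theta>1 s)) z + pair_kernel (\<lambda>s. cos (\<tau> s)) z" using main by linarith
      moreover have "f1 (fst z) * f2 (- 4 * x + snd z) = ennreal (g1 s * g2 t)"
        using True g_nn(1)[of s] g_nn(2)[of t]
        by (simp add: z f1_def f2_def g1_def g2_def \<tau>_def ennreal_mult)
      ultimately show ?thesis using sum_nn m0 g_nn
        by (simp add: ennreal_leI flip: ennreal_plus ennreal_mult)
    next
      case False
      then have f0: "f1 (fst z) * f2 (- 4 * x + snd z) = 0" by (auto simp: z f1_def f2_def indicator_def)
      have "0 \<le> g1 s * g2 t / (s - t)\<^sup>2 / pi" using g_nn by simp
      with main have "pair_kernel (\<lambda>s. cos (\<theta> s)) z \<le> pair_kernel (\<lambda>s. cos (\<theta>1 s)) z + pair_kernel (\<lambda>s. cos (\<tau> s)) z"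
        by linarith
      then show ?thesis unfolding f0 using sum_nn
        by (simp add: ennreal_leI flip: ennreal_plus)
    qed
  qed
  have f1I: "(\<integral>\<^sup>+s. f1 s \<partial>lborel) = ennreal (mass \<theta>1 x)" unfolding f1_def using x by (intro mass_eq) auto
  have "(\<integral>\<^sup>+s. f2 s \<partial>lborel) = ennreal (mass \<theta>2 x)" unfolding f2_def using x by (intro mass_eq) auto
  then have f2I: "(\<integral>\<^sup>+s. f2 (- 4 * x + s) \<partial>lborel) = ennreal (mass \<theta>2 x)"
    using nn_integral_shift[of f2 "- 4 * x"] by simp
  let ?P = "\<lambda>u. \<integral>\<^sup>+z. ennreal (pair_kernel (\<lambda>s. cos (u s)) z) \<partial>lborel"
  have P: "?P \<theta> + ennreal (mass \<theta>1 x * mass \<theta>2 x / (36 * pi * x\<^sup>2)) \<le> ?P \<theta>1 + ?P \<tau>"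
  proof -
    have pm: "(\<integral>\<^sup>+z. f1 (fst z) * f2 (- 4 * x + snd z) \<partial>lborel) = ennreal (mass \<theta>1 x) * ennreal (mass \<theta>2 x)"
      using plane_product[of f1 "\<lambda>s. f2 (- 4 * x + s)"] f1I f2I by simp
    have fm [measurable]: "(\<lambda>z. f1 (fst z) * f2 (- 4 * x + snd z)) \<in> borel_measurable (borel :: (real \<times> real) measure)"
      unfolding borel_prod[symmetric] by measurable
    have "ennreal (mass \<theta>1 x * mass \<theta>2 x / (36 * pi * x\<^sup>2)) = ennreal m * (ennreal (mass \<theta>1 x) * ennreal (mass \<theta>2 x))"
      using m0 mass_nonneg by (simp add: m_def flip: ennreal_mult)
    also have "\<dots> = (\<integral>\<^sup>+z. ennreal m * (f1 (fst z) * f2 (- 4 * x + snd z)) \<partial>lborel)"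
      unfolding pm[symmetric] by (rule nn_integral_cmult[symmetric]) measurable
    finally have "?P \<theta> + ennreal (mass \<theta>1 x * mass \<theta>2 x / (36 * pi * x\<^sup>2)) =
        (\<integral>\<^sup>+z. ennreal (pair_kernel (\<lambda>s. cos (\<theta> s)) z) + ennreal m * (f1 (fst z) * f2 (- 4 * x + snd z)) \<partial>lborel)"
      by (simp only:) (rule nn_integral_add[symmetric]; measurable)
    also have "\<dots> \<le> (\<integral>\<^sup>+z. ennreal (pair_kernel (\<lambda>s. cos (\<theta>1 s)) z) + ennreal (pair_kernel (\<lambda>s. cos (\<tau> s)) z) \<partial>lborel)"
      by (intro nn_integral_mono pair)
    also have "\<dots> = ?P \<theta>1 + ?P \<tau>" by (simp add: nn_integral_add)
    finally show ?thesis .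
  qed
  let ?A = "\<lambda>u. \<integral>\<^sup>+s. ennreal ((cos (u s) - 1)\<^sup>2) \<partial>lborel"
  have "(cos (\<theta> s) - 1)\<^sup>2 = (cos (\<theta>1 s) - 1)\<^sup>2 + (cos (\<tau> s) - 1)\<^sup>2" for s
  proof -
    have "(cos (\<theta> s) - 1)\<^sup>2 = (g1 s)\<^sup>2 + (g2 s)\<^sup>2 + 2 * (g1 s * g2 s)"
      unfolding cos_eq by (simp add: power2_eq_square algebra_simps)
    then show ?thesis unfolding g_prod by (simp add: g1_def g2_def power2_commute)
  qed
  then have A: "?A \<theta> = ?A \<theta>1 + ?A \<tau>" by (simp add: nn_integral_add)
  have W: "(\<integral>\<^sup>+s. W s \<partial>lborel) = (\<integral>\<^sup>+s. W1 s \<partial>lborel) + (\<integral>\<^sup>+s. V s \<partial>lborel)"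
    unfolding W_def by (simp add: nn_integral_add)
  have "energy2 1 \<theta> W UNIV + ennreal (mass \<theta>1 x * mass \<theta>2 x / (36 * pi * x\<^sup>2)) =
      (\<integral>\<^sup>+s. W s \<partial>lborel) + (?P \<theta> + ennreal (mass \<theta>1 x * mass \<theta>2 x / (36 * pi * x\<^sup>2))) + ?A \<theta>"
    by (simp add: energy2_def add_ac)
  also have "\<dots> \<le> (\<integral>\<^sup>+s. W s \<partial>lborel) + (?P \<theta>1 + ?P \<tau>) + ?A \<theta>" by (intro add_mono P) auto
  also have "\<dots> = energy2 1 \<theta>1 W1 UNIV + energy2 1 \<tau> V UNIV"
    unfolding W A by (simp add: energy2_def add_ac)
  finally show ?thesis using pr en3 by auto
qed

lemma mass_cutoff: "0 < x \<Longrightarrow> mass (\<lambda>s. cutoff x s * \<theta> s) x = mass \<theta> x"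
  unfolding mass_def by (intro arg_cong[where f = enn2real] nn_integral_cong) (auto simp: indicator_def cutoff_one)

text \<open>Cost and gain of joining two truncated minimisers both scale like
  \<open>1 / x^2\<close>. The cost is linear and the gain bilinear in the masses; as both masses are
  at least \<open>\<mu>\<close>, a small \<open>\<epsilon>\<close> decides the comparison even if
  the masses grow with \<open>x\<close>.\<close>

lemma min_energy_strict_subadditive:
  assumes ab: "1 \<le> a" "1 \<le> b"
    and pra: "profile a \<theta>a Wa pa" and mina: "energy2 1 \<theta>a Wa UNIV = min_energy 1 a" and fina: "min_energy 1 a < \<infinity>"
    and prb: "profile b \<theta>b Wb pb" and minb: "energy2 1 \<theta>b Wb UNIV = min_energy 1 b" and finb: "min_energy 1 b < \<infinity>"
  shows "min_energy 1 (a + b) < min_energy 1 a + min_energy 1 b"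
proof -
  obtain A B where A: "min_energy 1 a = ennreal A" "0 \<le> A" and B: "min_energy 1 b = ennreal B" "0 \<le> B"
    using fina finb by (cases "min_energy 1 a"; cases "min_energy 1 b") auto
  obtain \<mu>a where \<mu>a: "0 < \<mu>a" "\<And>\<epsilon>. 0 < \<epsilon> \<Longrightarrow> \<exists>x1>0. \<forall>x\<ge>x1. \<exists>W'. profile a (\<lambda>s. cutoff x s * \<theta>a s) W' pa \<and> \<mu>a \<le> mass \<theta>a x \<and>
    energy2 1 (\<lambda>s. cutoff x s * \<theta>a s) W' UNIV \<le> min_energy 1 a + ennreal (\<epsilon> * mass \<theta>a x / x\<^sup>2)"
    using minimizer_cutoff[OF ab(1) pra mina fina] by blast
  obtain \<mu>b where \<mu>b: "0 < \<mu>b" "\<And>\<epsilon>. 0 < \<epsilon> \<Longrightarrow> \<exists>x1>0. \<forall>x\<ge>x1. \<exists>W'. profile b (\<lambda>s. cutoff x s * \<theta>b s) W' pb \<and> \<mu>b \<le> mass \<theta>b x \<and>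
    energy2 1 (\<lambda>s. cutoff x s * \<theta>b s) W' UNIV \<le> min_energy 1 b + ennreal (\<epsilon> * mass \<theta>b x / x\<^sup>2)"
    using minimizer_cutoff[OF ab(2) prb minb finb] by blast
  define \<mu> where "\<mu> = min \<mu>a \<mu>b"
  have \<mu>: "0 < \<mu>" using \<mu>a \<mu>b by (simp add: \<mu>_def)
  \<comment> \<open>\<open>144 = 4 * 36\<close>: in units of \<open>1 / (36 * pi * x^2)\<close> the
    total cost is \<open>(\<mu> * Mb + \<mu> * Ma) / 4\<close>, which is at most half of the gain
    \<open>Ma * Mb\<close>.\<close>
  define \<epsilon> where "\<epsilon> = \<mu> / (144 * pi)"
  have \<epsilon>: "0 < \<epsilon>" using \<mu> by (simp add: \<epsilon>_def)
  obtain xa where xa: "0 < xa" "\<And>x. xa \<le> x \<Longrightarrow> \<exists>W'. profile a (\<lambda>s. cutoff x s * \<theta>a s) W' pa \<and> \<mu>a \<le> mass \<theta>a x \<and>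
    energy2 1 (\<lambda>s. cutoff x s * \<theta>a s) W' UNIV \<le> min_energy 1 a + ennreal (\<epsilon> * mass \<theta>a x / x\<^sup>2)"
    using \<mu>a(2)[OF \<epsilon>] by blast
  obtain xb where xb: "0 < xb" "\<And>x. xb \<le> x \<Longrightarrow> \<exists>W'. profile b (\<lambda>s. cutoff x s * \<theta>b s) W' pb \<and> \<mu>b \<le> mass \<theta>b x \<and>
    energy2 1 (\<lambda>s. cutoff x s * \<theta>b s) W' UNIV \<le> min_energy 1 b + ennreal (\<epsilon> * mass \<theta>b x / x\<^sup>2)"
    using \<mu>b(2)[OF \<epsilon>] by blast
  define x where "x = max xa xb"
  have x: "0 < x" "xa \<le> x" "xb \<le> x" using xa(1) by (auto simp: x_def)
  define Ma Mb where "Ma = mass \<theta>a x" and "Mb = mass \<theta>b x"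
  obtain W1 where W1: "profile a (\<lambda>s. cutoff x s * \<theta>a s) W1 pa" "\<mu>a \<le> Ma"
      "energy2 1 (\<lambda>s. cutoff x s * \<theta>a s) W1 UNIV \<le> min_energy 1 a + ennreal (\<epsilon> * Ma / x\<^sup>2)"
    using xa(2)[OF x(2)] unfolding Ma_def by blast
  obtain W2 where W2: "profile b (\<lambda>s. cutoff x s * \<theta>b s) W2 pb" "\<mu>b \<le> Mb"
      "energy2 1 (\<lambda>s. cutoff x s * \<theta>b s) W2 UNIV \<le> min_energy 1 b + ennreal (\<epsilon> * Mb / x\<^sup>2)"
    using xb(2)[OF x(3)] unfolding Mb_def by blast
  have M: "\<mu> \<le> Ma" "\<mu> \<le> Mb" using W1(2) W2(2) by (auto simp: \<mu>_def)
  obtain \<theta> W p where pr: "profile (a + b) \<theta> W p" and le: "energy2 1 \<theta> W UNIV + ennreal (Ma * Mb / (36 * pi * x\<^sup>2))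
      \<le> energy2 1 (\<lambda>s. cutoff x s * \<theta>a s) W1 UNIV + energy2 1 (\<lambda>s. cutoff x s * \<theta>b s) W2 UNIV"
    using two_bumps[OF W1(1) W2(1) ab x(1)] x(1) by (auto simp: mass_cutoff cutoff_zero Ma_def Mb_def)
  have Mpos: "0 < Ma" "0 < Mb" using M \<mu> by auto
  have "energy2 1 \<theta> W UNIV + ennreal (Ma * Mb / (36 * pi * x\<^sup>2)) \<le> ennreal A + ennreal (\<epsilon> * Ma / x\<^sup>2) + (ennreal B + ennreal (\<epsilon> * Mb / x\<^sup>2))"
    by (rule order_trans[OF le]) (use W1(3) W2(3) in \<open>simp add: A B add_mono\<close>)
  also have "\<dots> = ennreal (A + B + \<epsilon> * (Ma + Mb) / x\<^sup>2)"
    using A B \<epsilon> Mpos by (simp add: add_divide_distrib algebra_simps flip: ennreal_plus)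
  finally have sum: "energy2 1 \<theta> W UNIV + ennreal (Ma * Mb / (36 * pi * x\<^sup>2)) \<le> ennreal (A + B + \<epsilon> * (Ma + Mb) / x\<^sup>2)" .
  then have "energy2 1 \<theta> W UNIV \<le> ennreal (A + B + \<epsilon> * (Ma + Mb) / x\<^sup>2)" by (rule order_trans[rotated]) simp
  then obtain e where e: "energy2 1 \<theta> W UNIV = ennreal e" "0 \<le> e"
    by (cases "energy2 1 \<theta> W UNIV") (auto simp: top_unique)
  have pos: "0 \<le> A + B + \<epsilon> * (Ma + Mb) / x\<^sup>2" "0 \<le> Ma * Mb / (36 * pi * x\<^sup>2)" using A B \<epsilon> Mpos by auto
  have e_le: "e + Ma * Mb / (36 * pi * x\<^sup>2) \<le> A + B + \<epsilon> * (Ma + Mb) / x\<^sup>2"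
    using sum e pos by (simp add: ennreal_le_iff flip: ennreal_plus)
  have "\<mu> * Mb \<le> Ma * Mb" "\<mu> * Ma \<le> Mb * Ma" using M Mpos by (auto intro: mult_right_mono)
  then have "\<mu> * Mb + \<mu> * Ma \<le> 2 * (Ma * Mb)" by (simp only: mult.commute[of Mb Ma])
  moreover have "0 < \<mu> * Mb + \<mu> * Ma" using \<mu> Mpos by (simp add: add_pos_pos)
  moreover have "X / 4 < Y" if "X \<le> 2 * Y" "0 < X" for X Y :: real using that by linarith
  ultimately have "(\<mu> * Mb + \<mu> * Ma) / 4 < Ma * Mb" by blast
  then have "(\<mu> * Mb + \<mu> * Ma) / 4 / (36 * pi * x\<^sup>2) < Ma * Mb / (36 * pi * x\<^sup>2)"
    using x by (intro divide_strict_right_mono) auto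
  moreover have "(\<mu> * Mb + \<mu> * Ma) / 4 / (36 * pi * x\<^sup>2) = \<epsilon> * (Ma + Mb) / x\<^sup>2"
    by (simp add: \<epsilon>_def algebra_simps add_divide_distrib)
  ultimately have "e < A + B" using e_le by linarith
  then have "ennreal e < ennreal A + ennreal B" using A B e by (simp add: ennreal_lessI flip: ennreal_plus)
  then show ?thesis using min_energy_le[OF pr, of 1] A B e by simp
qed

section \<open>A competitor of finite energy and the induction on \<open>l\<close>\<close>

lemma min_energy_one_finite: "min_energy 1 1 < \<infinity>"
proof -
  define c :: "real \<Rightarrow> real" where "c s = max (- 1) (min 1 s)" for s
  \<comment> \<open>A tent of slope \<open>pi\<close> over \<open>[-1, 1]\<close>. Its cosine is
    Lipschitz and differs from 1 only there, so the pair energy is dominated by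
    \<open>cut_kernel\<close> with one point confined to \<open>[-1, 1]\<close>.\<close>
  define \<theta> where "\<theta> s = pi * (1 - \<bar>c s\<bar>)" for s
  define W where "W s = ennreal (pi\<^sup>2) * indicator {-1..1::real} s" for s
  have c1: "\<bar>c s\<bar> \<le> 1" for s by (auto simp: c_def)
  have lip: "\<bar>\<theta> t - \<theta> s\<bar> \<le> pi * \<bar>c t - c s\<bar>" for s t
  proof -
    have "\<theta> t - \<theta> s = pi * (\<bar>c s\<bar> - \<bar>c t\<bar>)" by (simp add: \<theta>_def algebra_simps)
    then have "\<bar>\<theta> t - \<theta> s\<bar> = pi * \<bar>\<bar>c s\<bar> - \<bar>c t\<bar>\<bar>" by (simp add: abs_mult)
    also have "\<dots> \<le> pi * \<bar>c t - c s\<bar>" by (intro mult_left_mono) auto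
    finally show ?thesis .
  qed
  have cl: "\<bar>c t - c s\<bar> \<le> \<bar>t - s\<bar>" for s t by (auto simp: c_def)
  have gb: "grad_bound \<theta> W"
    unfolding grad_bound_on_def
  proof (intro conjI ballI impI)
    show "W \<in> borel_measurable borel" unfolding W_def[abs_def] by measurable
    fix s t :: real assume st: "s \<le> t"
    have cc: "c s \<le> c t" "c t - c s \<le> t - s" using st by (auto simp: c_def)
    show "ennreal ((norm (\<theta> t - \<theta> s))\<^sup>2) \<le> ennreal (t - s) * (\<integral>\<^sup>+x\<in>{s..t}. W x \<partial>lborel)"
    proof (cases "c s = c t")
      case True
      then show ?thesis using lip[of t s] by simp
    next
      case False
      then have sub: "s \<le> c s" "c t \<le> t" using st by (auto simp: c_def split: if_splits)
      have "(norm (\<theta> t - \<theta> s))\<^sup>2 \<le> (pi * (c t - c s))\<^sup>2"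
        using lip[of t s] cc by (intro power_mono) auto
      also have "\<dots> = (c t - c s) * (pi\<^sup>2 * (c t - c s))" by (simp add: power2_eq_square)
      also have "\<dots> \<le> (t - s) * (pi\<^sup>2 * (c t - c s))" using cc by (intro mult_right_mono) auto
      finally have "ennreal ((norm (\<theta> t - \<theta> s))\<^sup>2) \<le> ennreal ((t - s) * (pi\<^sup>2 * (c t - c s)))" by (rule ennreal_leI)
      also have "\<dots> = ennreal (t - s) * (ennreal (pi\<^sup>2) * emeasure lborel {c s..c t})"
        using cc st by (simp add: ennreal_mult)
      also have "ennreal (pi\<^sup>2) * emeasure lborel {c s..c t} = (\<integral>\<^sup>+x. ennreal (pi\<^sup>2) * indicator {c s..c t} x \<partial>lborel)"
        by (subst nn_integral_cmult_indicator) auto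
      also have "\<dots> \<le> (\<integral>\<^sup>+x\<in>{s..t}. W x \<partial>lborel)"
        using sub c1[of s] c1[of t] by (intro nn_integral_mono) (auto simp: W_def indicator_def)
      finally show ?thesis by (simp add: mult_left_mono)
    qed
  qed
  have cont: "continuous_on UNIV \<theta>"
    unfolding \<theta>_def c_def by (intro continuous_intros)
  have pr: "profile 1 \<theta> W (\<lambda>_. 0)"
    unfolding profile_def
  proof (intro conjI allI cont gb)
    fix s
    show "0 \<le> \<theta> s" using c1[of s] by (simp add: \<theta>_def)
    have "pi * (1 - \<bar>c s\<bar>) \<le> pi * 1" by (intro mult_left_mono) auto
    then show "\<theta> s \<le> pi" by (simp add: \<theta>_def)
    show "touches 1 \<theta> (\<lambda>_. 0)" by (auto simp: touches_def \<theta>_def c_def)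
  qed
  note [measurable] = profile_measurable[OF pr]
  define I where "I = (\<lambda>s. indicator {-1..1::real} s :: ennreal)"
  have [measurable]: "I \<in> borel_measurable borel" unfolding I_def by measurable
  have I2: "(\<integral>\<^sup>+s. I s \<partial>lborel) = 2" by (simp add: I_def)
  have zero: "cos (\<theta> s) = 1" if "s \<notin> {-1..1}" for s using that by (auto simp: \<theta>_def c_def)
  have pk: "ennreal (pair_kernel (\<lambda>s. cos (\<theta> s)) z) \<le>
      16 * (I (fst z) * ennreal (cut_kernel 1 (fst z - snd z)) + I (snd z) * ennreal (cut_kernel 1 (fst z - snd z)))" for z
  proof -
    obtain s t where z: "z = (s, t)" by (cases z)
    define d where "d = cos (\<theta> s) - cos (\<theta> t)"
    have d1: "\<bar>d\<bar> \<le> \<bar>pi * (s - t)\<bar>"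
    proof -
      have "\<bar>d\<bar> \<le> \<bar>\<theta> s - \<theta> t\<bar>" unfolding d_def by (rule abs_cos_diff_le)
      also have "\<dots> \<le> pi * \<bar>c s - c t\<bar>" by (rule lip)
      also have "\<dots> \<le> pi * \<bar>s - t\<bar>" by (intro mult_left_mono cl) auto
      finally show ?thesis by (simp add: abs_mult)
    qed
    have d2: "\<bar>d\<bar> \<le> \<bar>2\<bar>"
      using abs_cos_le_one[of "\<theta> s"] abs_cos_le_one[of "\<theta> t"] unfolding d_def by linarith
    have le: "pair_kernel (\<lambda>s. cos (\<theta> s)) (s, t) \<le> 16 * cut_kernel 1 (s - t)"
    proof (cases "\<bar>s - t\<bar> \<le> 1")
      case True
      have "d\<^sup>2 \<le> pi\<^sup>2 * (s - t)\<^sup>2" using sq_le_sq_of_abs_le[OF d1] by (simp add: power_mult_distrib)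
      then have "d\<^sup>2 / (s - t)\<^sup>2 \<le> pi\<^sup>2" by (cases "s = t") (auto simp: divide_le_eq)
      then have "d\<^sup>2 / (s - t)\<^sup>2 / (2 * pi) \<le> pi\<^sup>2 / (2 * pi)" by (intro divide_right_mono) auto
      also have "\<dots> \<le> 16" using pi_less_4 by (simp add: power2_eq_square)
      finally show ?thesis using True by (simp add: pair_kernel_def d_def cut_kernel_def)
    next
      case False
      have "d\<^sup>2 \<le> 4" using sq_le_sq_of_abs_le[OF d2] by simp
      then have "d\<^sup>2 / (s - t)\<^sup>2 \<le> 4 / (s - t)\<^sup>2" by (intro divide_right_mono) auto
      then have "d\<^sup>2 / (s - t)\<^sup>2 / (2 * pi) \<le> d\<^sup>2 / (s - t)\<^sup>2 / 1"
        using pi_gt3 by (intro divide_left_mono) auto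
      then have "d\<^sup>2 / (s - t)\<^sup>2 / (2 * pi) \<le> 16 / (s - t)\<^sup>2"
        using \<open>d\<^sup>2 / (s - t)\<^sup>2 \<le> 4 / (s - t)\<^sup>2\<close> divide_right_mono[of 4 16 "(s - t)\<^sup>2"] by auto
      then show ?thesis using False by (simp add: pair_kernel_def d_def cut_kernel_def)
    qed
    show ?thesis
    proof (cases "s \<in> {-1..1} \<or> t \<in> {-1..1}")
      case True
      have k: "ennreal (pair_kernel (\<lambda>s. cos (\<theta> s)) z) \<le> 16 * ennreal (cut_kernel 1 (s - t))"
        using ennreal_leI[OF le] by (simp add: z ennreal_mult' cut_kernel_nonneg)
      have "ennreal (cut_kernel 1 (s - t)) \<le> I s * ennreal (cut_kernel 1 (s - t)) + I t * ennreal (cut_kernel 1 (s - t))"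
        using True by (auto simp: I_def indicator_def)
      then show ?thesis unfolding z fst_conv snd_conv by (intro order_trans[OF k[unfolded z] mult_left_mono]) auto
    next
      case False
      then show ?thesis by (simp add: z pair_kernel_def zero)
    qed
  qed
  have fin1: "(\<integral>\<^sup>+s. W s \<partial>lborel) < \<infinity>"
    unfolding W_def by (subst nn_integral_cmult_indicator) (auto simp: ennreal_mult_less_top)
  have fin2: "(\<integral>\<^sup>+z. ennreal (pair_kernel (\<lambda>s. cos (\<theta> s)) z) \<partial>lborel) < \<infinity>"
  proof -
    have m1 [measurable]: "(\<lambda>z. I (fst z) * ennreal (cut_kernel 1 (fst z - snd z))) \<in> borel_measurable (borel :: (real \<times> real) measure)"
      "(\<lambda>z. I (snd z) * ennreal (cut_kernel 1 (fst z - snd z))) \<in> borel_measurable (borel :: (real \<times> real) measure)"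
      unfolding borel_prod[symmetric] by measurable
    have k: "(\<integral>\<^sup>+r. ennreal (cut_kernel 1 r) \<partial>lborel) < \<infinity>"
      using nn_integral_cut_kernel[of 1] by (simp add: order.strict_trans1 ennreal_less_top)
    have "(\<integral>\<^sup>+z. ennreal (pair_kernel (\<lambda>s. cos (\<theta> s)) z) \<partial>lborel) \<le>
      (\<integral>\<^sup>+z. 16 * (I (fst z) * ennreal (cut_kernel 1 (fst z - snd z)) + I (snd z) * ennreal (cut_kernel 1 (fst z - snd z))) \<partial>lborel)"
      by (intro nn_integral_mono pk)
    also have "\<dots> = 16 * (2 * (\<integral>\<^sup>+r. ennreal (cut_kernel 1 r) \<partial>lborel) + 2 * (\<integral>\<^sup>+r. ennreal (cut_kernel 1 r) \<partial>lborel))"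
      using plane_convolution[of I "\<lambda>r. ennreal (cut_kernel 1 r)"] I2
      by (simp add: nn_integral_cmult nn_integral_add)
    also have "\<dots> < \<infinity>" using k by (simp add: ennreal_mult_less_top ennreal_add_less_top)
    finally show ?thesis .
  qed
  have fin3: "(\<integral>\<^sup>+s. ennreal ((cos (\<theta> s) - 1)\<^sup>2) \<partial>lborel) < \<infinity>"
  proof -
    have "ennreal ((cos (\<theta> s) - 1)\<^sup>2) \<le> 4 * I s" for s
    proof (cases "s \<in> {-1..1}")
      case True
      have "\<bar>cos (\<theta> s) - 1\<bar> \<le> \<bar>2\<bar>" using cos_ge_minus_one[of "\<theta> s"] cos_le_one[of "\<theta> s"] by linarith
      from sq_le_sq_of_abs_le[OF this] have "ennreal ((cos (\<theta> s) - 1)\<^sup>2) \<le> ennreal 4" by (intro ennreal_leI) simp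
      then show ?thesis using True by (simp add: I_def)
    next
      case False then show ?thesis using zero[of s] by simp
    qed
    then have "(\<integral>\<^sup>+s. ennreal ((cos (\<theta> s) - 1)\<^sup>2) \<partial>lborel) \<le> (\<integral>\<^sup>+s. 4 * I s \<partial>lborel)" by (intro nn_integral_mono)
    also have "\<dots> = 4 * 2" by (simp add: nn_integral_cmult I2)
    also have "\<dots> < \<infinity>" by (simp add: ennreal_mult_less_top)
    finally show ?thesis .
  qed
  have "energy2 1 \<theta> W UNIV < \<infinity>" using fin1 fin2 fin3 by (simp add: energy2_def)
  then show ?thesis using min_energy_le[OF pr, of 1] by (rule order.strict_trans1[rotated])
qed

text \<open>Two statements are carried through the induction: the \<open>window_bound\<close> of
  smaller numbers bounds the gaps, and their minimisers at \<open>h = 1\<close> are what strict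
  subadditivity truncates and joins. Finiteness for \<open>l > 1\<close> also follows from
  subadditivity.\<close>

lemma minimizers_exist:
  assumes "1 \<le> l"
  shows "window_bound l \<and> (\<exists>H. 0 < H \<and> H < 1 \<and> (\<forall>h. H < h \<and> h \<le> 1 \<longrightarrow>
    (\<exists>\<theta> W p. profile l \<theta> W p \<and> energy2 h \<theta> W UNIV = min_energy h l \<and> min_energy h l < \<infinity>)))"
  using assms
proof (induction l rule: less_induct)
  case (less l)
  have w: "window_bound j" if "1 \<le> j" "j < l" for j using less.IH that by blast
  have min1: "\<exists>\<theta> W p. profile j \<theta> W p \<and> energy2 1 \<theta> W UNIV = min_energy 1 j \<and> min_energy 1 j < \<infinity>" if "1 \<le> j" "j < l" for j
    using less.IH[OF that(2,1)] by (metis order_refl)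
  have sub: "min_energy 1 l < min_energy 1 j + min_energy 1 (l - j)" if j: "1 \<le> j" "j < l" for j
  proof -
    have k: "1 \<le> l - j" "l - j < l" using j by auto
    obtain \<theta>a Wa pa where a: "profile j \<theta>a Wa pa" "energy2 1 \<theta>a Wa UNIV = min_energy 1 j" "min_energy 1 j < \<infinity>"
      using min1[OF j] by blast
    obtain \<theta>b Wb pb where b: "profile (l - j) \<theta>b Wb pb" "energy2 1 \<theta>b Wb UNIV = min_energy 1 (l - j)" "min_energy 1 (l - j) < \<infinity>"
      using min1[OF k] by blast
    show ?thesis using min_energy_strict_subadditive[OF j(1) k(1) a b] j by simp
  qed
  have fin: "min_energy 1 l < \<infinity>"
  proof (cases "l = 1")
    case True then show ?thesis using min_energy_one_finite by simp
  next
    case False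
    then have "min_energy 1 l < min_energy 1 1 + min_energy 1 (l - 1)" using less.prems by (intro sub) auto
    also have "\<dots> \<le> \<infinity>" by simp
    finally show ?thesis .
  qed
  show ?case
    using window_bound_step[OF less.prems w less_imp_le[OF sub] fin]
      minimizer_near_one[OF less.prems w sub fin min_energy_upper[OF less.prems fin]] by blast
qed

theorem theorem1:
  "\<forall>l::nat. l \<ge> 1 \<longrightarrow>
     (\<exists>H::real. 0 < H \<and> H < 1 \<and>
        (\<forall>h::real. H < h \<and> h \<le> 1 \<longrightarrow> attains_infimum h (real l - arccos h / pi)))"
proof (intro allI impI)
  fix l :: nat assume l: "1 \<le> l"
  obtain H where H: "0 < H" "H < 1" "\<And>h. H < h \<Longrightarrow> h \<le> 1 \<Longrightarrow>
      \<exists>\<theta> W p. profile l \<theta> W p \<and> energy2 h \<theta> W UNIV = min_energy h l \<and> min_energy h l < \<infinity>"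
    using minimizers_exist[OF l] by blast
  have "attains_infimum h (real l - arccos h / pi)" if h: "H < h" "h \<le> 1" for h
  proof -
    obtain \<theta> W p where m: "profile l \<theta> W p" "energy2 h \<theta> W UNIV = min_energy h l" "min_energy h l < \<infinity>"
      using H(3)[OF h] by blast
    show ?thesis using H h l m
      by (intro attains_infimum_of_profile[OF _ _ l m(1)]) (auto intro: min_energy_le)
  qed
  then show "\<exists>H. 0 < H \<and> H < 1 \<and> (\<forall>h. H < h \<and> h \<le> 1 \<longrightarrow> attains_infimum h (real l - arccos h / pi))"
    using H(1,2) by blast
qed

end
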